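(* Let $\delta\in\mathbb Z/2\mathbb Z$. The signed Mellin transform $M_\delta$ establishes an isomorphism (of complex vector spaces) between $$\{\sigma\in\mathcal S'_\delta(\mathbb R)\mid \sigma \text{ vanishes to infinite order at } 0 \text{ and extends canonically across }\infty\}$$ and $$\{H:\mathbb C\to\mathbb C\mid H\text{ is entire, of moderate growth on vertical strips}\}.$$
   Context: Distributions on a one-dimensional smooth manifold $M$ (here $\mathbb R$, or $\mathbb{RP}^1=\mathbb R\cup\{\infty\}$ with coordinate $1/x$ near $\infty$) are the dual of compactly supported smooth measures; they transform like functions, and the pairing is written as an integral. A differential operator $D$ (linear, $C^\infty$ coefficients) near $p\in M$ is tangential to $\{p\}$ if for every $k$ it maps smooth functions vanishing to order $k$ at $p$ to such functions. A distribution $\sigma$ vanishes to order $k\ge0$ at $p$ if on some neighborhood $U_p$ of $p$, $\sigma=\sum_{j=1}^N f_jD_jh_j$ with $h_j\in L^\infty_{\rm loc}(U_p)$, $D_j$ tangential to $\{p\}$, $f_j\in C^\infty(U_p)$ vanishing to order $k$ at $p$; it vanishes to order $-k$ ($k>0$) at $p$ if $z^k\sigma$ vanishes to order $0$, where $z$ is a smooth function near $p$ vanishing exactly to first order at $p$; it vanishes to infinite order if it does so to every order. A distribution on $M-\{p\}$ extends canonically across $p$ if it is the restriction of a (necessarily unique) distribution on $M$ vanishing to infinite order at $p$. $\mathcal S'_\delta(\mathbb R)$ is the space of tempered distributions with $\sigma(-x)=(-1)^\delta\sigma(x)$. Signed Mellin transform. Let $\sigma\in\mathcal S'(\mathbb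 R)$ vanish to order $k_0$ at $0$ and have an extension to $\mathbb R\cup\{\infty\}$ vanishing to order $k_\infty$ at $\infty$, with $k_0+k_\infty\ge1$. For $\operatorname{Re}s>-k_0$ the distribution $(\operatorname{sgn}x)^\delta|x|^{s-1}\sigma(x)$ on $\mathbb R-\{0\}$ has a unique extension across $0$ which depends holomorphically on $s$ (when paired with any test measure) and vanishes at $0$ to order $\ell$ for every integer $\ell$ with $0\le\ell\le\operatorname{Re}s-1+k_0$; likewise, for $\operatorname{Re}s<k_\infty$, $(\operatorname{sgn}x)^\delta|x|^{-s-1}\sigma(1/x)$ has a unique extension across $x=0$ which depends holomorphically on $s$ and vanishes there to order $\ell$ whenever $0\le\ell\le k_\infty-\operatorname{Re}s-1$. With these extensions understood, and with $\phi\in C_c^\infty(\mathbb R)$ any function equal to $1$ near $0$, $$M_\delta\sigma(s)=\int_{\mathbb R}(\operatorname{sgn}x)^\delta|x|^{s-1}\sigma(x)\,dx:=\int_{\mathbb R}(\operatorname{sgn}x)^\delta|x|^{s-1}\phi(x)\sigma(x)\,dx+\int_{\mathbb R}(\operatorname{sgn}x)^\delta|x|^{-s-1}(1-\phi)(1/x)\sigma(1/x)\,dx ,$$ for $-k_0<\operatorname{Re}s<k_\infty$; this is independent of $\phi$ and holomorphic in that region. If $\sigma$ vanishes to infinite order at $0$ and extends canonically across $\infty$, $M_\delta\sigma$ is thus an entire function. A holomorphic function $H$ on $\mathbb C$ has moderate growth on vertical strips if for all real $a'<b'$ there are $T,C>0$ and $N\in\mathbb N$ with $|H(s)|\le C|\operatorname{Im}s|^N$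 whenever $a'\le\operatorname{Re}s\le b'$ and $|\operatorname{Im}s|\ge T$. *)

theory Defs
  imports "HOL-Analysis.Analysis"
begin

definition nderiv :: "nat \<Rightarrow> (real \<Rightarrow> complex) \<Rightarrow> real \<Rightarrow> complex" where
  "nderiv n f = ((\<lambda>g x. vector_derivative g (at x)) ^^ n) f"

text \<open>The next definition is only meant for open \<open>U\<close>; values of \<open>f\<close> outside \<open>U\<close> are irrelevant.\<close>

definition smooth_on :: "real set \<Rightarrow> (real \<Rightarrow> complex) \<Rightarrow> bool" where
  "smooth_on U f \<longleftrightarrow> (\<forall>n. \<forall>x\<in>U. nderiv n f differentiable (at x))"

text \<open>Vanishing to order \<open>k\<close> means \<open>f(x) = O((x - p)\<^sup>k)\<close>; order \<open>0\<close> is no condition.\<close>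

definition fun_vanishes_to_order :: "real \<Rightarrow> nat \<Rightarrow> (real \<Rightarrow> complex) \<Rightarrow> bool" where
  "fun_vanishes_to_order p k f \<longleftrightarrow> (\<forall>i<k. nderiv i f p = 0)"

definition test_fun :: "real set \<Rightarrow> (real \<Rightarrow> complex) set" where
  "test_fun U = {\<phi>. smooth_on UNIV \<phi> \<and> (\<exists>K. compact K \<and> K \<subseteq> U \<and> (\<forall>x. x \<notin> K \<longrightarrow> \<phi> x = 0))}"

definition schwartz :: "(real \<Rightarrow> complex) set" where
  "schwartz = {\<phi>. smooth_on UNIV \<phi> \<and>
     (\<forall>m n. bounded (range (\<lambda>x. of_real x ^ m * nderiv n \<phi> x)))}"

text \<open>
  On the real line a compactly supported smooth measure is \<open>\<phi>(x) dx\<close> with \<open>\<phi>\<close> a test function, so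
  a distribution is given as a functional of \<open>\<phi>\<close>, written \<open>\<integral> \<sigma>(x) \<phi>(x) dx = \<sigma> \<phi>\<close>.  Only the values
  of the functional on test functions matter.  Continuity is expressed by the usual seminorm
  estimates.
\<close>

type_synonym functional = "(real \<Rightarrow> complex) \<Rightarrow> complex"

definition linear_functional_on :: "(real \<Rightarrow> complex) set \<Rightarrow> functional \<Rightarrow> bool" where
  "linear_functional_on V L \<longleftrightarrow>
     (\<forall>\<phi>\<in>V. \<forall>\<psi>\<in>V. L (\<lambda>x. \<phi> x + \<psi> x) = L \<phi> + L \<psi>) \<and>
     (\<forall>c. \<forall>\<phi>\<in>V. L (\<lambda>x. c * \<phi> x) = c * L \<phi>)"

definition distribution_on :: "real set \<Rightarrow> functional \<Rightarrow> bool" where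
  "distribution_on U \<sigma> \<longleftrightarrow> linear_functional_on (test_fun U) \<sigma> \<and>
     (\<forall>K. compact K \<and> K \<subseteq> U \<longrightarrow>
       (\<exists>C N. \<forall>\<phi>\<in>test_fun U. (\<forall>x. x \<notin> K \<longrightarrow> \<phi> x = 0) \<longrightarrow>
          norm (\<sigma> \<phi>) \<le> C * (\<Sum>n\<le>N. SUP x. norm (nderiv n \<phi> x))))"

text \<open>
  The last clause fixes the irrelevant values outside the Schwartz space, so that tempered
  distributions are equal as functions iff they are equal as functionals on the Schwartz space.
\<close>

definition tempered_distribution :: "functional \<Rightarrow> bool" where
  "tempered_distribution \<sigma> \<longleftrightarrow> linear_functional_on schwartz \<sigma> \<and>
     (\<exists>C N. \<forall>\<phi>\<in>schwartz. norm (\<sigma> \<phi>) \<le>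
        C * (\<Sum>m\<le>N. \<Sum>n\<le>N. SUP x. norm (of_real x ^ m * nderiv n \<phi> x))) \<and>
     (\<forall>\<phi>. \<phi> \<notin> schwartz \<longrightarrow> \<sigma> \<phi> = 0)"

definition has_parity :: "nat \<Rightarrow> functional \<Rightarrow> bool" where
  "has_parity \<delta> \<sigma> \<longleftrightarrow> (\<forall>\<phi>\<in>schwartz. \<sigma> (\<lambda>x. \<phi> (- x)) = (-1) ^ \<delta> * \<sigma> \<phi>)"

definition dist_mult :: "(real \<Rightarrow> complex) \<Rightarrow> functional \<Rightarrow> functional" where
  "dist_mult f \<sigma> = (\<lambda>\<phi>. \<sigma> (\<lambda>x. f x * \<phi> x))"

definition dist_deriv :: "functional \<Rightarrow> functional" where
  "dist_deriv \<sigma> = (\<lambda>\<phi>. - \<sigma> (nderiv 1 \<phi>))"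

definition Linf_loc :: "real set \<Rightarrow> (real \<Rightarrow> complex) set" where
  "Linf_loc U = {h. h \<in> borel_measurable (lebesgue_on U) \<and>
     (\<forall>K. compact K \<and> K \<subseteq> U \<longrightarrow> (\<exists>C. AE x in lebesgue_on K. norm (h x) \<le> C))}"

definition dist_of_fun :: "real set \<Rightarrow> (real \<Rightarrow> complex) \<Rightarrow> functional" where
  "dist_of_fun U h = (\<lambda>\<phi>. integral\<^sup>L (lebesgue_on U) (\<lambda>x. h x * \<phi> x))"

text \<open>The list \<open>[a\<^sub>0, \<dots>, a\<^sub>m]\<close> encodes the differential operator \<open>\<Sum>\<^sub>i a\<^sub>i(x) (d/dx)\<^sup>i\<close>.\<close>

type_synonym diffop = "(real \<Rightarrow> complex) list"

definition diffop_fun :: "diffop \<Rightarrow> (real \<Rightarrow> complex) \<Rightarrow> real \<Rightarrow> complex" where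
  "diffop_fun D f = (\<lambda>x. \<Sum>i<length D. (D ! i) x * nderiv i f x)"

definition diffop_dist :: "diffop \<Rightarrow> functional \<Rightarrow> functional" where
  "diffop_dist D \<sigma> = (\<lambda>\<phi>. \<Sum>i<length D. dist_mult (D ! i) ((dist_deriv ^^ i) \<sigma>) \<phi>)"

definition tangential_diffop :: "real set \<Rightarrow> real \<Rightarrow> diffop \<Rightarrow> bool" where
  "tangential_diffop U p D \<longleftrightarrow> (\<forall>a\<in>set D. smooth_on U a) \<and>
     (\<forall>k f. smooth_on U f \<and> fun_vanishes_to_order p k f \<longrightarrow>
        fun_vanishes_to_order p k (diffop_fun D f))"

definition vanishing_presentation :: "real set \<Rightarrow> real \<Rightarrow> nat \<Rightarrow> functional \<Rightarrow> bool" where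
  "vanishing_presentation U p k \<sigma> \<longleftrightarrow>
     (\<exists>(N::nat) f D h.
        (\<forall>j<N. smooth_on U (f j) \<and> fun_vanishes_to_order p k (f j) \<and>
               tangential_diffop U p (D j) \<and> h j \<in> Linf_loc U) \<and>
        (\<forall>\<phi>\<in>test_fun U.
           \<sigma> \<phi> = (\<Sum>j<N. dist_mult (f j) (diffop_dist (D j) (dist_of_fun U (h j))) \<phi>)))"

definition vanishes_to_order :: "real \<Rightarrow> int \<Rightarrow> functional \<Rightarrow> bool" where
  "vanishes_to_order p k \<sigma> \<longleftrightarrow>
     (\<exists>U. open U \<and> p \<in> U \<and>
       (if k \<ge> 0 then vanishing_presentation U p (nat k) \<sigma>
        else \<exists>z. smooth_on U z \<and> z p = 0 \<and> nderiv 1 z p \<noteq> 0 \<and>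
               vanishing_presentation U p 0 (dist_mult (\<lambda>x. z x ^ nat (- k)) \<sigma>)))"

definition vanishes_to_infinite_order :: "real \<Rightarrow> functional \<Rightarrow> bool" where
  "vanishes_to_infinite_order p \<sigma> \<longleftrightarrow> (\<forall>k. vanishes_to_order p k \<sigma>)"

text \<open>
  Change of coordinates \<open>y = 1/x\<close> for measures: \<open>\<phi>(x) dx = \<phi>(1/y) y\<^sup>-\<^sup>2 dy\<close>.  If \<open>\<phi>\<close> has compact support
  the right-hand side vanishes near \<open>y = 0\<close>; the value at \<open>0\<close> given by \<open>1/0 = 0\<close> is then the right one.
\<close>

definition inversion :: "(real \<Rightarrow> complex) \<Rightarrow> real \<Rightarrow> complex" where
  "inversion \<phi> = (\<lambda>y. \<phi> (1 / y) / of_real (y ^ 2))"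

text \<open>
  A smooth measure on the projective line is the pair \<open>(\<phi>, \<psi>)\<close> of its densities \<open>\<phi>(x) dx\<close> and
  \<open>\<psi>(y) dy\<close> in the two charts.  The sets \<open>{-1..1}\<close> in the two charts together cover the
  projective line, so the seminorms below define the topology of uniform convergence of all
  derivatives.
\<close>

definition rp1_measures :: "((real \<Rightarrow> complex) \<times> (real \<Rightarrow> complex)) set" where
  "rp1_measures = {(\<phi>, \<psi>). smooth_on UNIV \<phi> \<and> smooth_on UNIV \<psi> \<and>
     (\<forall>y. y \<noteq> 0 \<longrightarrow> \<psi> y = inversion \<phi> y)}"

type_synonym rp1_functional = "(real \<Rightarrow> complex) \<times> (real \<Rightarrow> complex) \<Rightarrow> complex"

definition rp1_distribution :: "rp1_functional \<Rightarrow> bool" where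
  "rp1_distribution \<tau> \<longleftrightarrow>
     (\<forall>\<phi> \<psi> \<phi>' \<psi>'. (\<phi>, \<psi>) \<in> rp1_measures \<and> (\<phi>', \<psi>') \<in> rp1_measures \<longrightarrow>
        \<tau> (\<lambda>x. \<phi> x + \<phi>' x, \<lambda>y. \<psi> y + \<psi>' y) = \<tau> (\<phi>, \<psi>) + \<tau> (\<phi>', \<psi>')) \<and>
     (\<forall>c \<phi> \<psi>. (\<phi>, \<psi>) \<in> rp1_measures \<longrightarrow>
        \<tau> (\<lambda>x. c * \<phi> x, \<lambda>y. c * \<psi> y) = c * \<tau> (\<phi>, \<psi>)) \<and>
     (\<exists>C N. \<forall>\<phi> \<psi>. (\<phi>, \<psi>) \<in> rp1_measures \<longrightarrow>
        norm (\<tau> (\<phi>, \<psi>)) \<le> C * (\<Sum>n\<le>N. (SUP x\<in>{-1..1}. norm (nderiv n \<phi> x)) +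
                                        (SUP y\<in>{-1..1}. norm (nderiv n \<psi> y))))"

definition restrict_to_real_line :: "rp1_functional \<Rightarrow> functional" where
  "restrict_to_real_line \<tau> = (\<lambda>\<phi>. \<tau> (\<phi>, inversion \<phi>))"

text \<open>The restriction to the complement of the point \<open>x = 0\<close>, in the coordinate \<open>y = 1/x\<close>.\<close>

definition chart_at_infinity :: "rp1_functional \<Rightarrow> functional" where
  "chart_at_infinity \<tau> = (\<lambda>\<psi>. \<tau> (inversion \<psi>, \<psi>))"

definition extends_to_rp1 :: "functional \<Rightarrow> rp1_functional \<Rightarrow> bool" where
  "extends_to_rp1 \<sigma> \<tau> \<longleftrightarrow> rp1_distribution \<tau> \<and>
     (\<forall>\<phi>\<in>test_fun UNIV. restrict_to_real_line \<tau> \<phi> = \<sigma> \<phi>)"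

definition extends_canonically_across_infinity :: "functional \<Rightarrow> bool" where
  "extends_canonically_across_infinity \<sigma> \<longleftrightarrow>
     (\<exists>\<tau>. extends_to_rp1 \<sigma> \<tau> \<and> vanishes_to_infinite_order 0 (chart_at_infinity \<tau>))"

definition signed_power :: "nat \<Rightarrow> complex \<Rightarrow> real \<Rightarrow> complex" where
  "signed_power \<delta> s x = of_real (sgn x) ^ \<delta> * of_real \<bar>x\<bar> powr s"

text \<open>
  \<open>E\<close> is the holomorphic family of extensions across \<open>0\<close> of the distributions
  \<open>(sgn x)\<^sup>\<delta> \<bar>x\<bar>\<^sup>s\<^sup>-\<^sup>1 \<rho>(x)\<close>, \<open>Re s > -k\<close>, for a distribution \<open>\<rho>\<close> on the complement of \<open>0\<close>.
\<close>

definition holomorphic_extension ::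
    "nat \<Rightarrow> int \<Rightarrow> functional \<Rightarrow> (complex \<Rightarrow> functional) \<Rightarrow> bool" where
  "holomorphic_extension \<delta> k \<rho> E \<longleftrightarrow>
     (\<forall>s. Re s > - of_int k \<longrightarrow>
        distribution_on UNIV (E s) \<and>
        (\<forall>\<phi>\<in>test_fun (- {0}). E s \<phi> = dist_mult (signed_power \<delta> (s - 1)) \<rho> \<phi>) \<and>
        (\<forall>l::int. 0 \<le> l \<and> of_int l \<le> Re s - 1 + of_int k \<longrightarrow> vanishes_to_order 0 l (E s))) \<and>
     (\<forall>\<phi>\<in>test_fun UNIV. (\<lambda>s. E s \<phi>) holomorphic_on {s. Re s > - of_int k})"

text \<open>
  The function \<open>(1 - \<phi>)(1/y)\<close>, which equals \<open>1\<close> near \<open>y = 0\<close> when \<open>\<phi>\<close> has compact support; the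
  value at \<open>0\<close> has to be put in by hand because of \<open>1/0 = 0\<close>.
\<close>

definition complementary_cutoff :: "(real \<Rightarrow> complex) \<Rightarrow> real \<Rightarrow> complex" where
  "complementary_cutoff \<phi> = (\<lambda>y. if y = 0 then 1 else 1 - \<phi> (1 / y))"

text \<open>
  The distribution \<open>\<sigma>(1/x)\<close> off the origin is \<open>\<lambda>\<psi>. \<sigma> (inversion \<psi>)\<close>.  Its multiples by
  \<open>(sgn x)\<^sup>\<delta> \<bar>x\<bar>\<^sup>-\<^sup>s\<^sup>-\<^sup>1\<close>, \<open>Re s < k\<^sub>\<infinity>\<close>, are the ones considered above with \<open>-s\<close> in place of \<open>s\<close>,
  which is why the second family is evaluated at \<open>-s\<close>.  The value does not depend on \<open>k\<^sub>0\<close>, \<open>k\<^sub>\<infinity>\<close>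
  and \<open>\<phi>\<close>; when \<open>\<sigma>\<close> vanishes to infinite order at both points, every \<open>s\<close> lies in one of the strips.
\<close>

definition signed_mellin :: "nat \<Rightarrow> functional \<Rightarrow> complex \<Rightarrow> complex" where
  "signed_mellin \<delta> \<sigma> s =
     (THE w. \<exists>k0 kinf \<tau> E F \<phi>.
        vanishes_to_order 0 k0 \<sigma> \<and>
        extends_to_rp1 \<sigma> \<tau> \<and> vanishes_to_order 0 kinf (chart_at_infinity \<tau>) \<and>
        k0 + kinf \<ge> 1 \<and> - of_int k0 < Re s \<and> Re s < of_int kinf \<and>
        holomorphic_extension \<delta> k0 \<sigma> E \<and>
        holomorphic_extension \<delta> kinf (\<lambda>\<psi>. \<sigma> (inversion \<psi>)) F \<and>
        \<phi> \<in> test_fun UNIV \<and> (\<forall>\<^sub>F x in nhds 0. \<phi> x = 1) \<and>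
        w = E s \<phi> + F (- s) (complementary_cutoff \<phi>))"

definition mellin_source :: "nat \<Rightarrow> functional set" where
  "mellin_source \<delta> = {\<sigma>. tempered_distribution \<sigma> \<and> has_parity \<delta> \<sigma> \<and>
     vanishes_to_infinite_order 0 \<sigma> \<and> extends_canonically_across_infinity \<sigma>}"

definition moderate_growth_on_vertical_strips :: "(complex \<Rightarrow> complex) \<Rightarrow> bool" where
  "moderate_growth_on_vertical_strips H \<longleftrightarrow>
     (\<forall>a b::real. a < b \<longrightarrow> (\<exists>T C. \<exists>N::nat. T > 0 \<and> C > 0 \<and>
        (\<forall>s. a \<le> Re s \<and> Re s \<le> b \<and> \<bar>Im s\<bar> \<ge> T \<longrightarrow> norm (H s) \<le> C * \<bar>Im s\<bar> ^ N)))"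

definition complex_function_space :: "('a \<Rightarrow> complex) set \<Rightarrow> bool" where
  "complex_function_space V \<longleftrightarrow> (\<lambda>x. 0) \<in> V \<and>
     (\<forall>f\<in>V. \<forall>g\<in>V. (\<lambda>x. f x + g x) \<in> V) \<and> (\<forall>c. \<forall>f\<in>V. (\<lambda>x. c * f x) \<in> V)"

definition complex_linear_isomorphism ::
    "(('a \<Rightarrow> complex) \<Rightarrow> ('b \<Rightarrow> complex)) \<Rightarrow> ('a \<Rightarrow> complex) set \<Rightarrow> ('b \<Rightarrow> complex) set \<Rightarrow> bool" where
  "complex_linear_isomorphism T V W \<longleftrightarrow>
     complex_function_space V \<and> complex_function_space W \<and>
     (\<forall>f\<in>V. \<forall>g\<in>V. T (\<lambda>x. f x + g x) = (\<lambda>y. T f y + T g y)) \<and>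
     (\<forall>c. \<forall>f\<in>V. T (\<lambda>x. c * f x) = (\<lambda>y. c * T f y)) \<and>
     bij_betw T V W"

end

(*
  Let E = x d/dx.  A distribution that vanishes to infinite order at 0 and infinity is, on test
  functions f supported off the origin, bounded for every K by the suprema of
  |E^j f(x)| exp (-K |ln |x||), j <= N.  It therefore extends, by exhaustion with cutoffs, to all
  smooth functions off the origin of moderate growth at 0 and infinity, and its Mellin transform at s
  is the value of this extension at (sgn x)^delta |x|^(s-1).  Holomorphy and moderate growth in s
  follow from the bounds.

  In the coordinate ln |x| the values on Re s = 1 are a Fourier transform; approximating test
  functions by trigonometric polynomials of large period shows that they determine the distribution
  off the origin, hence everywhere.

  Conversely, given H and K, divide H by a power of s - (K + 1) to make it integrable on Re s = K and
  Re s = -K, use the inverse Mellin integrals along these two lines for |x| > 1 and |x| < 1, and undo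
  the division with a polynomial in E.  The resulting distribution vanishes to an order growing with
  K at both points, and does not depend on K by injectivity, so it vanishes to infinite order.
*)

theory Submission
  imports Defs "HOL-Complex_Analysis.Complex_Analysis"
begin

section \<open>Iterated derivatives\<close>

text \<open>The weighted bounds come from a normal form. The i-th coefficient of an operator
  tangential to 0 vanishes to order i, so transposing a presentation leads to integrals of bounded
  functions against x^k E^m phi; for |x| < 1 the factor x^k absorbs growth of weight k. The cutoffs
  are stretched in ln |x|, which bounds their E-derivatives uniformly; exhaustion then costs one
  unit of weight and gains exp(-n). The definite description of the transform has a value because a
  holomorphic family of extensions is forced for large Re s, where vanishing to order 1 leaves no
  freedom at 0, and elsewhere by analytic continuation. Trigonometric polynomials do not decay,
  which is the obstacle to injectivity. They are bounded by their values on one period, so one unit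
  of weight makes them negligible beyond a long period. The obstacle to surjectivity is infinity:
  vanishing there concerns the functional composed with x -> 1/x, whose transform is H(-s). The
  construction is therefore run for H(s) and for H(-s), and the results are matched by
  uniqueness.\<close>

lemma nderiv_0 [simp]: "nderiv 0 f = f"
  by (simp add: nderiv_def)

lemma nderiv_Suc: "nderiv (Suc n) f x = vector_derivative (nderiv n f) (at x)"
  by (simp add: nderiv_def)

lemma nderiv_1: "nderiv 1 f x = vector_derivative f (at x)"
  by (simp add: nderiv_def)

lemma nderiv_nderiv: "nderiv m (nderiv n f) = nderiv (m + n) f"
  by (simp add: nderiv_def funpow_add)

lemma nderiv_Suc_right: "nderiv (Suc n) f = nderiv n (nderiv 1 f)"
  by (simp add: nderiv_nderiv)

lemma nderiv_cong:
  assumes "open U" "\<And>x. x \<in> U \<Longrightarrow> f x = g x" "x \<in> U"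
  shows "nderiv n f x = nderiv n g x"
  using assms(3)
proof (induction n arbitrary: x)
  case (Suc n)
  have "\<forall>\<^sub>F y in nhds x. y \<in> UNIV \<longrightarrow> nderiv n f y = nderiv n g y"
    using eventually_nhds_in_open[OF assms(1) Suc.prems] by eventually_elim (auto simp: Suc.IH)
  then show ?case by (auto simp: nderiv_Suc intro: vector_derivative_cong_eq)
qed (simp add: assms)

lemma smooth_onD:
  assumes "smooth_on U f" "x \<in> U"
  shows "(nderiv n f has_vector_derivative nderiv (Suc n) f x) (at x)"
  using assms by (simp add: smooth_on_def nderiv_Suc vector_derivative_works[symmetric])

lemma smooth_onD0:
  assumes "smooth_on U f" "x \<in> U"
  shows "(f has_vector_derivative nderiv 1 f x) (at x)"
  using smooth_onD[OF assms, of 0] by simp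

text \<open>Exhibiting the whole sequence of derivatives gives smoothness and the values of
  \<open>nderiv\<close> at once, so that iterated \<open>vector_derivative\<close> terms are never
  computed. Openness of \<open>U\<close> lets each identity on \<open>U\<close> be differentiated
  again.\<close>

lemma smooth_on_seqI:
  assumes "open U" "\<And>x. x \<in> U \<Longrightarrow> f x = F 0 x"
    and "\<And>n x. x \<in> U \<Longrightarrow> (F n has_vector_derivative F (Suc n) x) (at x)"
  shows "smooth_on U f" "\<And>n x. x \<in> U \<Longrightarrow> nderiv n f x = F n x"
proof -
  have *: "\<forall>x\<in>U. nderiv n f x = F n x" for n
  proof (induction n)
    case (Suc n)
    show ?case
    proof
      fix x assume x: "x \<in> U"
      have "(nderiv n f has_vector_derivative F (Suc n) x) (at x)"
        by (rule has_vector_derivative_transform_within_open[OF assms(3)[OF x] assms(1) x])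
          (use Suc in auto)
      then show "nderiv (Suc n) f x = F (Suc n) x"
        by (simp add: nderiv_Suc vector_derivative_at)
    qed
  qed (use assms in auto)
  then show "\<And>n x. x \<in> U \<Longrightarrow> nderiv n f x = F n x" by blast
  show "smooth_on U f" unfolding smooth_on_def
  proof (intro allI ballI)
    fix n x assume x: "x \<in> U"
    have "(nderiv n f has_vector_derivative F (Suc n) x) (at x)"
      by (rule has_vector_derivative_transform_within_open[OF assms(3)[OF x] assms(1) x])
        (use * in auto)
    then show "nderiv n f differentiable at x" by (rule differentiableI_vector)
  qed
qed

lemma smooth_on_cong:
  assumes "open U" "\<And>x. x \<in> U \<Longrightarrow> f x = g x" "smooth_on U f"
  shows "smooth_on U g"
  by (rule smooth_on_seqI(1)[where F = "\<lambda>n. nderiv n f", OF assms(1)])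
    (use assms smooth_onD in auto)

text \<open>For functions whose derivatives have no convenient closed form: it suffices to find a
  class \<open>P\<close> closed under differentiation. Iterating a choice of derivative inside
  \<open>P\<close> supplies the sequence for \<open>smooth_on_seqI\<close>.\<close>

lemma smooth_on_coinduct:
  assumes "open U" "P f"
    and step: "\<And>f. P f \<Longrightarrow> \<exists>g. P g \<and> (\<forall>x\<in>U. (f has_vector_derivative g x) (at x))"
  shows "smooth_on U f"
proof -
  obtain d where d: "\<And>f. P f \<Longrightarrow> P (d f)" "\<And>f x. P f \<Longrightarrow> x \<in> U \<Longrightarrow> (f has_vector_derivative d f x) (at x)"
    using step by metis
  define F where "F n = (d ^^ n) f" for n
  have P: "P (F n)" for n by (induction n) (auto simp: F_def d assms(2))
  show ?thesis
    by (rule smooth_on_seqI(1)[where F = F, OF assms(1)]) (use d(2)[OF P] in \<open>auto simp: F_def\<close>)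
qed

lemma smooth_on_subset: "smooth_on U f \<Longrightarrow> V \<subseteq> U \<Longrightarrow> smooth_on V f"
  by (auto simp: smooth_on_def)

lemma smooth_on_Un: "smooth_on U f \<Longrightarrow> smooth_on V f \<Longrightarrow> smooth_on (U \<union> V) f"
  by (auto simp: smooth_on_def)

lemma smooth_on_nderiv: "smooth_on U f \<Longrightarrow> smooth_on U (nderiv n f)"
  by (auto simp: smooth_on_def nderiv_nderiv)

lemma smooth_on_continuous: "smooth_on U f \<Longrightarrow> continuous_on U (nderiv n f)"
  by (meson smooth_onD continuous_at_imp_continuous_on has_vector_derivative_continuous)

lemma
  assumes "open U"
  shows smooth_on_const: "smooth_on U (\<lambda>x. c)"
    and nderiv_const: "x \<in> U \<Longrightarrow> nderiv n (\<lambda>x. c) x = (if n = 0 then c else 0)"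
  using smooth_on_seqI[OF assms, of "\<lambda>x. c" "\<lambda>n x. if n = 0 then c else 0"] by auto

lemma
  assumes "open U" "smooth_on U f" "smooth_on U g"
  shows smooth_on_add: "smooth_on U (\<lambda>x. f x + g x)"
    and nderiv_add: "x \<in> U \<Longrightarrow> nderiv n (\<lambda>x. f x + g x) x = nderiv n f x + nderiv n g x"
proof -
  have D: "((\<lambda>x. nderiv n f x + nderiv n g x) has_vector_derivative nderiv (Suc n) f x + nderiv (Suc n) g x) (at x)"
    if "x \<in> U" for n x
    by (intro has_vector_derivative_add smooth_onD[where U = U] assms that)
  show "smooth_on U (\<lambda>x. f x + g x)"
    by (rule smooth_on_seqI(1)[where F = "\<lambda>n x. nderiv n f x + nderiv n g x", OF assms(1) _ D]) auto
  show "nderiv n (\<lambda>x. f x + g x) x = nderiv n f x + nderiv n g x" if "x \<in> U"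
    by (rule smooth_on_seqI(2)[where F = "\<lambda>n x. nderiv n f x + nderiv n g x", OF assms(1) _ D that]) auto
qed

lemma
  assumes "open U" "smooth_on U f"
  shows smooth_on_cmult: "smooth_on U (\<lambda>x. c * f x)"
    and nderiv_cmult: "x \<in> U \<Longrightarrow> nderiv n (\<lambda>x. c * f x) x = c * nderiv n f x"
proof -
  have D: "((\<lambda>x. c * nderiv n f x) has_vector_derivative c * nderiv (Suc n) f x) (at x)"
    if "x \<in> U" for n x
    by (intro has_vector_derivative_mult_right smooth_onD[where U = U] assms that)
  show "smooth_on U (\<lambda>x. c * f x)"
    by (rule smooth_on_seqI(1)[where F = "\<lambda>n x. c * nderiv n f x", OF assms(1) _ D]) auto
  show "nderiv n (\<lambda>x. c * f x) x = c * nderiv n f x" if "x \<in> U"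
    by (rule smooth_on_seqI(2)[where F = "\<lambda>n x. c * nderiv n f x", OF assms(1) _ D that]) auto
qed

lemma
  assumes "open U" "\<And>i. i \<in> I \<Longrightarrow> smooth_on U (f i)"
  shows smooth_on_sum: "smooth_on U (\<lambda>x. \<Sum>i\<in>I. f i x)"
    and nderiv_sum: "x \<in> U \<Longrightarrow> nderiv n (\<lambda>x. \<Sum>i\<in>I. f i x) x = (\<Sum>i\<in>I. nderiv n (f i) x)"
proof -
  have D: "((\<lambda>x. \<Sum>i\<in>I. nderiv n (f i) x) has_vector_derivative (\<Sum>i\<in>I. nderiv (Suc n) (f i) x)) (at x)"
    if "x \<in> U" for n x
    by (intro has_vector_derivative_sum smooth_onD[where U = U] assms that)
  show "smooth_on U (\<lambda>x. \<Sum>i\<in>I. f i x)"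
    by (rule smooth_on_seqI(1)[where F = "\<lambda>n x. \<Sum>i\<in>I. nderiv n (f i) x", OF assms(1) _ D]) auto
  show "nderiv n (\<lambda>x. \<Sum>i\<in>I. f i x) x = (\<Sum>i\<in>I. nderiv n (f i) x)" if "x \<in> U"
    by (rule smooth_on_seqI(2)[where F = "\<lambda>n x. \<Sum>i\<in>I. nderiv n (f i) x", OF assms(1) _ D that]) auto
qed

lemma
  assumes U: "open U" and f: "smooth_on U f" and g: "smooth_on U g"
  shows smooth_on_mult: "smooth_on U (\<lambda>x. f x * g x)"
    and nderiv_mult: "x \<in> U \<Longrightarrow> nderiv n (\<lambda>x. f x * g x) x =
          (\<Sum>i\<le>n. of_nat (n choose i) * (nderiv i f x * nderiv (n - i) g x))"
proof -
  define F where "F n x = (\<Sum>i\<le>n. of_nat (n choose i) * (nderiv i f x * nderiv (n - i) g x))" for n x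
  have D: "(F n has_vector_derivative F (Suc n) x) (at x)" if x: "x \<in> U" for n x
  proof -
    let ?t = "\<lambda>i j. nderiv i f x * nderiv j g x"
    have "(F n has_vector_derivative (\<Sum>i\<le>n. of_nat (n choose i) * (?t i (Suc (n-i)) + ?t (Suc i) (n-i)))) (at x)"
      unfolding F_def
      by (intro has_vector_derivative_sum has_vector_derivative_mult_right has_vector_derivative_mult
          smooth_onD[OF f x] smooth_onD[OF g x])
    moreover have "(\<Sum>i\<le>n. of_nat (n choose i) * (?t i (Suc (n-i)) + ?t (Suc i) (n-i))) = F (Suc n) x"
    proof -
      have "F (Suc n) x = ?t 0 (Suc n) + (\<Sum>i\<le>n. of_nat (Suc n choose Suc i) * ?t (Suc i) (n - i))"
        unfolding F_def by (subst sum.atMost_Suc_shift) simp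
      also have "(\<Sum>i\<le>n. of_nat (Suc n choose Suc i) * ?t (Suc i) (n - i)) =
          (\<Sum>i\<le>n. of_nat (n choose i) * ?t (Suc i) (n - i)) + (\<Sum>i\<le>n. of_nat (n choose Suc i) * ?t (Suc i) (n - i))"
        by (simp add: algebra_simps sum.distrib)
      also have "?t 0 (Suc n) + (\<dots>) = (\<Sum>i\<le>n. of_nat (n choose i) * ?t (Suc i) (n - i)) +
          (?t 0 (Suc n) + (\<Sum>i\<le>n. of_nat (n choose Suc i) * ?t (Suc i) (n - i)))" by simp
      also have "?t 0 (Suc n) + (\<Sum>i\<le>n. of_nat (n choose Suc i) * ?t (Suc i) (n - i)) =
          (\<Sum>i\<le>Suc n. of_nat (n choose i) * ?t i (Suc n - i))"
        by (subst sum.atMost_Suc_shift[of _ n]) simp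
      also have "\<dots> = (\<Sum>i\<le>n. of_nat (n choose i) * ?t i (Suc (n - i)))"
        by (simp add: Suc_diff_le)
      finally show ?thesis by (simp add: algebra_simps sum.distrib)
    qed
    ultimately show ?thesis by simp
  qed
  show "smooth_on U (\<lambda>x. f x * g x)"
    by (rule smooth_on_seqI(1)[where F = F, OF U]) (use D in \<open>auto simp: F_def\<close>)
  show "nderiv n (\<lambda>x. f x * g x) x = (\<Sum>i\<le>n. of_nat (n choose i) * (nderiv i f x * nderiv (n - i) g x))" if "x \<in> U"
    by (subst smooth_on_seqI(2)[where F = F, OF U _ _ that]) (use D in \<open>auto simp: F_def\<close>)
qed

lemma smooth_on_of_real: "open U \<Longrightarrow> smooth_on U of_real"
  by (rule smooth_on_seqI(1)[where F = "\<lambda>n x. if n = 0 then of_real x else if n = 1 then 1 else 0"])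
    (auto intro!: derivative_eq_intros has_vector_derivative_of_real)

lemma smooth_on_power: "open U \<Longrightarrow> smooth_on U f \<Longrightarrow> smooth_on U (\<lambda>x. f x ^ n)"
  by (induction n) (auto intro: smooth_on_const smooth_on_mult)

text \<open>The coefficient is the falling factorial m (m - 1) ... (m - n + 1); the natural number
  division in it is exact.\<close>

lemma nderiv_of_real_power:
  "nderiv n (\<lambda>x. of_real x ^ m) x =
     (if n \<le> m then of_nat (fact m div fact (m - n)) * of_real x ^ (m - n) else 0)"
proof -
  define F :: "nat \<Rightarrow> real \<Rightarrow> complex" where "F n x = (if n \<le> m then of_nat (fact m div fact (m - n)) * of_real x ^ (m - n) else 0)" for n x
  have "(F n has_vector_derivative F (Suc n) x) (at x)" for n x
  proof (cases "n < m")
    case True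
    then obtain k where k: "m = n + Suc k" using less_iff_Suc_add by auto
    \<comment> \<open>Recursion of the falling factorials. It is an identity of truncating
      divisions, so divisibility of the factorials has to be brought in.\<close>
    have "(fact m div fact (Suc k) :: nat) * Suc k = fact m div fact k"
    proof -
      have "(fact (Suc k) :: nat) dvd fact m" by (rule fact_dvd) (use k in auto)
      then obtain c :: nat where c: "fact m = fact (Suc k) * c" by (elim dvdE)
      have "fact m div fact (Suc k) = c" unfolding c by simp
      moreover have "fact m div fact k = Suc k * c" unfolding c fact_Suc
        by (metis div_mult_self1_is_m fact_gt_zero mult.assoc mult.commute of_nat_id)
      ultimately show ?thesis by simp
    qed
    then have *: "(of_nat (fact m div fact (Suc k)) :: complex) * of_nat (Suc k) = of_nat (fact m div fact k)"
      by (metis of_nat_mult)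
    have "((\<lambda>x. of_real x ^ Suc k) has_vector_derivative (of_nat (Suc k) * of_real x ^ k :: complex)) (at x)"
      by (rule has_vector_derivative_eq_rhs[OF has_vector_derivative_real_field]) (auto intro!: derivative_eq_intros, cases k, auto simp: algebra_simps)
    from has_vector_derivative_mult_right[OF this, of "of_nat (fact m div fact (Suc k))"]
    moreover have "n \<le> m" "Suc n \<le> m" "m - n = Suc k" "m - Suc n = k" using k by auto
    ultimately show ?thesis unfolding F_def
      by (simp only: * mult.assoc[symmetric] if_True)
  next
    case False
    then have "F n = (\<lambda>x. F n 0)" "F (Suc n) x = 0" by (auto simp: F_def fun_eq_iff)
    then show ?thesis by (metis has_vector_derivative_const)
  qed
  then show ?thesis
    using smooth_on_seqI(2)[where F = F and U = UNIV and f = "\<lambda>x. of_real x ^ m"] by (auto simp: F_def)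
qed

lemma
  assumes "smooth_on UNIV f"
  shows smooth_on_scale: "smooth_on UNIV (\<lambda>x. f (c * x))"
    and nderiv_scale: "nderiv n (\<lambda>x. f (c * x)) x = of_real c ^ n * nderiv n f (c * x)"
proof -
  have "((\<lambda>x. of_real c ^ n * nderiv n f (c * x)) has_vector_derivative of_real c ^ n * (of_real c * nderiv (Suc n) f (c * x))) (at x)" for n x
    using vector_diff_chain_at[where f = "\<lambda>x. c * x" and x = x and f' = c, OF _ smooth_onD[OF assms, of "c * x" n]]
    by (intro has_vector_derivative_mult_right)
      (auto simp: o_def scaleR_conv_of_real has_real_derivative_iff_has_vector_derivative[symmetric] intro!: derivative_eq_intros)
  then show "smooth_on UNIV (\<lambda>x. f (c * x))" "nderiv n (\<lambda>x. f (c * x)) x = of_real c ^ n * nderiv n f (c * x)"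
    using smooth_on_seqI[where F = "\<lambda>n x. of_real c ^ n * nderiv n f (c * x)" and U = UNIV and f = "\<lambda>x. f (c * x)"]
    by (auto simp: mult_ac)
qed

lemma smooth_on_shift:
  assumes "smooth_on UNIV f"
  shows "smooth_on UNIV (\<lambda>x. f (x + c))"
proof (rule smooth_on_seqI(1)[where F = "\<lambda>n x. nderiv n f (x + c)"])
  show "((\<lambda>x. nderiv n f (x + c)) has_vector_derivative nderiv (Suc n) f (x + c)) (at x)" for n x
  proof -
    have "((\<lambda>x. x + c) has_vector_derivative 1) (at x)"
      by (simp add: has_vector_derivative_def has_derivative_add_const has_derivative_ident)
    from vector_diff_chain_at[OF this smooth_onD[OF assms, of "x + c" n]] show ?thesis
      by (simp add: o_def)
  qed
qed auto

section \<open>Composition with 1/x, ln |x| and exp\<close>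

lemma has_vector_derivative_inverse_power:
  assumes "x \<noteq> 0"
  shows "((\<lambda>x. inverse (of_real x ^ m)) has_vector_derivative (- of_nat m / of_real x ^ Suc m :: complex)) (at x)"
proof -
  have "((\<lambda>z. inverse (z ^ m)) has_field_derivative (- of_nat m / of_real x ^ Suc m :: complex)) (at (of_real x))"
  proof (cases m)
    case (Suc k)
    show ?thesis
      by (rule derivative_eq_intros refl)+ (use assms Suc in \<open>auto simp: field_simps\<close>)
  qed simp
  then show ?thesis by (rule has_vector_derivative_real_field)
qed
text \<open>The class of functions f(1/x) is closed under differentiation: the derivative is g(1/x)
  with g(y) = - y^2 f'(y).\<close>

lemma smooth_on_inv_compose:
  assumes U: "open U" "0 \<notin> U" and V: "open V" "\<And>x. x \<in> U \<Longrightarrow> 1 / x \<in> V" and f: "smooth_on V f"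
  shows "smooth_on U (\<lambda>x. f (1 / x))"
proof (rule smooth_on_coinduct[where P = "\<lambda>h. \<exists>f. smooth_on V f \<and> (\<forall>x. h x = f (1 / x))", OF U(1)])
  fix h assume "\<exists>f. smooth_on V f \<and> (\<forall>x. h x = f (1 / x))"
  then obtain f where f: "smooth_on V f" "h = (\<lambda>x. f (1 / x))" by blast
  define g where "g y = (-1) * (of_real y ^ 2 * nderiv 1 f y)" for y
  have "smooth_on V g" unfolding g_def
    by (intro smooth_on_cmult smooth_on_mult smooth_on_power smooth_on_of_real smooth_on_nderiv V f)
  moreover have "(h has_vector_derivative g (1 / x)) (at x)" if x: "x \<in> U" for x
  proof -
    have x0: "x \<noteq> 0" using x assms by auto
    have "((\<lambda>x. 1 / x) has_vector_derivative - (1 / x ^ 2)) (at x)"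
      unfolding has_real_derivative_iff_has_vector_derivative[symmetric]
      using x0 by (auto intro!: derivative_eq_intros simp: power2_eq_square)
    from vector_diff_chain_at[OF this smooth_onD0[OF f(1) V(2)[OF x]]]
    show ?thesis unfolding f(2) o_def
      by (rule has_vector_derivative_eq_rhs) (use x0 in \<open>simp add: g_def scaleR_conv_of_real power_divide\<close>)
  qed
  ultimately show "\<exists>g. (\<exists>f. smooth_on V f \<and> (\<forall>x. g x = f (1 / x))) \<and> (\<forall>x\<in>U. (h has_vector_derivative g x) (at x))"
    by (intro exI[of _ "\<lambda>x. g (1 / x)"]) auto
qed (use f in auto)

lemma has_vector_derivative_ln_abs:
  "x \<noteq> 0 \<Longrightarrow> ((\<lambda>x. ln \<bar>x\<bar>) has_vector_derivative 1 / x) (at x)" for x :: real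
proof (cases "x > 0")
  case True
  show ?thesis
    by (rule has_vector_derivative_transform_within_open[where S = "{0<..}" and f = ln])
      (use True in \<open>auto simp: has_real_derivative_iff_has_vector_derivative[symmetric] intro!: derivative_eq_intros\<close>)
next
  assume "x \<noteq> 0" case False
  show ?thesis
    by (rule has_vector_derivative_transform_within_open[where S = "{..<0}" and f = "\<lambda>x. ln (- x)"])
      (use False \<open>x \<noteq> 0\<close> in \<open>auto simp: has_real_derivative_iff_has_vector_derivative[symmetric] intro!: derivative_eq_intros\<close>)
qed

lemma has_vector_derivative_ln_compose:
  assumes "smooth_on UNIV f" "x \<noteq> 0"
  shows "((\<lambda>x. f (ln \<bar>x\<bar>)) has_vector_derivative nderiv 1 f (ln \<bar>x\<bar>) / of_real x) (at x)"
  using vector_diff_chain_at[OF has_vector_derivative_ln_abs[OF assms(2)] smooth_onD0[OF assms(1), of "ln \<bar>x\<bar>"]]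
  by (simp add: o_def scaleR_conv_of_real divide_inverse mult.commute)

text \<open>Each differentiation of f(ln |x|) produces a factor 1/x. The class is therefore enlarged
  by powers x^(-m), after which it is closed, with f' - m f in place of f.\<close>

lemma smooth_on_ln_compose:
  assumes "smooth_on UNIV f"
  shows "smooth_on (- {0}) (\<lambda>x. f (ln \<bar>x\<bar>))"
proof (rule smooth_on_coinduct[where P = "\<lambda>h. \<exists>f m. smooth_on UNIV f \<and> h = (\<lambda>x. f (ln \<bar>x\<bar>) * inverse (of_real x ^ m))"])
  show "\<exists>fa m. smooth_on UNIV fa \<and> (\<lambda>x. f (ln \<bar>x\<bar>)) = (\<lambda>x. fa (ln \<bar>x\<bar>) * inverse (complex_of_real x ^ m))"
    using assms by (intro exI[of _ f] exI[of _ 0]) auto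
  fix h assume "\<exists>f m. smooth_on UNIV f \<and> h = (\<lambda>x. f (ln \<bar>x\<bar>) * inverse (complex_of_real x ^ m))"
  then obtain f m where f: "smooth_on UNIV f" "h = (\<lambda>x. f (ln \<bar>x\<bar>) * inverse (of_real x ^ m))" by blast
  define g where "g y = nderiv 1 f y + (- of_nat m) * f y" for y
  have "smooth_on UNIV g" unfolding g_def
    by (intro smooth_on_add smooth_on_cmult smooth_on_nderiv f) auto
  moreover have "(h has_vector_derivative g (ln \<bar>x\<bar>) * inverse (of_real x ^ Suc m)) (at x)" if x: "x \<in> - {0}" for x
  proof -
    have x0: "x \<noteq> 0" using x by auto
    have "((\<lambda>x. inverse (of_real x ^ m)) has_vector_derivative (- of_nat m / of_real x ^ Suc m :: complex)) (at x)"
      by (rule has_vector_derivative_inverse_power[OF x0])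
    from has_vector_derivative_mult[OF has_vector_derivative_ln_compose[OF f(1) x0] this]
    show ?thesis unfolding f(2)
      by (rule has_vector_derivative_eq_rhs) (use x0 in \<open>simp add: g_def field_simps\<close>)
  qed
  ultimately show "\<exists>g. (\<exists>f m. smooth_on UNIV f \<and> g = (\<lambda>x. f (ln \<bar>x\<bar>) * inverse (complex_of_real x ^ m))) \<and>
            (\<forall>x\<in>- {0}. (h has_vector_derivative g x) (at x))"
    by (intro exI[of _ "\<lambda>x. g (ln \<bar>x\<bar>) * inverse (of_real x ^ Suc m)"]) (auto simp del: power_Suc)
qed auto

lemma smooth_on_exp_compose:
  assumes "smooth_on (- {0}) f"
  shows "smooth_on UNIV (\<lambda>u. f (exp u))"
proof (rule smooth_on_coinduct[where P = "\<lambda>h. \<exists>f. smooth_on (- {0}) f \<and> h = (\<lambda>u. f (exp u))"])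
  fix h assume "\<exists>f. smooth_on (- {0}) f \<and> h = (\<lambda>u. f (exp u))"
  then obtain f where f: "smooth_on (- {0}) f" "h = (\<lambda>u. f (exp u))" by blast
  have "smooth_on (- {0}) (\<lambda>x. of_real x * nderiv 1 f x)"
    by (intro smooth_on_mult smooth_on_of_real smooth_on_nderiv f) auto
  moreover have "(h has_vector_derivative of_real (exp x) * nderiv 1 f (exp x)) (at x)" for x
    using vector_diff_chain_at[OF _ smooth_onD0[OF f(1)], of exp "exp x" x]
    by (simp add: f(2) o_def scaleR_conv_of_real has_real_derivative_iff_has_vector_derivative[symmetric])
  ultimately show "\<exists>g. (\<exists>f. smooth_on (- {0}) f \<and> g = (\<lambda>u. f (exp u))) \<and> (\<forall>x\<in>UNIV. (h has_vector_derivative g x) (at x))"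
    by (intro exI[of _ "\<lambda>u. of_real (exp u) * nderiv 1 f (exp u)"]) auto
qed (use assms in auto)

section \<open>The Euler operator and weighted bounds\<close>

text \<open>In the coordinate u = ln |x| this operator is d/du; together with multiplication by
  smooth functions it generates the operators tangential to 0.\<close>

definition euler :: "(real \<Rightarrow> complex) \<Rightarrow> real \<Rightarrow> complex" where
  "euler f = (\<lambda>x. of_real x * nderiv 1 f x)"

lemma euler_cong:
  assumes "open U" "\<And>x. x \<in> U \<Longrightarrow> f x = g x" "x \<in> U"
  shows "(euler ^^ n) f x = (euler ^^ n) g x"
  using assms(3)
proof (induction n arbitrary: x)
  case (Suc n)
  then show ?case using nderiv_cong[OF assms(1) Suc.IH, where x = x and n = 1] by (simp add: euler_def)
qed (use assms in simp)

lemma smooth_on_euler: "open U \<Longrightarrow> smooth_on U f \<Longrightarrow> smooth_on U ((euler ^^ n) f)"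
  by (induction n) (simp_all add: euler_def smooth_on_mult smooth_on_of_real smooth_on_nderiv)

lemma euler_power_Suc: "(euler ^^ Suc n) f = (euler ^^ n) (euler f)"
  by (simp add: funpow_swap1)

lemma euler_add:
  assumes "open U" "smooth_on U f" "smooth_on U g" "x \<in> U"
  shows "(euler ^^ n) (\<lambda>x. f x + g x) x = (euler ^^ n) f x + (euler ^^ n) g x"
  using assms(2-)
proof (induction n arbitrary: f g)
  case (Suc n)
  have "(euler ^^ n) (euler (\<lambda>x. f x + g x)) x = (euler ^^ n) (\<lambda>x. euler f x + euler g x) x"
    by (rule euler_cong[OF assms(1) _ assms(4)])
      (use Suc in \<open>simp add: euler_def nderiv_add[OF assms(1)] algebra_simps\<close>)
  then show ?case
    using Suc.IH[of "euler f" "euler g"] Suc.prems smooth_on_euler[OF assms(1), of _ 1]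
    by (simp add: euler_power_Suc del: funpow.simps)
qed simp

lemma euler_cmult:
  assumes "open U" "smooth_on U f" "x \<in> U"
  shows "(euler ^^ n) (\<lambda>x. c * f x) x = c * (euler ^^ n) f x"
  using assms(2-)
proof (induction n arbitrary: f)
  case (Suc n)
  have "(euler ^^ n) (euler (\<lambda>x. c * f x)) x = (euler ^^ n) (\<lambda>x. c * euler f x) x"
    by (rule euler_cong[OF assms(1) _ assms(3)])
      (use Suc in \<open>simp add: euler_def nderiv_cmult[OF assms(1)] algebra_simps\<close>)
  then show ?case
    using Suc.IH[of "euler f"] Suc.prems smooth_on_euler[OF assms(1), of _ 1]
    by (simp add: euler_power_Suc del: funpow.simps)
qed simp

lemma euler_sum:
  assumes "open U" "\<And>i. i \<in> I \<Longrightarrow> smooth_on U (f i)" "finite I" "x \<in> U"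
  shows "(euler ^^ n) (\<lambda>x. \<Sum>i\<in>I. f i x) x = (\<Sum>i\<in>I. (euler ^^ n) (f i) x)"
  using assms(3,2)
proof (induction I rule: finite_induct)
  case empty
  show ?case using euler_cmult[OF assms(1) smooth_on_const[OF assms(1), of 0] assms(4), of n 0] by simp
next
  case (insert i I)
  moreover have "smooth_on U (\<lambda>x. \<Sum>i\<in>I. f i x)" by (rule smooth_on_sum[OF assms(1)]) (use insert in auto)
  ultimately show ?case using euler_add[OF assms(1) _ _ assms(4), of "f i" "\<lambda>x. \<Sum>i\<in>I. f i x" n] by simp
qed

lemma euler_mult:
  assumes "open U" "smooth_on U f" "smooth_on U g" "x \<in> U"
  shows "euler (\<lambda>x. f x * g x) x = euler f x * g x + f x * euler g x"
  using nderiv_mult[OF assms, of 1] by (simp add: euler_def algebra_simps)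

section \<open>Conversion between powers of the Euler operator and x^i (d/dx)^i\<close>

lemma of_real_power_nderiv_Suc:
  assumes "open U" "smooth_on U f" "x \<in> U"
  shows "euler (\<lambda>x. of_real x ^ i * nderiv i f x) x =
      of_nat i * (of_real x ^ i * nderiv i f x) + of_real x ^ Suc i * nderiv (Suc i) f x"
proof -
  have "nderiv 1 (\<lambda>x. of_real x ^ i) x = of_nat i * of_real x ^ (i - 1)"
  proof -
    have "fact i div fact (i - 1) = i" if "i \<ge> 1" for i :: nat using that by (cases i) auto
    then show ?thesis unfolding nderiv_of_real_power by (auto simp: Suc_le_eq)
  qed
  then have "euler (\<lambda>x. of_real x ^ i) x = of_nat i * of_real x ^ i"
    by (cases i) (auto simp: euler_def)
  moreover have "euler (nderiv i f) x = of_real x * nderiv (Suc i) f x"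
    by (simp add: euler_def nderiv_nderiv)
  ultimately show ?thesis
    using assms by (subst euler_mult) (auto intro: smooth_on_nderiv smooth_on_power smooth_on_of_real simp: algebra_simps)
qed

text \<open>The recursion for \<open>c'\<close> is that of the Stirling numbers of the second kind.
  The coefficients are quantified before \<open>U\<close>, \<open>f\<close> and \<open>x\<close>,
  because the estimates drawn from them must be uniform in the function.\<close>

lemma euler_eq_nderiv:
  "\<exists>c. \<forall>U f x. open U \<and> smooth_on U f \<and> x \<in> U \<longrightarrow>
     (euler ^^ j) f x = (\<Sum>i\<le>j. c i * (of_real x ^ i * nderiv i f x))"
proof (induction j)
  case (Suc j)
  then obtain c where c: "\<And>U f x. \<lbrakk>open U; smooth_on U f; x \<in> U\<rbrakk> \<Longrightarrow>
     (euler ^^ j) f x = (\<Sum>i\<le>j. c i * (of_real x ^ i * nderiv i f x))" by blast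
  define c' where "c' i = (if i \<le> j then c i * of_nat i else 0) + (if i = 0 then 0 else c (i - 1))" for i
  have "(euler ^^ Suc j) f x = (\<Sum>i\<le>Suc j. c' i * (of_real x ^ i * nderiv i f x))"
    if U: "open U" "smooth_on U f" "x \<in> U" for U f x
  proof -
    let ?t = "\<lambda>i. of_real x ^ i * nderiv i f x"
    have "(euler ^^ Suc j) f x = euler (\<lambda>x. \<Sum>i\<le>j. c i * (of_real x ^ i * nderiv i f x)) x"
      using euler_cong[OF U(1) c[OF U(1,2)] U(3), where n = 1] by simp
    also have "\<dots> = (\<Sum>i\<le>j. c i * (of_nat i * ?t i + ?t (Suc i)))"
      using euler_sum[OF U(1) _ _ U(3), of "{..j}" "\<lambda>i x. c i * (of_real x ^ i * nderiv i f x)" 1]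
        euler_cmult[OF U(1) _ U(3), of _ 1] of_real_power_nderiv_Suc[OF U] U
      by (simp add: smooth_on_cmult smooth_on_mult smooth_on_nderiv smooth_on_power smooth_on_of_real)
    also have "\<dots> = (\<Sum>i\<le>j. c i * of_nat i * ?t i) + (\<Sum>i\<le>j. c i * ?t (Suc i))"
      by (simp add: algebra_simps sum.distrib)
    also have "(\<Sum>i\<le>j. c i * of_nat i * ?t i) = (\<Sum>i\<le>Suc j. (if i \<le> j then c i * of_nat i else 0) * ?t i)"
      by simp
    also have "(\<Sum>i\<le>j. c i * ?t (Suc i)) = (\<Sum>i\<le>Suc j. (if i = 0 then 0 else c (i - 1)) * ?t i)"
      by (subst sum.atMost_Suc_shift) simp
    finally show ?thesis unfolding c'_def by (simp add: algebra_simps sum.distrib)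
  qed
  then show ?case by blast
qed (auto intro!: exI[of _ "\<lambda>_. 1"])

text \<open>The inverse conversion, x^j (d/dx)^j = E (E - 1) ... (E - j + 1), whose coefficients are
  the signed Stirling numbers of the first kind.\<close>

lemma nderiv_eq_euler:
  "\<exists>c. \<forall>U f x. open U \<and> smooth_on U f \<and> x \<in> U \<longrightarrow>
     of_real x ^ j * nderiv j f x = (\<Sum>i\<le>j. c i * (euler ^^ i) f x)"
proof (induction j)
  case (Suc j)
  then obtain c where c: "\<And>U f x. \<lbrakk>open U; smooth_on U f; x \<in> U\<rbrakk> \<Longrightarrow>
     of_real x ^ j * nderiv j f x = (\<Sum>i\<le>j. c i * (euler ^^ i) f x)" by blast
  define c' where "c' i = (if i = 0 then 0 else c (i - 1)) - (if i \<le> j then of_nat j * c i else 0)" for i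
  have "of_real x ^ Suc j * nderiv (Suc j) f x = (\<Sum>i\<le>Suc j. c' i * (euler ^^ i) f x)"
    if U: "open U" "smooth_on U f" "x \<in> U" for U f x
  proof -
    have "euler (\<lambda>x. of_real x ^ j * nderiv j f x) x = euler (\<lambda>x. \<Sum>i\<le>j. c i * (euler ^^ i) f x) x"
      using euler_cong[OF U(1) c[OF U(1,2)] U(3), where n = 1] by simp
    also have "\<dots> = (\<Sum>i\<le>j. c i * (euler ^^ Suc i) f x)"
      using euler_sum[OF U(1) _ _ U(3), of "{..j}" "\<lambda>i x. c i * (euler ^^ i) f x" 1]
        euler_cmult[OF U(1) _ U(3), of _ 1] U
      by (simp add: smooth_on_cmult smooth_on_euler)
    also have "\<dots> = (\<Sum>i\<le>Suc j. (if i = 0 then 0 else c (i - 1)) * (euler ^^ i) f x)"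
      by (subst sum.atMost_Suc_shift) simp
    finally have "of_real x ^ Suc j * nderiv (Suc j) f x = \<dots> - of_nat j * (\<Sum>i\<le>j. c i * (euler ^^ i) f x)"
      using of_real_power_nderiv_Suc[OF U, of j] c[OF U] by (simp add: algebra_simps)
    also have "of_nat j * (\<Sum>i\<le>j. c i * (euler ^^ i) f x) = (\<Sum>i\<le>Suc j. (if i \<le> j then of_nat j * c i else 0) * (euler ^^ i) f x)"
      by (simp add: sum_distrib_left mult.assoc)
    finally show ?thesis unfolding c'_def by (simp add: algebra_simps sum_subtractf del: funpow.simps)
  qed
  then show ?case by blast
qed (auto intro!: exI[of _ "\<lambda>_. 1"])

lemma norm_euler_le:
  "\<exists>C\<ge>0. \<forall>U f x. open U \<and> smooth_on U f \<and> x \<in> U \<longrightarrow>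
     norm ((euler ^^ j) f x) \<le> C * (\<Sum>i\<le>j. \<bar>x\<bar> ^ i * norm (nderiv i f x))"
proof -
  obtain c where c: "\<And>U f x. \<lbrakk>open U; smooth_on U f; x \<in> U\<rbrakk> \<Longrightarrow>
     (euler ^^ j) f x = (\<Sum>i\<le>j. c i * (of_real x ^ i * nderiv i f x))" using euler_eq_nderiv[of j] by blast
  define C where "C = (\<Sum>i\<le>j. norm (c i))"
  have "norm ((euler ^^ j) f x) \<le> C * (\<Sum>i\<le>j. \<bar>x\<bar> ^ i * norm (nderiv i f x))"
    if "open U" "smooth_on U f" "x \<in> U" for U f x
    unfolding c[OF that] sum_distrib_left
    by (rule order_trans[OF norm_sum sum_mono])
      (auto simp: norm_mult norm_power C_def intro!: mult_right_mono member_le_sum)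
  moreover have "C \<ge> 0" unfolding C_def by (simp add: sum_nonneg)
  ultimately show ?thesis by blast
qed

lemma norm_nderiv_le:
  "\<exists>C\<ge>0. \<forall>U f x. open U \<and> smooth_on U f \<and> x \<in> U \<longrightarrow>
     \<bar>x\<bar> ^ j * norm (nderiv j f x) \<le> C * (\<Sum>i\<le>j. norm ((euler ^^ i) f x))"
proof -
  obtain c where c: "\<And>U f x. \<lbrakk>open U; smooth_on U f; x \<in> U\<rbrakk> \<Longrightarrow>
     of_real x ^ j * nderiv j f x = (\<Sum>i\<le>j. c i * (euler ^^ i) f x)" using nderiv_eq_euler[of j] by blast
  define C where "C = (\<Sum>i\<le>j. norm (c i))"
  have "norm (of_real x ^ j * nderiv j f x) \<le> C * (\<Sum>i\<le>j. norm ((euler ^^ i) f x))"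
    if "open U" "smooth_on U f" "x \<in> U" for U f x
    unfolding c[OF that] sum_distrib_left
    by (rule order_trans[OF norm_sum sum_mono])
      (auto simp: norm_mult C_def intro!: mult_right_mono member_le_sum)
  moreover have "C \<ge> 0" unfolding C_def by (simp add: sum_nonneg)
  ultimately show ?thesis by (auto simp: norm_mult norm_power intro!: exI[of _ C])
qed

section \<open>Weighted bounds on Euler derivatives\<close>

text \<open>The constant \<open>B\<close> is kept apart from the weight \<open>w\<close>, so that
  functionals can be bounded linearly in \<open>B\<close>. The point 0 is left out: the functions of
  interest may be singular there.\<close>

definition ebound :: "nat \<Rightarrow> (real \<Rightarrow> real) \<Rightarrow> (real \<Rightarrow> complex) \<Rightarrow> real \<Rightarrow> bool" where
  "ebound N w f B \<longleftrightarrow> (\<forall>j\<le>N. \<forall>x. x \<noteq> 0 \<longrightarrow> norm ((euler ^^ j) f x) \<le> B * w x)"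

lemma ebound_Suc: "ebound (Suc N) w f B \<longleftrightarrow> (\<forall>x. x \<noteq> 0 \<longrightarrow> norm (f x) \<le> B * w x) \<and> ebound N w (euler f) B"
proof -
  have "(\<forall>j\<le>Suc N. P j) \<longleftrightarrow> P 0 \<and> (\<forall>j\<le>N. P (Suc j))" for P :: "nat \<Rightarrow> bool"
    by (metis Suc_le_mono le0 not0_implies_Suc)
  from this[of "\<lambda>j. \<forall>x. x \<noteq> 0 \<longrightarrow> norm ((euler ^^ j) f x) \<le> B * w x"]
  show ?thesis unfolding ebound_def euler_power_Suc by simp
qed

lemma ebound_0: "ebound 0 w f B \<longleftrightarrow> (\<forall>x. x \<noteq> 0 \<longrightarrow> norm (f x) \<le> B * w x)"
  by (simp add: ebound_def)

lemma ebound_cong: "(\<And>x. x \<noteq> 0 \<Longrightarrow> f x = g x) \<Longrightarrow> ebound N w f B \<Longrightarrow> ebound N w g B"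
  using euler_cong[of "- {0}" f g] by (simp add: ebound_def open_Compl)

lemma ebound_mono:
  assumes "ebound N w f B" "M \<le> N" "\<And>x. x \<noteq> 0 \<Longrightarrow> B * w x \<le> B' * v x"
  shows "ebound M v f B'"
  using assms unfolding ebound_def by (meson order_trans)

lemma ebound_add:
  assumes "smooth_on (- {0}) f" "smooth_on (- {0}) g" "ebound N w f B" "ebound N w g C"
  shows "ebound N w (\<lambda>x. f x + g x) (B + C)"
  using assms unfolding ebound_def
  by (auto simp: euler_add[of "- {0}"] open_Compl algebra_simps intro!: order_trans[OF norm_triangle_ineq] add_mono)

lemma ebound_cmult:
  assumes "smooth_on (- {0}) f" "ebound N w f B"
  shows "ebound N w (\<lambda>x. c * f x) (norm c * B)"
  using assms unfolding ebound_def
  by (auto simp: euler_cmult[of "- {0}"] open_Compl norm_mult mult.assoc intro!: mult_left_mono)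

text \<open>Since E is a derivation, each application doubles the number of terms; this is the
  origin of the factor 2^N.\<close>

lemma ebound_mult:
  assumes "smooth_on (- {0}) f" "smooth_on (- {0}) g" "ebound N w f B" "ebound N v g C"
  shows "ebound N (\<lambda>x. w x * v x) (\<lambda>x. f x * g x) (2 ^ N * (B * C))"
  using assms
proof (induction N arbitrary: f g)
  case 0
  then show ?case by (auto simp: ebound_0 norm_mult) (smt (verit) mult.assoc mult.left_commute mult_mono norm_ge_zero)
next
  case (Suc N)
  have o: "open (- {0::real})" by (simp add: open_Compl)
  have sm: "smooth_on (- {0}) (euler f)" "smooth_on (- {0}) (euler g)"
    using smooth_on_euler[OF o, of _ 1] Suc.prems by auto
  have le: "ebound N w f B" "ebound N v g C" "ebound N w (euler f) B" "ebound N v (euler g) C"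
    using Suc.prems(3,4) unfolding ebound_Suc using Suc.prems(3,4) by (auto simp: ebound_def)
  have "ebound N (\<lambda>x. w x * v x) (\<lambda>x. euler f x * g x + f x * euler g x) (2 ^ N * (B * C) + 2 ^ N * (B * C))"
    by (intro ebound_add Suc.IH smooth_on_mult o sm Suc.prems le)
  then have "ebound N (\<lambda>x. w x * v x) (euler (\<lambda>x. f x * g x)) (2 ^ Suc N * (B * C))"
    unfolding mult_2[symmetric] power_Suc mult.assoc
    by (rule ebound_cong[rotated]) (use Suc.prems o in \<open>auto simp: euler_mult[of "- {0}"]\<close>)
  moreover have "norm (f x * g x) \<le> 2 ^ Suc N * (B * C) * (w x * v x)" if "x \<noteq> 0" for x
  proof -
    have "norm (f x) \<le> B * w x" "norm (g x) \<le> C * v x" using Suc.prems(3,4) that by (auto simp: ebound_Suc)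
    then have "norm (f x) * norm (g x) \<le> (B * w x) * (C * v x)" by (intro mult_mono) (auto intro: order_trans[OF norm_ge_zero])
    moreover have "(B * w x) * (C * v x) \<le> 2 ^ Suc N * ((B * w x) * (C * v x))"
      using calculation by (smt (verit) mult_le_cancel_right1 norm_ge_zero mult_nonneg_nonneg one_le_power)
    ultimately show ?thesis by (simp add: norm_mult mult_ac)
  qed
  ultimately show ?case unfolding ebound_Suc by blast
qed

text \<open>For x different from 0 this is max(|x|, 1/|x|)^K, which treats 0 and infinity
  symmetrically. At x = 0 it is 1, because ln 0 is 0.\<close>

definition wt :: "real \<Rightarrow> real \<Rightarrow> real" where
  "wt K x = exp (K * \<bar>ln \<bar>x\<bar>\<bar>)"

lemma wt_pos [simp]: "wt K x > 0" "wt K x \<ge> 0" "wt K x \<noteq> 0" by (auto simp: wt_def)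
lemma wt_0 [simp]: "wt 0 x = 1" by (simp add: wt_def)
lemma wt_add: "wt (K + L) x = wt K x * wt L x" by (simp add: wt_def exp_add[symmetric] algebra_simps)
lemma wt_mono: "K \<le> L \<Longrightarrow> wt K x \<le> wt L x" by (simp add: wt_def mult_right_mono)
lemma wt_inverse [simp]: "wt K (1 / x) = wt K x" by (cases "x = 0") (simp_all add: wt_def ln_div)
lemma wt_minus [simp]: "wt K (- x) = wt K x" by (simp add: wt_def)
lemma power_wt: "\<bar>x\<bar> < 1 \<Longrightarrow> x \<noteq> 0 \<Longrightarrow> \<bar>x\<bar> ^ n = wt (- real n) x"
  by (simp add: wt_def exp_of_nat_mult abs_of_neg[of "ln \<bar>x\<bar>"])
lemma power_wt': "\<bar>x\<bar> \<ge> 1 \<Longrightarrow> \<bar>x\<bar> ^ n = wt (real n) x"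
  by (cases "x = 0") (simp_all add: wt_def exp_of_nat_mult)

section \<open>Cutoffs and test functions\<close>

text \<open>By the quotient rule the functions f / g^m form a class closed under
  differentiation.\<close>

lemma smooth_on_divide:
  assumes "open U" "smooth_on U f" "smooth_on U g" "\<And>x. x \<in> U \<Longrightarrow> g x \<noteq> 0"
  shows "smooth_on U (\<lambda>x. f x / g x)"
proof (rule smooth_on_coinduct[where P = "\<lambda>h. \<exists>f m. smooth_on U f \<and> h = (\<lambda>x. f x * inverse (g x ^ m))", OF assms(1)])
  show "\<exists>f' m. smooth_on U f' \<and> (\<lambda>x. f x / g x) = (\<lambda>x. f' x * inverse (g x ^ m))"
    by (rule exI[of _ f], rule exI[of _ 1]) (use assms(2) in \<open>auto simp: divide_inverse\<close>)
  fix h assume "\<exists>f m. smooth_on U f \<and> h = (\<lambda>x. f x * inverse (g x ^ m))"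
  then obtain f m where f: "smooth_on U f" "h = (\<lambda>x. f x * inverse (g x ^ m))" by blast
  define k where "k x = nderiv 1 f x * g x + (- of_nat m) * (f x * nderiv 1 g x)" for x
  have "smooth_on U k" unfolding k_def
    by (intro smooth_on_add smooth_on_mult smooth_on_cmult smooth_on_nderiv assms f)
  moreover have "(h has_vector_derivative k x * inverse (g x ^ Suc m)) (at x)" if x: "x \<in> U" for x
  proof -
    have "((\<lambda>z. inverse (z ^ m)) has_field_derivative (- of_nat m / g x ^ Suc m :: complex)) (at (g x))"
    proof (cases m)
      case (Suc k)
      show ?thesis
        by (rule derivative_eq_intros refl)+ (use assms(4)[OF x] Suc in \<open>auto simp: field_simps\<close>)
    qed simp
    from field_vector_diff_chain_at[OF smooth_onD0[OF assms(3) x] this]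
    have "((\<lambda>x. inverse (g x ^ m)) has_vector_derivative nderiv 1 g x * (- of_nat m / g x ^ Suc m)) (at x)"
      by (simp add: o_def)
    from has_vector_derivative_mult[OF smooth_onD0[OF f(1) x] this]
    show ?thesis unfolding f(2)
      by (rule has_vector_derivative_eq_rhs) (use assms(4)[OF x] in \<open>simp add: k_def field_simps\<close>)
  qed
  ultimately show "\<exists>k. (\<exists>f m. smooth_on U f \<and> k = (\<lambda>x. f x * inverse (g x ^ m))) \<and>
            (\<forall>x\<in>U. (h has_vector_derivative k x) (at x))"
    by (intro exI[of _ "\<lambda>x. k x * inverse (g x ^ Suc m)"]) (auto simp del: power_Suc)
qed

section \<open>A smooth cutoff function\<close>

definition flat :: "real \<Rightarrow> real" where
  "flat x = (if x > 0 then exp (- (1 / x)) else 0)"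

lemma poly_times_exp_minus_tendsto_0: "((\<lambda>y::real. poly p y * exp (- y)) \<longlongrightarrow> 0) at_top"
proof -
  have "((\<lambda>y. \<Sum>i\<le>degree p. coeff p i * (y ^ i / exp y)) \<longlongrightarrow> (\<Sum>i\<le>degree p. coeff p i * 0)) at_top"
    by (intro tendsto_intros tendsto_power_div_exp_0)
  then show ?thesis by (simp add: poly_altdef exp_minus divide_inverse sum_distrib_left sum_distrib_right mult_ac)
qed

text \<open>All derivatives have the form p(1/x) exp(-1/x) for x > 0 and 0 otherwise. With y = 1/x,
  differentiation replaces p by y^2 (p - p'), and \<open>[:0, 0, 1:]\<close> is the polynomial
  y^2.\<close>

lemma smooth_on_flat: "smooth_on UNIV (\<lambda>x. of_real (flat x))"
proof -
  define F :: "real poly \<Rightarrow> real \<Rightarrow> real" where "F p x = (if x > 0 then poly p (1 / x) * exp (- (1 / x)) else 0)" for p x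
  have D: "(F p has_real_derivative F ([:0, 0, 1:] * (p - pderiv p)) x) (at x)" for p x
  proof (cases x "0 :: real" rule: linorder_cases)
    case greater
    have "((\<lambda>x. poly p (1 / x) * exp (- (1 / x))) has_real_derivative F ([:0, 0, 1:] * (p - pderiv p)) x) (at x)"
      using greater by (auto intro!: derivative_eq_intros DERIV_chain2[OF poly_DERIV] simp: F_def power2_eq_square field_simps)
    then show ?thesis
      by (rule has_field_derivative_transform_within_open[where S = "{0<..}"]) (use greater in \<open>auto simp: F_def\<close>)
  next
    case less
    have "((\<lambda>x. 0) has_real_derivative F ([:0, 0, 1:] * (p - pderiv p)) x) (at x)"
      using less by (simp add: F_def)
    then show ?thesis
      by (rule has_field_derivative_transform_within_open[where S = "{..<0}"]) (use less in \<open>auto simp: F_def\<close>)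
  next
    case equal
    have "((\<lambda>y. F p y / y) \<longlongrightarrow> 0) (at_left 0)"
      by (rule tendsto_eventually) (auto simp: F_def eventually_at_filter)
    \<comment> \<open>Dividing by the variable multiplies the polynomial in 1/y by its argument,
      hence \<open>pCons 0 p\<close>; the exponential still wins.\<close>
    moreover have "((\<lambda>y. F p y / y) \<longlongrightarrow> 0) (at_right 0)"
    proof (rule Lim_transform_eventually)
      show "((\<lambda>y. poly (pCons 0 p) (inverse y) * exp (- inverse y)) \<longlongrightarrow> 0) (at_right 0)"
        by (rule filterlim_compose[OF poly_times_exp_minus_tendsto_0 filterlim_inverse_at_top_right])
      show "\<forall>\<^sub>F y in at_right 0. poly (pCons 0 p) (inverse y) * exp (- inverse y) = F p y / y"
        using eventually_at_right_less[of 0] by eventually_elim (auto simp: F_def field_simps)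
    qed
    ultimately have "((\<lambda>y. F p y / y) \<longlongrightarrow> 0) (at 0)" by (rule filterlim_split_at)
    moreover have "F q 0 = 0" for q by (simp add: F_def)
    ultimately have "(F p has_real_derivative F ([:0, 0, 1:] * (p - pderiv p)) 0) (at 0)"
      unfolding has_field_derivative_iff by simp
    then show ?thesis using equal by metis
  qed
  have "smooth_on UNIV (\<lambda>x. of_real (F 1 x))"
  proof (rule smooth_on_coinduct[where P = "\<lambda>h. \<exists>p. h = (\<lambda>x. of_real (F p x))"])
    fix h :: "real \<Rightarrow> complex" assume "\<exists>p. h = (\<lambda>x. of_real (F p x))"
    then obtain p where p: "h = (\<lambda>x. of_real (F p x))" by blast
    have "(h has_vector_derivative of_real (F ([:0, 0, 1:] * (p - pderiv p)) x)) (at x)" for x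
      unfolding p by (rule has_vector_derivative_of_real) (rule D)
    then show "\<exists>g. (\<exists>p. g = (\<lambda>x. of_real (F p x))) \<and> (\<forall>x\<in>UNIV. (h has_vector_derivative g x) (at x))" by blast
  qed auto
  moreover have "F 1 = flat" by (auto simp: F_def flat_def)
  ultimately show ?thesis by simp
qed

definition step :: "real \<Rightarrow> complex" where
  "step x = of_real (flat x) / (of_real (flat x) + of_real (flat (1 - x)))"

lemma step_denominator: "flat x + flat (1 - x) > 0"
  by (cases "x > 0") (auto simp: flat_def add_pos_nonneg)

lemma smooth_on_step: "smooth_on UNIV step"
proof -
  have "smooth_on UNIV (\<lambda>x. of_real (flat (1 - x)))"
    using smooth_on_shift[OF smooth_on_scale[OF smooth_on_flat, of "-1"], of "-1"] by simp
  then have "smooth_on UNIV (\<lambda>x. of_real (flat x) / (of_real (flat x) + of_real (flat (1 - x))))"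
    using step_denominator
    by (intro smooth_on_divide smooth_on_add smooth_on_flat)
      (auto simp: of_real_add[symmetric] less_le simp del: of_real_add)
  then show ?thesis by (simp add: step_def[abs_def])
qed

lemma step_0: "x \<le> 0 \<Longrightarrow> step x = 0" and step_1: "x \<ge> 1 \<Longrightarrow> step x = 1"
  by (auto simp: step_def flat_def)

definition cutoff :: "real \<Rightarrow> complex" where
  "cutoff u = step (2 + u) * step (2 - u)"

lemma smooth_on_cutoff: "smooth_on UNIV cutoff"
proof -
  have "smooth_on UNIV (\<lambda>u. step (u + 2) * step ((-1) * (u + - 2)))"
    by (intro smooth_on_mult smooth_on_shift[where f = "\<lambda>u. step (-1 * u)"] smooth_on_shift smooth_on_scale smooth_on_step open_UNIV)
  then show ?thesis by (simp add: cutoff_def[abs_def] add.commute)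
qed

lemma cutoff_1: "\<bar>u\<bar> \<le> 1 \<Longrightarrow> cutoff u = 1" and cutoff_0: "\<bar>u\<bar> \<ge> 2 \<Longrightarrow> cutoff u = 0"
  and cutoff_minus: "cutoff (- u) = cutoff u"
  by (auto simp: cutoff_def step_0 step_1 abs_if split: if_splits)

section \<open>Test functions and their supports\<close>

lemma nderiv_zero_outside:
  assumes "closed K" "\<And>x. x \<notin> K \<Longrightarrow> f x = 0" "x \<notin> K"
  shows "nderiv n f x = 0"
  using nderiv_cong[of "- K" f "\<lambda>x. 0" x n] nderiv_const[of "- K" x n 0] assms
  by (auto simp: open_Compl)

lemma euler_zero_outside:
  assumes "closed K" "\<And>x. x \<notin> K \<Longrightarrow> f x = 0" "x \<notin> K"
  shows "(euler ^^ n) f x = 0"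
  using assms(3)
proof (induction n arbitrary: x)
  case (Suc n)
  show ?case using nderiv_zero_outside[OF assms(1) Suc.IH Suc.prems, where n = 1] by (simp add: euler_def)
qed (use assms in auto)

lemma nderiv_bounded:
  assumes "smooth_on UNIV f" "compact K" "\<And>x. x \<notin> K \<Longrightarrow> f x = 0"
  shows "bounded (range (nderiv n f))"
proof -
  have "bounded (nderiv n f ` K)"
    by (intro compact_imp_bounded compact_continuous_image continuous_on_subset[OF smooth_on_continuous[OF assms(1)]] assms) auto
  moreover have "range (nderiv n f) \<subseteq> insert 0 (nderiv n f ` K)"
    using nderiv_zero_outside[where f = f, OF compact_imp_closed[OF assms(2)] assms(3)] by auto
  ultimately show ?thesis by (meson bounded_insert bounded_subset)
qed

lemma test_funI: "smooth_on UNIV f \<Longrightarrow> compact K \<Longrightarrow> K \<subseteq> U \<Longrightarrow> (\<And>x. x \<notin> K \<Longrightarrow> f x = 0) \<Longrightarrow> f \<in> test_fun U"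
  by (auto simp: test_fun_def)

lemma test_funE:
  assumes "f \<in> test_fun U"
  obtains K where "smooth_on UNIV f" "compact K" "K \<subseteq> U" "\<And>x. x \<notin> K \<Longrightarrow> f x = 0"
  using assms by (auto simp: test_fun_def)

lemma test_fun_smooth: "f \<in> test_fun U \<Longrightarrow> smooth_on UNIV f"
  by (auto simp: test_fun_def)

lemma test_fun_mono: "f \<in> test_fun U \<Longrightarrow> U \<subseteq> V \<Longrightarrow> f \<in> test_fun V"
  by (auto simp: test_fun_def)

lemma test_fun_bounded: "f \<in> test_fun U \<Longrightarrow> bounded (range (nderiv n f))"
  by (metis nderiv_bounded test_funE)

lemma test_fun_le_SUP: "f \<in> test_fun U \<Longrightarrow> norm (nderiv n f x) \<le> (SUP x. norm (nderiv n f x))"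
  using test_fun_bounded[of f U n] by (intro cSUP_upper) (auto simp: bounded_iff bdd_above_def)

lemma test_fun_add: "f \<in> test_fun U \<Longrightarrow> g \<in> test_fun U \<Longrightarrow> (\<lambda>x. f x + g x) \<in> test_fun U"
  by (elim test_funE, rule_tac K = "K \<union> Ka" in test_funI) (auto intro: smooth_on_add)

lemma test_fun_cmult: "f \<in> test_fun U \<Longrightarrow> (\<lambda>x. c * f x) \<in> test_fun U"
  by (elim test_funE, rule_tac K = "K" in test_funI) (auto intro: smooth_on_cmult)

text \<open>The product is smooth because \<open>f\<close> only matters near the support of \<open>g\<close>.\<close>

lemma test_fun_mult:
  assumes "open U" "smooth_on U f" "g \<in> test_fun U"
  shows "(\<lambda>x. f x * g x) \<in> test_fun U"
proof -
  obtain K where K: "smooth_on UNIV g" "compact K" "K \<subseteq> U" "\<And>x. x \<notin> K \<Longrightarrow> g x = 0"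
    using assms(3) by (rule test_funE) blast
  have o: "open (- K)" using K(2) by (simp add: compact_imp_closed open_Compl)
  have "smooth_on U (\<lambda>x. f x * g x)"
    by (intro smooth_on_mult assms smooth_on_subset[OF K(1)]) auto
  moreover have "smooth_on (- K) (\<lambda>x. f x * g x)"
    by (rule smooth_on_cong[OF o _ smooth_on_const[OF o, of 0]]) (use K in auto)
  ultimately have "smooth_on (U \<union> - K) (\<lambda>x. f x * g x)" by (rule smooth_on_Un)
  then show ?thesis using K by (intro test_funI[of _ K]) (auto elim!: smooth_on_subset)
qed

lemma open_nonzero: "open (- {0::real})"
  by (simp add: open_Compl)

text \<open>One number bounds the support from both sides, as the inner radius and as the reciprocal
  of the outer one. In this form the condition is invariant under x -> 1/x.\<close>

lemma test_fun_nonzero: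
  assumes "f \<in> test_fun (- {0})"
  obtains e where "e > 0" "e < 1" "\<And>x. \<bar>x\<bar> < e \<Longrightarrow> f x = 0" "\<And>x. 1 / e < \<bar>x\<bar> \<Longrightarrow> f x = 0"
proof -
  obtain K where K: "compact K" "K \<subseteq> - {0}" "\<And>x. x \<notin> K \<Longrightarrow> f x = 0"
    using assms by (rule test_funE) blast
  obtain e1 where e1: "e1 > 0" "ball 0 e1 \<subseteq> - K"
    using K(1,2) open_contains_ball[of "- K"] by (auto simp: compact_imp_closed open_Compl)
  obtain b where b: "b > 0" "\<And>x. x \<in> K \<Longrightarrow> \<bar>x\<bar> \<le> b"
    using compact_imp_bounded[OF K(1)] by (auto simp: bounded_pos)
  define e where "e = min (min e1 (1 / b)) (1 / 2)"
  have "e > 0" "e < 1" "e \<le> e1" "e \<le> 1 / b" using e1 b by (auto simp: e_def)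
  moreover have "f x = 0" if "\<bar>x\<bar> < e" for x using that e1 K(3)[of x] \<open>e \<le> e1\<close> by (auto simp: subset_iff)
  moreover have "f x = 0" if "1 / e < \<bar>x\<bar>" for x
  proof -
    have "b \<le> 1 / e" using \<open>e \<le> 1 / b\<close> \<open>e > 0\<close> b(1) by (simp add: field_simps)
    then show ?thesis using that b(2)[of x] K(3)[of x] by force
  qed
  ultimately show ?thesis using that by blast
qed

lemma test_fun_nonzeroI:
  assumes "smooth_on (- {0}) f" "e > 0" "\<And>x. \<bar>x\<bar> < e \<Longrightarrow> f x = 0" "\<And>x. b < \<bar>x\<bar> \<Longrightarrow> f x = 0"
  shows "f \<in> test_fun (- {0})"
proof -
  let ?K = "cball 0 b - ball 0 e"
  have "smooth_on (ball 0 e) f"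
    by (rule smooth_on_cong[OF _ _ smooth_on_const[of _ 0]]) (use assms(3) in auto)
  from smooth_on_Un[OF assms(1) this] have "smooth_on UNIV f"
    by (rule smooth_on_subset) (use assms in auto)
  then show ?thesis
    by (rule test_funI[of _ ?K]) (use assms in \<open>auto simp: compact_diff\<close>)
qed

section \<open>Cutoffs in the logarithmic coordinate\<close>

text \<open>The cutoff is stretched in ln |x| and not in x, so that its Euler derivatives do not
  grow with \<open>n\<close>. It depends only on |ln |x||, which makes it invariant under x -> -x
  and x -> 1/x.\<close>

definition annulus_cutoff :: "nat \<Rightarrow> real \<Rightarrow> complex" where
  "annulus_cutoff n x = (if x = 0 then 0 else cutoff (ln \<bar>x\<bar> / (real n + 1)))"

text \<open>This is the statement that E is d/du for u = ln |x|.\<close>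

lemma euler_ln_compose:
  assumes "smooth_on UNIV h" "x \<noteq> 0"
  shows "(euler ^^ j) (\<lambda>x. h (ln \<bar>x\<bar>)) x = nderiv j h (ln \<bar>x\<bar>)"
  using assms
proof (induction j arbitrary: h)
  case (Suc j)
  have "(euler ^^ j) (euler (\<lambda>x. h (ln \<bar>x\<bar>))) x = (euler ^^ j) (\<lambda>x. nderiv 1 h (ln \<bar>x\<bar>)) x"
  proof (rule euler_cong[OF open_nonzero])
    fix y :: real assume y: "y \<in> - {0}"
    then have "nderiv 1 (\<lambda>x. h (ln \<bar>x\<bar>)) y = nderiv 1 h (ln \<bar>y\<bar>) / of_real y"
      unfolding nderiv_1[of _ y] using has_vector_derivative_ln_compose[OF Suc.prems(1)] vector_derivative_at by blast
    then show "euler (\<lambda>x. h (ln \<bar>x\<bar>)) y = nderiv 1 h (ln \<bar>y\<bar>)"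
      using y by (simp add: euler_def del: One_nat_def)
  qed (use Suc.prems in auto)
  also have "\<dots> = nderiv (Suc j) h (ln \<bar>x\<bar>)"
    using Suc.IH[of "nderiv 1 h"] Suc.prems smooth_on_nderiv by (simp add: nderiv_nderiv)
  finally show ?case by (simp add: euler_power_Suc del: funpow.simps)
qed simp

lemma smooth_on_annulus_cutoff: "smooth_on UNIV (annulus_cutoff n)"
  and euler_annulus_cutoff:
    "x \<noteq> 0 \<Longrightarrow> (euler ^^ j) (annulus_cutoff n) x = nderiv j cutoff (ln \<bar>x\<bar> / (real n + 1)) / of_nat (Suc n) ^ j"
  and annulus_cutoff_test_fun: "annulus_cutoff n \<in> test_fun (- {0})"
proof -
  let ?c = "1 / (real n + 1)"
  let ?h = "\<lambda>u. cutoff (?c * u)"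
  have h: "smooth_on UNIV ?h" by (rule smooth_on_scale[OF smooth_on_cutoff])
  have eq: "annulus_cutoff n x = ?h (ln \<bar>x\<bar>)" if "x \<noteq> 0" for x
    using that by (simp add: annulus_cutoff_def)
  have sm: "smooth_on (- {0}) (annulus_cutoff n)"
    by (rule smooth_on_cong[OF open_nonzero _ smooth_on_ln_compose[OF h]]) (use eq in auto)
  show "(euler ^^ j) (annulus_cutoff n) x = nderiv j cutoff (ln \<bar>x\<bar> / (real n + 1)) / of_nat (Suc n) ^ j" if "x \<noteq> 0" for x
  proof -
    have "(euler ^^ j) (annulus_cutoff n) x = (euler ^^ j) (\<lambda>x. ?h (ln \<bar>x\<bar>)) x"
      by (rule euler_cong[OF open_nonzero]) (use eq that in auto)
    also have "\<dots> = of_real ?c ^ j * nderiv j cutoff (?c * ln \<bar>x\<bar>)"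
      using euler_ln_compose[OF h that, of j] nderiv_scale[OF smooth_on_cutoff, of j ?c "ln \<bar>x\<bar>"] by simp
    finally show ?thesis by (simp add: power_divide power_one_over add.commute)
  qed
  have *: "annulus_cutoff n x = 0" if "\<bar>ln \<bar>x\<bar>\<bar> > 2 * (real n + 1)" for x
  proof -
    have "\<bar>ln \<bar>x\<bar> / (real n + 1)\<bar> \<ge> 2" using that by (simp add: abs_divide field_simps)
    then show ?thesis by (simp add: annulus_cutoff_def cutoff_0)
  qed
  show "annulus_cutoff n \<in> test_fun (- {0})"
  proof (rule test_fun_nonzeroI[OF sm, of "exp (- (2 * (real n + 1)))" "exp (2 * (real n + 1))"])
    fix x :: real assume a: "\<bar>x\<bar> < exp (- (2 * (real n + 1)))"
    show "annulus_cutoff n x = 0"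
    proof (cases "x = 0")
      case False
      then have "ln \<bar>x\<bar> < - (2 * (real n + 1))" using a by (metis exp_less_cancel_iff exp_ln zero_less_abs_iff)
      then show ?thesis by (intro *) auto
    qed (simp add: annulus_cutoff_def)
  next
    fix x :: real assume a: "exp (2 * (real n + 1)) < \<bar>x\<bar>"
    then have "ln \<bar>x\<bar> > (2 * (real n + 1))" by (metis a exp_gt_zero exp_less_cancel_iff exp_ln order_less_trans)
    then show "annulus_cutoff n x = 0" by (intro *) auto
  qed simp
  then show "smooth_on UNIV (annulus_cutoff n)" by (rule test_fun_smooth)
qed

lemma annulus_cutoff_1: "x \<noteq> 0 \<Longrightarrow> \<bar>ln \<bar>x\<bar>\<bar> \<le> real n + 1 \<Longrightarrow> annulus_cutoff n x = 1"
  by (simp add: annulus_cutoff_def cutoff_1 abs_divide)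

lemma annulus_cutoff_inverse: "annulus_cutoff n (1 / x) = annulus_cutoff n x"
  by (simp add: annulus_cutoff_def ln_div cutoff_minus)

lemma annulus_cutoff_minus: "annulus_cutoff n (- x) = annulus_cutoff n x"
  by (simp add: annulus_cutoff_def)

text \<open>The bound is uniform in \<open>n\<close> because each Euler derivative contributes a
  factor 1/(n + 1), which is at most 1.\<close>

lemma ebound_annulus_cutoff: "\<exists>B\<ge>0. \<forall>n. ebound N (\<lambda>x. 1) (annulus_cutoff n) B"
proof -
  have "bounded (range (nderiv j cutoff))" for j
    by (rule nderiv_bounded[OF smooth_on_cutoff, of "{-2..2}"]) (auto intro: cutoff_0)
  then have "\<forall>j. \<exists>B. \<forall>x. norm (nderiv j cutoff x) \<le> B" by (simp add: bounded_iff)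
  then obtain B where B: "\<And>j x. norm (nderiv j cutoff x) \<le> B j" by metis
  have pos: "0 \<le> B j" for j using B[of j 0] norm_ge_zero order_trans by blast
  have "norm ((euler ^^ j) (annulus_cutoff n) x) \<le> (\<Sum>j\<le>N. B j)" if "j \<le> N" "x \<noteq> 0" for j x n
  proof -
    have "norm ((euler ^^ j) (annulus_cutoff n) x) \<le> B j / 1"
      unfolding euler_annulus_cutoff[OF that(2)] norm_divide norm_power norm_of_nat
      by (intro frac_le B one_le_power pos) auto
    also have "\<dots> \<le> (\<Sum>j\<le>N. B j)" using that(1) by (auto intro!: member_le_sum pos)
    finally show ?thesis .
  qed
  moreover have "0 \<le> (\<Sum>j\<le>N. B j)" by (intro sum_nonneg pos)
  ultimately show ?thesis unfolding ebound_def by (intro exI[of _ "\<Sum>j\<le>N. B j"]) simp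
qed

lemma annulus_cutoff_mult_test_fun: "smooth_on (- {0}) f \<Longrightarrow> (\<lambda>x. annulus_cutoff n x * f x) \<in> test_fun (- {0})"
  using test_fun_mult[OF open_nonzero _ annulus_cutoff_test_fun, of f n] by (simp add: mult.commute[of "f _"])

lemma annulus_cutoff_mult_eventually:
  assumes "f \<in> test_fun (- {0})"
  shows "\<forall>\<^sub>F n in sequentially. (\<lambda>x. annulus_cutoff n x * f x) = f"
proof -
  obtain e where e: "e > 0" "e < 1" "\<And>x. \<bar>x\<bar> < e \<Longrightarrow> f x = 0" "\<And>x. 1 / e < \<bar>x\<bar> \<Longrightarrow> f x = 0"
    using test_fun_nonzero[OF assms] by blast
  obtain n0 :: nat where n0: "- ln e \<le> real n0" using real_arch_simple by blast
  have "(\<lambda>x. annulus_cutoff n x * f x) = f" if "n \<ge> n0" for n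
  proof
    fix x
    show "annulus_cutoff n x * f x = f x"
    proof (cases "e \<le> \<bar>x\<bar> \<and> \<bar>x\<bar> \<le> 1 / e")
      case True
      then have "\<bar>x\<bar> > 0" using e(1) by linarith
      then have "ln e \<le> ln \<bar>x\<bar>" "ln \<bar>x\<bar> \<le> ln (1 / e)" using True e(1) by simp_all
      then have x: "x \<noteq> 0" "ln e \<le> ln \<bar>x\<bar>" "ln \<bar>x\<bar> \<le> - ln e"
        using \<open>\<bar>x\<bar> > 0\<close> e(1) by (simp_all add: ln_div)
      have "real n0 \<le> real n" using that by simp
      then have "\<bar>ln \<bar>x\<bar>\<bar> \<le> real n + 1" using x n0 by linarith
      from annulus_cutoff_1[OF x(1) this] show ?thesis by simp
    next
      case False
      then have "f x = 0" using e(3)[of x] e(4)[of x] by linarith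
      then show ?thesis by simp
    qed
  qed
  then show ?thesis by (rule eventually_sequentiallyI)
qed

section \<open>Signed powers and functions of sgn x and ln |x|\<close>

lemma
  shows smooth_on_sgn: "smooth_on (- {0}) (\<lambda>x. of_real (sgn x) ^ d)"
    and euler_sgn: "x \<noteq> 0 \<Longrightarrow> euler (\<lambda>x. of_real (sgn x) ^ d) x = 0"
proof -
  have D: "((\<lambda>x. of_real (sgn x) ^ d) has_vector_derivative (0::complex)) (at x)" if "x \<noteq> 0" for x
  proof (cases "x > 0")
    case True
    show ?thesis
      by (rule has_vector_derivative_transform_within_open[where S = "{0<..}", OF has_vector_derivative_const[of 1]])
        (use True in auto)
  next
    case False
    show ?thesis
      by (rule has_vector_derivative_transform_within_open[where S = "{..<0}", OF has_vector_derivative_const[of "(-1) ^ d"]])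
        (use that False in auto)
  qed
  show "smooth_on (- {0}) (\<lambda>x. of_real (sgn x) ^ d)"
  proof (rule smooth_on_seqI(1)[where F = "\<lambda>n x. if n = 0 then of_real (sgn x) ^ d else 0", OF open_nonzero])
    show "((\<lambda>x. if n = 0 then of_real (sgn x) ^ d else 0) has_vector_derivative
        (if Suc n = 0 then of_real (sgn x) ^ d else 0 :: complex)) (at x)" if "x \<in> - {0}" for n x
      using D[of x] that by (cases "n = 0") auto
  qed auto
  show "euler (\<lambda>x. of_real (sgn x) ^ d) x = 0" if "x \<noteq> 0"
    using vector_derivative_at[OF D[OF that]] by (simp add: euler_def nderiv_1 del: One_nat_def)
qed

lemma
  assumes "smooth_on UNIV h"
  shows smooth_on_sgn_ln: "smooth_on (- {0}) (\<lambda>x. of_real (sgn x) ^ d * h (ln \<bar>x\<bar>))"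
    and euler_sgn_ln: "x \<noteq> 0 \<Longrightarrow> (euler ^^ j) (\<lambda>x. of_real (sgn x) ^ d * h (ln \<bar>x\<bar>)) x = of_real (sgn x) ^ d * nderiv j h (ln \<bar>x\<bar>)"
proof -
  show sm: "smooth_on (- {0}) (\<lambda>x. of_real (sgn x) ^ d * h (ln \<bar>x\<bar>))"
    by (intro smooth_on_mult smooth_on_sgn smooth_on_ln_compose open_nonzero assms)
  have "(euler ^^ j) (\<lambda>x. of_real (sgn x) ^ d * h (ln \<bar>x\<bar>)) x = of_real (sgn x) ^ d * (euler ^^ j) (\<lambda>x. h (ln \<bar>x\<bar>)) x"
    if "x \<noteq> 0" for x
    using that
  proof (induction j arbitrary: x)
    case (Suc j)
    have "euler ((euler ^^ j) (\<lambda>x. of_real (sgn x) ^ d * h (ln \<bar>x\<bar>))) x =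
        euler (\<lambda>x. of_real (sgn x) ^ d * (euler ^^ j) (\<lambda>x. h (ln \<bar>x\<bar>)) x) x"
      by (rule euler_cong[OF open_nonzero, where n = 1, simplified]) (use Suc in auto)
    also have "\<dots> = of_real (sgn x) ^ d * euler ((euler ^^ j) (\<lambda>x. h (ln \<bar>x\<bar>))) x"
      using Suc.prems euler_sgn
      by (subst euler_mult[OF open_nonzero smooth_on_sgn smooth_on_euler[OF open_nonzero smooth_on_ln_compose[OF assms]]]) auto
    finally show ?case by simp
  qed simp
  then show "x \<noteq> 0 \<Longrightarrow> (euler ^^ j) (\<lambda>x. of_real (sgn x) ^ d * h (ln \<bar>x\<bar>)) x = of_real (sgn x) ^ d * nderiv j h (ln \<bar>x\<bar>)"
    using euler_ln_compose[OF assms] by simp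
qed

lemma
  shows smooth_on_exp: "smooth_on UNIV (\<lambda>u. exp (s * of_real u))"
    and nderiv_exp: "nderiv n (\<lambda>u. exp (s * of_real u)) x = s ^ n * exp (s * of_real x)"
proof -
  have "((\<lambda>u. s ^ n * exp (s * of_real u)) has_vector_derivative s ^ n * (s * exp (s * of_real x))) (at x)" for n x
    by (intro has_vector_derivative_mult_right has_vector_derivative_real_field) (auto intro!: derivative_eq_intros)
  then have D: "((\<lambda>u. s ^ n * exp (s * of_real u)) has_vector_derivative s ^ Suc n * exp (s * of_real x)) (at x)" for n x
    by (simp add: mult.assoc mult.left_commute)
  define F where "F n u = s ^ n * exp (s * of_real u)" for n u
  have D': "(F n has_vector_derivative F (Suc n) x) (at x)" for n x
    using D by (simp add: F_def[abs_def])
  show "smooth_on UNIV (\<lambda>u. exp (s * of_real u))"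
    by (rule smooth_on_seqI(1)[where F = F, OF open_UNIV _ D']) (simp add: F_def)
  show "nderiv n (\<lambda>u. exp (s * of_real u)) x = s ^ n * exp (s * of_real x)"
    using smooth_on_seqI(2)[where F = F, OF open_UNIV _ D', of "\<lambda>u. exp (s * of_real u)" x n] by (simp add: F_def)
qed

lemma signed_power_eq: "x \<noteq> 0 \<Longrightarrow> signed_power d s x = of_real (sgn x) ^ d * exp (s * of_real (ln \<bar>x\<bar>))"
  by (simp add: signed_power_def powr_def Ln_of_real)

lemma signed_power_0 [simp]: "signed_power d s 0 = 0"
  by (simp add: signed_power_def)

lemma smooth_on_signed_power: "smooth_on (- {0}) (signed_power d s)"
  by (rule smooth_on_cong[OF open_nonzero _ smooth_on_sgn_ln[OF smooth_on_exp]]) (auto simp: signed_power_eq)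

text \<open>Signed powers are the eigenfunctions of E. Polynomial growth of Mellin transforms in s
  rests on this, and so does the later recovery of a factor polynomial in s.\<close>

lemma euler_signed_power:
  assumes "x \<noteq> 0"
  shows "(euler ^^ j) (signed_power d s) x = s ^ j * signed_power d s x"
  using euler_cong[OF open_nonzero, of "signed_power d s" "\<lambda>x. of_real (sgn x) ^ d * exp (s * of_real (ln \<bar>x\<bar>))" x j]
    euler_sgn_ln[OF smooth_on_exp assms, of j d s] assms
  by (simp add: nderiv_exp signed_power_eq)

lemma norm_signed_power: "x \<noteq> 0 \<Longrightarrow> norm (signed_power d s x) = exp (Re s * ln \<bar>x\<bar>)"
  by (simp add: signed_power_eq norm_mult norm_power norm_of_real)

lemma norm_signed_power_le: "x \<noteq> 0 \<Longrightarrow> norm (signed_power d s x) \<le> wt \<bar>Re s\<bar> x"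
  by (simp add: norm_signed_power wt_def abs_mult[symmetric])

text \<open>The weight depends on Re s only, while Im s enters polynomially through the eigenvalue
  powers. On a vertical strip this becomes moderate growth.\<close>

lemma ebound_signed_power: "ebound N (wt \<bar>Re s\<bar>) (signed_power d s) ((1 + norm s) ^ N)"
  unfolding ebound_def
proof (intro allI impI)
  fix j x assume "j \<le> N" "x \<noteq> (0::real)"
  have "norm s ^ j \<le> (1 + norm s) ^ j" by (intro power_mono) auto
  also have "\<dots> \<le> (1 + norm s) ^ N" by (intro power_increasing) (auto simp: \<open>j \<le> N\<close>)
  finally show "norm ((euler ^^ j) (signed_power d s) x) \<le> (1 + norm s) ^ N * wt \<bar>Re s\<bar> x"
    using norm_signed_power_le[OF \<open>x \<noteq> 0\<close>, of d s] by (simp add: euler_signed_power \<open>x \<noteq> 0\<close> norm_mult norm_power mult_mono)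
qed

section \<open>Normal form of vanishing distributions\<close>

lemma fun_vanishes_add:
  assumes "open U" "p \<in> U" "smooth_on U f" "smooth_on U g" "fun_vanishes_to_order p k f" "fun_vanishes_to_order p k g"
  shows "fun_vanishes_to_order p k (\<lambda>x. f x + g x)"
  using assms by (simp add: fun_vanishes_to_order_def nderiv_add)

lemma fun_vanishes_cmult:
  assumes "open U" "p \<in> U" "smooth_on U f" "fun_vanishes_to_order p k f"
  shows "fun_vanishes_to_order p k (\<lambda>x. c * f x)"
  using assms by (simp add: fun_vanishes_to_order_def nderiv_cmult)

lemma fun_vanishes_sum:
  assumes "open U" "p \<in> U" "\<And>i. i \<in> I \<Longrightarrow> smooth_on U (f i)" "\<And>i. i \<in> I \<Longrightarrow> fun_vanishes_to_order p k (f i)"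
  shows "fun_vanishes_to_order p k (\<lambda>x. \<Sum>i\<in>I. f i x)"
  using assms by (simp add: fun_vanishes_to_order_def nderiv_sum)

lemma fun_vanishes_mult:
  assumes "open U" "p \<in> U" "smooth_on U f" "smooth_on U g" "fun_vanishes_to_order p k f" "fun_vanishes_to_order p l g"
  shows "fun_vanishes_to_order p (k + l) (\<lambda>x. f x * g x)"
  unfolding fun_vanishes_to_order_def
proof (intro allI impI)
  fix n assume n: "n < k + l"
  have "nderiv i f p * nderiv (n - i) g p = 0" if "i \<le> n" for i
    using assms(5,6) n that unfolding fun_vanishes_to_order_def by (cases "i < k") auto
  then show "nderiv n (\<lambda>x. f x * g x) p = 0"
    by (auto simp: nderiv_mult[OF assms(1,3,4,2)] intro!: sum.neutral)
qed

lemma fun_vanishes_power: "fun_vanishes_to_order 0 m (\<lambda>x. of_real x ^ m)"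
  by (simp add: fun_vanishes_to_order_def nderiv_of_real_power)

text \<open>Apply \<open>D\<close> to x^i, which vanishes to order i. The result is the sum over j <
  i of a_j times the j-th derivative of x^i, plus i! a_i. By induction each term of the sum vanishes
  to order j + (i - j) = i, hence so does a_i.\<close>

lemma tangential_coefficient_vanishes:
  assumes U: "open U" "0 \<in> U" and D: "tangential_diffop U 0 D" and "i < length D"
  shows "fun_vanishes_to_order 0 i (D ! i)"
  using assms(4)
proof (induction i rule: less_induct)
  case (less i)
  have smD: "smooth_on U (D ! j)" if "j < length D" for j
    using D that by (auto simp: tangential_diffop_def)
  define q :: "nat \<Rightarrow> real \<Rightarrow> complex" where "q j = nderiv j (\<lambda>x. of_real x ^ i)" for j
  have smq: "smooth_on U (q j)" for j
    unfolding q_def by (intro smooth_on_nderiv smooth_on_power smooth_on_of_real U)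
  have q: "q j x = (if j \<le> i then of_nat (fact i div fact (i - j)) * of_real x ^ (i - j) else 0)" for j x
    by (simp add: q_def nderiv_of_real_power)
  have "fun_vanishes_to_order 0 i (diffop_fun D (\<lambda>x. of_real x ^ i))"
    using D fun_vanishes_power smooth_on_power[OF U(1) smooth_on_of_real[OF U(1)]] by (auto simp: tangential_diffop_def)
  moreover have "diffop_fun D (\<lambda>x. of_real x ^ i) x = (\<Sum>j<i. (D ! j) x * q j x) + fact i * (D ! i) x" for x
  proof -
    \<comment> \<open>Derivatives of x^i of order above i are zero, so only the coefficients up to
      index i remain.\<close>
    have "(\<Sum>j<length D. (D ! j) x * q j x) = (\<Sum>j<Suc i. (D ! j) x * q j x)"
      using less.prems by (intro sum.mono_neutral_right) (auto simp: q)
    then show ?thesis by (simp add: diffop_fun_def q_def[symmetric] q[of i])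
  qed
  then have "diffop_fun D (\<lambda>x. of_real x ^ i) = (\<lambda>x. (\<Sum>j<i. (D ! j) x * q j x) + fact i * (D ! i) x)"
    by (intro ext)
  ultimately have 1: "fun_vanishes_to_order 0 i (\<lambda>x. (\<Sum>j<i. (D ! j) x * q j x) + fact i * (D ! i) x)"
    by (simp only:)
  have "fun_vanishes_to_order 0 (j + (i - j)) (\<lambda>x. (D ! j) x * q j x)" if "j < i" for j
  proof (rule fun_vanishes_mult[OF U smD smq])
    show "fun_vanishes_to_order 0 j (D ! j)" using less that by auto
    have "q j = (\<lambda>x. of_nat (fact i div fact (i - j)) * of_real x ^ (i - j))" using that by (auto simp: q)
    then show "fun_vanishes_to_order 0 (i - j) (q j)"
      using fun_vanishes_cmult[OF open_UNIV UNIV_I _ fun_vanishes_power] smooth_on_power smooth_on_of_real by auto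
  qed (use less.prems that in auto)
  then have "fun_vanishes_to_order 0 i (\<lambda>x. \<Sum>j<i. (D ! j) x * q j x)"
    using less.prems by (intro fun_vanishes_sum[OF U] smooth_on_mult U smD smq) auto
  then have 2: "fun_vanishes_to_order 0 i (\<lambda>x. (-1) * (\<Sum>j<i. (D ! j) x * q j x))"
    using less.prems by (intro fun_vanishes_cmult[OF U] smooth_on_sum smooth_on_mult U smD smq) auto
  have "fun_vanishes_to_order 0 i (\<lambda>x. ((\<Sum>j<i. (D ! j) x * q j x) + fact i * (D ! i) x) + (-1) * (\<Sum>j<i. (D ! j) x * q j x))"
    using less.prems
    by (intro fun_vanishes_add[OF U] 1 2 smooth_on_add smooth_on_cmult smooth_on_sum smooth_on_mult U smD smq) auto
  then have "fun_vanishes_to_order 0 i (\<lambda>x. fact i * (D ! i) x)" by simp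
  from fun_vanishes_cmult[OF U _ this, of "1 / fact i"] show ?case
    using smooth_on_cmult[OF U(1) smD] less.prems by simp
qed

text \<open>The list encodes x^i (d/dx)^i. In the Leibniz formula at 0 only the term that
  differentiates x^i exactly i times survives, and it carries the derivative of f of the same order
  n < k, which is zero.\<close>

lemma tangential_monomial:
  assumes "open U" "0 \<in> U"
  shows "tangential_diffop U 0 (replicate i (\<lambda>x. 0) @ [\<lambda>x. of_real x ^ i])"
  unfolding tangential_diffop_def
proof (intro conjI ballI allI impI)
  fix a :: "real \<Rightarrow> complex" assume "a \<in> set (replicate i (\<lambda>x. 0) @ [\<lambda>x. of_real x ^ i])"
  then show "smooth_on U a" using smooth_on_const[OF assms(1)] smooth_on_power[OF assms(1) smooth_on_of_real[OF assms(1)]] by auto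
next
  fix k f assume f: "smooth_on U f \<and> fun_vanishes_to_order 0 k f"
  have "fun_vanishes_to_order 0 k (\<lambda>x. of_real x ^ i * nderiv i f x)"
    unfolding fun_vanishes_to_order_def
  proof (intro allI impI)
    fix n assume n: "n < k"
    have "nderiv j (\<lambda>x. of_real x ^ i) 0 * nderiv (n - j) (nderiv i f) 0 = 0" if "j \<le> n" for j
      using that f n by (cases "i = j") (auto simp: nderiv_of_real_power nderiv_nderiv fun_vanishes_to_order_def)
    then show "nderiv n (\<lambda>x. of_real x ^ i * nderiv i f x) 0 = 0"
      using f assms by (subst nderiv_mult[OF assms(1)]) (auto intro: smooth_on_nderiv smooth_on_power smooth_on_of_real intro!: sum.neutral)
  qed
  moreover have "diffop_fun (replicate i (\<lambda>x. 0) @ [\<lambda>x. of_real x ^ i]) f = (\<lambda>x. of_real x ^ i * nderiv i f x)"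
    by (auto simp: diffop_fun_def nth_append)
  ultimately show "fun_vanishes_to_order 0 k (diffop_fun (replicate i (\<lambda>x. 0) @ [\<lambda>x. of_real x ^ i]) f)" by simp
qed

lemma norm_diff_le_vector_derivative:
  fixes f :: "real \<Rightarrow> complex"
  assumes "convex S" "\<And>y. y \<in> S \<Longrightarrow> (f has_vector_derivative f' y) (at y)"
    "\<And>y. y \<in> S \<Longrightarrow> norm (f' y) \<le> B" "a \<in> S" "b \<in> S"
  shows "norm (f a - f b) \<le> B * \<bar>a - b\<bar>"
proof -
  have "norm (f a - f b) \<le> B * norm (a - b)"
  proof (rule differentiable_bound[OF assms(1) _ _ assms(4,5)])
    show "(f has_derivative (\<lambda>h. h *\<^sub>R f' y)) (at y within S)" if "y \<in> S" for y
      using assms(2)[OF that] by (simp add: has_vector_derivative_def has_derivative_at_withinI)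
    show "onorm (\<lambda>h. h *\<^sub>R f' y) \<le> B" if "y \<in> S" for y
      using assms(3)[OF that] order_trans[OF norm_ge_zero assms(3)[OF that]]
      by (intro onorm_bound) (auto simp: mult.commute[of B] intro!: mult_left_mono)
  qed
  then show ?thesis by simp
qed

text \<open>Taylor's estimate by induction on \<open>m\<close>: the derivative vanishes to order one
  less, and the mean value inequality on the segment from 0 to x returns the lost power.\<close>

lemma fun_vanishes_bound:
  assumes "smooth_on U u" "{-r..r} \<subseteq> U" "fun_vanishes_to_order 0 m u"
  shows "\<exists>C\<ge>0. \<forall>x\<in>{-r..r}. norm (u x) \<le> C * \<bar>x\<bar> ^ m"
  using assms(1,3)
proof (induction m arbitrary: u)
  case 0
  have "bounded (u ` {-r..r})"
    using smooth_on_continuous[OF 0(1), of 0]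
    by (intro compact_imp_bounded compact_continuous_image) (use assms(2) in \<open>auto intro: continuous_on_subset\<close>)
  then obtain C where "\<forall>x\<in>{-r..r}. norm (u x) \<le> C" by (auto simp: bounded_iff)
  then show ?case by (intro exI[of _ "max C 0"]) auto
next
  case (Suc m)
  have "fun_vanishes_to_order 0 m (nderiv 1 u)"
    using Suc.prems(2) by (auto simp: fun_vanishes_to_order_def nderiv_nderiv)
  then obtain C where C: "C \<ge> 0" "\<forall>x\<in>{-r..r}. norm (nderiv 1 u x) \<le> C * \<bar>x\<bar> ^ m"
    using Suc.IH smooth_on_nderiv[OF Suc.prems(1)] by blast
  have u0: "u 0 = 0" using Suc.prems(2) unfolding fun_vanishes_to_order_def by (metis nderiv_0 zero_less_Suc)
  have "norm (u x) \<le> C * \<bar>x\<bar> ^ Suc m" if x: "x \<in> {-r..r}" for x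
  proof -
    have "norm (u x - u 0) \<le> C * \<bar>x\<bar> ^ m * \<bar>x - 0\<bar>"
    proof (rule norm_diff_le_vector_derivative[where S = "closed_segment 0 x" and f' = "\<lambda>y. nderiv 1 u y"])
      fix y assume "y \<in> closed_segment 0 x"
      then have y: "\<bar>y\<bar> \<le> \<bar>x\<bar>" by (auto simp: closed_segment_eq_real_ivl split: if_splits)
      then have yr: "y \<in> {-r..r}" using x by auto
      show "(u has_vector_derivative nderiv 1 u y) (at y)"
        using smooth_onD0[OF Suc.prems(1)] yr assms(2) by blast
      show "norm (nderiv 1 u y) \<le> C * \<bar>x\<bar> ^ m"
        using C(2) yr mult_left_mono[OF power_mono[OF y] C(1), of m] by fastforce
    qed auto
    then show ?thesis by (simp add: u0 mult_ac)
  qed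
  then show ?case using C(1) by blast
qed

lemma lebesgue_measurable_continuous:
  "continuous_on UNIV f \<Longrightarrow> f \<in> borel_measurable lebesgue" for f :: "real \<Rightarrow> complex"
  by (intro measurable_completion) (simp add: borel_measurable_continuous_onI)

lemma test_fun_measurable:
  assumes "f \<in> test_fun A"
  shows "nderiv n f \<in> borel_measurable lebesgue" "(euler ^^ n) f \<in> borel_measurable lebesgue"
  using smooth_on_continuous[OF test_fun_smooth[OF assms]]
    smooth_on_continuous[OF smooth_on_euler[OF open_UNIV test_fun_smooth[OF assms]], where n = 0]
  by (auto intro: lebesgue_measurable_continuous)

lemma integrable_bounded_support:
  fixes f :: "real \<Rightarrow> complex"
  assumes "f \<in> borel_measurable lebesgue" "\<And>x. norm (f x) \<le> C" "\<And>x. x \<notin> {-R..R} \<Longrightarrow> f x = 0"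
  shows "integrable lebesgue f"
  by (rule integrableI_bounded_set[where A = "{-R..R}" and B = C]) (use assms in \<open>auto simp: emeasure_lborel_Icc_eq\<close>)

lemma euler_test_fun: "f \<in> test_fun A \<Longrightarrow> (euler ^^ j) f \<in> test_fun A"
  by (elim test_funE, rule test_funI)
    (auto intro: smooth_on_euler euler_zero_outside[OF compact_imp_closed])

lemma nderiv_test_fun: "f \<in> test_fun A \<Longrightarrow> nderiv j f \<in> test_fun A"
  by (elim test_funE, rule test_funI)
    (auto intro: smooth_on_nderiv nderiv_zero_outside[OF compact_imp_closed])

lemma integrable_mult_test_fun:
  assumes "g \<in> borel_measurable lebesgue" "\<And>x. norm (g x) \<le> C" "f \<in> test_fun A"
  shows "integrable lebesgue (\<lambda>x. g x * f x)"
proof -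
  obtain K where K: "compact K" "\<And>x. x \<notin> K \<Longrightarrow> f x = 0" using assms(3) by (rule test_funE) blast
  obtain R where R: "\<And>x. x \<in> K \<Longrightarrow> norm x \<le> R" using compact_imp_bounded[OF K(1)] by (auto simp: bounded_iff)
  obtain B where B: "\<And>x. norm (f x) \<le> B" using test_fun_bounded[OF assms(3), of 0] by (auto simp: bounded_iff)
  have "0 \<le> B" using B[of 0] norm_ge_zero order_trans by blast
  show ?thesis
  proof (rule integrable_bounded_support[of _ "C * B" R])
    show "(\<lambda>x. g x * f x) \<in> borel_measurable lebesgue"
      using assms(1) test_fun_measurable(1)[OF assms(3), of 0] by simp
    show "norm (g x * f x) \<le> C * B" for x
      unfolding norm_mult by (rule mult_mono'[OF assms(2) B]) auto
    show "g x * f x = 0" if "x \<notin> {-R..R}" for x using K(2)[of x] R[of x] that by force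
  qed
qed

section \<open>Algebra of normal forms\<close>

text \<open>The second component, unconstrained here, is the power of the Euler operator that
  \<open>g\<close> multiplies. Bounds are required everywhere and not almost everywhere, so that
  later estimates are pointwise.\<close>

definition admissible :: "((real \<Rightarrow> complex) \<times> nat) list \<Rightarrow> bool" where
  "admissible L \<longleftrightarrow> (\<forall>(g, m)\<in>set L. g \<in> borel_measurable lebesgue \<and> (\<exists>C. \<forall>x. norm (g x) \<le> C))"

text \<open>Regular singular counterpart of a presentation, with all derivatives moved to the test function.\<close>

definition normal_form :: "nat \<Rightarrow> real set \<Rightarrow> functional \<Rightarrow> bool" where
  "normal_form k A \<rho> \<longleftrightarrow> (\<exists>L. admissible L \<and>
     (\<forall>\<phi>\<in>test_fun A. \<rho> \<phi> = (\<Sum>(g, m)\<leftarrow>L. LINT x|lebesgue. g x * (of_real x ^ k * (euler ^^ m) \<phi> x))))"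

text \<open>The same normal form at the level of integrands. It can be added and rearranged freely;
  integrability is settled once, in \<open>normal_formI_pointwise\<close>.\<close>

definition pointwise_normal_form :: "nat \<Rightarrow> real set \<Rightarrow> ((real \<Rightarrow> complex) \<Rightarrow> real \<Rightarrow> complex) \<Rightarrow> bool" where
  "pointwise_normal_form k A Q \<longleftrightarrow> (\<exists>L. admissible L \<and>
     (\<forall>\<phi>\<in>test_fun A. \<forall>x. Q \<phi> x = (\<Sum>(g, m)\<leftarrow>L. g x * (of_real x ^ k * (euler ^^ m) \<phi> x))))"

lemma pointwise_normal_form_add:
  assumes "pointwise_normal_form k A Q" "pointwise_normal_form k A R"
  shows "pointwise_normal_form k A (\<lambda>\<phi> x. Q \<phi> x + R \<phi> x)"
proof -
  obtain L M where LM: "admissible L" "admissible M"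
    "\<forall>\<phi>\<in>test_fun A. \<forall>x. Q \<phi> x = (\<Sum>(g, m)\<leftarrow>L. g x * (of_real x ^ k * (euler ^^ m) \<phi> x))"
    "\<forall>\<phi>\<in>test_fun A. \<forall>x. R \<phi> x = (\<Sum>(g, m)\<leftarrow>M. g x * (of_real x ^ k * (euler ^^ m) \<phi> x))"
    using assms by (auto simp: pointwise_normal_form_def)
  show ?thesis unfolding pointwise_normal_form_def
  proof (intro exI[of _ "L @ M"] conjI ballI)
    show "admissible (L @ M)" using LM by (auto simp: admissible_def)
    fix \<phi> assume "\<phi> \<in> test_fun A"
    from LM(3)[rule_format, OF this] LM(4)[rule_format, OF this]
    show "\<forall>x. Q \<phi> x + R \<phi> x = (\<Sum>(g, m)\<leftarrow>L @ M. g x * (of_real x ^ k * (euler ^^ m) \<phi> x))"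
      by simp
  qed
qed

lemma pointwise_normal_form_zero: "pointwise_normal_form k A (\<lambda>\<phi> x. 0)"
  by (auto simp: pointwise_normal_form_def admissible_def intro!: exI[of _ "[]"])

lemma pointwise_normal_form_sum:
  "(\<And>i. i \<in> I \<Longrightarrow> pointwise_normal_form k A (Q i)) \<Longrightarrow> pointwise_normal_form k A (\<lambda>\<phi> x. \<Sum>i\<in>I. Q i \<phi> x)"
  by (induction I rule: infinite_finite_induct) (auto intro: pointwise_normal_form_add pointwise_normal_form_zero)

lemma pointwise_normal_form_cong:
  assumes "\<And>\<phi>. \<phi> \<in> test_fun A \<Longrightarrow> \<forall>x. Q \<phi> x = R \<phi> x" "pointwise_normal_form k A Q"
  shows "pointwise_normal_form k A R"
proof -
  obtain L where L: "admissible L"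
    "\<forall>\<phi>\<in>test_fun A. \<forall>x. Q \<phi> x = (\<Sum>(g, m)\<leftarrow>L. g x * (of_real x ^ k * (euler ^^ m) \<phi> x))"
    using assms by (auto simp: pointwise_normal_form_def)
  show ?thesis unfolding pointwise_normal_form_def
  proof (intro exI[of _ L] conjI ballI L)
    fix \<phi> assume "\<phi> \<in> test_fun A"
    from L(2)[rule_format, OF this] assms(1)[OF this]
    show "\<forall>x. R \<phi> x = (\<Sum>(g, m)\<leftarrow>L. g x * (of_real x ^ k * (euler ^^ m) \<phi> x))"
      by simp
  qed
qed

lemma pointwise_normal_form_single:
  assumes "g \<in> borel_measurable lebesgue" "\<And>x. norm (g x) \<le> C"
  shows "pointwise_normal_form k A (\<lambda>\<phi> x. g x * (of_real x ^ k * (euler ^^ m) \<phi> x))"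
  unfolding pointwise_normal_form_def admissible_def
  by (intro exI[of _ "[(g, m)]"]) (use assms in auto)

text \<open>Write v (d/dx)^m as (v / x^(k+m)) x^k x^m (d/dx)^m. The quotient is bounded by
  hypothesis, and x^m (d/dx)^m is a polynomial in E.\<close>

lemma pointwise_normal_form_nderiv:
  assumes v: "v \<in> borel_measurable lebesgue" "\<And>x. norm (v x) \<le> C * \<bar>x\<bar> ^ (k + m)"
  shows "pointwise_normal_form k A (\<lambda>\<phi> x. v x * nderiv m \<phi> x)"
proof -
  obtain c where c: "\<And>f x. smooth_on UNIV f \<Longrightarrow>
     of_real x ^ m * nderiv m f x = (\<Sum>i\<le>m. c i * (euler ^^ i) f x)"
    using nderiv_eq_euler[of m] by (metis UNIV_I open_UNIV)
  define g where "g i x = c i * (v x / of_real x ^ (k + m))" for i x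
  have "g i \<in> borel_measurable lebesgue" for i
  proof -
    have [measurable]: "(\<lambda>x. complex_of_real x ^ (k + m)) \<in> borel_measurable lebesgue"
      by (intro lebesgue_measurable_continuous continuous_intros)
    show ?thesis unfolding g_def using v(1) by measurable
  qed
  moreover have "norm (g i x) \<le> norm (c i) * C" for i x
  proof -
    have "norm (v x / of_real x ^ (k + m)) \<le> C"
    proof (cases "x = 0")
      case True
      have "norm (v 1) \<le> C" using v(2)[of 1] by simp
      then have "0 \<le> C" using norm_ge_zero order_trans by blast
      then show ?thesis using v(2)[of 0] True by (cases "k + m = 0") (auto simp: power_0_left)
    qed (use v(2)[of x] in \<open>simp add: norm_divide norm_power divide_le_eq\<close>)
    from mult_left_mono[OF this norm_ge_zero[of "c i"]] show ?thesis
      by (simp only: g_def norm_mult)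
  qed
  ultimately have "pointwise_normal_form k A (\<lambda>\<phi> x. \<Sum>i\<le>m. g i x * (of_real x ^ k * (euler ^^ i) \<phi> x))"
    by (intro pointwise_normal_form_sum pointwise_normal_form_single)
  then show ?thesis
  proof (rule pointwise_normal_form_cong[rotated])
    fix \<phi> assume \<phi>: "\<phi> \<in> test_fun A"
    show "\<forall>x. (\<Sum>i\<le>m. g i x * (of_real x ^ k * (euler ^^ i) \<phi> x)) = v x * nderiv m \<phi> x"
    proof
      fix x
      have "(\<Sum>i\<le>m. g i x * (of_real x ^ k * (euler ^^ i) \<phi> x)) =
          v x / of_real x ^ (k + m) * of_real x ^ k * (\<Sum>i\<le>m. c i * (euler ^^ i) \<phi> x)"
        by (simp add: g_def sum_distrib_left sum_divide_distrib mult_ac)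
      also have "\<dots> = v x / of_real x ^ (k + m) * of_real x ^ (k + m) * nderiv m \<phi> x"
        by (simp add: c[OF test_fun_smooth[OF \<phi>], symmetric] power_add)
      \<comment> \<open>At x = 0 either k + m = 0 and the power is 1, or k + m > 0 and the bound
        forces v 0 = 0.\<close>
      also have "v x / of_real x ^ (k + m) * of_real x ^ (k + m) = v x"
        using v(2)[of x] by (cases "x = 0"; cases "k + m = 0") (auto simp: power_0_left)
      finally show "(\<Sum>i\<le>m. g i x * (of_real x ^ k * (euler ^^ i) \<phi> x)) = v x * nderiv m \<phi> x" .
    qed
  qed
qed

lemma normal_formI_pointwise:
  assumes "pointwise_normal_form k A Q" "\<And>\<phi>. \<phi> \<in> test_fun A \<Longrightarrow> \<rho> \<phi> = (LINT x|lebesgue. Q \<phi> x)"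
  shows "normal_form k A \<rho>"
proof -
  obtain L where L: "admissible L"
    "\<forall>\<phi>\<in>test_fun A. \<forall>x. Q \<phi> x = (\<Sum>(g, m)\<leftarrow>L. g x * (of_real x ^ k * (euler ^^ m) \<phi> x))"
    using assms by (auto simp: pointwise_normal_form_def)
  have int: "integrable lebesgue (\<lambda>x. \<Sum>(g, m)\<leftarrow>L. g x * (of_real x ^ k * (euler ^^ m) \<phi> x)) \<and>
     (LINT x|lebesgue. (\<Sum>(g, m)\<leftarrow>L. g x * (of_real x ^ k * (euler ^^ m) \<phi> x))) =
     (\<Sum>(g, m)\<leftarrow>L. LINT x|lebesgue. g x * (of_real x ^ k * (euler ^^ m) \<phi> x))" if "\<phi> \<in> test_fun A" for \<phi>
    using L(1)
  proof (induction L)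
    case (Cons a L)
    obtain g m where a: "a = (g, m)" by force
    have "integrable lebesgue (\<lambda>x. g x * (of_real x ^ k * (euler ^^ m) \<phi> x))"
    proof -
      obtain C where "g \<in> borel_measurable lebesgue" "\<And>x. norm (g x) \<le> C"
        using Cons.prems a by (auto simp: admissible_def)
      moreover have "(\<lambda>x. of_real x ^ k * (euler ^^ m) \<phi> x) \<in> test_fun UNIV"
        using test_fun_mono[OF euler_test_fun[OF that]]
        by (intro test_fun_mult smooth_on_power smooth_on_of_real) auto
      ultimately show ?thesis by (rule integrable_mult_test_fun)
    qed
    moreover have "admissible L" using Cons.prems by (auto simp: admissible_def)
    ultimately show ?case using Cons.IH a by simp
  qed simp
  show ?thesis unfolding normal_form_def
  proof (intro exI[of _ L] conjI ballI L)
    fix \<phi> assume \<phi>: "\<phi> \<in> test_fun A"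
    have "\<rho> \<phi> = (LINT x|lebesgue. (\<Sum>(g, m)\<leftarrow>L. g x * (of_real x ^ k * (euler ^^ m) \<phi> x)))"
      unfolding assms(2)[OF \<phi>] using L(2) \<phi> by (intro Bochner_Integration.integral_cong) auto
    then show "\<rho> \<phi> = (\<Sum>(g, m)\<leftarrow>L. LINT x|lebesgue. g x * (of_real x ^ k * (euler ^^ m) \<phi> x))"
      using int[OF \<phi>] by simp
  qed
qed

lemma normal_formE:
  assumes "normal_form k A \<rho>"
  obtains L where "admissible L"
    "\<forall>\<phi>\<in>test_fun A. \<rho> \<phi> = (\<Sum>(g, m)\<leftarrow>L. LINT x|lebesgue. g x * (of_real x ^ k * (euler ^^ m) \<phi> x))"
  using assms unfolding normal_form_def by (elim exE conjE) (rule that)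

lemma normal_formI:
  assumes "admissible L"
    "\<And>\<phi>. \<phi> \<in> test_fun A \<Longrightarrow> \<rho> \<phi> = (\<Sum>(g, m)\<leftarrow>L. LINT x|lebesgue. g x * (of_real x ^ k * (euler ^^ m) \<phi> x))"
  shows "normal_form k A \<rho>"
  unfolding normal_form_def by (rule exI[of _ L]) (simp add: assms)

lemma normal_form_cong:
  assumes "\<And>\<phi>. \<phi> \<in> test_fun A \<Longrightarrow> \<rho> \<phi> = \<rho>' \<phi>" "normal_form k A \<rho>"
  shows "normal_form k A \<rho>'"
proof -
  obtain L where L: "admissible L"
    "\<forall>\<phi>\<in>test_fun A. \<rho> \<phi> = (\<Sum>(g, m)\<leftarrow>L. LINT x|lebesgue. g x * (of_real x ^ k * (euler ^^ m) \<phi> x))"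
    using assms(2) by (rule normal_formE)
  show ?thesis by (rule normal_formI[OF L(1)]) (use L(2) assms(1) in simp)
qed

lemma normal_form_mono:
  assumes "normal_form k A \<rho>" "B \<subseteq> A"
  shows "normal_form k B \<rho>"
proof -
  obtain L where L: "admissible L"
    "\<forall>\<phi>\<in>test_fun A. \<rho> \<phi> = (\<Sum>(g, m)\<leftarrow>L. LINT x|lebesgue. g x * (of_real x ^ k * (euler ^^ m) \<phi> x))"
    using assms(1) by (rule normal_formE)
  show ?thesis by (rule normal_formI[OF L(1)]) (use L(2) test_fun_mono[OF _ assms(2)] in simp)
qed

lemma normal_form_zero: "normal_form k A (\<lambda>\<phi>. 0)"
  by (rule normal_formI[of "[]"]) (simp_all add: admissible_def)

lemma normal_form_add:
  assumes "normal_form k A \<rho>" "normal_form k A \<rho>'"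
  shows "normal_form k A (\<lambda>\<phi>. \<rho> \<phi> + \<rho>' \<phi>)"
proof -
  obtain L where L: "admissible L"
    "\<forall>\<phi>\<in>test_fun A. \<rho> \<phi> = (\<Sum>(g, m)\<leftarrow>L. LINT x|lebesgue. g x * (of_real x ^ k * (euler ^^ m) \<phi> x))"
    using assms(1) by (rule normal_formE)
  obtain M where M: "admissible M"
    "\<forall>\<phi>\<in>test_fun A. \<rho>' \<phi> = (\<Sum>(g, m)\<leftarrow>M. LINT x|lebesgue. g x * (of_real x ^ k * (euler ^^ m) \<phi> x))"
    using assms(2) by (rule normal_formE)
  show ?thesis
  proof (rule normal_formI[of "L @ M"])
    show "admissible (L @ M)" using L(1) M(1) unfolding admissible_def set_append by blast
  qed (use L(2) M(2) in simp)
qed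

lemma normal_form_cmult:
  assumes "normal_form k A \<rho>"
  shows "normal_form k A (\<lambda>\<phi>. c * \<rho> \<phi>)"
proof -
  obtain L where L: "admissible L"
    "\<forall>\<phi>\<in>test_fun A. \<rho> \<phi> = (\<Sum>(g, m)\<leftarrow>L. LINT x|lebesgue. g x * (of_real x ^ k * (euler ^^ m) \<phi> x))"
    using assms by (rule normal_formE)
  let ?M = "map (\<lambda>(g, m). (\<lambda>x. c * g x, m)) L"
  have "admissible [(\<lambda>x. c * g x, m)]" if gm: "(g, m) \<in> set L" for g m
  proof -
    obtain C where C: "g \<in> borel_measurable lebesgue" "\<forall>x. norm (g x) \<le> C"
      using L(1) gm unfolding admissible_def by blast
    have "\<forall>x. norm (c * g x) \<le> norm c * C" using C(2) by (simp add: norm_mult mult_left_mono)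
    moreover have "(\<lambda>x. c * g x) \<in> borel_measurable lebesgue" using C(1) by measurable
    ultimately show ?thesis unfolding admissible_def by auto
  qed
  then have "admissible ?M" unfolding admissible_def by auto
  moreover have "c * (\<Sum>(g, m)\<leftarrow>L. LINT x|lebesgue. g x * (of_real x ^ k * (euler ^^ m) \<phi> x)) =
      (\<Sum>(g, m)\<leftarrow>?M. LINT x|lebesgue. g x * (of_real x ^ k * (euler ^^ m) \<phi> x))" for \<phi>
    by (induction L) (auto simp: distrib_left mult.assoc)
  ultimately show ?thesis
    by (intro normal_formI[of ?M]) (simp_all only: L(2)[rule_format])
qed

lemma normal_form_sum:
  "(\<And>i. i \<in> I \<Longrightarrow> normal_form k A (\<rho> i)) \<Longrightarrow> normal_form k A (\<lambda>\<phi>. \<Sum>i\<in>I. \<rho> i \<phi>)"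
  by (induction I rule: infinite_finite_induct) (auto intro: normal_form_add normal_form_zero)

section \<open>From presentations to normal forms\<close>

lemma dist_deriv_funpow: "(dist_deriv ^^ i) \<sigma> \<phi> = (-1) ^ i * \<sigma> (nderiv i \<phi>)"
proof (induction i arbitrary: \<phi>)
  case (Suc i)
  then show ?case by (simp add: dist_deriv_def nderiv_nderiv)
qed simp

text \<open>By Leibniz the i derivatives split into m on phi and i - m on \<open>u\<close>. Since
  \<open>u\<close> vanishes to order k + i, the coefficient of the m-th derivative of phi vanishes
  to order k + m, as \<open>pointwise_normal_form_nderiv\<close> demands.\<close>

lemma normal_form_presentation_term:
  assumes U: "open U" "{-r..r} \<subseteq> U" "r > 0"
    and h: "h \<in> Linf_loc U" and u: "smooth_on U u" "fun_vanishes_to_order 0 (k + i) u"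
  shows "normal_form k {-r<..<r} (\<lambda>\<phi>. dist_of_fun U h (nderiv i (\<lambda>x. u x * \<phi> x)))"
proof -
  have U0: "0 \<in> U" using U by auto
  obtain C where C: "AE x in lebesgue_on {-r..r}. norm (h x) \<le> C"
    using h U(2) by (auto simp: Linf_loc_def)
  \<comment> \<open>Truncation turns the essential bound on [-r, r] into a bound everywhere and
    changes \<open>h\<close> there only on a null set.\<close>
  define h' where "h' x = (if x \<in> {-r..r} \<and> norm (h x) \<le> C then h x else 0)" for x
  have hU: "(\<lambda>x. indicator U x *\<^sub>R h x) \<in> borel_measurable lebesgue"
    using h U(1) by (simp add: Linf_loc_def borel_measurable_restrict_space_iff)
  have h'_meas: "h' \<in> borel_measurable lebesgue"
  proof -
    define T where "T y = (if norm y \<le> C then y else 0)" for y :: complex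
    have "T \<in> borel_measurable borel" unfolding T_def by measurable
    from measurable_compose[OF hU this]
    have "(\<lambda>x. indicator {-r..r} x *\<^sub>R T (indicator U x *\<^sub>R h x)) \<in> borel_measurable lebesgue"
      by (intro borel_measurable_scaleR borel_measurable_indicator) auto
    moreover have "h' = (\<lambda>x. indicator {-r..r} x *\<^sub>R T (indicator U x *\<^sub>R h x))"
      using U(2) by (auto simp: h'_def T_def fun_eq_iff indicator_def)
    ultimately show ?thesis by simp
  qed
  have h'_le: "norm (h' x) \<le> max C 0" for x by (auto simp: h'_def)
  have eq: "AE x in lebesgue. x \<in> {-r..r} \<longrightarrow> h' x = h x"
  proof -
    have "AE x in lebesgue. x \<in> {-r..r} \<longrightarrow> norm (h x) \<le> C"
      using C by (simp add: AE_restrict_space_iff)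
    then show ?thesis by eventually_elim (simp add: h'_def)
  qed
  define v where "v m x = h' x * (of_nat (i choose m) * (indicator {-r..r} x *\<^sub>R nderiv (i - m) u x))" for m x
  have "pointwise_normal_form k {-r<..<r} (\<lambda>\<phi> x. \<Sum>m\<le>i. v m x * nderiv m \<phi> x)"
  proof (intro pointwise_normal_form_sum)
    fix m assume m: "m \<in> {..i}"
    have "fun_vanishes_to_order 0 (k + m) (nderiv (i - m) u)"
      using u(2) m by (auto simp: fun_vanishes_to_order_def nderiv_nderiv)
    from fun_vanishes_bound[OF smooth_on_nderiv[OF u(1)] U(2) this]
    obtain B where B: "B \<ge> 0" "\<forall>x\<in>{-r..r}. norm (nderiv (i - m) u x) \<le> B * \<bar>x\<bar> ^ (k + m)" by blast
    show "pointwise_normal_form k {-r<..<r} (\<lambda>\<phi> x. v m x * nderiv m \<phi> x)"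
    proof (rule pointwise_normal_form_nderiv)
      have "(\<lambda>x. indicator {-r..r} x *\<^sub>R nderiv (i - m) u x) \<in> borel_measurable lborel"
        using smooth_on_continuous[OF u(1)] U(2)
        by (simp, intro borel_measurable_continuous_on_indicator) (auto intro: continuous_on_subset)
      from measurable_completion[OF this]
      show "v m \<in> borel_measurable lebesgue" unfolding v_def using h'_meas by measurable
      show "norm (v m x) \<le> (max C 0 * (of_nat (i choose m) * B)) * \<bar>x\<bar> ^ (k + m)" for x
      proof -
        have "norm (v m x) \<le> max C 0 * (of_nat (i choose m) * (B * \<bar>x\<bar> ^ (k + m)))"
          unfolding v_def norm_mult using B h'_le
          by (intro mult_mono) (auto simp: indicator_def)
        then show ?thesis by (simp add: mult_ac)
      qed
    qed
  qed
  then show ?thesis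
  proof (rule normal_formI_pointwise)
    fix \<phi> assume \<phi>: "\<phi> \<in> test_fun {-r<..<r}"
    let ?F = "nderiv i (\<lambda>x. u x * \<phi> x)"
    have sm: "smooth_on U \<phi>" using test_fun_smooth[OF \<phi>] by (rule smooth_on_subset) auto
    have F: "?F x = (\<Sum>m\<le>i. of_nat (i choose m) * (nderiv m \<phi> x * nderiv (i - m) u x))" if "x \<in> U" for x
      using nderiv_mult[OF U(1) sm u(1) that, of i] by (simp add: mult.commute)
    have out: "nderiv m \<phi> x = 0" if "x \<notin> {-r<..<r}" for m x
    proof -
      obtain K where "compact K" "K \<subseteq> {-r<..<r}" "\<And>x. x \<notin> K \<Longrightarrow> \<phi> x = 0"
        using \<phi> by (rule test_funE) blast
      moreover from this that have "x \<notin> K" by blast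
      ultimately show ?thesis using nderiv_zero_outside[of K \<phi> x m] by (simp add: compact_imp_closed)
    qed
    have G: "(\<lambda>x. indicator U x *\<^sub>R ?F x) \<in> borel_measurable lebesgue"
    proof (intro measurable_completion)
      show "(\<lambda>x. indicator U x *\<^sub>R ?F x) \<in> borel_measurable lborel"
        using U(1) smooth_on_continuous[OF smooth_on_mult[OF U(1) u(1) sm]]
        by (simp, intro borel_measurable_continuous_on_indicator) auto
    qed
    have "dist_of_fun U h ?F = (LINT x|lebesgue. indicator U x *\<^sub>R (h x * ?F x))"
      unfolding dist_of_fun_def using U(1) by (subst integral_restrict_space) auto
    also have "\<dots> = (LINT x|lebesgue. (indicator U x *\<^sub>R h x) * (indicator U x *\<^sub>R ?F x))"
      by (intro Bochner_Integration.integral_cong) (auto simp: indicator_def)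
    also have "\<dots> = (LINT x|lebesgue. h' x * (indicator U x *\<^sub>R ?F x))"
    proof (rule integral_cong_AE)
      show "(\<lambda>x. (indicator U x *\<^sub>R h x) * (indicator U x *\<^sub>R ?F x)) \<in> borel_measurable lebesgue"
        using hU G by (rule borel_measurable_times)
      show "(\<lambda>x. h' x * (indicator U x *\<^sub>R ?F x)) \<in> borel_measurable lebesgue"
        using h'_meas G by (rule borel_measurable_times)
      show "AE x in lebesgue. (indicator U x *\<^sub>R h x) * (indicator U x *\<^sub>R ?F x) = h' x * (indicator U x *\<^sub>R ?F x)"
        using eq
      proof eventually_elim
        case (elim x)
        show ?case
        proof (cases "x \<in> {-r..r}")
          case True then show ?thesis using elim U(2) by (auto simp: indicator_def)
        next
          case False
          then have "nderiv m \<phi> x = 0" for m by (intro out) auto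
          then have "x \<in> U \<Longrightarrow> ?F x = 0" by (simp add: F)
          then show ?thesis by (auto simp: indicator_def)
        qed
      qed
    qed
    also have "\<dots> = (LINT x|lebesgue. (\<Sum>m\<le>i. v m x * nderiv m \<phi> x))"
    proof (intro Bochner_Integration.integral_cong refl)
      fix x
      show "h' x * (indicator U x *\<^sub>R ?F x) = (\<Sum>m\<le>i. v m x * nderiv m \<phi> x)"
      proof (cases "x \<in> {-r..r}")
        case True
        then have "x \<in> U" using U(2) by blast
        then show ?thesis using True unfolding F[OF \<open>x \<in> U\<close>] by (simp add: v_def sum_distrib_left mult_ac)
      next
        case False
        then have "h' x = 0" by (simp only: h'_def if_False simp_thms)
        then show ?thesis by (simp add: v_def)
      qed
    qed
    finally show "dist_of_fun U h ?F = (LINT x|lebesgue. (\<Sum>m\<le>i. v m x * nderiv m \<phi> x))" .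
  qed
qed

lemma presentationE:
  assumes "vanishing_presentation U p k \<sigma>"
  obtains N :: nat and f D h where
    "\<forall>j<N. smooth_on U (f j) \<and> fun_vanishes_to_order p k (f j) \<and>
               tangential_diffop U p (D j) \<and> h j \<in> Linf_loc U"
    "\<forall>\<phi>\<in>test_fun U. \<sigma> \<phi> = (\<Sum>j<N. dist_mult (f j) (diffop_dist (D j) (dist_of_fun U (h j))) \<phi>)"
  using assms unfolding vanishing_presentation_def by (elim exE conjE) (rule that)

lemma presentationI:
  fixes N :: nat
  assumes "\<And>j. j < N \<Longrightarrow> smooth_on U (f j) \<and> fun_vanishes_to_order p k (f j) \<and>
               tangential_diffop U p (D j) \<and> h j \<in> Linf_loc U"
    and "\<And>\<phi>. \<phi> \<in> test_fun U \<Longrightarrow> \<sigma> \<phi> = (\<Sum>j<N. dist_mult (f j) (diffop_dist (D j) (dist_of_fun U (h j))) \<phi>)"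
  shows "vanishing_presentation U p k \<sigma>"
  unfolding vanishing_presentation_def
  by (rule exI[of _ N], rule exI[of _ f], rule exI[of _ D], rule exI[of _ h]) (use assms in simp)

text \<open>Transposition places both the coefficient \<open>D j ! i\<close> and the factor
  \<open>f j\<close> under the i-th derivative. They vanish to orders i and k, so their product
  vanishes to order k + i.\<close>

lemma presentation_imp_normal_form:
  assumes U: "open U" "0 \<in> U" and pres: "vanishing_presentation U 0 k \<sigma>"
  shows "\<exists>r>0. r < 1 \<and> normal_form k {-r<..<r} \<sigma>"
proof -
  obtain N :: nat and f D h where
    P: "\<forall>j<N. smooth_on U (f j) \<and> fun_vanishes_to_order 0 k (f j) \<and>
               tangential_diffop U 0 (D j) \<and> h j \<in> Linf_loc U"
    and eq: "\<forall>\<phi>\<in>test_fun U. \<sigma> \<phi> = (\<Sum>j<N. dist_mult (f j) (diffop_dist (D j) (dist_of_fun U (h j))) \<phi>)"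
    using pres by (rule presentationE)
  note P = P[rule_format]
  obtain e where e: "e > 0" "cball 0 e \<subseteq> U" using U open_contains_cball by blast
  \<comment> \<open>The bound 1/2 keeps the interval inside |x| < 1, where powers of |x| are weights
    with negative exponent.\<close>
  define r where "r = min e (1 / 2)"
  have r: "r > 0" "r < 1" "{-r..r} \<subseteq> U" using e by (auto simp: r_def subset_iff)
  have "normal_form k {-r<..<r}
     (\<lambda>\<phi>. \<Sum>j<N. \<Sum>i<length (D j). (-1) ^ i * dist_of_fun U (h j) (nderiv i (\<lambda>x. ((D j ! i) x * f j x) * \<phi> x)))"
  proof (intro normal_form_sum normal_form_cmult)
    fix j i assume ji: "j \<in> {..<N}" "i \<in> {..<length (D j)}"
    have sm: "smooth_on U (D j ! i)" using P[of j] ji by (auto simp: tangential_diffop_def)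
    show "normal_form k {-r<..<r} (\<lambda>\<phi>. dist_of_fun U (h j) (nderiv i (\<lambda>x. ((D j ! i) x * f j x) * \<phi> x)))"
    proof (rule normal_form_presentation_term[OF U(1) r(3,1)])
      show "smooth_on U (\<lambda>x. (D j ! i) x * f j x)" using P[of j] ji sm U by (intro smooth_on_mult) auto
      have "fun_vanishes_to_order 0 (i + k) (\<lambda>x. (D j ! i) x * f j x)"
        using P[of j] ji sm tangential_coefficient_vanishes[OF U] by (intro fun_vanishes_mult[OF U]) auto
      then show "fun_vanishes_to_order 0 (k + i) (\<lambda>x. (D j ! i) x * f j x)" by (simp add: add.commute)
    qed (use P ji in auto)
  qed
  then have "normal_form k {-r<..<r} \<sigma>"
  proof (rule normal_form_cong[rotated])
    fix \<phi> assume "\<phi> \<in> test_fun {-r<..<r}"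
    moreover have "{-r<..<r} \<subseteq> U" using r by auto
    ultimately have "\<phi> \<in> test_fun U" by (rule test_fun_mono)
    then show "(\<Sum>j<N. \<Sum>i<length (D j). (-1) ^ i * dist_of_fun U (h j) (nderiv i (\<lambda>x. ((D j ! i) x * f j x) * \<phi> x))) = \<sigma> \<phi>"
      using eq by (simp add: dist_mult_def diffop_dist_def dist_deriv_funpow mult.assoc)
  qed
  then show ?thesis using r by blast
qed

section \<open>From normal forms back to presentations\<close>

lemma presentation_add:
  assumes "vanishing_presentation U p k \<sigma>" "vanishing_presentation U p k \<tau>"
  shows "vanishing_presentation U p k (\<lambda>\<phi>. \<sigma> \<phi> + \<tau> \<phi>)"
proof -
  obtain N :: nat and f D h where
    P: "\<forall>j<N. smooth_on U (f j) \<and> fun_vanishes_to_order p k (f j) \<and>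
               tangential_diffop U p (D j) \<and> h j \<in> Linf_loc U"
    and eq: "\<forall>\<phi>\<in>test_fun U. \<sigma> \<phi> = (\<Sum>j<N. dist_mult (f j) (diffop_dist (D j) (dist_of_fun U (h j))) \<phi>)"
    using assms(1) by (rule presentationE)
  note P = P[rule_format]
  obtain N' :: nat and f' D' h' where
    P': "\<forall>j<N'. smooth_on U (f' j) \<and> fun_vanishes_to_order p k (f' j) \<and>
               tangential_diffop U p (D' j) \<and> h' j \<in> Linf_loc U"
    and eq': "\<forall>\<phi>\<in>test_fun U. \<tau> \<phi> = (\<Sum>j<N'. dist_mult (f' j) (diffop_dist (D' j) (dist_of_fun U (h' j))) \<phi>)"
    using assms(2) by (rule presentationE)
  note P' = P'[rule_format]
  define F where "F j = (if j < N then f j else f' (j - N))" for j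
  define DD where "DD j = (if j < N then D j else D' (j - N))" for j
  define H where "H j = (if j < N then h j else h' (j - N))" for j
  have split: "(\<Sum>j<N + N'. g j) = (\<Sum>j<N. g j) + (\<Sum>j<N'. g (N + j))" for g :: "nat \<Rightarrow> complex"
    by (induction N') (auto simp: add.assoc)
  show ?thesis
  proof (rule presentationI[where N = "N + N'" and f = F and D = DD and h = H])
    fix j assume "j < N + N'"
    then have "j < N \<or> \<not> j < N \<and> j - N < N'" by auto
    then show "smooth_on U (F j) \<and> fun_vanishes_to_order p k (F j) \<and> tangential_diffop U p (DD j) \<and> H j \<in> Linf_loc U"
      using P[of j] P'[of "j - N"] by (auto simp: F_def DD_def H_def)
  next
    fix \<phi> assume "\<phi> \<in> test_fun U"
    then show "\<sigma> \<phi> + \<tau> \<phi> = (\<Sum>j<N + N'. dist_mult (F j) (diffop_dist (DD j) (dist_of_fun U (H j))) \<phi>)"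
      using eq eq' unfolding split by (simp add: F_def DD_def H_def)
  qed
qed

lemma presentation_zero: "vanishing_presentation U p k (\<lambda>\<phi>. 0)"
  by (rule presentationI[where N = 0]) auto

lemma presentation_cong:
  assumes "\<And>\<phi>. \<phi> \<in> test_fun U \<Longrightarrow> \<sigma> \<phi> = \<sigma>' \<phi>" "vanishing_presentation U p k \<sigma>"
  shows "vanishing_presentation U p k \<sigma>'"
proof -
  obtain N :: nat and f D h where
    "\<forall>j<N. smooth_on U (f j) \<and> fun_vanishes_to_order p k (f j) \<and>
               tangential_diffop U p (D j) \<and> h j \<in> Linf_loc U"
    "\<forall>\<phi>\<in>test_fun U. \<sigma> \<phi> = (\<Sum>j<N. dist_mult (f j) (diffop_dist (D j) (dist_of_fun U (h j))) \<phi>)"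
    using assms(2) by (rule presentationE)
  then show ?thesis using assms(1)
    by (intro presentationI[where N = N and f = f and D = D and h = h]) simp_all
qed

lemma presentation_sum:
  "(\<And>i. i \<in> I \<Longrightarrow> vanishing_presentation U p k (\<rho> i)) \<Longrightarrow> vanishing_presentation U p k (\<lambda>\<phi>. \<Sum>i\<in>I. \<rho> i \<phi>)"
  by (induction I rule: infinite_finite_induct) (auto intro: presentation_add presentation_zero)

lemma presentation_sum_list:
  "(\<And>a. a \<in> set L \<Longrightarrow> vanishing_presentation U p k (\<rho> a)) \<Longrightarrow> vanishing_presentation U p k (\<lambda>\<phi>. \<Sum>a\<leftarrow>L. \<rho> a \<phi>)"
  by (induction L) (auto intro: presentation_add presentation_zero)

text \<open>A transposed presentation has its derivatives on the outside, acting on coefficient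
  times factor times phi. Hence x^k E^m phi is rewritten with terms (d/dx)^i (x^i x^k phi).\<close>

lemma power_euler_eq_nderiv:
  "\<exists>c. \<forall>\<phi> x. smooth_on UNIV \<phi> \<longrightarrow>
     of_real x ^ k * (euler ^^ m) \<phi> x = (\<Sum>i\<le>m. c i * nderiv i (\<lambda>x. of_real x ^ i * (of_real x ^ k * \<phi> x)) x)"
proof (induction m)
  case 0
  then show ?case by (auto intro!: exI[of _ "\<lambda>_. 1"])
next
  case (Suc m)
  define S where "S i \<phi> = nderiv i (\<lambda>x. of_real x ^ i * (of_real x ^ k * \<phi> x))" for i \<phi>
  obtain c where c: "\<And>\<phi> x. smooth_on UNIV \<phi> \<Longrightarrow> of_real x ^ k * (euler ^^ m) \<phi> x = (\<Sum>i\<le>m. c i * S i \<phi> x)"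
    using Suc.IH unfolding S_def by blast
  define c' where "c' i = (if i = 0 then 0 else c (i - 1)) - (if i \<le> m then (of_nat i + of_nat k + 1) * c i else 0)" for i
  have "of_real x ^ k * (euler ^^ Suc m) \<phi> x = (\<Sum>i\<le>Suc m. c' i * S i \<phi> x)" if \<phi>: "smooth_on UNIV \<phi>" for \<phi> x
  proof -
    have smp: "smooth_on UNIV (\<lambda>x. of_real x ^ i * (of_real x ^ k * \<phi> x))" for i
      by (intro smooth_on_mult smooth_on_power smooth_on_of_real \<phi>) auto
    have smS: "smooth_on UNIV (S i \<phi>)" for i unfolding S_def by (rule smooth_on_nderiv[OF smp])
    \<comment> \<open>With G = x^i x^k phi, Leibniz for x G has only two terms, since x has no
      second derivative: (x G)^(i+1) = x G^(i+1) + (i + 1) G^(i).\<close>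
    have eS: "euler (S i \<phi>) x = S (Suc i) \<phi> x - (of_nat i + 1) * S i \<phi> x" for i
    proof -
      let ?G = "\<lambda>x. of_real x ^ i * (of_real x ^ k * \<phi> x)"
      have "S (Suc i) \<phi> x = nderiv (Suc i) (\<lambda>x. of_real x * ?G x) x" by (simp add: S_def mult.assoc)
      also have "\<dots> = (\<Sum>j\<le>Suc i. of_nat (Suc i choose j) * (nderiv j of_real x * nderiv (Suc i - j) ?G x))"
        by (rule nderiv_mult[OF open_UNIV smooth_on_of_real smp]) auto
      also have "\<dots> = (\<Sum>j\<in>{0, 1}. of_nat (Suc i choose j) * (nderiv j of_real x * nderiv (Suc i - j) ?G x))"
        using nderiv_of_real_power[where m = 1 and x = x] by (intro sum.mono_neutral_right) auto
      also have "\<dots> = of_real x * nderiv (Suc i) ?G x + of_nat (Suc i) * nderiv i ?G x"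
        using nderiv_of_real_power[where m = 1 and x = x and n = 1] by simp
      finally show ?thesis unfolding euler_def S_def by (simp add: nderiv_nderiv algebra_simps)
    qed
    have "euler (\<lambda>x. of_real x ^ k * (euler ^^ m) \<phi> x) x = (\<Sum>i\<le>m. c i * euler (S i \<phi>) x)"
      using euler_sum[OF open_UNIV _ _ UNIV_I, of "{..m}" "\<lambda>i x. c i * S i \<phi> x" 1]
        euler_cmult[OF open_UNIV smS UNIV_I, where n = 1] smooth_on_cmult[OF open_UNIV smS]
      by (simp add: c[OF \<phi>])
    moreover have "euler (\<lambda>x. of_real x ^ k * (euler ^^ m) \<phi> x) x =
        of_nat k * (of_real x ^ k * (euler ^^ m) \<phi> x) + of_real x ^ k * (euler ^^ Suc m) \<phi> x"
    proof -
      have "euler (\<lambda>x. of_real x ^ k) x = of_nat k * of_real x ^ k"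
        using nderiv_of_real_power[of 1 k x] by (cases k) (auto simp: euler_def)
      then show ?thesis
        by (subst euler_mult[OF open_UNIV smooth_on_power[OF open_UNIV smooth_on_of_real[OF open_UNIV]] smooth_on_euler[OF open_UNIV \<phi>]]) auto
    qed
    ultimately have "of_real x ^ k * (euler ^^ Suc m) \<phi> x = (\<Sum>i\<le>m. c i * (S (Suc i) \<phi> x - (of_nat i + 1) * S i \<phi> x)) - of_nat k * (\<Sum>i\<le>m. c i * S i \<phi> x)"
      by (simp add: eS c[OF \<phi>] algebra_simps)
    also have "\<dots> = (\<Sum>i\<le>m. c i * S (Suc i) \<phi> x) - (\<Sum>i\<le>m. (of_nat i + of_nat k + 1) * c i * S i \<phi> x)"
      by (simp add: algebra_simps sum.distrib sum_subtractf sum_distrib_left)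
    also have "(\<Sum>i\<le>m. c i * S (Suc i) \<phi> x) = (\<Sum>i\<le>Suc m. (if i = 0 then 0 else c (i - 1)) * S i \<phi> x)"
      by (subst sum.atMost_Suc_shift) simp
    also have "(\<Sum>i\<le>m. (of_nat i + of_nat k + 1) * c i * S i \<phi> x) = (\<Sum>i\<le>Suc m. (if i \<le> m then (of_nat i + of_nat k + 1) * c i else 0) * S i \<phi> x)"
      by simp
    finally show ?thesis unfolding c'_def by (simp add: algebra_simps sum_subtractf del: sum.atMost_Suc funpow.simps)
  qed
  then show ?case unfolding S_def by blast
qed

text \<open>Each summand becomes a presentation with the single smooth factor x^k, the tangential
  operator x^i (d/dx)^i and a bounded density.\<close>

lemma normal_form_imp_presentation:
  assumes r: "r > 0" and nf: "normal_form k {-r<..<r} \<rho>"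
  shows "vanishing_presentation {-r<..<r} 0 k \<rho>"
proof -
  let ?U = "{-r<..<r}"
  obtain L where L: "admissible L"
    "\<forall>\<phi>\<in>test_fun ?U. \<rho> \<phi> = (\<Sum>(g, m)\<leftarrow>L. LINT x|lebesgue. g x * (of_real x ^ k * (euler ^^ m) \<phi> x))"
    using nf by (auto simp: normal_form_def)
  have "vanishing_presentation ?U 0 k (\<lambda>\<phi>. \<Sum>(g, m)\<leftarrow>L. LINT x|lebesgue. g x * (of_real x ^ k * (euler ^^ m) \<phi> x))"
  proof (rule presentation_sum_list)
    fix a assume a: "a \<in> set L"
    obtain g m where gm: "a = (g, m)" by force
    obtain C where g: "g \<in> borel_measurable lebesgue" "\<And>x. norm (g x) \<le> C"
      using L(1) a gm unfolding admissible_def by blast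
    obtain c where c: "\<And>\<phi> x. smooth_on UNIV \<phi> \<Longrightarrow>
       of_real x ^ k * (euler ^^ m) \<phi> x = (\<Sum>i\<le>m. c i * nderiv i (\<lambda>x. of_real x ^ i * (of_real x ^ k * \<phi> x)) x)"
      using power_euler_eq_nderiv[of k m] by blast
    have "vanishing_presentation ?U 0 k (\<lambda>\<phi>. \<Sum>i\<le>m. LINT x|lebesgue. (c i * g x) * nderiv i (\<lambda>x. of_real x ^ i * (of_real x ^ k * \<phi> x)) x)"
    proof (rule presentation_sum)
      fix i
      define D where "D = replicate i (\<lambda>x. 0) @ [\<lambda>x. complex_of_real x ^ i]"
      \<comment> \<open>The sign cancels the one from moving i derivatives onto the test
        function.\<close>
      define h where "h x = (-1) ^ i * (c i * g x)" for x
      show "vanishing_presentation ?U 0 k (\<lambda>\<phi>. LINT x|lebesgue. (c i * g x) * nderiv i (\<lambda>x. of_real x ^ i * (of_real x ^ k * \<phi> x)) x)"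
      proof (rule presentationI[where N = 1 and f = "\<lambda>_ x. of_real x ^ k" and D = "\<lambda>_. D" and h = "\<lambda>_. h"], intro conjI)
        show "smooth_on ?U (\<lambda>x. of_real x ^ k)" by (intro smooth_on_power smooth_on_of_real) auto
        show "fun_vanishes_to_order 0 k (\<lambda>x. of_real x ^ k)" by (rule fun_vanishes_power)
        show "tangential_diffop ?U 0 D" unfolding D_def by (rule tangential_monomial) (use r in auto)
        show "h \<in> Linf_loc ?U" unfolding Linf_loc_def
        proof (intro CollectI conjI allI impI)
          have "h \<in> borel_measurable lebesgue" unfolding h_def using g(1) by measurable
          then show "h \<in> borel_measurable (lebesgue_on ?U)" by (rule measurable_restrict_space1)
          show "\<exists>C. AE x in lebesgue_on K. norm (h x) \<le> C" for K
            using g(2) by (intro exI[of _ "norm (c i) * C"] AE_I2) (auto simp: h_def norm_mult norm_power intro: mult_left_mono)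
        qed
      next
        fix \<phi> assume \<phi>: "\<phi> \<in> test_fun ?U"
        show "(LINT x|lebesgue. (c i * g x) * nderiv i (\<lambda>x. of_real x ^ i * (of_real x ^ k * \<phi> x)) x) =
            (\<Sum>j<(1::nat). dist_mult (\<lambda>x. of_real x ^ k) (diffop_dist D (dist_of_fun ?U h)) \<phi>)"
        proof -
        have sm: "smooth_on ?U (\<lambda>x. of_real x ^ j)" for j by (intro smooth_on_power smooth_on_of_real) auto
        define F where "F = nderiv i (\<lambda>x. of_real x ^ i * (of_real x ^ k * \<phi> x))"
        have F: "F \<in> test_fun ?U" unfolding F_def
          by (intro nderiv_test_fun test_fun_mult sm \<phi>) auto
        have z: "nderiv j (\<lambda>x. 0) = (\<lambda>x. 0 :: complex)" for j
          using nderiv_const[OF open_UNIV UNIV_I, of j 0] by auto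
        have "dist_mult (\<lambda>x. of_real x ^ k) (diffop_dist D (dist_of_fun ?U h)) \<phi> =
            (\<Sum>j<Suc i. (-1) ^ j * dist_of_fun ?U h (nderiv j (\<lambda>x. (D ! j) x * (of_real x ^ k * \<phi> x))))"
          by (simp add: dist_mult_def diffop_dist_def dist_deriv_funpow D_def)
        also have "\<dots> = (-1) ^ i * dist_of_fun ?U h F"
          by (simp add: D_def nth_append z F_def) (simp add: dist_of_fun_def)
        also have "dist_of_fun ?U h F = (LINT x|lebesgue. indicator ?U x *\<^sub>R (h x * F x))"
          unfolding dist_of_fun_def by (subst integral_restrict_space) auto
        also have "(\<lambda>x. indicator ?U x *\<^sub>R (h x * F x)) = (\<lambda>x. (-1) ^ i * ((c i * g x) * F x))"
          using F by (elim test_funE) (auto simp: indicator_def h_def subset_iff fun_eq_iff)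
        also have "(-1) ^ i * (LINT x|lebesgue. (-1) ^ i * ((c i * g x) * F x)) = (LINT x|lebesgue. (c i * g x) * F x)"
          by (simp only: integral_mult_right_zero left_minus_one_mult_self)
        finally show ?thesis
          by (simp add: F_def lessThan_Suc del: sum_constant)
        qed
      qed
    qed
    then show "vanishing_presentation ?U 0 k (\<lambda>\<phi>. (case a of (g, m) \<Rightarrow> LINT x|lebesgue. g x * (of_real x ^ k * (euler ^^ m) \<phi> x)))"
    proof (rule presentation_cong[rotated])
      fix \<phi> assume \<phi>: "\<phi> \<in> test_fun ?U"
      have "integrable lebesgue (\<lambda>x. (c i * g x) * nderiv i (\<lambda>x. of_real x ^ i * (of_real x ^ k * \<phi> x)) x)" for i
      proof (rule integrable_mult_test_fun)
        show "(\<lambda>x. c i * g x) \<in> borel_measurable lebesgue" using g(1) by measurable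
        show "norm (c i * g x) \<le> norm (c i) * C" for x using g(2) by (simp add: norm_mult mult_left_mono)
        show "nderiv i (\<lambda>x. of_real x ^ i * (of_real x ^ k * \<phi> x)) \<in> test_fun ?U"
          by (intro nderiv_test_fun test_fun_mult smooth_on_power smooth_on_of_real \<phi>) auto
      qed
      then show "(\<Sum>i\<le>m. LINT x|lebesgue. (c i * g x) * nderiv i (\<lambda>x. of_real x ^ i * (of_real x ^ k * \<phi> x)) x) =
          (case a of (g, m) \<Rightarrow> LINT x|lebesgue. g x * (of_real x ^ k * (euler ^^ m) \<phi> x))"
        unfolding gm prod.case c[OF test_fun_smooth[OF \<phi>]]
        by (subst Bochner_Integration.integral_sum[symmetric]) (auto simp: sum_distrib_left mult_ac)
    qed
  qed
  then show ?thesis using L(2) by (elim presentation_cong[rotated]) (simp add: case_prod_unfold)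
qed

section \<open>Orders of vanishing expressed by normal forms\<close>

lemma vanishes_to_order_int:
  "vanishes_to_order p (int k) \<sigma> \<longleftrightarrow> (\<exists>U. open U \<and> p \<in> U \<and> vanishing_presentation U p k \<sigma>)"
  unfolding vanishes_to_order_def by (simp only: of_nat_0_le_iff if_True nat_int)

lemma vanishes_to_order_iff:
  "vanishes_to_order 0 (int k) \<sigma> \<longleftrightarrow> (\<exists>r>0. r < 1 \<and> normal_form k {-r<..<r} \<sigma>)"
proof
  assume "vanishes_to_order 0 (int k) \<sigma>"
  then obtain U where "open U" "0 \<in> U" "vanishing_presentation U 0 k \<sigma>"
    unfolding vanishes_to_order_int by (elim exE conjE) (rule that)
  then show "\<exists>r>0. r < 1 \<and> normal_form k {-r<..<r} \<sigma>" by (rule presentation_imp_normal_form)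
next
  assume "\<exists>r>0. r < 1 \<and> normal_form k {-r<..<r} \<sigma>"
  then obtain r where r: "r > 0" "normal_form k {-r<..<r} \<sigma>" by blast
  then show "vanishes_to_order 0 (int k) \<sigma>"
    unfolding vanishes_to_order_int
    using normal_form_imp_presentation[OF r] by (intro exI[of _ "{-r<..<r}"]) simp
qed

text \<open>The coordinate itself serves as \<open>z\<close>, and its power is absorbed into the
  smooth factors \<open>f j\<close> of a presentation of order 0.\<close>

lemma vanishes_to_negative_order:
  assumes "vanishes_to_order 0 0 \<sigma>" "k < 0"
  shows "vanishes_to_order 0 k \<sigma>"
proof -
  obtain U where U: "open U" "0 \<in> U" "vanishing_presentation U 0 0 \<sigma>"
    using iffD1[OF vanishes_to_order_int[of 0 0 \<sigma>, unfolded of_nat_0] assms(1)] by (elim exE conjE) (rule that)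
  obtain N :: nat and f D h where
    P: "\<forall>j<N. smooth_on U (f j) \<and> fun_vanishes_to_order 0 0 (f j) \<and>
               tangential_diffop U 0 (D j) \<and> h j \<in> Linf_loc U"
    and eq: "\<forall>\<phi>\<in>test_fun U. \<sigma> \<phi> = (\<Sum>j<N. dist_mult (f j) (diffop_dist (D j) (dist_of_fun U (h j))) \<phi>)"
    using U(3) by (rule presentationE)
  note P = P[rule_format]
  define q where "q x = complex_of_real x ^ nat (- k)" for x
  have q: "smooth_on U q" unfolding q_def by (intro smooth_on_power smooth_on_of_real U)
  have "vanishing_presentation U 0 0 (dist_mult q \<sigma>)"
  proof (rule presentationI[where N = N and f = "\<lambda>j x. f j x * q x" and D = D and h = h])
    fix \<phi> assume "\<phi> \<in> test_fun U"
    then have "(\<lambda>x. q x * \<phi> x) \<in> test_fun U" by (rule test_fun_mult[OF U(1) q])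
    then show "dist_mult q \<sigma> \<phi> = (\<Sum>j<N. dist_mult (\<lambda>x. f j x * q x) (diffop_dist (D j) (dist_of_fun U (h j))) \<phi>)"
      using eq by (simp add: dist_mult_def mult.assoc)
  qed (use P q U in \<open>simp add: smooth_on_mult fun_vanishes_to_order_def\<close>)
  moreover have "smooth_on U of_real" "nderiv 1 complex_of_real 0 \<noteq> 0"
    using smooth_on_of_real[OF U(1)] nderiv_of_real_power[where n = 1 and m = 1 and x = 0] by auto
  ultimately show ?thesis using U assms(2) unfolding vanishes_to_order_def q_def
    by (intro exI[of _ U]) (simp, rule exI[of _ complex_of_real], simp)
qed

lemma vanishes_to_infinite_order_iff:
  "vanishes_to_infinite_order 0 \<sigma> \<longleftrightarrow> (\<forall>k. \<exists>r>0. r < 1 \<and> normal_form k {-r<..<r} \<sigma>)"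
proof -
  have "vanishes_to_order 0 k \<sigma>" if "\<forall>k. vanishes_to_order 0 (int k) \<sigma>" for k
  proof (cases "k \<ge> 0")
    case True then show ?thesis using that by (metis nonneg_int_cases)
  next
    case False
    then show ?thesis using that[rule_format, of 0] vanishes_to_negative_order by simp
  qed
  then show ?thesis unfolding vanishes_to_infinite_order_def vanishes_to_order_iff[symmetric]
    by (intro iffI allI) simp_all
qed

section \<open>Extension to functions of moderate growth\<close>

lemma ebound_nonneg:
  assumes "ebound N (wt K) f B" shows "B \<ge> 0"
proof -
  have "norm ((euler ^^ 0) f 1) \<le> B * wt K 1"
    by (rule assms[unfolded ebound_def, rule_format]) auto
  from order_trans[OF norm_ge_zero this] show ?thesis by (simp add: wt_def)
qed

lemma ebound_wt_mono:
  assumes "ebound N (wt K) f B" "K \<le> L" "M \<le> N"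
  shows "ebound M (wt L) f B"
  using assms(1,3) by (rule ebound_mono) (rule mult_left_mono[OF wt_mono[OF assms(2)] ebound_nonneg[OF assms(1)]])

definition moderate :: "real \<Rightarrow> (real \<Rightarrow> complex) \<Rightarrow> bool" where
  "moderate K f \<longleftrightarrow> smooth_on (- {0}) f \<and> (\<forall>N. \<exists>B. ebound N (wt K) f B)"

lemma moderate_smooth: "moderate K f \<Longrightarrow> smooth_on (- {0}) f"
  by (simp add: moderate_def)

lemma moderateE:
  assumes "moderate K f" obtains B where "ebound N (wt K) f B"
  using assms by (auto simp: moderate_def)

lemma moderateI:
  assumes "smooth_on (- {0}) f" "\<And>N. ebound N (wt K) f (B N)"
  shows "moderate K f"
  using assms by (auto simp: moderate_def)

lemma moderate_mono: "moderate K f \<Longrightarrow> K \<le> L \<Longrightarrow> moderate L f"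
  unfolding moderate_def using ebound_wt_mono[OF _ _ order_refl] by blast

lemma moderate_cong: "moderate K f \<Longrightarrow> (\<And>x. x \<noteq> 0 \<Longrightarrow> f x = g x) \<Longrightarrow> moderate K g"
proof -
  assume f: "moderate K f" and eq: "\<And>x. x \<noteq> 0 \<Longrightarrow> f x = g x"
  have "smooth_on (- {0}) g" by (rule smooth_on_cong[OF open_nonzero _ moderate_smooth[OF f]]) (use eq in auto)
  moreover have "\<exists>B. ebound N (wt K) g B" for N
  proof -
    obtain B where "ebound N (wt K) f B" using f by (rule moderateE)
    from ebound_cong[OF eq this] show ?thesis by (rule exI)
  qed
  ultimately show ?thesis by (simp add: moderate_def)
qed

lemma moderate_add:
  assumes "moderate K f" "moderate K g"
  shows "moderate K (\<lambda>x. f x + g x)"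
  unfolding moderate_def
proof (intro conjI allI)
  show "smooth_on (- {0}) (\<lambda>x. f x + g x)"
    by (intro smooth_on_add open_nonzero moderate_smooth[OF assms(1)] moderate_smooth[OF assms(2)])
  fix N
  obtain B where B: "ebound N (wt K) f B" using assms(1) by (rule moderateE)
  obtain C where C: "ebound N (wt K) g C" using assms(2) by (rule moderateE)
  show "\<exists>B. ebound N (wt K) (\<lambda>x. f x + g x) B"
    using ebound_add[OF moderate_smooth[OF assms(1)] moderate_smooth[OF assms(2)] B C] by (rule exI)
qed

lemma moderate_cmult:
  assumes "moderate K f"
  shows "moderate K (\<lambda>x. c * f x)"
  unfolding moderate_def
proof (intro conjI allI)
  show "smooth_on (- {0}) (\<lambda>x. c * f x)"
    by (intro smooth_on_cmult open_nonzero moderate_smooth[OF assms(1)])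
  fix N
  obtain B where B: "ebound N (wt K) f B" using assms(1) by (rule moderateE)
  show "\<exists>B. ebound N (wt K) (\<lambda>x. c * f x) B"
    using ebound_cmult[OF moderate_smooth[OF assms(1)] B] by (rule exI)
qed

lemma ebound_wt_mult:
  assumes "smooth_on (- {0}) f" "smooth_on (- {0}) g" "ebound N (wt K) f B" "ebound N (wt L) g C"
  shows "ebound N (wt (K + L)) (\<lambda>x. f x * g x) (2 ^ N * (B * C))"
  using ebound_mult[OF assms] by (simp add: wt_add[abs_def])

lemma moderate_mult:
  assumes "moderate K f" "moderate L g"
  shows "moderate (K + L) (\<lambda>x. f x * g x)"
  unfolding moderate_def
proof (intro conjI allI)
  show "smooth_on (- {0}) (\<lambda>x. f x * g x)"
    by (intro smooth_on_mult open_nonzero moderate_smooth[OF assms(1)] moderate_smooth[OF assms(2)])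
  fix N
  obtain B where B: "ebound N (wt K) f B" using assms(1) by (rule moderateE)
  obtain C where C: "ebound N (wt L) g C" using assms(2) by (rule moderateE)
  show "\<exists>B. ebound N (wt (K + L)) (\<lambda>x. f x * g x) B"
    using ebound_wt_mult[OF moderate_smooth[OF assms(1)] moderate_smooth[OF assms(2)] B C] by (rule exI)
qed

lemma moderate_signed_power: "moderate \<bar>Re s\<bar> (signed_power d s)"
  by (rule moderateI[OF smooth_on_signed_power ebound_signed_power])

lemma moderate_const: "moderate 0 (\<lambda>x. c)"
proof -
  have "moderate 0 (\<lambda>x. c * signed_power 0 0 x)"
    using moderate_cmult[OF moderate_signed_power[of 0 0]] by simp
  then show ?thesis by (rule moderate_cong) (simp add: signed_power_def)
qed

lemma moderate_test_fun:
  assumes "f \<in> test_fun A"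
  shows "moderate 0 f"
  unfolding moderate_def
proof (intro conjI allI)
  show "smooth_on (- {0}) f" using test_fun_smooth[OF assms] by (rule smooth_on_subset) auto
  fix N
  have "bounded (range ((euler ^^ j) f))" for j
    using test_fun_bounded[OF euler_test_fun[OF assms], of 0 j] by simp
  then have "\<forall>j. \<exists>B. \<forall>x. norm ((euler ^^ j) f x) \<le> B" by (simp add: bounded_iff)
  then obtain B where B: "\<And>j x. norm ((euler ^^ j) f x) \<le> B j" by metis
  have pos: "0 \<le> B j" for j using B[of j 0] norm_ge_zero order_trans by blast
  have "norm ((euler ^^ j) f x) \<le> (\<Sum>j\<le>N. B j)" if "j \<le> N" for j x
    by (rule order_trans[OF B[of j x]], rule member_le_sum) (use that pos in auto)
  then show "\<exists>B. ebound N (wt 0) f B" unfolding ebound_def by (intro exI[of _ "\<Sum>j\<le>N. B j"]) simp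
qed

text \<open>The difference is locally zero where |ln |x|| < n + 1, and elsewhere exp(-n) times the
  weight of exponent 1 is at least 1. One unit of weight thus buys the factor exp(-n).\<close>

lemma ebound_annulus_tail:
  "\<exists>B\<ge>0. \<forall>n. ebound N (\<lambda>x. exp (- real n) * wt 1 x) (\<lambda>x. annulus_cutoff n x - 1) B"
proof -
  obtain B where B: "B \<ge> 0" "\<And>n. ebound N (\<lambda>x. 1) (annulus_cutoff n) B"
    using ebound_annulus_cutoff[of N] by blast
  obtain C where C: "ebound N (wt 0) (\<lambda>x. -1) C" using moderate_const by (rule moderateE)
  have C0: "C \<ge> 0" using ebound_nonneg[OF C] .
  have sm: "smooth_on (- {0}) (annulus_cutoff n)" "smooth_on (- {0}) (\<lambda>x. -1)" for n
    using smooth_on_subset[OF smooth_on_annulus_cutoff] smooth_on_const[OF open_nonzero] by auto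
  have BC: "ebound N (\<lambda>x. 1) (\<lambda>x. annulus_cutoff n x + (-1)) (B + C)" for n
    by (rule ebound_add[OF sm B(2)]) (use C in \<open>simp add: wt_def[abs_def]\<close>)
  have "ebound N (\<lambda>x. exp (- real n) * wt 1 x) (\<lambda>x. annulus_cutoff n x - 1) (B + C)" for n
    unfolding ebound_def
  proof (intro allI impI)
    fix j and x :: real assume j: "j \<le> N" and x: "x \<noteq> 0"
    show "norm ((euler ^^ j) (\<lambda>x. annulus_cutoff n x - 1) x) \<le> (B + C) * (exp (- real n) * wt 1 x)"
    proof (cases "\<bar>ln \<bar>x\<bar>\<bar> < real n + 1")
      case True
      let ?U = "{y :: real. exp (- (real n + 1)) < \<bar>y\<bar> \<and> \<bar>y\<bar> < exp (real n + 1)}"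
      have "open ?U" by (intro open_Collect_conj open_Collect_less continuous_intros)
      moreover have "annulus_cutoff n y - 1 = 0" if "y \<in> ?U" for y
      proof -
        have "\<bar>y\<bar> > 0" using that order.strict_trans[OF exp_gt_zero, of "- (real n + 1)" "\<bar>y\<bar>"] by blast
        then have "- (real n + 1) < ln \<bar>y\<bar>" "ln \<bar>y\<bar> < real n + 1"
          using that by (metis (no_types, lifting) exp_less_cancel_iff exp_ln mem_Collect_eq)+
        then show ?thesis using \<open>\<bar>y\<bar> > 0\<close> annulus_cutoff_1[of y n] by simp
      qed
      moreover have "x \<in> ?U"
      proof -
        have "exp (- (real n + 1)) < exp (ln \<bar>x\<bar>)" "exp (ln \<bar>x\<bar>) < exp (real n + 1)" using True by auto
        then show ?thesis using x by simp
      qed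
      ultimately have "(euler ^^ j) (\<lambda>x. annulus_cutoff n x - 1) x = (euler ^^ j) (\<lambda>x. 0) x"
        by (rule euler_cong)
      also have "\<dots> = 0" by (rule euler_zero_outside[of "{}"]) auto
      finally show ?thesis using B C0 by simp
    next
      case False
      have "norm ((euler ^^ j) (\<lambda>x. annulus_cutoff n x - 1) x) \<le> (B + C) * 1"
        using BC[of n] j x by (auto simp: ebound_def)
      also have "\<dots> \<le> (B + C) * (exp (- real n) * wt 1 x)"
        using False B C0 by (intro mult_left_mono) (auto simp: wt_def exp_add[symmetric])
      finally show ?thesis .
    qed
  qed
  then show ?thesis using B C0 by (intro exI[of _ "B + C"]) simp
qed

section \<open>Extension of weight-bounded functionals by exhaustion\<close>

text \<open>Continuity in a weighted seminorm. A larger exponent is the stronger property, since it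
  controls functions that grow faster.\<close>

definition weight_bounded :: "real \<Rightarrow> functional \<Rightarrow> bool" where
  "weight_bounded K \<rho> \<longleftrightarrow> (\<exists>C N. C \<ge> 0 \<and>
     (\<forall>f\<in>test_fun (- {0}). \<forall>B. ebound N (wt K) f B \<longrightarrow> norm (\<rho> f) \<le> C * B))"

lemma weight_boundedE:
  assumes "weight_bounded K \<rho>"
  obtains C N where "C \<ge> 0" "\<forall>f\<in>test_fun (- {0}). \<forall>B. ebound N (wt K) f B \<longrightarrow> norm (\<rho> f) \<le> C * B"
  using assms unfolding weight_bounded_def by (elim exE conjE) (rule that)

lemma weight_bounded_mono: "weight_bounded L \<rho> \<Longrightarrow> K \<le> L \<Longrightarrow> weight_bounded K \<rho>"
  unfolding weight_bounded_def using ebound_wt_mono[OF _ _ order_refl] by blast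

abbreviation linear_off_0 :: "functional \<Rightarrow> bool" where
  "linear_off_0 \<equiv> linear_functional_on (test_fun (- {0}))"

lemma linear_functional_add: "linear_functional_on V L \<Longrightarrow> f \<in> V \<Longrightarrow> g \<in> V \<Longrightarrow> L (\<lambda>x. f x + g x) = L f + L g"
  and linear_functional_cmult: "linear_functional_on V L \<Longrightarrow> f \<in> V \<Longrightarrow> L (\<lambda>x. c * f x) = c * L f"
  by (auto simp: linear_functional_on_def)

text \<open>The value of \<open>\<rho>\<close> at a function of moderate growth at \<open>0\<close> and \<open>\<infinity>\<close>, by exhaustion.\<close>

definition moderate_extension :: "functional \<Rightarrow> functional" where
  "moderate_extension \<rho> f = lim (\<lambda>n. \<rho> (\<lambda>x. annulus_cutoff n x * f x))"

text \<open>Functional and function differ by one unit of weight: two cutoffs from index M on differ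
  by a multiple of exp(-M) in weight 1, so the values form a Cauchy sequence.\<close>

lemma moderate_extension_lim:
  assumes "linear_off_0 \<rho>" "weight_bounded (K + 1) \<rho>" "moderate K f"
  shows "(\<lambda>n. \<rho> (\<lambda>x. annulus_cutoff n x * f x)) \<longlonglongrightarrow> moderate_extension \<rho> f"
proof -
  obtain C N where CN: "C \<ge> 0" "\<forall>f\<in>test_fun (- {0}). \<forall>B. ebound N (wt (K + 1)) f B \<longrightarrow> norm (\<rho> f) \<le> C * B"
    using assms(2) by (rule weight_boundedE)
  note CN = CN(1) CN(2)[rule_format]
  obtain B where B: "ebound N (wt K) f B" using assms(3) by (rule moderateE)
  obtain T where T: "T \<ge> 0" "\<And>n. ebound N (\<lambda>x. exp (- real n) * wt 1 x) (\<lambda>x. annulus_cutoff n x - 1) T"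
    using ebound_annulus_tail[of N] by blast
  note sf = moderate_smooth[OF assms(3)]
  have sm: "smooth_on (- {0}) (annulus_cutoff n)" for n
    using smooth_on_subset[OF smooth_on_annulus_cutoff] by auto
  define D where "D = 2 ^ N * (B * (2 * T))"
  have "B \<ge> 0" using B by (rule ebound_nonneg)
  have est: "norm (\<rho> (\<lambda>x. annulus_cutoff n x * f x) - \<rho> (\<lambda>x. annulus_cutoff m x * f x)) \<le> C * D * exp (- real M)"
    if "n \<ge> M" "m \<ge> M" for n m M
  proof -
    have mono: "ebound N (\<lambda>x. exp (- real M) * wt 1 x) (\<lambda>x. annulus_cutoff k x - 1) T" if "k \<ge> M" for k
      by (rule ebound_mono[OF T(2)]) (use that T(1) in \<open>auto intro!: mult_left_mono mult_right_mono\<close>)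
    have sm1: "smooth_on (- {0}) (\<lambda>x. annulus_cutoff k x + (-1))" for k
      by (intro smooth_on_add sm smooth_on_const open_nonzero)
    have "ebound N (\<lambda>x. exp (- real M) * wt 1 x) (\<lambda>x. (annulus_cutoff n x - 1) + (-1) * (annulus_cutoff m x - 1)) (T + norm (-1 :: complex) * T)"
      using sm1 by (intro ebound_add ebound_cmult mono that smooth_on_cmult open_nonzero) simp_all
    then have "ebound N (\<lambda>x. exp (- real M) * wt 1 x) (\<lambda>x. annulus_cutoff n x - annulus_cutoff m x) (2 * T)"
      by simp
    from ebound_mult[OF sf _ B this] have "ebound N (\<lambda>x. wt K x * (exp (- real M) * wt 1 x)) (\<lambda>x. f x * (annulus_cutoff n x - annulus_cutoff m x)) D"
      using smooth_on_add[OF open_nonzero sm smooth_on_cmult[OF open_nonzero sm, of "-1"]] by (simp add: D_def)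
    then have "ebound N (wt (K + 1)) (\<lambda>x. f x * (annulus_cutoff n x - annulus_cutoff m x)) (D * exp (- real M))"
      by (rule ebound_mono) (simp_all add: wt_add mult_ac)
    moreover have "(\<lambda>x. f x * (annulus_cutoff n x - annulus_cutoff m x)) =
        (\<lambda>x. annulus_cutoff n x * f x + (-1) * (annulus_cutoff m x * f x))"
      by (simp add: algebra_simps)
    moreover have "(\<lambda>x. annulus_cutoff n x * f x + (-1) * (annulus_cutoff m x * f x)) \<in> test_fun (- {0})"
      by (intro test_fun_add test_fun_cmult annulus_cutoff_mult_test_fun sf)
    ultimately have "norm (\<rho> (\<lambda>x. annulus_cutoff n x * f x + (-1) * (annulus_cutoff m x * f x))) \<le> C * (D * exp (- real M))"
      using CN(2) by simp
    then show ?thesis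
      using linear_functional_add[OF assms(1) annulus_cutoff_mult_test_fun[OF sf] test_fun_cmult[OF annulus_cutoff_mult_test_fun[OF sf]], of n "-1" m]
        linear_functional_cmult[OF assms(1) annulus_cutoff_mult_test_fun[OF sf], of "-1" m]
      by (simp add: mult.assoc)
  qed
  have "Cauchy (\<lambda>n. \<rho> (\<lambda>x. annulus_cutoff n x * f x))"
  proof (rule CauchyI)
    fix e :: real assume "e > 0"
    have "(\<lambda>n. C * D * exp (- real n)) \<longlonglongrightarrow> C * D * 0"
      by (intro tendsto_intros filterlim_compose[OF exp_at_bot] filterlim_compose[OF filterlim_uminus_at_bot_at_top] filterlim_real_sequentially)
    then have "\<forall>\<^sub>F n in sequentially. C * D * exp (- real n) < e"
      using \<open>e > 0\<close> by (intro order_tendstoD(2)) auto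
    then obtain M where "C * D * exp (- real M) < e" by (auto simp: eventually_sequentially)
    then show "\<exists>M. \<forall>m\<ge>M. \<forall>n\<ge>M. norm (\<rho> (\<lambda>x. annulus_cutoff m x * f x) - \<rho> (\<lambda>x. annulus_cutoff n x * f x)) < e"
      using est by (meson le_less_trans)
  qed
  then show ?thesis unfolding moderate_extension_def
    by (simp add: Cauchy_convergent_iff convergent_LIMSEQ_iff)
qed

text \<open>Annulus cutoffs vanish at 0, so the conventional values of signed powers and inversions
  at that point never matter.\<close>

lemma moderate_extension_cong:
  assumes "\<And>x. x \<noteq> 0 \<Longrightarrow> f x = g x"
  shows "moderate_extension \<rho> f = moderate_extension \<rho> g"
proof -
  have "(\<lambda>x. annulus_cutoff n x * f x) = (\<lambda>x. annulus_cutoff n x * g x)" for n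
    using assms by (auto simp: fun_eq_iff annulus_cutoff_def)
  then show ?thesis by (simp add: moderate_extension_def)
qed

lemma moderate_extension_test_fun:
  assumes "f \<in> test_fun (- {0})"
  shows "moderate_extension \<rho> f = \<rho> f"
  unfolding moderate_extension_def
  by (rule limI, rule tendsto_eventually) (use annulus_cutoff_mult_eventually[OF assms] in \<open>rule eventually_mono, simp\<close>)

lemma moderate_extension_add:
  assumes "linear_off_0 \<rho>" "weight_bounded (K + 1) \<rho>" "moderate K f" "moderate K g"
  shows "moderate_extension \<rho> (\<lambda>x. f x + g x) = moderate_extension \<rho> f + moderate_extension \<rho> g"
proof -
  have "(\<lambda>n. \<rho> (\<lambda>x. annulus_cutoff n x * f x) + \<rho> (\<lambda>x. annulus_cutoff n x * g x)) \<longlonglongrightarrow> moderate_extension \<rho> f + moderate_extension \<rho> g"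
    by (intro tendsto_add moderate_extension_lim[OF assms(1,2)] assms)
  moreover have "\<rho> (\<lambda>x. annulus_cutoff n x * f x) + \<rho> (\<lambda>x. annulus_cutoff n x * g x) = \<rho> (\<lambda>x. annulus_cutoff n x * (f x + g x))" for n
    using linear_functional_add[OF assms(1) annulus_cutoff_mult_test_fun[OF moderate_smooth[OF assms(3)]] annulus_cutoff_mult_test_fun[OF moderate_smooth[OF assms(4)]]]
    by (simp add: distrib_left)
  ultimately show ?thesis
    using moderate_extension_lim[OF assms(1,2) moderate_add[OF assms(3,4)]] LIMSEQ_unique by simp
qed

lemma moderate_extension_cmult:
  assumes "linear_off_0 \<rho>" "weight_bounded (K + 1) \<rho>" "moderate K f"
  shows "moderate_extension \<rho> (\<lambda>x. c * f x) = c * moderate_extension \<rho> f"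
proof -
  have "(\<lambda>n. c * \<rho> (\<lambda>x. annulus_cutoff n x * f x)) \<longlonglongrightarrow> c * moderate_extension \<rho> f"
    by (intro tendsto_mult_left moderate_extension_lim[OF assms(1,2)] assms)
  moreover have "c * \<rho> (\<lambda>x. annulus_cutoff n x * f x) = \<rho> (\<lambda>x. annulus_cutoff n x * (c * f x))" for n
    using linear_functional_cmult[OF assms(1) annulus_cutoff_mult_test_fun[OF moderate_smooth[OF assms(3)]]]
    by (simp add: mult.left_commute)
  ultimately show ?thesis
    using moderate_extension_lim[OF assms(1,2) moderate_cmult[OF assms(3)], of c] LIMSEQ_unique by simp
qed

lemma moderate_extension_bound:
  assumes "linear_off_0 \<rho>" "weight_bounded (K + 1) \<rho>"
  shows "\<exists>C N. C \<ge> 0 \<and> (\<forall>f B. moderate K f \<longrightarrow> ebound N (wt K) f B \<longrightarrow> norm (moderate_extension \<rho> f) \<le> C * B)"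
proof -
  obtain C N where CN: "C \<ge> 0" "\<forall>f\<in>test_fun (- {0}). \<forall>B. ebound N (wt (K + 1)) f B \<longrightarrow> norm (\<rho> f) \<le> C * B"
    using assms(2) by (rule weight_boundedE)
  note CN = CN(1) CN(2)[rule_format]
  obtain A where A: "A \<ge> 0" "\<And>n. ebound N (\<lambda>x. 1) (annulus_cutoff n) A"
    using ebound_annulus_cutoff[of N] by blast
  have "norm (moderate_extension \<rho> f) \<le> C * (2 ^ N * A) * B" if f: "moderate K f" "ebound N (wt K) f B" for f B
  proof (rule LIMSEQ_le_const2[OF tendsto_norm[OF moderate_extension_lim[OF assms f(1)]]], intro exI allI impI)
    fix n
    have "smooth_on (- {0}) (annulus_cutoff n)" using smooth_on_annulus_cutoff by (rule smooth_on_subset) auto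
    from ebound_mult[OF this moderate_smooth[OF f(1)] A(2) f(2)]
    have "ebound N (wt K) (\<lambda>x. annulus_cutoff n x * f x) (2 ^ N * (A * B))" by simp
    then have "ebound N (wt (K + 1)) (\<lambda>x. annulus_cutoff n x * f x) (2 ^ N * (A * B))"
      by (rule ebound_wt_mono) auto
    from CN(2)[OF annulus_cutoff_mult_test_fun[OF moderate_smooth[OF f(1)]] this]
    show "norm (\<rho> (\<lambda>x. annulus_cutoff n x * f x)) \<le> C * (2 ^ N * A) * B" by (simp add: mult_ac)
  qed
  then show ?thesis using CN(1) A(1) by (intro exI[of _ "C * (2 ^ N * A)"] exI[of _ N]) simp
qed

section \<open>Holomorphic dependence on the exponent\<close>

text \<open>This is the second-order remainder of |x|^h in h, with its Euler derivatives. For |h| <=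
  1 one factor exp |ln |x|| bounds the exponential and a second one the polynomial in ln |x|, hence
  the weight 2.\<close>

lemma moderate_exp_remainder:
  assumes "norm h \<le> 1"
  shows "smooth_on (- {0}) (\<lambda>x. exp (h * of_real (ln \<bar>x\<bar>)) - 1 - h * of_real (ln \<bar>x\<bar>))" (is ?S)
    and "ebound N (wt 2) (\<lambda>x. exp (h * of_real (ln \<bar>x\<bar>)) - 1 - h * of_real (ln \<bar>x\<bar>)) (2 * norm h ^ 2)" (is ?E)
proof -
  define F :: "nat \<Rightarrow> real \<Rightarrow> complex" where
    "F n v = h ^ n * exp (h * of_real v) - (if n = 0 then 1 + h * of_real v else if n = 1 then h else 0)" for n v
  have D: "(F n has_vector_derivative F (Suc n) x) (at x)" for n x
  proof -
    have "((\<lambda>v. h ^ n * exp (h * of_real v)) has_vector_derivative h ^ Suc n * exp (h * of_real x)) (at x)"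
      by (rule has_vector_derivative_eq_rhs[OF has_vector_derivative_real_field]) (auto intro!: derivative_eq_intros)
    moreover have "((\<lambda>v. if n = 0 then 1 + h * of_real v else if n = 1 then h else 0) has_vector_derivative
        (if Suc n = 0 then 1 + h * of_real x else if Suc n = 1 then h else 0)) (at x)"
      by (cases "n = 0") (auto intro!: has_vector_derivative_eq_rhs[OF has_vector_derivative_real_field] derivative_eq_intros)
    ultimately show ?thesis unfolding F_def[abs_def] by (rule has_vector_derivative_diff)
  qed
  have sm: "smooth_on UNIV (F 0)" and nd: "nderiv n (F 0) x = F n x" for n x
    using smooth_on_seqI[where F = F, OF open_UNIV _ D] by auto
  have eq: "(\<lambda>x. exp (h * of_real (ln \<bar>x\<bar>)) - 1 - h * of_real (ln \<bar>x\<bar>)) = (\<lambda>x. F 0 (ln \<bar>x\<bar>))"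
    by (simp add: F_def diff_diff_eq)
  show ?S unfolding eq by (rule smooth_on_ln_compose[OF sm])
  show ?E unfolding eq ebound_def
  proof (intro allI impI)
    fix j and x :: real assume "j \<le> N" and x: "x \<noteq> 0"
    let ?v = "ln \<bar>x\<bar>"
    let ?z = "h * of_real ?v"
    have z: "norm ?z = norm h * \<bar>?v\<bar>" "norm ?z \<le> \<bar>?v\<bar>"
      using assms by (auto simp: norm_mult mult_left_le_one_le)
    have re: "\<bar>Re ?z\<bar> \<le> \<bar>?v\<bar>" using abs_Re_le_cmod[of ?z] z by linarith
    have wt: "wt 2 x = exp \<bar>?v\<bar> * exp \<bar>?v\<bar>" by (simp add: wt_def exp_add[symmetric])
    have e1: "\<bar>?v\<bar> \<le> exp \<bar>?v\<bar>" using exp_ge_add_one_self[of "\<bar>?v\<bar>"] by linarith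
    have e2: "\<bar>?v\<bar> ^ 2 \<le> 2 * exp \<bar>?v\<bar>"
      using exp_lower_Taylor_quadratic[of "\<bar>?v\<bar>"] by simp
    have e3: "1 \<le> exp \<bar>?v\<bar>" by simp
    have "norm (F j ?v) \<le> 2 * norm h ^ 2 * (exp \<bar>?v\<bar> * exp \<bar>?v\<bar>)"
    proof -
      \<comment> \<open>The subtracted polynomial 1 + h v contributes to the function and its first
        derivative only. From the second derivative on, the factor h^j already supplies
        |h|^2.\<close>
      consider "j = 0" | "j = 1" | "j \<ge> 2" by linarith
      then show ?thesis
      proof cases
        case 1
        have "norm (exp ?z - (\<Sum>i\<le>1. ?z ^ i / fact i)) \<le> exp \<bar>Re ?z\<bar> * norm ?z ^ Suc 1 / fact 1" by (rule Taylor_exp)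
        then have "norm (F j ?v) \<le> exp \<bar>Re ?z\<bar> * (norm h ^ 2 * \<bar>?v\<bar> ^ 2)"
          using 1 by (simp add: F_def z(1) power_mult_distrib power2_eq_square diff_diff_eq mult_ac)
        also have "\<dots> \<le> exp \<bar>?v\<bar> * (norm h ^ 2 * (2 * exp \<bar>?v\<bar>))"
          by (intro mult_mono mult_left_mono e2) (use re in auto)
        finally show ?thesis by (simp add: mult_ac)
      next
        case 2
        have "norm (exp ?z - (\<Sum>i\<le>0. ?z ^ i / fact i)) \<le> exp \<bar>Re ?z\<bar> * norm ?z ^ Suc 0 / fact 0" by (rule Taylor_exp)
        then have "norm (exp ?z - 1) \<le> exp \<bar>Re ?z\<bar> * (norm h * \<bar>?v\<bar>)" by (simp add: z(1))
        also have "\<dots> \<le> exp \<bar>?v\<bar> * (norm h * exp \<bar>?v\<bar>)"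
          by (intro mult_mono mult_left_mono e1) (use re in auto)
        finally have "norm h * norm (exp ?z - 1) \<le> norm h * (exp \<bar>?v\<bar> * (norm h * exp \<bar>?v\<bar>))"
          by (intro mult_left_mono) auto
        moreover have "norm (F j ?v) = norm h * norm (exp ?z - 1)"
          using 2 by (simp add: F_def norm_mult[symmetric] algebra_simps)
        ultimately have "norm (F j ?v) \<le> norm h ^ 2 * (exp \<bar>?v\<bar> * exp \<bar>?v\<bar>)" by (simp add: power2_eq_square mult_ac)
        also have "\<dots> \<le> 2 * norm h ^ 2 * (exp \<bar>?v\<bar> * exp \<bar>?v\<bar>)" by simp
        finally show ?thesis .
      next
        case 3
        have "norm (F j ?v) = norm h ^ j * exp (Re ?z)" using 3 by (simp add: F_def norm_mult norm_power)
        also have "\<dots> \<le> norm h ^ 2 * exp \<bar>?v\<bar>"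
          using 3 assms re by (intro mult_mono power_decreasing) auto
        also have "\<dots> \<le> norm h ^ 2 * (exp \<bar>?v\<bar> * exp \<bar>?v\<bar>)" by (intro mult_left_mono) auto
        also have "\<dots> \<le> 2 * norm h ^ 2 * (exp \<bar>?v\<bar> * exp \<bar>?v\<bar>)" by simp
        finally show ?thesis .
      qed
    qed
    then show "norm ((euler ^^ j) (\<lambda>x. F 0 (ln \<bar>x\<bar>)) x) \<le> 2 * norm h ^ 2 * wt 2 x"
      by (simp add: euler_ln_compose[OF sm x] nd wt)
  qed
qed

lemma moderate_ln: "moderate 1 (\<lambda>x. of_real (ln \<bar>x\<bar>))"
proof (rule moderateI)
  show "smooth_on (- {0}) (\<lambda>x. complex_of_real (ln \<bar>x\<bar>))"
    by (rule smooth_on_ln_compose[OF smooth_on_of_real[OF open_UNIV]])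
  have nd: "nderiv j complex_of_real v = (if j = 0 then of_real v else if j = 1 then 1 else 0)" for j v
    using nderiv_of_real_power[of j 1 v] by auto
  show "ebound N (wt 1) (\<lambda>x. complex_of_real (ln \<bar>x\<bar>)) 1" for N
    unfolding ebound_def
  proof (intro allI impI)
    fix j and x :: real assume x: "x \<noteq> 0"
    have "\<bar>ln \<bar>x\<bar>\<bar> \<le> exp \<bar>ln \<bar>x\<bar>\<bar>" "1 \<le> exp \<bar>ln \<bar>x\<bar>\<bar>"
      using exp_ge_add_one_self[of "\<bar>ln \<bar>x\<bar>\<bar>"] by linarith+
    then show "norm ((euler ^^ j) (\<lambda>x. complex_of_real (ln \<bar>x\<bar>)) x) \<le> 1 * wt 1 x"
      using euler_ln_compose[OF smooth_on_of_real[OF open_UNIV] x, of j] by (auto simp: nd wt_def)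
  qed
qed

lemma signed_power_add: "x \<noteq> 0 \<Longrightarrow> signed_power d (s + h) x = signed_power d s x * exp (h * of_real (ln \<bar>x\<bar>))"
  by (simp add: signed_power_eq exp_add distrib_right)

text \<open>The derivative in s inserts a factor ln |x|. The error of the difference quotient is the
  extended functional at the remainder of \<open>moderate_exp_remainder\<close> times the original
  function, divided by h; it is of size |h|.\<close>

lemma holomorphic_moderate_extension:
  assumes "linear_off_0 \<rho>" "\<And>K. weight_bounded K \<rho>" "moderate K f"
  shows "(\<lambda>s. moderate_extension \<rho> (\<lambda>x. signed_power d s x * f x)) holomorphic_on UNIV"
proof -
  define F where "F s = moderate_extension \<rho> (\<lambda>x. signed_power d s x * f x)" for s
  have "(F has_field_derivative moderate_extension \<rho> (\<lambda>x. of_real (ln \<bar>x\<bar>) * (signed_power d s x * f x))) (at s)" for s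
  proof -
    define L where "L = \<bar>Re s\<bar> + K"
    define D where "D = moderate_extension \<rho> (\<lambda>x. of_real (ln \<bar>x\<bar>) * (signed_power d s x * f x))"
    have mod: "moderate L (\<lambda>x. signed_power d s x * f x)"
      unfolding L_def by (rule moderate_mult[OF moderate_signed_power assms(3)])
    define J where "J = \<bar>Re s\<bar> + 1 + (2 + \<bar>K\<bar>)"
    obtain C N where CN: "C \<ge> 0" "\<And>f B. moderate (2 + L) f \<Longrightarrow> ebound N (wt (2 + L)) f B \<Longrightarrow> norm (moderate_extension \<rho> f) \<le> C * B"
      using moderate_extension_bound[OF assms(1) assms(2)] by blast
    obtain B where B: "ebound N (wt L) (\<lambda>x. signed_power d s x * f x) B" using mod by (rule moderateE)
    have est: "norm ((F (s + h) - F s) / h - D) \<le> C * (2 ^ N * (2 * B)) * norm h" if h: "h \<noteq> 0" "norm h \<le> 1" for h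
    proof -
      let ?r = "\<lambda>x. (exp (h * of_real (ln \<bar>x\<bar>)) - 1 - h * of_real (ln \<bar>x\<bar>)) * (signed_power d s x * f x)"
      have mr: "moderate 2 (\<lambda>x. exp (h * of_real (ln \<bar>x\<bar>)) - 1 - h * of_real (ln \<bar>x\<bar>))"
        by (rule moderateI[OF moderate_exp_remainder[OF h(2)]])
      have m1: "moderate (2 + L) ?r" by (rule moderate_mult[OF mr mod])
      have m2: "moderate (2 + L) (\<lambda>x. signed_power d s x * f x)" by (rule moderate_mono[OF mod]) simp
      have m3: "moderate (2 + L) (\<lambda>x. of_real (ln \<bar>x\<bar>) * (signed_power d s x * f x))"
        by (rule moderate_mono[OF moderate_mult[OF moderate_ln mod]]) simp
      have "F (s + h) = moderate_extension \<rho> (\<lambda>x. ?r x + (signed_power d s x * f x + h * (of_real (ln \<bar>x\<bar>) * (signed_power d s x * f x))))"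
        unfolding F_def by (rule moderate_extension_cong) (simp add: signed_power_add, simp add: algebra_simps)
      also have "\<dots> = moderate_extension \<rho> ?r + (F s + h * D)"
        using moderate_extension_add[OF assms(1,2) m1 moderate_add[OF m2 moderate_cmult[OF m3]]]
          moderate_extension_add[OF assms(1,2) m2 moderate_cmult[OF m3]]
          moderate_extension_cmult[OF assms(1,2) m3]
        by (simp add: F_def D_def)
      finally have "(F (s + h) - F s) / h - D = moderate_extension \<rho> ?r / h"
        using h by (simp add: field_simps)
      moreover have "norm (moderate_extension \<rho> ?r) \<le> C * (2 ^ N * ((2 * norm h ^ 2) * B))"
        by (rule CN(2)[OF m1 ebound_wt_mult[OF moderate_exp_remainder(1)[OF h(2)] moderate_smooth[OF mod] moderate_exp_remainder(2)[OF h(2)] B]])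
      ultimately show ?thesis using h by (simp add: norm_divide divide_le_eq power2_eq_square mult_ac)
    qed
    have "((\<lambda>h. (F (s + h) - F s) / h - D) \<longlongrightarrow> 0) (at 0)"
    proof (rule Lim_null_comparison)
      show "\<forall>\<^sub>F h in at 0. norm ((F (s + h) - F s) / h - D) \<le> C * (2 ^ N * (2 * B)) * norm h"
        unfolding eventually_at by (intro exI[of _ 1]) (auto intro!: est)
      have "((\<lambda>h::complex. C * (2 ^ N * (2 * B)) * norm h) \<longlongrightarrow> C * (2 ^ N * (2 * B)) * norm (0::complex)) (at 0)"
        by (intro tendsto_mult_left tendsto_norm tendsto_ident_at)
      then show "((\<lambda>h::complex. C * (2 ^ N * (2 * B)) * norm h) \<longlongrightarrow> 0) (at 0)" by simp
    qed
    then show ?thesis unfolding DERIV_def D_def[symmetric] by (simp add: LIM_zero_iff)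
  qed
  then show ?thesis unfolding F_def[symmetric] holomorphic_on_open[OF open_UNIV] by blast
qed

section \<open>Normal forms near 0 of the extended functional\<close>

lemma AE_lebesgue_nonzero: "AE x in lebesgue. x \<noteq> (0::real)"
  using AE_completion[OF AE_lborel_singleton[of "0::real"]] .

lemma norm_LINT_le:
  fixes f :: "real \<Rightarrow> complex"
  assumes "integrable lebesgue f" "\<And>x. x \<noteq> 0 \<Longrightarrow> norm (f x) \<le> D * indicator {-1..1} x"
  shows "norm (LINT x|lebesgue. f x) \<le> 2 * D"
proof -
  have int: "integrable lebesgue (\<lambda>x::real. D * indicator {-1..1} x)"
    by (intro integrable_mult_right integrable_real_indicator) (auto simp: emeasure_lborel_Icc_eq)
  have "norm (LINT x|lebesgue. f x) \<le> (LINT x|lebesgue. norm (f x))" by (rule integral_norm_bound)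
  also have "\<dots> \<le> (LINT x|lebesgue. D * indicator {-1..1::real} x)"
  proof (rule Bochner_Integration.integral_mono_AE)
    show "AE x in lebesgue. norm (f x) \<le> D * indicator {-1..1} x"
      using AE_lebesgue_nonzero by eventually_elim (rule assms(2))
  qed (use int assms(1) in auto)
  also have "\<dots> = 2 * D" by (simp add: measure_def emeasure_lborel_Icc_eq)
  finally show ?thesis .
qed

lemma test_fun_euler_outside:
  assumes "f \<in> test_fun A" "x \<notin> A" shows "(euler ^^ j) f x = 0"
proof -
  obtain K where K: "compact K" "K \<subseteq> A" "\<And>x. x \<notin> K \<Longrightarrow> f x = 0" using assms(1) by (rule test_funE) blast
  show ?thesis by (rule euler_zero_outside[OF compact_imp_closed[OF K(1)] K(3)]) (use K(2) assms(2) in auto)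
qed

lemma power_mult_wt: "x \<noteq> 0 \<Longrightarrow> \<bar>x\<bar> \<le> 1 \<Longrightarrow> \<bar>x\<bar> ^ n * wt (real n) x = 1"
proof -
  assume x: "x \<noteq> 0" "\<bar>x\<bar> \<le> 1"
  then have "ln \<bar>x\<bar> \<le> 0" by simp
  then show ?thesis using x by (simp add: wt_def abs_of_nonpos exp_minus exp_of_nat_mult)
qed

text \<open>On |x| <= 1 the factor x^k exactly compensates the weight of exponent k, so every
  integrand is bounded on an interval of length 2.\<close>

lemma normal_form_estimate:
  assumes "normal_form k A \<rho>" "A \<subseteq> {-1<..<1}"
  obtains C N where "C \<ge> 0" "\<forall>\<phi>\<in>test_fun A. \<forall>B. ebound N (wt (real k)) \<phi> B \<longrightarrow> norm (\<rho> \<phi>) \<le> C * B"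
proof -
  obtain L where L: "admissible L"
    "\<forall>\<phi>\<in>test_fun A. \<rho> \<phi> = (\<Sum>(g, m)\<leftarrow>L. LINT x|lebesgue. g x * (of_real x ^ k * (euler ^^ m) \<phi> x))"
    using assms(1) by (rule normal_formE)
  have "\<exists>C N. C \<ge> 0 \<and> (\<forall>\<phi>\<in>test_fun A. \<forall>B. ebound N (wt (real k)) \<phi> B \<longrightarrow>
      norm (\<Sum>(g, m)\<leftarrow>L. LINT x|lebesgue. g x * (of_real x ^ k * (euler ^^ m) \<phi> x)) \<le> C * B)"
    using L(1)
  proof (induction L)
    case Nil
    show ?case by (intro exI[of _ 0]) simp
  next
    case (Cons a L)
    obtain g m where a: "a = (g, m)" by force
    have "admissible L" using Cons.prems by (simp add: admissible_def)
    from Cons.IH[OF this] obtain C N where CN: "C \<ge> 0" "\<forall>\<phi>\<in>test_fun A. \<forall>B. ebound N (wt (real k)) \<phi> B \<longrightarrow>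
      norm (\<Sum>(g, m)\<leftarrow>L. LINT x|lebesgue. g x * (of_real x ^ k * (euler ^^ m) \<phi> x)) \<le> C * B" by (elim exE conjE)
    obtain G where G: "g \<in> borel_measurable lebesgue" "\<forall>x. norm (g x) \<le> G"
      using Cons.prems a by (auto simp: admissible_def)
    have G0: "G \<ge> 0" using G(2)[rule_format, of 0] norm_ge_zero[of "g 0"] by linarith
    have "norm (\<Sum>(g, m)\<leftarrow>a # L. LINT x|lebesgue. g x * (of_real x ^ k * (euler ^^ m) \<phi> x)) \<le> (2 * G + C) * B"
      if \<phi>: "\<phi> \<in> test_fun A" and B: "ebound (max N m) (wt (real k)) \<phi> B" for \<phi> B
    proof -
      have B0: "B \<ge> 0" using B by (rule ebound_nonneg)
      have "norm (LINT x|lebesgue. g x * (of_real x ^ k * (euler ^^ m) \<phi> x)) \<le> 2 * (G * B)"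
      proof (rule norm_LINT_le)
        have "(\<lambda>x. of_real x ^ k * (euler ^^ m) \<phi> x) \<in> test_fun UNIV"
          using test_fun_mono[OF euler_test_fun[OF \<phi>]]
          by (intro test_fun_mult smooth_on_power smooth_on_of_real) auto
        then show "integrable lebesgue (\<lambda>x. g x * (of_real x ^ k * (euler ^^ m) \<phi> x))"
          by (rule integrable_mult_test_fun[OF G(1) G(2)[rule_format]])
        fix x :: real assume x: "x \<noteq> 0"
        show "norm (g x * (of_real x ^ k * (euler ^^ m) \<phi> x)) \<le> G * B * indicator {-1..1} x"
        proof (cases "x \<in> A")
          case True
          then have x1: "x \<in> {-1<..<1}" using assms(2) by blast
          have "norm ((euler ^^ m) \<phi> x) \<le> B * wt (real k) x" using B x by (simp add: ebound_def)
          then have "norm (g x) * (\<bar>x\<bar> ^ k * norm ((euler ^^ m) \<phi> x)) \<le> G * (\<bar>x\<bar> ^ k * (B * wt (real k) x))"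
            using G G0 by (intro mult_mono mult_left_mono) auto
          also have "\<dots> = G * B * (\<bar>x\<bar> ^ k * wt (real k) x)" by simp
          also have "\<bar>x\<bar> ^ k * wt (real k) x = 1" using x x1 by (intro power_mult_wt) auto
          finally show ?thesis using x1 by (simp add: norm_mult norm_power)
        next
          case False
          then show ?thesis using G0 B0 test_fun_euler_outside[OF \<phi> False] by simp
        qed
      qed
      moreover have "ebound N (wt (real k)) \<phi> B" by (rule ebound_wt_mono[OF B]) auto
      then have "norm (\<Sum>(g, m)\<leftarrow>L. LINT x|lebesgue. g x * (of_real x ^ k * (euler ^^ m) \<phi> x)) \<le> C * B"
        using CN(2) \<phi> by simp
      ultimately show ?thesis unfolding a
        by (simp, intro order_trans[OF norm_triangle_ineq]) (simp add: algebra_simps)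
    qed
    then show ?case using CN(1) G0 by (intro exI[of _ "2 * G + C"] exI[of _ "max N m"]) simp
  qed
  then obtain C N where CN: "C \<ge> 0" "\<forall>\<phi>\<in>test_fun A. \<forall>B. ebound N (wt (real k)) \<phi> B \<longrightarrow>
      norm (\<Sum>(g, m)\<leftarrow>L. LINT x|lebesgue. g x * (of_real x ^ k * (euler ^^ m) \<phi> x)) \<le> C * B" by (elim exE conjE)
  show thesis by (rule that[OF CN(1), of N]) (use CN(2) L(2) in simp)
qed

text \<open>Conjugating E by the signed power of exponent s gives E + s, so the coefficients are
  those of (E + s)^m.\<close>

lemma euler_signed_power_mult:
  "\<exists>c. \<forall>\<phi> x. smooth_on (- {0}) \<phi> \<and> x \<noteq> 0 \<longrightarrow>
     (euler ^^ m) (\<lambda>x. signed_power d s x * \<phi> x) x = signed_power d s x * (\<Sum>i\<le>m. c i * (euler ^^ i) \<phi> x)"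
proof (induction m)
  case 0
  show ?case by (intro exI[of _ "\<lambda>_. 1"]) simp
next
  case (Suc m)
  then obtain c where c: "\<forall>\<phi> x. smooth_on (- {0}) \<phi> \<and> x \<noteq> 0 \<longrightarrow>
     (euler ^^ m) (\<lambda>x. signed_power d s x * \<phi> x) x = signed_power d s x * (\<Sum>i\<le>m. c i * (euler ^^ i) \<phi> x)"
     by (elim exE) (rule that)
  note c = c[rule_format, OF conjI]
  define c' where "c' i = (if i \<le> m then s * c i else 0) + (if i = 0 then 0 else c (i - 1))" for i
  have "(euler ^^ Suc m) (\<lambda>x. signed_power d s x * \<phi> x) x = signed_power d s x * (\<Sum>i\<le>Suc m. c' i * (euler ^^ i) \<phi> x)"
    if \<phi>: "smooth_on (- {0}) \<phi>" and x: "x \<noteq> 0" for \<phi> x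
  proof -
    have sm: "smooth_on (- {0}) (\<lambda>x. \<Sum>i\<le>m. c i * (euler ^^ i) \<phi> x)"
      by (intro smooth_on_sum smooth_on_cmult smooth_on_euler open_nonzero \<phi>)
    have "(euler ^^ 1) ((euler ^^ m) (\<lambda>x. signed_power d s x * \<phi> x)) x =
        (euler ^^ 1) (\<lambda>x. signed_power d s x * (\<Sum>i\<le>m. c i * (euler ^^ i) \<phi> x)) x"
      by (rule euler_cong[OF open_nonzero]) (use c[OF \<phi>] x in auto)
    then have "(euler ^^ Suc m) (\<lambda>x. signed_power d s x * \<phi> x) x =
        euler (\<lambda>x. signed_power d s x * (\<Sum>i\<le>m. c i * (euler ^^ i) \<phi> x)) x" by simp
    also have "\<dots> = signed_power d s x * (s * (\<Sum>i\<le>m. c i * (euler ^^ i) \<phi> x) + euler (\<lambda>x. \<Sum>i\<le>m. c i * (euler ^^ i) \<phi> x) x)"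
      using euler_mult[OF open_nonzero smooth_on_signed_power sm, of x d s] x euler_signed_power[OF x, of 1 d s]
      by (simp add: algebra_simps)
    also have "euler (\<lambda>x. \<Sum>i\<le>m. c i * (euler ^^ i) \<phi> x) x = (\<Sum>i\<le>m. c i * (euler ^^ Suc i) \<phi> x)"
      using euler_sum[OF open_nonzero _ _, of "{..m}" "\<lambda>i x. c i * (euler ^^ i) \<phi> x" x 1] x
        euler_cmult[OF open_nonzero smooth_on_euler[OF open_nonzero \<phi>], of x 1]
      by (simp add: smooth_on_cmult smooth_on_euler open_nonzero \<phi>)
    also have "\<dots> = (\<Sum>i\<le>Suc m. (if i = 0 then 0 else c (i - 1)) * (euler ^^ i) \<phi> x)"
      by (subst sum.atMost_Suc_shift) simp
    also have "s * (\<Sum>i\<le>m. c i * (euler ^^ i) \<phi> x) = (\<Sum>i\<le>Suc m. (if i \<le> m then s * c i else 0) * (euler ^^ i) \<phi> x)"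
      by (simp add: sum_distrib_left mult.assoc)
    finally show ?thesis unfolding c'_def by (simp add: algebra_simps sum.distrib del: sum.atMost_Suc funpow.simps)
  qed
  then show ?case by (intro exI[of _ c']) simp
qed

lemma smooth_off_0_measurable:
  assumes "smooth_on (- {0}) h" "h 0 = 0"
  shows "h \<in> borel_measurable lebesgue"
proof -
  have "(\<lambda>x. indicator (- {0}) x *\<^sub>R h x) \<in> borel_measurable borel"
    using smooth_on_continuous[OF assms(1), of 0] by (intro borel_measurable_continuous_on_indicator) auto
  moreover have "(\<lambda>x. indicator (- {0}) x *\<^sub>R h x) = h" using assms(2) by (auto simp: indicator_def fun_eq_iff)
  ultimately show ?thesis by (intro measurable_completion) simp
qed

lemma euler_at_0: "f 0 = 0 \<Longrightarrow> (euler ^^ j) f 0 = 0"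
  by (cases j) (simp_all add: euler_def)

lemma tendsto_sum_list:
  assumes "\<And>a. a \<in> set L \<Longrightarrow> (\<lambda>n. f n a) \<longlonglongrightarrow> g a"
  shows "(\<lambda>n. \<Sum>a\<leftarrow>L. f n a) \<longlonglongrightarrow> (\<Sum>a\<leftarrow>L. g a :: complex)"
  using assms by (induction L) (auto intro!: tendsto_add)

lemma normal_form_sum_list:
  "(\<And>a. a \<in> set L \<Longrightarrow> normal_form k A (\<rho> a)) \<Longrightarrow> normal_form k A (\<lambda>\<phi>. \<Sum>a\<leftarrow>L. \<rho> a \<phi>)"
  by (induction L) (auto intro: normal_form_add normal_form_zero)

lemma annulus_cutoff_eventually_1:
  assumes "x \<noteq> 0"
  shows "\<forall>\<^sub>F n in sequentially. \<forall>j. (euler ^^ j) (\<lambda>x. annulus_cutoff n x * f x) x = (euler ^^ j) f x"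
proof -
  obtain n0 :: nat where n0: "\<bar>ln \<bar>x\<bar>\<bar> \<le> real n0" using real_arch_simple by blast
  show ?thesis
  proof (rule eventually_sequentiallyI[of n0], intro allI)
    fix n j assume "n0 \<le> n"
    let ?U = "{y :: real. exp (- (real n + 1)) < \<bar>y\<bar> \<and> \<bar>y\<bar> < exp (real n + 1)}"
    have "open ?U" by (intro open_Collect_conj open_Collect_less continuous_intros)
    moreover have "annulus_cutoff n y * f y = f y" if "y \<in> ?U" for y
    proof -
      have "\<bar>y\<bar> > 0" using that order.strict_trans[OF exp_gt_zero, of "- (real n + 1)" "\<bar>y\<bar>"] by blast
      then have "- (real n + 1) < ln \<bar>y\<bar>" "ln \<bar>y\<bar> < real n + 1"
        using that by (metis (no_types, lifting) exp_less_cancel_iff exp_ln mem_Collect_eq)+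
      then show ?thesis using \<open>\<bar>y\<bar> > 0\<close> annulus_cutoff_1[of y n] by simp
    qed
    moreover have "x \<in> ?U"
    proof -
      have "\<bar>ln \<bar>x\<bar>\<bar> < real n + 1" using n0 \<open>n0 \<le> n\<close> by linarith
      then have "exp (- (real n + 1)) < exp (ln \<bar>x\<bar>)" "exp (ln \<bar>x\<bar>) < exp (real n + 1)" by auto
      then show ?thesis using assms by simp
    qed
    ultimately show "(euler ^^ j) (\<lambda>x. annulus_cutoff n x * f x) x = (euler ^^ j) f x"
      by (rule euler_cong)
  qed
qed

text \<open>Dominated convergence: the cutoffs have Euler bounds uniform in \<open>n\<close>, and
  x^k with k >= |Re s| turns the growth of the signed power into a constant on the support of
  phi.\<close>

lemma moderate_extension_term_tendsto:
  assumes g: "g \<in> borel_measurable lebesgue" "\<forall>x. norm (g x) \<le> G"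
    and r: "r < 1" and \<phi>: "\<phi> \<in> test_fun {-r<..<r}" and k: "real k \<ge> \<bar>Re s\<bar>"
  shows "(\<lambda>n. LINT x|lebesgue. g x * (of_real x ^ k * (euler ^^ m) (\<lambda>x. annulus_cutoff n x * (signed_power d s x * \<phi> x)) x)) \<longlonglongrightarrow>
     (LINT x|lebesgue. g x * (of_real x ^ k * (euler ^^ m) (\<lambda>x. signed_power d s x * \<phi> x) x))"
proof -
  let ?f = "\<lambda>x. signed_power d s x * \<phi> x"
  have mf: "moderate (\<bar>Re s\<bar> + 0) ?f"
    by (intro moderate_mult moderate_signed_power moderate_test_fun[OF \<phi>])
  obtain B where B: "ebound m (wt (\<bar>Re s\<bar> + 0)) ?f B" using mf by (rule moderateE)
  obtain A where A: "A \<ge> 0" "\<And>n. ebound m (\<lambda>x. 1) (annulus_cutoff n) A"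
    using ebound_annulus_cutoff[of m] by blast
  note sf = moderate_smooth[OF mf]
  have sn: "smooth_on (- {0}) (annulus_cutoff n)" for n
    by (rule smooth_on_subset[OF smooth_on_annulus_cutoff]) auto
  have E: "ebound m (wt (real k)) (\<lambda>x. annulus_cutoff n x * ?f x) (2 ^ m * (A * B))" for n
  proof -
    have "ebound m (wt \<bar>Re s\<bar>) (\<lambda>x. annulus_cutoff n x * ?f x) (2 ^ m * (A * B))"
      using ebound_mult[OF sn sf A(2) B] by simp
    then show ?thesis by (rule ebound_wt_mono[OF _ k]) simp
  qed
  obtain K where K: "compact K" "K \<subseteq> {-r<..<r}" "\<And>x. x \<notin> K \<Longrightarrow> \<phi> x = 0" using \<phi> by (rule test_funE) blast
  have G0: "G \<ge> 0" using g(2)[rule_format, of 0] norm_ge_zero[of "g 0"] by linarith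
  have B0: "B \<ge> 0" using ebound_nonneg[OF B] .
  show ?thesis
  proof (rule integral_dominated_convergence[where w = "\<lambda>x. G * (2 ^ m * (A * B)) * indicator {-1..1} x"])
    have p: "(\<lambda>x. complex_of_real x ^ k) \<in> borel_measurable lebesgue"
      by (intro lebesgue_measurable_continuous continuous_intros)
    have "(euler ^^ m) ?f \<in> borel_measurable lebesgue"
      by (intro smooth_off_0_measurable smooth_on_euler open_nonzero sf euler_at_0) simp
    then show "(\<lambda>x. g x * (of_real x ^ k * (euler ^^ m) ?f x)) \<in> borel_measurable lebesgue"
      using g(1) p by measurable
    show "(\<lambda>x. g x * (of_real x ^ k * (euler ^^ m) (\<lambda>x. annulus_cutoff n x * ?f x) x)) \<in> borel_measurable lebesgue" for n
      using g(1) p test_fun_measurable(2)[OF annulus_cutoff_mult_test_fun[OF sf]] by measurable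
    show "integrable lebesgue (\<lambda>x. G * (2 ^ m * (A * B)) * indicator {-1..1::real} x)"
      by (intro integrable_mult_right integrable_real_indicator) (auto simp: emeasure_lborel_Icc_eq)
    show "AE x in lebesgue. (\<lambda>n. g x * (of_real x ^ k * (euler ^^ m) (\<lambda>x. annulus_cutoff n x * ?f x) x)) \<longlonglongrightarrow>
        g x * (of_real x ^ k * (euler ^^ m) ?f x)"
      using AE_lebesgue_nonzero
    proof eventually_elim
      case (elim x)
      show ?case
        by (rule tendsto_eventually, rule eventually_mono[OF annulus_cutoff_eventually_1[OF elim, of ?f]]) simp
    qed
    show "AE x in lebesgue. norm (g x * (of_real x ^ k * (euler ^^ m) (\<lambda>x. annulus_cutoff n x * ?f x) x)) \<le>
        G * (2 ^ m * (A * B)) * indicator {-1..1} x" for n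
      using AE_lebesgue_nonzero
    proof eventually_elim
      case (elim x)
      show ?case
      proof (cases "x \<in> K")
        case True
        then have x1: "\<bar>x\<bar> < 1" using K(2) r by force
        have "norm ((euler ^^ m) (\<lambda>x. annulus_cutoff n x * ?f x) x) \<le> 2 ^ m * (A * B) * wt (real k) x"
          using E elim unfolding ebound_def by blast
        then have "norm (g x) * (\<bar>x\<bar> ^ k * norm ((euler ^^ m) (\<lambda>x. annulus_cutoff n x * ?f x) x)) \<le> G * (\<bar>x\<bar> ^ k * (2 ^ m * (A * B) * wt (real k) x))"
          using g G0 by (intro mult_mono mult_left_mono) auto
        also have "\<dots> = G * (2 ^ m * (A * B)) * (\<bar>x\<bar> ^ k * wt (real k) x)" by (simp add: mult_ac)
        also have "\<bar>x\<bar> ^ k * wt (real k) x = 1" using elim x1 by (intro power_mult_wt) auto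
        finally show ?thesis using x1 by (simp add: norm_mult norm_power abs_less_iff indicator_def)
      next
        case False
        have "(euler ^^ m) (\<lambda>x. annulus_cutoff n x * ?f x) x = 0"
          by (rule euler_zero_outside[OF compact_imp_closed[OF K(1)] _ False]) (simp add: K(3))
        then show ?thesis using G0 A(1) B0 by simp
      qed
    qed
  qed
qed

text \<open>The signed power is absorbed into the bounded coefficient: x^(k-l) times it is bounded
  near 0, because k - l + Re s is not negative.\<close>

lemma normal_form_signed_power_term:
  assumes g: "g \<in> borel_measurable lebesgue" "\<forall>x. norm (g x) \<le> G"
    and r: "r < 1" and k: "real k + Re s \<ge> real l" "l \<le> k"
  shows "normal_form l {-r<..<r} (\<lambda>\<phi>. LINT x|lebesgue. g x * (of_real x ^ k * (euler ^^ m) (\<lambda>x. signed_power d s x * \<phi> x) x))"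
proof -
  obtain c where c: "\<forall>\<phi> x. smooth_on (- {0}) \<phi> \<and> x \<noteq> 0 \<longrightarrow>
     (euler ^^ m) (\<lambda>x. signed_power d s x * \<phi> x) x = signed_power d s x * (\<Sum>i\<le>m. c i * (euler ^^ i) \<phi> x)"
    using euler_signed_power_mult[of m d s] by (elim exE) (rule that)
  note c = c[rule_format, OF conjI]
  define q where "q x = indicator {-1<..<1} x *\<^sub>R (of_real x ^ (k - l) * signed_power d s x)" for x :: real
  have q_meas: "q \<in> borel_measurable lebesgue"
  proof -
    have "(\<lambda>x. complex_of_real x ^ (k - l)) \<in> borel_measurable lebesgue"
      by (intro lebesgue_measurable_continuous continuous_intros)
    moreover have "signed_power d s \<in> borel_measurable lebesgue"
      by (intro smooth_off_0_measurable smooth_on_signed_power) simp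
    ultimately show ?thesis unfolding q_def[abs_def]
      by (intro borel_measurable_scaleR borel_measurable_indicator borel_measurable_times) auto
  qed
  have q_le: "norm (q x) \<le> 1" for x
  proof (cases "x \<in> {-1<..<1} \<and> x \<noteq> 0")
    case True
    then have ln: "ln \<bar>x\<bar> \<le> 0" by auto
    have "norm (q x) = exp (real (k - l) * ln \<bar>x\<bar>) * exp (Re s * ln \<bar>x\<bar>)"
      using True by (simp add: q_def norm_mult norm_power norm_signed_power exp_of_nat_mult)
    also have "\<dots> = exp ((real k + Re s - real l) * ln \<bar>x\<bar>)"
      using k(2) by (simp add: exp_add[symmetric] algebra_simps of_nat_diff)
    also have "\<dots> \<le> 1" using ln k(1) by (simp add: mult_nonneg_nonpos)
    finally show ?thesis .
  qed (auto simp: q_def)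
  have "pointwise_normal_form l {-r<..<r} (\<lambda>\<phi> x. \<Sum>i\<le>m. (g x * q x * c i) * (of_real x ^ l * (euler ^^ i) \<phi> x))"
  proof (intro pointwise_normal_form_sum pointwise_normal_form_single)
    fix i
    show "(\<lambda>x. g x * q x * c i) \<in> borel_measurable lebesgue" using g(1) q_meas by measurable
    show "norm (g x * q x * c i) \<le> G * 1 * norm (c i)" for x
      unfolding norm_mult using g(2)[rule_format, of x] q_le[of x]
      by (intro mult_mono mult_right_mono) (auto intro: order_trans[OF norm_ge_zero])
  qed
  then show ?thesis
  proof (rule normal_formI_pointwise)
    fix \<phi> assume \<phi>: "\<phi> \<in> test_fun {-r<..<r}"
    have sm: "smooth_on (- {0}) \<phi>" by (rule smooth_on_subset[OF test_fun_smooth[OF \<phi>]]) auto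
    obtain K where K: "compact K" "K \<subseteq> {-r<..<r}" "\<And>x. x \<notin> K \<Longrightarrow> \<phi> x = 0" using \<phi> by (rule test_funE) blast
    have "g x * (of_real x ^ k * (euler ^^ m) (\<lambda>x. signed_power d s x * \<phi> x) x) =
        (\<Sum>i\<le>m. (g x * q x * c i) * (of_real x ^ l * (euler ^^ i) \<phi> x))" for x
    proof (cases "x \<in> K \<and> x \<noteq> 0")
      case True
      then have "x \<in> {-1<..<1}" using K(2) r by force
      have "of_real x ^ k = (of_real x ^ (k - l) * of_real x ^ l :: complex)" using k(2) by (simp add: power_add[symmetric])
      then show ?thesis unfolding c[OF sm True[THEN conjunct2]]
        using \<open>x \<in> {-1<..<1}\<close> by (simp add: q_def sum_distrib_left mult_ac)
    next
      case False
      have "(euler ^^ m) (\<lambda>x. signed_power d s x * \<phi> x) x = 0"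
      proof (cases "x = 0")
        case True then show ?thesis using euler_at_0[of "\<lambda>x. signed_power d s x * \<phi> x"] by simp
      next
        case F: False
        show ?thesis by (rule euler_zero_outside[OF compact_imp_closed[OF K(1)]]) (use K(3) False F in auto)
      qed
      moreover have "q x * (euler ^^ i) \<phi> x = 0" for i
      proof (cases "x = 0")
        case F: False
        have "(euler ^^ i) \<phi> x = 0"
          by (rule euler_zero_outside[OF compact_imp_closed[OF K(1)]]) (use K(3) False F in auto)
        then show ?thesis by simp
      qed (simp add: q_def)
      then have "(g x * q x * c i) * (of_real x ^ l * (euler ^^ i) \<phi> x) = 0" for i
        by (metis (no_types, lifting) mult.assoc mult.commute mult_zero_right)
      then have "(\<Sum>i\<le>m. (g x * q x * c i) * (of_real x ^ l * (euler ^^ i) \<phi> x)) = 0"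
        by (simp only: sum.neutral_const)
      ultimately show ?thesis by simp
    qed
    then show "(LINT x|lebesgue. g x * (of_real x ^ k * (euler ^^ m) (\<lambda>x. signed_power d s x * \<phi> x) x)) =
        (LINT x|lebesgue. (\<Sum>i\<le>m. (g x * q x * c i) * (of_real x ^ l * (euler ^^ i) \<phi> x)))" by simp
  qed
qed

text \<open>What an element of the source retains away from 0. The weight bounds concern both ends,
  the normal forms only the origin; those at infinity are expressed by the same property of the
  inverted functional.\<close>

definition regular_off_0 :: "functional \<Rightarrow> bool" where
  "regular_off_0 \<rho> \<longleftrightarrow> linear_off_0 \<rho> \<and> (\<forall>K. weight_bounded K \<rho>) \<and>
     (\<forall>k. \<exists>r>0. r < 1 \<and> normal_form k ({-r<..<r} - {0}) \<rho>)"

lemma regular_off_0D: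
  assumes "regular_off_0 \<rho>"
  shows "linear_off_0 \<rho>" "weight_bounded K \<rho>"
  using assms by (auto simp: regular_off_0_def)

text \<open>A normal form on the punctured interval passes to the full interval in the limit of the
  cutoffs. Multiplying by the signed power costs at most |Re s| orders, so the original is used with
  correspondingly higher order.\<close>

lemma normal_form_moderate_extension:
  assumes "regular_off_0 \<rho>"
  shows "\<exists>r>0. r < 1 \<and> normal_form l {-r<..<r} (\<lambda>\<phi>. moderate_extension \<rho> (\<lambda>x. signed_power d s x * \<phi> x))"
proof -
  note lin = regular_off_0D(1)[OF assms] and wb = regular_off_0D(2)[OF assms]
  \<comment> \<open>Large enough both for the domination, k >= |Re s|, and for keeping order l, k +
    Re s >= l.\<close>
  define k where "k = l + nat \<lceil>\<bar>Re s\<bar>\<rceil>"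
  have "\<bar>Re s\<bar> \<le> real (nat \<lceil>\<bar>Re s\<bar>\<rceil>)" by (rule real_nat_ceiling_ge)
  then have k: "real k \<ge> \<bar>Re s\<bar>" "real k + Re s \<ge> real l" "l \<le> k" unfolding k_def of_nat_add by linarith+
  obtain r where r: "r > 0" "r < 1" and nf: "normal_form k ({-r<..<r} - {0}) \<rho>"
    using assms unfolding regular_off_0_def by blast
  obtain L where L: "admissible L"
    "\<forall>\<phi>\<in>test_fun ({-r<..<r} - {0}). \<rho> \<phi> = (\<Sum>(g, m)\<leftarrow>L. LINT x|lebesgue. g x * (of_real x ^ k * (euler ^^ m) \<phi> x))"
    using nf by (rule normal_formE)
  have "normal_form l {-r<..<r} (\<lambda>\<phi>. \<Sum>a\<leftarrow>L. case a of (g, m) \<Rightarrow>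
      LINT x|lebesgue. g x * (of_real x ^ k * (euler ^^ m) (\<lambda>x. signed_power d s x * \<phi> x) x))"
  proof (rule normal_form_sum_list)
    fix a assume a: "a \<in> set L"
    obtain g m where gm: "a = (g, m)" by force
    obtain G where "g \<in> borel_measurable lebesgue" "\<forall>x. norm (g x) \<le> G"
      using L(1) a gm unfolding admissible_def by blast
    then show "normal_form l {-r<..<r} (\<lambda>\<phi>. case a of (g, m) \<Rightarrow>
      LINT x|lebesgue. g x * (of_real x ^ k * (euler ^^ m) (\<lambda>x. signed_power d s x * \<phi> x) x))"
      unfolding gm prod.case by (rule normal_form_signed_power_term[OF _ _ r(2) k(2,3)])
  qed
  then have "normal_form l {-r<..<r} (\<lambda>\<phi>. moderate_extension \<rho> (\<lambda>x. signed_power d s x * \<phi> x))"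
  proof (rule normal_form_cong[rotated])
    fix \<phi> assume \<phi>: "\<phi> \<in> test_fun {-r<..<r}"
    let ?f = "\<lambda>x. signed_power d s x * \<phi> x"
    have mf: "moderate (\<bar>Re s\<bar> + 0) ?f"
      by (intro moderate_mult moderate_signed_power moderate_test_fun[OF \<phi>])
    have tf: "(\<lambda>x. annulus_cutoff n x * ?f x) \<in> test_fun ({-r<..<r} - {0})" for n
    proof -
      obtain K where K: "compact K" "K \<subseteq> {-r<..<r}" "\<And>x. x \<notin> K \<Longrightarrow> \<phi> x = 0" using \<phi> by (rule test_funE) blast
      obtain M where M: "smooth_on UNIV (\<lambda>x. annulus_cutoff n x * ?f x)" "compact M" "M \<subseteq> - {0}"
        "\<And>x. x \<notin> M \<Longrightarrow> annulus_cutoff n x * ?f x = 0"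
        using annulus_cutoff_mult_test_fun[OF moderate_smooth[OF mf], of n] by (rule test_funE) blast
      show ?thesis
      proof (rule test_funI[OF M(1)])
        show "compact (K \<inter> M)" by (intro compact_Int K M)
        show "annulus_cutoff n x * ?f x = 0" if "x \<notin> K \<inter> M" for x using that K(3)[of x] M(4)[of x] by (cases "x \<in> K") auto
      qed (use K M in auto)
    qed
    have "(\<lambda>n. \<Sum>a\<leftarrow>L. case a of (g, m) \<Rightarrow> LINT x|lebesgue. g x * (of_real x ^ k * (euler ^^ m) (\<lambda>x. annulus_cutoff n x * ?f x) x)) \<longlonglongrightarrow>
        (\<Sum>a\<leftarrow>L. case a of (g, m) \<Rightarrow> LINT x|lebesgue. g x * (of_real x ^ k * (euler ^^ m) ?f x))"
    proof (rule tendsto_sum_list)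
      fix a assume a: "a \<in> set L"
      obtain g m where gm: "a = (g, m)" by force
      obtain G where "g \<in> borel_measurable lebesgue" "\<forall>x. norm (g x) \<le> G"
        using L(1) a gm unfolding admissible_def by blast
      then show "(\<lambda>n. case a of (g, m) \<Rightarrow> LINT x|lebesgue. g x * (of_real x ^ k * (euler ^^ m) (\<lambda>x. annulus_cutoff n x * ?f x) x)) \<longlonglongrightarrow>
        (case a of (g, m) \<Rightarrow> LINT x|lebesgue. g x * (of_real x ^ k * (euler ^^ m) ?f x))"
        unfolding gm prod.case by (rule moderate_extension_term_tendsto[OF _ _ r(2) \<phi> k(1)])
    qed
    then have "(\<lambda>n. \<rho> (\<lambda>x. annulus_cutoff n x * ?f x)) \<longlonglongrightarrow>
        (\<Sum>a\<leftarrow>L. case a of (g, m) \<Rightarrow> LINT x|lebesgue. g x * (of_real x ^ k * (euler ^^ m) ?f x))"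
      using L(2) tf by simp
    from LIMSEQ_unique[OF this moderate_extension_lim[OF lin wb mf]]
    show "(\<Sum>a\<leftarrow>L. case a of (g, m) \<Rightarrow> LINT x|lebesgue. g x * (of_real x ^ k * (euler ^^ m) ?f x)) =
      moderate_extension \<rho> ?f" .
  qed
  then show ?thesis using r by blast
qed

section \<open>Holomorphic extensions and inversion\<close>

lemma ebound_SUP:
  assumes "compact K"
  obtains D where "D \<ge> 0" "\<forall>\<phi>\<in>test_fun UNIV. (\<forall>x. x \<notin> K \<longrightarrow> \<phi> x = 0) \<longrightarrow>
     ebound N (wt 0) \<phi> (D * (\<Sum>n\<le>N. SUP x. norm (nderiv n \<phi> x)))"
proof -
  obtain R0 where R0: "\<forall>x\<in>K. norm x \<le> R0" using compact_imp_bounded[OF assms] by (auto simp: bounded_iff)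
  define R where "R = max R0 1"
  have R: "R \<ge> 1" "\<And>x. x \<in> K \<Longrightarrow> \<bar>x\<bar> \<le> R" using R0 by (force simp: R_def)+
  define P where "P j C \<longleftrightarrow> C \<ge> 0 \<and> (\<forall>U f x. open U \<and> smooth_on U f \<and> x \<in> U \<longrightarrow>
     norm ((euler ^^ j) f x) \<le> C * (\<Sum>i\<le>j. \<bar>x\<bar> ^ i * norm (nderiv i f x)))" for j C
  have "\<forall>j. \<exists>C. P j C" unfolding P_def by (intro allI norm_euler_le)
  then obtain C where "\<forall>j. P j (C j)" by (rule choice[THEN exE])
  then have C: "C j \<ge> 0" "open U \<and> smooth_on U f \<and> x \<in> U \<longrightarrow>
     norm ((euler ^^ j) f x) \<le> C j * (\<Sum>i\<le>j. \<bar>x\<bar> ^ i * norm (nderiv i f x))" for j U f x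
    unfolding P_def by simp_all
  define D where "D = (\<Sum>j\<le>N. C j) * R ^ N"
  have "ebound N (wt 0) \<phi> (D * (\<Sum>n\<le>N. SUP x. norm (nderiv n \<phi> x)))"
    if \<phi>: "\<phi> \<in> test_fun UNIV" "\<forall>x. x \<notin> K \<longrightarrow> \<phi> x = 0" for \<phi>
    unfolding ebound_def
  proof (intro allI impI)
    fix j and x :: real assume j: "j \<le> N" and x: "x \<noteq> 0"
    let ?S = "\<Sum>n\<le>N. SUP x. norm (nderiv n \<phi> x)"
    have s0: "0 \<le> (SUP x. norm (nderiv n \<phi> x))" for n
      using order_trans[OF norm_ge_zero test_fun_le_SUP[OF \<phi>(1), of n 0]] .
    then have S0: "?S \<ge> 0" by (intro sum_nonneg)
    show "norm ((euler ^^ j) \<phi> x) \<le> D * ?S * wt 0 x"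
    proof (cases "x \<in> K")
      case True
      have "norm ((euler ^^ j) \<phi> x) \<le> C j * (\<Sum>i\<le>j. \<bar>x\<bar> ^ i * norm (nderiv i \<phi> x))"
        using C(2)[where U = UNIV and f = \<phi> and x = x and j = j] test_fun_smooth[OF \<phi>(1)] by simp
      also have "\<dots> \<le> C j * (\<Sum>i\<le>j. R ^ N * (SUP x. norm (nderiv i \<phi> x)))"
      proof (intro mult_left_mono sum_mono mult_mono test_fun_le_SUP[OF \<phi>(1)] C(1))
        fix i assume "i \<in> {..j}"
        have "\<bar>x\<bar> ^ i \<le> R ^ i" using R(2)[OF True] by (intro power_mono) auto
        also have "\<dots> \<le> R ^ N" using R(1) \<open>i \<in> {..j}\<close> j by (intro power_increasing) auto
        finally show "\<bar>x\<bar> ^ i \<le> R ^ N" .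
      qed (use R(1) in auto)
      also have "\<dots> \<le> C j * (R ^ N * ?S)"
        unfolding sum_distrib_left[symmetric] using j R(1) s0
        by (intro mult_left_mono sum_mono2 C(1)) auto
      also have "\<dots> \<le> (\<Sum>j\<le>N. C j) * (R ^ N * ?S)"
        using j C(1) S0 R(1) by (intro mult_right_mono member_le_sum mult_nonneg_nonneg) auto
      finally show ?thesis by (simp add: D_def mult.assoc)
    next
      case False
      have "(euler ^^ j) \<phi> x = 0"
        by (rule euler_zero_outside[OF compact_imp_closed[OF assms] _ False]) (use \<phi>(2) in simp)
      moreover have "D \<ge> 0" unfolding D_def using C(1) R(1) by (intro mult_nonneg_nonneg sum_nonneg) auto
      ultimately show ?thesis using S0 by simp
    qed
  qed
  moreover have "D \<ge> 0" unfolding D_def using C(1) R(1) by (intro mult_nonneg_nonneg sum_nonneg) auto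
  ultimately show thesis by (intro that[of D]) simp_all
qed

lemma distribution_moderate_extension:
  assumes "regular_off_0 \<rho>"
  shows "distribution_on UNIV (\<lambda>\<phi>. moderate_extension \<rho> (\<lambda>x. signed_power d s x * \<phi> x))"
  unfolding distribution_on_def
proof (intro conjI allI impI)
  note lin = regular_off_0D(1)[OF assms] and wb = regular_off_0D(2)[OF assms]
  have mf: "moderate (\<bar>Re s\<bar> + 0) (\<lambda>x. signed_power d s x * \<phi> x)" if "\<phi> \<in> test_fun UNIV" for \<phi>
    by (intro moderate_mult moderate_signed_power moderate_test_fun[OF that])
  show "linear_functional_on (test_fun UNIV) (\<lambda>\<phi>. moderate_extension \<rho> (\<lambda>x. signed_power d s x * \<phi> x))"
    unfolding linear_functional_on_def
  proof (intro conjI ballI allI)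
    fix \<phi> \<psi> assume "\<phi> \<in> test_fun UNIV" "\<psi> \<in> test_fun UNIV"
    from moderate_extension_add[OF lin wb mf[OF this(1)] mf[OF this(2)]]
    show "moderate_extension \<rho> (\<lambda>x. signed_power d s x * (\<phi> x + \<psi> x)) =
        moderate_extension \<rho> (\<lambda>x. signed_power d s x * \<phi> x) + moderate_extension \<rho> (\<lambda>x. signed_power d s x * \<psi> x)"
      by (simp add: distrib_left)
  next
    fix c \<phi> assume "\<phi> \<in> test_fun UNIV"
    from moderate_extension_cmult[OF lin wb mf[OF this], of c]
    show "moderate_extension \<rho> (\<lambda>x. signed_power d s x * (c * \<phi> x)) = c * moderate_extension \<rho> (\<lambda>x. signed_power d s x * \<phi> x)"
      by (simp add: mult.left_commute)
  qed
  fix K :: "real set" assume K: "compact K \<and> K \<subseteq> UNIV"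
  obtain C N where CN: "C \<ge> 0" "\<forall>f B. moderate (\<bar>Re s\<bar> + 0) f \<longrightarrow> ebound N (wt (\<bar>Re s\<bar> + 0)) f B \<longrightarrow> norm (moderate_extension \<rho> f) \<le> C * B"
    using moderate_extension_bound[where K = "\<bar>Re s\<bar> + 0", OF lin wb] by (elim exE conjE) (rule that)
  obtain D where D: "D \<ge> 0" "\<forall>\<phi>\<in>test_fun UNIV. (\<forall>x. x \<notin> K \<longrightarrow> \<phi> x = 0) \<longrightarrow>
     ebound N (wt 0) \<phi> (D * (\<Sum>n\<le>N. SUP x. norm (nderiv n \<phi> x)))" by (rule ebound_SUP[OF K[THEN conjunct1]])
  show "\<exists>C N. \<forall>\<phi>\<in>test_fun UNIV. (\<forall>x. x \<notin> K \<longrightarrow> \<phi> x = 0) \<longrightarrow>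
      norm (moderate_extension \<rho> (\<lambda>x. signed_power d s x * \<phi> x)) \<le> C * (\<Sum>n\<le>N. SUP x. norm (nderiv n \<phi> x))"
  proof (rule exI[of _ "C * (2 ^ N * ((1 + norm s) ^ N * D))"], rule exI[of _ N], intro ballI impI)
    fix \<phi> assume \<phi>: "\<phi> \<in> test_fun UNIV" "\<forall>x. x \<notin> K \<longrightarrow> \<phi> x = 0"
    have "norm (moderate_extension \<rho> (\<lambda>x. signed_power d s x * \<phi> x)) \<le>
        C * (2 ^ N * ((1 + norm s) ^ N * (D * (\<Sum>n\<le>N. SUP x. norm (nderiv n \<phi> x)))))"
      by (rule CN(2)[rule_format, OF mf[OF \<phi>(1)] ebound_wt_mult[OF smooth_on_signed_power
            moderate_smooth[OF moderate_test_fun[OF \<phi>(1)]] ebound_signed_power D(2)[rule_format, OF \<phi>(1) \<phi>(2)[rule_format]]]])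
    then show "norm (moderate_extension \<rho> (\<lambda>x. signed_power d s x * \<phi> x)) \<le>
        C * (2 ^ N * ((1 + norm s) ^ N * D)) * (\<Sum>n\<le>N. SUP x. norm (nderiv n \<phi> x))"
      by (simp add: mult.assoc)
  qed
qed

lemma holomorphic_extension_exists:
  assumes "regular_off_0 \<rho>"
  shows "holomorphic_extension d k \<rho> (\<lambda>s \<phi>. moderate_extension \<rho> (\<lambda>x. signed_power d (s - 1) x * \<phi> x))"
  unfolding holomorphic_extension_def
proof (intro conjI allI impI ballI)
  note lin = regular_off_0D(1)[OF assms] and wb = regular_off_0D(2)[OF assms]
  show "distribution_on UNIV (\<lambda>\<phi>. moderate_extension \<rho> (\<lambda>x. signed_power d (s - 1) x * \<phi> x))" for s
    by (rule distribution_moderate_extension[OF assms])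
  show "moderate_extension \<rho> (\<lambda>x. signed_power d (s - 1) x * \<phi> x) = dist_mult (signed_power d (s - 1)) \<rho> \<phi>"
    if "\<phi> \<in> test_fun (- {0})" for s \<phi>
    unfolding dist_mult_def
    by (intro moderate_extension_test_fun test_fun_mult open_nonzero smooth_on_signed_power that)
  show "vanishes_to_order 0 l (\<lambda>\<phi>. moderate_extension \<rho> (\<lambda>x. signed_power d (s - 1) x * \<phi> x))"
    if "0 \<le> l \<and> real_of_int l \<le> Re s - 1 + real_of_int k" for l :: int and s
  proof -
    have "l = int (nat l)" using that by simp
    moreover have "vanishes_to_order 0 (int (nat l)) (\<lambda>\<phi>. moderate_extension \<rho> (\<lambda>x. signed_power d (s - 1) x * \<phi> x))"
      by (rule vanishes_to_order_iff[THEN iffD2, OF normal_form_moderate_extension[OF assms]])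
    ultimately show ?thesis by (simp only:)
  qed
  show "(\<lambda>s. moderate_extension \<rho> (\<lambda>x. signed_power d (s - 1) x * \<phi> x)) holomorphic_on {s. Re s > - real_of_int k}"
    if "\<phi> \<in> test_fun UNIV" for \<phi>
  proof -
    have "(\<lambda>s. s - 1) holomorphic_on {s. Re s > - real_of_int k}" by (intro holomorphic_intros)
    from holomorphic_on_compose_gen[OF this holomorphic_moderate_extension[OF lin wb moderate_test_fun[OF that]]]
    show ?thesis by (simp add: o_def)
  qed
qed

text \<open>The difference T of the two has a normal form of order 1 near 0. After localization its
  value at phi0 is that at (1 - cutoff) phi0, which the normal form bounds by a multiple of
  exp(-n).\<close>

lemma vanishing_distribution_unique:
  assumes lin: "linear_functional_on (test_fun UNIV) S" "linear_functional_on (test_fun UNIV) S'"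
    and eq: "\<And>\<phi>. \<phi> \<in> test_fun (- {0}) \<Longrightarrow> S \<phi> = S' \<phi>"
    and van: "vanishes_to_order 0 1 S" "vanishes_to_order 0 1 S'"
    and \<phi>: "\<phi> \<in> test_fun UNIV"
  shows "S \<phi> = S' \<phi>"
proof -
  define T where "T \<phi> = S \<phi> + (-1) * S' \<phi>" for \<phi>
  obtain r1 where r1: "r1 > 0" "r1 < 1" "normal_form 1 {-r1<..<r1} S"
    using van(1) vanishes_to_order_iff[of 1 S] by auto
  obtain r2 where r2: "r2 > 0" "r2 < 1" "normal_form 1 {-r2<..<r2} S'"
    using van(2) vanishes_to_order_iff[of 1 S'] by auto
  define r where "r = min r1 r2"
  have r: "r > 0" "r < 1" "{-r<..<r} \<subseteq> {-r1<..<r1}" "{-r<..<r} \<subseteq> {-r2<..<r2}" "{-r<..<r} \<subseteq> {-1<..<1}"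
    using r1 r2 by (auto simp: r_def)
  have nf: "normal_form 1 {-r<..<r} T"
    unfolding T_def[abs_def]
    by (intro normal_form_add normal_form_cmult normal_form_mono[OF r1(3) r(3)] normal_form_mono[OF r2(3) r(4)])
  obtain C N where CN: "C \<ge> 0" "\<forall>\<phi>\<in>test_fun {-r<..<r}. \<forall>B. ebound N (wt (real 1)) \<phi> B \<longrightarrow> norm (T \<phi>) \<le> C * B"
    using nf r(5) by (rule normal_form_estimate)
  have T0: "T f = 0" if "f \<in> test_fun (- {0})" for f using eq[OF that] by (simp add: T_def)
  have Tadd: "T (\<lambda>x. f x + g x) = T f + T g" if "f \<in> test_fun UNIV" "g \<in> test_fun UNIV" for f g
    using linear_functional_add[OF lin(1) that] linear_functional_add[OF lin(2) that] by (simp add: T_def)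
  \<comment> \<open>This cutoff is 1 for |x| <= r/3 and 0 for |x| >= 2r/3: it isolates the part of
    phi inside the interval of the normal form, and the rest is supported off 0.\<close>
  define h where "h x = cutoff ((3 / r) * x)" for x
  have h: "smooth_on UNIV h" unfolding h_def[abs_def] by (rule smooth_on_scale[OF smooth_on_cutoff])
  have h_test: "h \<in> test_fun {-r<..<r}"
  proof (rule test_funI[OF h, of "{-(2 * r / 3)..2 * r / 3}"])
    show "h x = 0" if "x \<notin> {-(2 * r / 3)..2 * r / 3}" for x
    proof -
      have "\<bar>x\<bar> > 2 * r / 3" using that by (auto simp: abs_if)
      then have "\<bar>(3 / r) * x\<bar> \<ge> 2" using r(1) by (simp add: abs_mult field_simps)
      then show ?thesis unfolding h_def by (rule cutoff_0)
    qed
  qed (use r(1) in auto)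
  have h1: "h x = 1" if "\<bar>x\<bar> \<le> r / 3" for x
  proof -
    have "\<bar>(3 / r) * x\<bar> \<le> 1" using that r(1) by (simp add: abs_mult field_simps)
    then show ?thesis unfolding h_def by (rule cutoff_1)
  qed
  define \<phi>0 where "\<phi>0 x = \<phi> x * h x" for x
  have \<phi>0: "\<phi>0 \<in> test_fun {-r<..<r}" unfolding \<phi>0_def[abs_def]
    by (intro test_fun_mult h_test smooth_on_subset[OF test_fun_smooth[OF \<phi>]]) auto
  have \<phi>0U: "\<phi>0 \<in> test_fun UNIV" using test_fun_mono[OF \<phi>0] by auto
  have d0: "(\<lambda>x. \<phi> x + (-1) * \<phi>0 x) \<in> test_fun (- {0})"
  proof -
    have tf: "(\<lambda>x. \<phi> x + (-1) * \<phi>0 x) \<in> test_fun UNIV" by (intro test_fun_add test_fun_cmult \<phi> \<phi>0U)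
    then obtain K where K: "compact K" "\<And>x. x \<notin> K \<Longrightarrow> \<phi> x + (-1) * \<phi>0 x = 0" by (rule test_funE) blast
    obtain b where b: "\<forall>x\<in>K. norm x \<le> b" using compact_imp_bounded[OF K(1)] by (auto simp: bounded_iff)
    show ?thesis
    proof (rule test_fun_nonzeroI[of _ "r / 3" b])
      show "smooth_on (- {0}) (\<lambda>x. \<phi> x + (-1) * \<phi>0 x)" by (rule smooth_on_subset[OF test_fun_smooth[OF tf]]) auto
      show "\<phi> x + (-1) * \<phi>0 x = 0" if "\<bar>x\<bar> < r / 3" for x using h1[of x] that by (simp add: \<phi>0_def)
      show "\<phi> x + (-1) * \<phi>0 x = 0" if "b < \<bar>x\<bar>" for x using b that by (intro K(2)) auto
    qed (use r(1) in auto)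
  qed
  have "T (\<lambda>x. \<phi>0 x + (\<phi> x + (-1) * \<phi>0 x)) = T \<phi>0 + T (\<lambda>x. \<phi> x + (-1) * \<phi>0 x)"
    by (rule Tadd[OF \<phi>0U test_fun_mono[OF d0]]) auto
  then have 1: "T \<phi> = T \<phi>0" using T0[OF d0] by simp
  obtain A where A: "A \<ge> 0" "\<And>n. ebound N (\<lambda>x. exp (- real n) * wt 1 x) (\<lambda>x. annulus_cutoff n x - 1) A"
    using ebound_annulus_tail[of N] by blast
  obtain B where B: "ebound N (wt 0) \<phi>0 B" using moderate_test_fun[OF \<phi>0] by (rule moderateE)
  note s0 = moderate_smooth[OF moderate_test_fun[OF \<phi>0]]
  have "norm (T \<phi>0) \<le> C * (2 ^ N * (A * B)) * exp (- real n)" for n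
  proof -
    have sn: "smooth_on UNIV (\<lambda>x. annulus_cutoff n x + (-1))"
      by (intro smooth_on_add smooth_on_annulus_cutoff smooth_on_const) auto
    let ?f = "\<lambda>x. (annulus_cutoff n x - 1) * \<phi>0 x"
    have f: "?f \<in> test_fun {-r<..<r}"
      using smooth_on_subset[OF sn] by (intro test_fun_mult \<phi>0) simp_all
    have "ebound N (\<lambda>x. exp (- real n) * wt 1 x * wt 0 x) ?f (2 ^ N * (A * B))"
      using smooth_on_subset[OF sn] by (intro ebound_mult A(2) B s0) simp_all
    then have "ebound N (wt (real 1)) ?f (2 ^ N * (A * B) * exp (- real n))"
      by (rule ebound_mono) auto
    then have 2: "norm (T ?f) \<le> C * (2 ^ N * (A * B) * exp (- real n))" using CN(2) f by blast
    have nf: "(\<lambda>x. (-1) * ?f x) \<in> test_fun UNIV"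
      by (intro test_fun_cmult test_fun_mono[OF f]) auto
    have "T (\<lambda>x. annulus_cutoff n x * \<phi>0 x + (-1) * ?f x) = T (\<lambda>x. annulus_cutoff n x * \<phi>0 x) + T (\<lambda>x. (-1) * ?f x)"
      by (rule Tadd[OF test_fun_mono[OF annulus_cutoff_mult_test_fun[OF s0]] nf]) auto
    also have "T (\<lambda>x. annulus_cutoff n x * \<phi>0 x) = 0" by (rule T0[OF annulus_cutoff_mult_test_fun[OF s0]])
    also have "T (\<lambda>x. (-1) * ?f x) = (-1) * T ?f"
      using linear_functional_cmult[OF lin(1) test_fun_mono[OF f], of "-1"] linear_functional_cmult[OF lin(2) test_fun_mono[OF f], of "-1"]
      by (simp add: T_def)
    finally have "T \<phi>0 = - T ?f" by (simp add: algebra_simps)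
    then show ?thesis using 2 by (simp add: mult.assoc)
  qed
  moreover have "(\<lambda>n. C * (2 ^ N * (A * B)) * exp (- real n)) \<longlonglongrightarrow> C * (2 ^ N * (A * B)) * 0"
    by (intro tendsto_intros filterlim_compose[OF exp_at_bot] filterlim_compose[OF filterlim_uminus_at_bot_at_top] filterlim_real_sequentially)
  ultimately have "norm (T \<phi>0) \<le> C * (2 ^ N * (A * B)) * 0"
    by (intro LIMSEQ_le_const) auto
  then have "T \<phi> = 0" by (simp add: 1)
  then show ?thesis by (simp add: T_def)
qed

text \<open>Far to the right both families must vanish to order 1 at 0, hence agree by
  \<open>vanishing_distribution_unique\<close>. Analytic continuation in the common half-plane
  carries the equality to s.\<close>

lemma holomorphic_extension_unique:
  assumes E: "holomorphic_extension d k \<rho> E" and E': "holomorphic_extension d k' \<rho> E'"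
    and s: "Re s > - real_of_int k" "Re s > - real_of_int k'" and \<phi>: "\<phi> \<in> test_fun UNIV"
  shows "E s \<phi> = E' s \<phi>"
proof -
  define m where "m = min k k'"
  \<comment> \<open>Beyond this abscissa Re z - 1 + k >= 1 for both orders, so l = 1 is among the
    prescribed orders of vanishing.\<close>
  define b where "b = 2 - real_of_int m"
  have large: "E z \<phi> = E' z \<phi>" if z: "Re z > b" for z
  proof -
    have zk: "Re z > - real_of_int k" "Re z > - real_of_int k'" "real_of_int 1 \<le> Re z - 1 + real_of_int k"
      "real_of_int 1 \<le> Re z - 1 + real_of_int k'" using z by (auto simp: b_def m_def)
    show ?thesis
    proof (rule vanishing_distribution_unique[OF _ _ _ _ _ \<phi>])
      show "linear_functional_on (test_fun UNIV) (E z)" "linear_functional_on (test_fun UNIV) (E' z)"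
        using E E' zk by (simp_all add: holomorphic_extension_def distribution_on_def)
      show "E z \<psi> = E' z \<psi>" if "\<psi> \<in> test_fun (- {0})" for \<psi>
        using E E' zk that by (simp add: holomorphic_extension_def)
      show "vanishes_to_order 0 1 (E z)" "vanishes_to_order 0 1 (E' z)"
        using E E' zk by (auto simp: holomorphic_extension_def)
    qed
  qed
  show ?thesis
  proof (rule analytic_continuation_open[where s = "{z. Re z > b}" and s' = "{z. Re z > - real_of_int m}" and f = "\<lambda>z. E z \<phi>" and g = "\<lambda>z. E' z \<phi>"])
    show "open {z. Re z > b}" "open {z. Re z > - real_of_int m}" by (simp_all add: open_halfspace_Re_gt)
    show "{z. Re z > b} \<noteq> {}" by (auto intro!: exI[of _ "of_real (b + 1)"])
    show "connected {z. Re z > - real_of_int m}" by (intro convex_connected convex_halfspace_Re_gt)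
    show "{z. Re z > b} \<subseteq> {z. Re z > - real_of_int m}" by (auto simp: b_def)
    show "(\<lambda>z. E z \<phi>) holomorphic_on {z. Re z > - real_of_int m}"
      using E \<phi> by (auto simp: holomorphic_extension_def m_def intro: holomorphic_on_subset)
    show "(\<lambda>z. E' z \<phi>) holomorphic_on {z. Re z > - real_of_int m}"
      using E' \<phi> by (auto simp: holomorphic_extension_def m_def intro: holomorphic_on_subset)
  qed (use large s in \<open>auto simp: m_def\<close>)
qed

section \<open>Behaviour under x -> 1/x\<close>

text \<open>In the coordinate ln |x| inversion is reflection, which reverses the sign of
  d/du.\<close>

lemma euler_inverse_compose:
  assumes "smooth_on (- {0}) f" "x \<noteq> 0"
  shows "(euler ^^ j) (\<lambda>x. f (1 / x)) x = (-1) ^ j * (euler ^^ j) f (1 / x)"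
  using assms
proof (induction j arbitrary: f)
  case (Suc j)
  have "(euler ^^ j) (euler (\<lambda>x. f (1 / x))) x = (euler ^^ j) (\<lambda>x. (-1) * euler f (1 / x)) x"
  proof (rule euler_cong[OF open_nonzero])
    fix y :: real assume y: "y \<in> - {0}"
    have "((\<lambda>x. 1 / x) has_vector_derivative - (1 / y ^ 2)) (at y)"
      unfolding has_real_derivative_iff_has_vector_derivative[symmetric]
      using y by (auto intro!: derivative_eq_intros simp: power2_eq_square)
    from vector_diff_chain_at[OF this smooth_onD0[OF Suc.prems(1), of "1 / y"]] y
    have "((\<lambda>x. f (1 / x)) has_vector_derivative - (1 / y ^ 2) *\<^sub>R nderiv 1 f (1 / y)) (at y)" by (simp add: o_def)
    from vector_derivative_at[OF this] show "euler (\<lambda>x. f (1 / x)) y = (-1) * euler f (1 / y)"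
      using y by (simp add: euler_def nderiv_1[of "\<lambda>x. f (1 / x)"] scaleR_conv_of_real power2_eq_square del: One_nat_def)
  qed (use Suc.prems in auto)
  also have "\<dots> = (-1) * (euler ^^ j) (\<lambda>x. euler f (1 / x)) x"
  proof (rule euler_cmult[OF open_nonzero])
    show "smooth_on (- {0}) (\<lambda>x. euler f (1 / x))"
      by (rule smooth_on_inv_compose[OF open_nonzero _ open_nonzero _ smooth_on_euler[OF open_nonzero Suc.prems(1), of 1, simplified]]) auto
  qed (use Suc.prems in auto)
  also have "(euler ^^ j) (\<lambda>x. euler f (1 / x)) x = (-1) ^ j * (euler ^^ j) (euler f) (1 / x)"
    using smooth_on_euler[OF open_nonzero Suc.prems(1), of 1] Suc.prems(2) by (intro Suc.IH) auto
  finally show ?case by (simp add: euler_power_Suc del: funpow.simps)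
qed simp

text \<open>Reading the Jacobian as an even signed power of exponent -2 makes the weighted product
  estimates applicable to inversion.\<close>

lemma inversion_eq: "x \<noteq> 0 \<Longrightarrow> inversion f x = signed_power 0 (-2) x * f (1 / x)"
proof -
  assume x: "x \<noteq> 0"
  have "signed_power 0 (-2) x = of_real (exp (-2 * ln \<bar>x\<bar>))" using x by (simp add: signed_power_eq exp_of_real[symmetric])
  also have "exp (-2 * ln \<bar>x\<bar>) = 1 / x ^ 2"
    using x exp_of_nat_mult[of 2 "ln \<bar>x\<bar>"] by (simp add: exp_minus divide_inverse)
  finally show ?thesis by (simp add: inversion_def)
qed

lemma inversion_0 [simp]: "inversion f 0 = 0"
  by (simp add: inversion_def)

lemma inversion_inversion: "f 0 = 0 \<Longrightarrow> inversion (inversion f) = f"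
proof
  fix y assume "f 0 = 0"
  then show "inversion (inversion f) y = f y"
    by (cases "y = 0") (simp_all add: inversion_def power_divide)
qed

lemma smooth_on_inverse_compose_off_0: "smooth_on (- {0}) f \<Longrightarrow> smooth_on (- {0}) (\<lambda>x. f (1 / x))"
  by (rule smooth_on_inv_compose[OF open_nonzero _ open_nonzero]) auto

lemma smooth_on_inversion:
  assumes "smooth_on (- {0}) f"
  shows "smooth_on (- {0}) (inversion f)"
  by (rule smooth_on_cong[OF open_nonzero _ smooth_on_mult[OF open_nonzero smooth_on_signed_power[of 0 "-2"] smooth_on_inverse_compose_off_0[OF assms]]])
    (simp add: inversion_eq)

lemma ebound_inverse_compose:
  assumes "smooth_on (- {0}) f" "ebound N (wt K) f B"
  shows "ebound N (wt K) (\<lambda>x. f (1 / x)) B"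
  unfolding ebound_def
proof (intro allI impI)
  fix j and x :: real assume j: "j \<le> N" and x: "x \<noteq> 0"
  have "norm ((euler ^^ j) f (1 / x)) \<le> B * wt K (1 / x)"
    using assms(2)[unfolded ebound_def, rule_format, OF j, of "1 / x"] x by simp
  then show "norm ((euler ^^ j) (\<lambda>x. f (1 / x)) x) \<le> B * wt K x"
    by (simp add: euler_inverse_compose[OF assms(1) x] norm_mult norm_power)
qed

lemma moderate_inverse_compose:
  assumes "moderate K f" shows "moderate K (\<lambda>x. f (1 / x))"
  unfolding moderate_def
proof (intro conjI allI)
  show "smooth_on (- {0}) (\<lambda>x. f (1 / x))" by (rule smooth_on_inverse_compose_off_0[OF moderate_smooth[OF assms]])
  fix N
  obtain B where "ebound N (wt K) f B" using assms by (rule moderateE)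
  from ebound_inverse_compose[OF moderate_smooth[OF assms] this]
  show "\<exists>B. ebound N (wt K) (\<lambda>x. f (1 / x)) B" by (rule exI)
qed

text \<open>The Jacobian raises the weight by 2; the factor 3^N is (1 + |-2|)^N from
  \<open>ebound_signed_power\<close>.\<close>

lemma ebound_inversion:
  assumes "smooth_on (- {0}) f" "ebound N (wt K) f B"
  shows "ebound N (wt (2 + K)) (inversion f) (2 ^ N * (3 ^ N * B))"
proof -
  from ebound_wt_mult[OF smooth_on_signed_power smooth_on_inverse_compose_off_0[OF assms(1)] ebound_signed_power ebound_inverse_compose[OF assms], of "-2" 0]
  have "ebound N (wt (2 + K)) (\<lambda>x. signed_power 0 (-2) x * f (1 / x)) (2 ^ N * (3 ^ N * B))" by simp
  then show ?thesis by (rule ebound_cong[rotated]) (simp add: inversion_eq)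
qed

lemma inversion_test_fun:
  assumes "f \<in> test_fun (- {0})"
  shows "inversion f \<in> test_fun (- {0})"
proof -
  obtain e where e: "e > 0" "e < 1" "\<And>x. \<bar>x\<bar> < e \<Longrightarrow> f x = 0" "\<And>x. 1 / e < \<bar>x\<bar> \<Longrightarrow> f x = 0"
    using test_fun_nonzero[OF assms] by blast
  show ?thesis
  proof (rule test_fun_nonzeroI[of _ e "1 / e"])
    show "smooth_on (- {0}) (inversion f)"
      by (rule smooth_on_inversion[OF moderate_smooth[OF moderate_test_fun[OF assms]]])
    show "inversion f x = 0" if "\<bar>x\<bar> < e" for x
    proof (cases "x = 0")
      case False
      then have "1 / e < \<bar>1 / x\<bar>" using that e(1) by (simp add: field_simps)
      then show ?thesis using e(4) by (simp add: inversion_def)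
    qed simp
    show "inversion f x = 0" if "1 / e < \<bar>x\<bar>" for x
    proof -
      have "\<bar>x\<bar> > 0" using that e(1) by (meson less_trans zero_less_divide_1_iff)
      then have "\<bar>1 / x\<bar> < e" using that e(1) by (simp add: field_simps)
      then show ?thesis using e(3) by (simp add: inversion_def)
    qed
  qed (use e in auto)
qed

text \<open>Both sides are limits of the same sequence, since the annulus cutoffs are invariant
  under inversion.\<close>

lemma moderate_extension_inversion:
  "moderate_extension (\<lambda>\<psi>. \<rho> (inversion \<psi>)) f = moderate_extension \<rho> (inversion f)"
proof -
  have "inversion (\<lambda>x. annulus_cutoff n x * f x) = (\<lambda>x. annulus_cutoff n x * inversion f x)" for n
    by (simp add: fun_eq_iff inversion_def annulus_cutoff_inverse)
  then show ?thesis by (simp add: moderate_extension_def)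
qed

text \<open>Exponent s goes to -s - 2. With the shift by one in the Mellin kernel, s - 1 goes to -s
  - 1: inversion replaces the Mellin variable by its negative.\<close>

lemma inversion_signed_power:
  assumes "x \<noteq> 0"
  shows "inversion (\<lambda>y. signed_power d s y * f y) x = signed_power d (- s - 2) x * f (1 / x)"
proof -
  have "exp ((- s - 2) * of_real (ln \<bar>x\<bar>)) = exp (-2 * of_real (ln \<bar>x\<bar>)) * exp (s * of_real (- ln \<bar>x\<bar>))"
    by (simp add: exp_add[symmetric] algebra_simps)
  then show ?thesis using assms by (simp add: inversion_eq signed_power_eq sgn_divide ln_div)
qed

lemma complementary_cutoff_test_fun:
  assumes "\<phi> \<in> test_fun UNIV" "\<forall>\<^sub>F x in nhds 0. \<phi> x = 1"
  shows "complementary_cutoff \<phi> \<in> test_fun UNIV"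
proof -
  obtain K where K: "smooth_on UNIV \<phi>" "compact K" "\<And>x. x \<notin> K \<Longrightarrow> \<phi> x = 0" using assms(1) by (rule test_funE) blast
  obtain b where b: "b > 0" "\<forall>x\<in>K. norm x \<le> b" using compact_imp_bounded[OF K(2)] by (auto simp: bounded_pos)
  obtain e where e: "e > 0" "\<And>x. \<bar>x\<bar> < e \<Longrightarrow> \<phi> x = 1"
    using assms(2) unfolding eventually_nhds_metric by (auto simp: dist_norm)
  have 1: "complementary_cutoff \<phi> y = 1" if "\<bar>y\<bar> < 1 / b" for y
  proof (cases "y = 0")
    case False
    then have "b < \<bar>1 / y\<bar>" using that b(1) by (simp add: field_simps)
    then have "\<phi> (1 / y) = 0" using b(2) by (intro K(3)) auto
    then show ?thesis using False by (simp add: complementary_cutoff_def)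
  qed (simp add: complementary_cutoff_def)
  have "smooth_on (- {0}) (\<lambda>y. 1 + (-1) * \<phi> (1 / y))"
    by (intro smooth_on_add smooth_on_cmult smooth_on_const open_nonzero smooth_on_inverse_compose_off_0 smooth_on_subset[OF K(1)]) auto
  then have A: "smooth_on (- {0}) (complementary_cutoff \<phi>)"
    by (rule smooth_on_cong[OF open_nonzero, rotated]) (simp add: complementary_cutoff_def)
  have "smooth_on (ball 0 (1 / b)) (complementary_cutoff \<phi>)"
    by (rule smooth_on_cong[OF _ _ smooth_on_const[of _ 1]]) (use 1 in auto)
  from smooth_on_Un[OF A this] have "smooth_on UNIV (complementary_cutoff \<phi>)"
    by (rule smooth_on_subset) (use b(1) in auto)
  then show ?thesis
  proof (rule test_funI[of _ "{- (1 / e)..1 / e}"])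
    show "complementary_cutoff \<phi> y = 0" if "y \<notin> {- (1 / e)..1 / e}" for y
    proof -
      have "1 / e < \<bar>y\<bar>" using that by (auto simp: abs_if)
      moreover from this have "y \<noteq> 0" using e(1) by (auto simp: field_simps)
      ultimately have "\<bar>1 / y\<bar> < e" using e(1) by (simp add: field_simps)
      then show ?thesis using \<open>y \<noteq> 0\<close> by (simp add: complementary_cutoff_def e(2))
    qed
  qed auto
qed

text \<open>Uniqueness identifies \<open>E\<close> and \<open>F\<close> with the families built by
  exhaustion. Inverting the second term turns its cutoff into 1 - phi, so both terms add up to the
  full signed power, independently of all choices.\<close>

lemma mellin_value:
  assumes reg: "regular_off_0 \<sigma>" "regular_off_0 (\<lambda>\<psi>. \<sigma> (inversion \<psi>))"
    and E: "holomorphic_extension d k0 \<sigma> E" and F: "holomorphic_extension d kinf (\<lambda>\<psi>. \<sigma> (inversion \<psi>)) F"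
    and s: "- real_of_int k0 < Re s" "Re s < real_of_int kinf"
    and \<phi>: "\<phi> \<in> test_fun UNIV" "\<forall>\<^sub>F x in nhds 0. \<phi> x = 1"
  shows "E s \<phi> + F (- s) (complementary_cutoff \<phi>) = moderate_extension \<sigma> (signed_power d (s - 1))"
proof -
  let ?cc = "complementary_cutoff \<phi>"
  note lin = regular_off_0D(1)[OF reg(1)] and wb = regular_off_0D(2)[OF reg(1)]
  have cc: "?cc \<in> test_fun UNIV" by (rule complementary_cutoff_test_fun[OF \<phi>])
  have "E s \<phi> = moderate_extension \<sigma> (\<lambda>x. signed_power d (s - 1) x * \<phi> x)"
    using holomorphic_extension_unique[OF E holomorphic_extension_exists[OF reg(1), of d k0] s(1) s(1) \<phi>(1)] by simp
  moreover have "F (- s) ?cc = moderate_extension (\<lambda>\<psi>. \<sigma> (inversion \<psi>)) (\<lambda>x. signed_power d (- s - 1) x * ?cc x)"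
    using holomorphic_extension_unique[OF F holomorphic_extension_exists[OF reg(2), of d kinf] _ _ cc, of "- s"] s(2) by simp
  moreover have "moderate_extension (\<lambda>\<psi>. \<sigma> (inversion \<psi>)) (\<lambda>x. signed_power d (- s - 1) x * ?cc x) =
      moderate_extension \<sigma> (\<lambda>x. signed_power d (s - 1) x * (1 + (-1) * \<phi> x))"
    unfolding moderate_extension_inversion
    by (rule moderate_extension_cong) (simp add: inversion_signed_power complementary_cutoff_def)
  moreover have m1: "moderate (\<bar>Re (s - 1)\<bar> + 0) (\<lambda>x. signed_power d (s - 1) x * \<phi> x)"
    by (intro moderate_mult moderate_signed_power moderate_test_fun[OF \<phi>(1)])
  moreover have m2: "moderate (\<bar>Re (s - 1)\<bar> + 0) (\<lambda>x. signed_power d (s - 1) x * (1 + (-1) * \<phi> x))"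
    by (intro moderate_mult moderate_signed_power moderate_add moderate_const moderate_cmult moderate_test_fun[OF \<phi>(1)])
  ultimately have "E s \<phi> + F (- s) ?cc =
      moderate_extension \<sigma> (\<lambda>x. signed_power d (s - 1) x * \<phi> x + signed_power d (s - 1) x * (1 + (-1) * \<phi> x))"
    by (simp only: moderate_extension_add[OF lin wb m1 m2])
  also have "\<dots> = moderate_extension \<sigma> (signed_power d (s - 1))"
    by (rule arg_cong[where f = "moderate_extension \<sigma>"], rule ext) (simp add: distrib_left[symmetric])
  finally show ?thesis .
qed

section \<open>The source space off the origin\<close>

lemma schwartzD:
  assumes "\<phi> \<in> schwartz"
  shows "smooth_on UNIV \<phi>" "bounded (range (\<lambda>x. of_real x ^ m * nderiv n \<phi> x))"
  using assms by (auto simp: schwartz_def)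

lemma schwartz_le_SUP:
  assumes "\<phi> \<in> schwartz"
  shows "norm (of_real x ^ m * nderiv n \<phi> x) \<le> (SUP x. norm (of_real x ^ m * nderiv n \<phi> x))"
  using schwartzD(2)[OF assms, of m n] by (intro cSUP_upper) (auto simp: bounded_iff bdd_above_def)

lemma test_fun_schwartz:
  assumes "f \<in> test_fun A"
  shows "f \<in> schwartz"
  unfolding schwartz_def
proof (intro CollectI conjI allI)
  show "smooth_on UNIV f" by (rule test_fun_smooth[OF assms])
  fix m n
  have "(\<lambda>x. of_real x ^ m * nderiv n f x) \<in> test_fun UNIV"
    using test_fun_mono[OF nderiv_test_fun[OF assms]]
    by (intro test_fun_mult smooth_on_power smooth_on_of_real) auto
  from test_fun_bounded[OF this, of 0] show "bounded (range (\<lambda>x. of_real x ^ m * nderiv n f x))" by simp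
qed

lemma schwartz_mult:
  assumes g: "smooth_on UNIV g" "\<And>n. bounded (range (nderiv n g))" and \<phi>: "\<phi> \<in> schwartz"
  shows "(\<lambda>x. g x * \<phi> x) \<in> schwartz"
  unfolding schwartz_def
proof (intro CollectI conjI allI)
  note s = schwartzD(1)[OF \<phi>]
  show "smooth_on UNIV (\<lambda>x. g x * \<phi> x)" by (intro smooth_on_mult g s open_UNIV)
  fix m n
  have "bounded (range (\<lambda>x. nderiv i g x * (of_real x ^ m * nderiv (n - i) \<phi> x)))" for i
  proof -
    obtain A where A: "\<And>x. norm (nderiv i g x) \<le> A" using g(2)[of i] by (auto simp: bounded_iff)
    obtain B where B: "\<And>x. norm (of_real x ^ m * nderiv (n - i) \<phi> x) \<le> B"
      using schwartzD(2)[OF \<phi>, of m "n - i"] by (auto simp: bounded_iff)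
    have "norm (nderiv i g x * (of_real x ^ m * nderiv (n - i) \<phi> x)) \<le> A * B" for x
      unfolding norm_mult[of "nderiv i g x"] by (rule mult_mono'[OF A B]) auto
    then show ?thesis by (auto simp: bounded_iff)
  qed
  then obtain C where C: "\<And>i x. norm (nderiv i g x * (of_real x ^ m * nderiv (n - i) \<phi> x)) \<le> C i"
    unfolding bounded_iff by (simp, metis)
  have "norm (of_real x ^ m * nderiv n (\<lambda>x. g x * \<phi> x) x) \<le> (\<Sum>i\<le>n. of_nat (n choose i) * C i)" for x
  proof -
    have "of_real x ^ m * nderiv n (\<lambda>x. g x * \<phi> x) x =
        (\<Sum>i\<le>n. of_nat (n choose i) * (nderiv i g x * (of_real x ^ m * nderiv (n - i) \<phi> x)))"
      unfolding nderiv_mult[OF open_UNIV g(1) s UNIV_I] by (simp add: sum_distrib_left mult_ac)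
    also have "norm \<dots> \<le> (\<Sum>i\<le>n. of_nat (n choose i) * C i)"
      by (rule order_trans[OF norm_sum sum_mono]) (simp add: norm_mult[of "of_nat _"] mult_left_mono[OF C])
    finally show ?thesis .
  qed
  then show "bounded (range (\<lambda>x. of_real x ^ m * nderiv n (\<lambda>x. g x * \<phi> x) x))" by (auto simp: bounded_iff)
qed

lemma schwartz_cmult: "\<phi> \<in> schwartz \<Longrightarrow> (\<lambda>x. c * \<phi> x) \<in> schwartz"
  by (rule schwartz_mult) (auto simp: smooth_on_const nderiv_const[OF open_UNIV UNIV_I] bounded_iff image_iff)

lemma schwartz_add:
  assumes "\<phi> \<in> schwartz" "\<psi> \<in> schwartz"
  shows "(\<lambda>x. \<phi> x + \<psi> x) \<in> schwartz"
  unfolding schwartz_def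
proof (intro CollectI conjI allI)
  note s = schwartzD(1)[OF assms(1)] schwartzD(1)[OF assms(2)]
  show "smooth_on UNIV (\<lambda>x. \<phi> x + \<psi> x)" by (intro smooth_on_add s open_UNIV)
  fix m n
  show "bounded (range (\<lambda>x. of_real x ^ m * nderiv n (\<lambda>x. \<phi> x + \<psi> x) x))"
    unfolding nderiv_add[OF open_UNIV s UNIV_I] distrib_left
    by (intro bounded_plus_comp schwartzD(2) assms)
qed

lemma tempered_linear: "tempered_distribution \<sigma> \<Longrightarrow> linear_functional_on schwartz \<sigma>"
  by (simp add: tempered_distribution_def)

lemma linear_functional_subset: "linear_functional_on V L \<Longrightarrow> W \<subseteq> V \<Longrightarrow> linear_functional_on W L"
  unfolding linear_functional_on_def by blast

text \<open>Away from \<open>0\<close> the Schwartz seminorms are dominated by the weighted Euler bounds.\<close>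

lemma tempered_estimate:
  assumes "tempered_distribution \<sigma>"
  obtains C N where "C \<ge> 0" "\<forall>f\<in>schwartz. \<forall>e>0. (\<forall>x. \<bar>x\<bar> < e \<longrightarrow> f x = 0) \<longrightarrow>
    (\<forall>B. ebound N (wt (- real N)) f B \<longrightarrow> norm (\<sigma> f) \<le> C * B)"
proof -
  obtain C0 N where C0: "\<forall>\<phi>\<in>schwartz. norm (\<sigma> \<phi>) \<le>
        C0 * (\<Sum>m\<le>N. \<Sum>n\<le>N. SUP x. norm (of_real x ^ m * nderiv n \<phi> x))"
    using assms unfolding tempered_distribution_def by (elim exE conjE) (rule that)
  define P where "P j C \<longleftrightarrow> C \<ge> 0 \<and> (\<forall>U f x. open U \<and> smooth_on U f \<and> x \<in> U \<longrightarrow>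
     \<bar>x\<bar> ^ j * norm (nderiv j f x) \<le> C * (\<Sum>i\<le>j. norm ((euler ^^ i) f x)))" for j C
  have "\<forall>j. \<exists>C. P j C" unfolding P_def by (intro allI norm_nderiv_le)
  then obtain D where "\<forall>j. P j (D j)" by (rule choice[THEN exE])
  then have D: "D j \<ge> 0" "open U \<and> smooth_on U f \<and> x \<in> U \<longrightarrow>
     \<bar>x\<bar> ^ j * norm (nderiv j f x) \<le> D j * (\<Sum>i\<le>j. norm ((euler ^^ i) f x))" for j U f x
    unfolding P_def by simp_all
  define E where "E = (\<Sum>m\<le>N. \<Sum>n\<le>N. D n * (real n + 1))"
  have E0: "E \<ge> 0" unfolding E_def by (intro sum_nonneg mult_nonneg_nonneg D) auto
  have "norm (\<sigma> f) \<le> (\<bar>C0\<bar> * E) * B"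
    if f: "f \<in> schwartz" "e > 0" "\<forall>x. \<bar>x\<bar> < e \<longrightarrow> f x = 0" and B: "ebound N (wt (- real N)) f B" for f e B
  proof -
    have sm: "smooth_on UNIV f" by (rule schwartzD[OF f(1)])
    have B0: "B \<ge> 0" using B by (rule ebound_nonneg)
    have pt: "norm (of_real x ^ m * nderiv n f x) \<le> D n * (real n + 1) * B" if mn: "m \<le> N" "n \<le> N" for m n x
    proof (cases "x = 0")
      case True
      have "nderiv n f x = 0"
        by (rule nderiv_zero_outside[of "- ball 0 e"]) (use f True in auto)
      then show ?thesis using D(1) B0 by simp
    next
      case False
      have "\<bar>x\<bar> ^ n * norm (nderiv n f x) \<le> D n * (\<Sum>i\<le>n. norm ((euler ^^ i) f x))"
        using D(2)[where U = UNIV and f = f and x = x and j = n] sm by simp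
      also have "\<dots> \<le> D n * (\<Sum>i\<le>n. B * wt (- real N) x)"
        using mn False B by (intro mult_left_mono sum_mono D(1)) (auto simp: ebound_def)
      also have "\<dots> = D n * (real n + 1) * B * wt (- real N) x" by simp
      finally have 1: "\<bar>x\<bar> ^ n * norm (nderiv n f x) \<le> D n * (real n + 1) * B * wt (- real N) x" .
      \<comment> \<open>For |x| >= 1 this is m <= N + n; for |x| < 1 the left side is at most 1, and
        the weight is at least |x|^(-n).\<close>
      have "\<bar>x\<bar> ^ m \<le> wt (real N) x * \<bar>x\<bar> ^ n"
      proof (cases "\<bar>x\<bar> \<ge> 1")
        case True
        have "\<bar>x\<bar> ^ m \<le> \<bar>x\<bar> ^ (N + n)" using True mn by (intro power_increasing) auto
        then show ?thesis using True by (simp add: power_add power_wt')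
      next
        case F: False
        have "wt (real N) x * \<bar>x\<bar> ^ n \<ge> wt (real n) x * \<bar>x\<bar> ^ n" using mn by (intro mult_right_mono wt_mono) auto
        moreover have "wt (real n) x * \<bar>x\<bar> ^ n = 1" using power_mult_wt[OF False, of n] F by (simp add: mult.commute)
        moreover have "\<bar>x\<bar> ^ m \<le> 1" using F by (intro power_le_one) auto
        ultimately show ?thesis by linarith
      qed
      then have "\<bar>x\<bar> ^ m * norm (nderiv n f x) \<le> wt (real N) x * \<bar>x\<bar> ^ n * norm (nderiv n f x)"
        by (intro mult_right_mono) auto
      also have "\<dots> \<le> wt (real N) x * (D n * (real n + 1) * B * wt (- real N) x)"
        using mult_left_mono[OF 1 wt_pos(2)[of "real N" x]] by (simp add: mult.assoc)
      also have "\<dots> = D n * (real n + 1) * B * (wt (real N) x * wt (- real N) x)" by simp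
      also have "wt (real N) x * wt (- real N) x = 1" using wt_add[of "real N" "- real N" x] by simp
      finally show ?thesis by (simp add: norm_mult norm_power)
    qed
    have "norm (\<sigma> f) \<le> C0 * (\<Sum>m\<le>N. \<Sum>n\<le>N. SUP x. norm (of_real x ^ m * nderiv n f x))"
      using C0 f(1) by simp
    also have "\<dots> \<le> \<bar>C0\<bar> * (\<Sum>m\<le>N. \<Sum>n\<le>N. SUP x. norm (of_real x ^ m * nderiv n f x))"
      using order_trans[OF norm_ge_zero schwartz_le_SUP[OF f(1)]]
      by (intro mult_right_mono sum_nonneg) auto
    also have "\<dots> \<le> \<bar>C0\<bar> * (\<Sum>m\<le>N. \<Sum>n\<le>N. D n * (real n + 1) * B)"
      by (intro mult_left_mono sum_mono cSUP_least pt) auto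
    also have "\<dots> = (\<bar>C0\<bar> * E) * B" by (simp add: E_def sum_distrib_right mult.assoc)
    finally show ?thesis .
  qed
  then show thesis using E0 by (intro that[of "\<bar>C0\<bar> * E" N]) auto
qed

lemma test_fun_punctured:
  assumes "f \<in> test_fun (- {0})" "a < r" "\<And>x. \<bar>x\<bar> > a \<Longrightarrow> f x = 0"
  shows "f \<in> test_fun ({-r<..<r} - {0})"
proof -
  obtain K where K: "smooth_on UNIV f" "compact K" "K \<subseteq> - {0}" "\<And>x. x \<notin> K \<Longrightarrow> f x = 0"
    using assms(1) by (rule test_funE) blast
  show ?thesis
  proof (rule test_funI[OF K(1), of "K \<inter> {-a..a}"])
    show "f x = 0" if "x \<notin> K \<inter> {-a..a}" for x
    proof (cases "x \<in> K")
      case True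
      then have "\<bar>x\<bar> > a" using that by (auto simp: abs_if)
      then show ?thesis by (rule assms(3))
    qed (rule K(4))
  qed (use K assms(2) in \<open>auto intro: compact_Int\<close>)
qed

definition zero_cutoff :: "real \<Rightarrow> real \<Rightarrow> complex" where
  "zero_cutoff r x = cutoff ((3 / r) * x)"

lemma zero_cutoff:
  assumes "r > 0"
  shows "zero_cutoff r \<in> test_fun {-r<..<r}" "\<bar>x\<bar> \<le> r / 3 \<Longrightarrow> zero_cutoff r x = 1"
    "\<bar>x\<bar> > 2 * r / 3 \<Longrightarrow> zero_cutoff r x = 0"
proof -
  show 0: "zero_cutoff r x = 0" if "\<bar>x\<bar> > 2 * r / 3" for x
  proof -
    have "\<bar>(3 / r) * x\<bar> \<ge> 2" using that assms by (simp add: abs_mult field_simps)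
    then show ?thesis unfolding zero_cutoff_def by (rule cutoff_0)
  qed
  show "zero_cutoff r x = 1" if "\<bar>x\<bar> \<le> r / 3"
  proof -
    have "\<bar>(3 / r) * x\<bar> \<le> 1" using that assms by (simp add: abs_mult field_simps)
    then show ?thesis unfolding zero_cutoff_def by (rule cutoff_1)
  qed
  show "zero_cutoff r \<in> test_fun {-r<..<r}"
  proof (rule test_funI[of _ "{-(2 * r / 3)..2 * r / 3}"])
    show "smooth_on UNIV (zero_cutoff r)"
      unfolding zero_cutoff_def[abs_def] by (rule smooth_on_scale[OF smooth_on_cutoff])
    show "zero_cutoff r x = 0" if "x \<notin> {-(2 * r / 3)..2 * r / 3}" for x
      using that by (intro 0) (auto simp: abs_if)
  qed (use assms in auto)
qed

section \<open>Weight bounds and regularity of the source\<close>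

text \<open>A partition into parts near 0, near infinity and in between: the two normal forms
  control the ends, the tempered bound the middle. The order at infinity is k + 2 because inverting
  the test function costs weight 2.\<close>

lemma weight_bounded_glue:
  assumes temp: "tempered_distribution \<sigma>"
    and r0: "r0 > 0" "r0 < 1" "normal_form k ({-r0<..<r0} - {0}) \<sigma>"
    and r1: "r1 > 0" "r1 < 1" "normal_form (k + 2) ({-r1<..<r1} - {0}) (\<lambda>\<psi>. \<sigma> (inversion \<psi>))"
  shows "weight_bounded (real k) \<sigma>"
proof -
  have lin: "linear_off_0 \<sigma>"
    using tempered_linear[OF temp] by (rule linear_functional_subset) (auto intro: test_fun_schwartz)
  obtain C0 N0 where C0: "C0 \<ge> 0" "\<forall>\<phi>\<in>test_fun ({-r0<..<r0} - {0}). \<forall>B. ebound N0 (wt (real k)) \<phi> B \<longrightarrow> norm (\<sigma> \<phi>) \<le> C0 * B"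
    using r0(3) by (rule normal_form_estimate) (use r0 in auto)
  obtain C1 N1 where C1: "C1 \<ge> 0" "\<forall>\<phi>\<in>test_fun ({-r1<..<r1} - {0}). \<forall>B. ebound N1 (wt (real (k + 2))) \<phi> B \<longrightarrow> norm (\<sigma> (inversion \<phi>)) \<le> C1 * B"
    using r1(3) by (rule normal_form_estimate) (use r1 in auto)
  obtain C2 N2 where C2: "C2 \<ge> 0" "\<forall>f\<in>schwartz. \<forall>e>0. (\<forall>x. \<bar>x\<bar> < e \<longrightarrow> f x = 0) \<longrightarrow>
    (\<forall>B. ebound N2 (wt (- real N2)) f B \<longrightarrow> norm (\<sigma> f) \<le> C2 * B)"
    using temp by (rule tempered_estimate)
  define N where "N = max N0 (max N1 N2)"
  have N: "N0 \<le> N" "N1 \<le> N" "N2 \<le> N" by (auto simp: N_def)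
  let ?c0 = "zero_cutoff r0"
  let ?c1 = "\<lambda>x. zero_cutoff r1 (1 / x)"
  have m0: "moderate 0 ?c0" by (rule moderate_test_fun[OF zero_cutoff(1)[OF r0(1)]])
  have m1: "moderate 0 ?c1" by (rule moderate_inverse_compose[OF moderate_test_fun[OF zero_cutoff(1)[OF r1(1)]]])
  have m2: "moderate 0 (\<lambda>x. 1 + (-1) * (?c0 x + ?c1 x))"
    by (intro moderate_add moderate_cmult moderate_const m0 m1)
  obtain A0 where A0: "ebound N (wt 0) ?c0 A0" using m0 by (rule moderateE)
  obtain A1 where A1: "ebound N (wt 0) ?c1 A1" using m1 by (rule moderateE)
  obtain A2 where A2: "ebound N (wt 0) (\<lambda>x. 1 + (-1) * (?c0 x + ?c1 x)) A2" using m2 by (rule moderateE)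
  \<comment> \<open>The middle part lives on r0/3 <= |x| <= 3/r1. There \<open>W\<close> bounds the
    weight of exponent k + N2, the price of passing from weight k to the weight -N2 of the tempered
    estimate.\<close>
  define W where "W = exp ((real k + real N2) * (\<bar>ln (r0 / 3)\<bar> + \<bar>ln (r1 / 3)\<bar>))"
  define C where "C = C0 * (2 ^ N * A0) + C1 * (2 ^ N * (3 ^ N * (2 ^ N * A1))) + C2 * (W * (2 ^ N * A2))"
  have "norm (\<sigma> f) \<le> C * B" if f: "f \<in> test_fun (- {0})" and B: "ebound N (wt (real k)) f B" for f B
  proof -
    have B0: "B \<ge> 0" using B by (rule ebound_nonneg)
    have sf: "smooth_on (- {0}) f" by (rule moderate_smooth[OF moderate_test_fun[OF f]])
    define f0 where "f0 x = ?c0 x * f x" for x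
    define f1 where "f1 x = ?c1 x * f x" for x
    define f2 where "f2 x = (1 + (-1) * (?c0 x + ?c1 x)) * f x" for x
    have t: "f0 \<in> test_fun (- {0})" "f1 \<in> test_fun (- {0})" "f2 \<in> test_fun (- {0})"
      unfolding f0_def[abs_def] f1_def[abs_def] f2_def[abs_def]
      by (intro test_fun_mult open_nonzero f moderate_smooth[OF m0] moderate_smooth[OF m1] moderate_smooth[OF m2])+
    have e: "ebound N (wt (real k)) f0 (2 ^ N * (A0 * B))" "ebound N (wt (real k)) f1 (2 ^ N * (A1 * B))"
      "ebound N (wt (real k)) f2 (2 ^ N * (A2 * B))"
      unfolding f0_def[abs_def] f1_def[abs_def] f2_def[abs_def]
      using ebound_wt_mult[OF moderate_smooth[OF m0] sf A0 B] ebound_wt_mult[OF moderate_smooth[OF m1] sf A1 B]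
        ebound_wt_mult[OF moderate_smooth[OF m2] sf A2 B] by simp_all
    have 0: "norm (\<sigma> f0) \<le> C0 * (2 ^ N * (A0 * B))"
    proof (rule C0(2)[rule_format])
      show "f0 \<in> test_fun ({-r0<..<r0} - {0})"
        by (rule test_fun_punctured[OF t(1), of "2 * r0 / 3"]) (use r0(1) zero_cutoff(3)[OF r0(1)] in \<open>auto simp: f0_def\<close>)
      show "ebound N0 (wt (real k)) f0 (2 ^ N * (A0 * B))" by (rule ebound_wt_mono[OF e(1)]) (use N in auto)
    qed
    have 1: "norm (\<sigma> f1) \<le> C1 * (2 ^ N * (3 ^ N * (2 ^ N * (A1 * B))))"
    proof -
      have "norm (\<sigma> (inversion (inversion f1))) \<le> C1 * (2 ^ N * (3 ^ N * (2 ^ N * (A1 * B))))"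
      proof (rule C1(2)[rule_format])
        show "inversion f1 \<in> test_fun ({-r1<..<r1} - {0})"
          by (rule test_fun_punctured[OF inversion_test_fun[OF t(2)], of "2 * r1 / 3"])
            (use r1(1) zero_cutoff(3)[OF r1(1)] in \<open>auto simp: f1_def inversion_def\<close>)
        have "ebound N (wt (real (k + 2))) (inversion f1) (2 ^ N * (3 ^ N * (2 ^ N * (A1 * B))))"
          using ebound_inversion[OF moderate_smooth[OF moderate_test_fun[OF t(2)]] e(2)] by (simp add: add.commute)
        then show "ebound N1 (wt (real (k + 2))) (inversion f1) (2 ^ N * (3 ^ N * (2 ^ N * (A1 * B))))"
          by (rule ebound_wt_mono) (use N in auto)
      qed
      moreover have "f1 0 = 0" using test_fun_nonzero[OF t(2)] by (metis abs_zero)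
      ultimately show ?thesis by (simp add: inversion_inversion)
    qed
    have 2: "norm (\<sigma> f2) \<le> C2 * (W * (2 ^ N * (A2 * B)))"
    proof (rule C2(2)[rule_format])
      show "f2 \<in> schwartz" by (rule test_fun_schwartz[OF t(3)])
      have f2z: "f2 x = 0" if "\<bar>x\<bar> < r0 / 3 \<or> \<bar>x\<bar> > 3 / r1" for x
      proof (cases "x = 0")
        case True
        then show ?thesis using test_fun_nonzero[OF f] by (simp add: f2_def) (metis abs_zero)
      next
        case x: False
        from that show ?thesis
        proof
          assume a: "\<bar>x\<bar> < r0 / 3"
          have "1 / \<bar>x\<bar> > 1" using a r0(2) x by (simp add: field_simps)
          then have "\<bar>1 / x\<bar> > 2 * r1 / 3" using r1(2) by (simp add: abs_divide)
          then show ?thesis using a zero_cutoff(2)[OF r0(1), of x] zero_cutoff(3)[OF r1(1), of "1 / x"] by (simp add: f2_def)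
        next
          assume a: "\<bar>x\<bar> > 3 / r1"
          have "3 / r1 > 3" using r1 by (simp add: field_simps)
          then have "\<bar>x\<bar> > 2 * r0 / 3" using a r0(2) by linarith
          moreover have "\<bar>1 / x\<bar> \<le> r1 / 3" using a r1(1) x by (simp add: abs_divide field_simps)
          ultimately show ?thesis using zero_cutoff(3)[OF r0(1), of x] zero_cutoff(2)[OF r1(1), of "1 / x"] by (simp add: f2_def)
        qed
      qed
      show "r0 / 3 > 0" using r0(1) by simp
      show "f2 x = 0" if "\<bar>x\<bar> < r0 / 3" for x using that f2z by blast
      show "ebound N2 (wt (- real N2)) f2 (W * (2 ^ N * (A2 * B)))"
        unfolding ebound_def
      proof (intro allI impI)
        fix j and x :: real assume j: "j \<le> N2" and x: "x \<noteq> 0"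
        have b0: "2 ^ N * (A2 * B) \<ge> 0" using ebound_nonneg[OF e(3)] .
        show "norm ((euler ^^ j) f2 x) \<le> W * (2 ^ N * (A2 * B)) * wt (- real N2) x"
        proof (cases "r0 / 3 \<le> \<bar>x\<bar> \<and> \<bar>x\<bar> \<le> 3 / r1")
          case True
          have w: "wt (real k + real N2) x \<le> W"
          proof -
            have "ln (r0 / 3) \<le> ln \<bar>x\<bar>" "ln \<bar>x\<bar> \<le> ln (3 / r1)" using True r0(1) r1(1) x by auto
            moreover have "ln (3 / r1) = - ln (r1 / 3)" using r1(1) by (simp add: ln_div)
            ultimately have "\<bar>ln \<bar>x\<bar>\<bar> \<le> \<bar>ln (r0 / 3)\<bar> + \<bar>ln (r1 / 3)\<bar>" by linarith
            then show ?thesis unfolding wt_def W_def by (simp add: mult_left_mono)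
          qed
          have "norm ((euler ^^ j) f2 x) \<le> 2 ^ N * (A2 * B) * wt (real k) x"
            using e(3) j N x by (auto simp: ebound_def)
          also have "wt (real k) x = wt (real k + real N2) x * wt (- real N2) x" by (simp add: wt_add[symmetric])
          also have "2 ^ N * (A2 * B) * (wt (real k + real N2) x * wt (- real N2) x) \<le> 2 ^ N * (A2 * B) * (W * wt (- real N2) x)"
            by (intro mult_left_mono mult_right_mono w b0) auto
          finally show ?thesis by (simp add: mult_ac)
        next
          case False
          have "(euler ^^ j) f2 x = 0"
          proof (rule euler_zero_outside[of "{y. r0 / 3 \<le> \<bar>y\<bar> \<and> \<bar>y\<bar> \<le> 3 / r1}"])
            show "closed {y. r0 / 3 \<le> \<bar>y\<bar> \<and> \<bar>y\<bar> \<le> 3 / r1}"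
              by (intro closed_Collect_conj closed_Collect_le continuous_intros)
          qed (use f2z False in auto)
          then show ?thesis using b0 by (simp add: W_def)
        qed
      qed
    qed
    have "(\<lambda>x. f0 x + (f1 x + f2 x)) = f" by (simp add: fun_eq_iff f0_def f1_def f2_def algebra_simps)
    then have "\<sigma> f = \<sigma> f0 + (\<sigma> f1 + \<sigma> f2)"
      using linear_functional_add[OF lin t(1) test_fun_add[OF t(2,3)]] linear_functional_add[OF lin t(2,3)] by simp
    then have "norm (\<sigma> f) \<le> norm (\<sigma> f0) + (norm (\<sigma> f1) + norm (\<sigma> f2))"
      by (metis norm_triangle_ineq norm_triangle_mono order_refl)
    then show ?thesis using 0 1 2 by (simp add: C_def algebra_simps)
  qed
  moreover have "C \<ge> 0"
    unfolding C_def W_def using C0(1) C1(1) C2(1) ebound_nonneg[OF A0] ebound_nonneg[OF A1] ebound_nonneg[OF A2] by simp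
  ultimately show ?thesis unfolding weight_bounded_def by (intro exI[of _ C] exI[of _ N]) simp
qed

lemma inversion_add: "inversion (\<lambda>x. f x + g x) = (\<lambda>x. inversion f x + inversion g x)"
  and inversion_cmult: "inversion (\<lambda>x. c * f x) = (\<lambda>x. c * inversion f x)"
  by (auto simp: inversion_def add_divide_distrib)

lemma linear_off_0_inversion:
  assumes "linear_off_0 \<rho>" shows "linear_off_0 (\<lambda>\<psi>. \<rho> (inversion \<psi>))"
  unfolding linear_functional_on_def inversion_add inversion_cmult
  using linear_functional_add[OF assms inversion_test_fun inversion_test_fun] linear_functional_cmult[OF assms inversion_test_fun] by simp

lemma weight_bounded_inversion:
  assumes "weight_bounded (2 + K) \<rho>" shows "weight_bounded K (\<lambda>\<psi>. \<rho> (inversion \<psi>))"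
proof -
  obtain C N where CN: "C \<ge> 0" "\<forall>f\<in>test_fun (- {0}). \<forall>B. ebound N (wt (2 + K)) f B \<longrightarrow> norm (\<rho> f) \<le> C * B"
    using assms by (rule weight_boundedE)
  have "norm (\<rho> (inversion f)) \<le> C * (2 ^ N * 3 ^ N) * B" if f: "f \<in> test_fun (- {0})" "ebound N (wt K) f B" for f B
    using CN(2)[rule_format, OF inversion_test_fun[OF f(1)] ebound_inversion[OF moderate_smooth[OF moderate_test_fun[OF f(1)]] f(2)]]
    by (simp add: mult.assoc)
  then show ?thesis unfolding weight_bounded_def
    using CN(1) by (intro exI[of _ "C * (2 ^ N * 3 ^ N)"] exI[of _ N]) simp
qed

text \<open>Away from its origin the chart at infinity of the extension is sigma composed with
  inversion, so vanishing at infinity supplies the normal forms of the inverted functional. The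
  weight bounds follow by gluing.\<close>

lemma mellin_source_regular:
  assumes "\<sigma> \<in> mellin_source d"
  shows "regular_off_0 \<sigma>" "regular_off_0 (\<lambda>\<psi>. \<sigma> (inversion \<psi>))"
proof -
  have temp: "tempered_distribution \<sigma>" and van: "vanishes_to_infinite_order 0 \<sigma>"
    and ext: "extends_canonically_across_infinity \<sigma>" using assms by (auto simp: mellin_source_def)
  obtain \<tau> where \<tau>: "extends_to_rp1 \<sigma> \<tau>" "vanishes_to_infinite_order 0 (chart_at_infinity \<tau>)"
    using ext unfolding extends_canonically_across_infinity_def by blast
  have lin: "linear_off_0 \<sigma>"
    using tempered_linear[OF temp] by (rule linear_functional_subset) (auto intro: test_fun_schwartz)
  have nf0: "\<exists>r>0. r < 1 \<and> normal_form k ({-r<..<r} - {0}) \<sigma>" for k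
  proof -
    obtain r where r: "r > 0" "r < 1" "normal_form k {-r<..<r} \<sigma>"
      using van unfolding vanishes_to_infinite_order_iff by blast
    then show ?thesis using normal_form_mono[OF r(3), of "{-r<..<r} - {0}"] by blast
  qed
  have nf1: "\<exists>r>0. r < 1 \<and> normal_form k ({-r<..<r} - {0}) (\<lambda>\<psi>. \<sigma> (inversion \<psi>))" for k
  proof -
    obtain r where r: "r > 0" "r < 1" "normal_form k {-r<..<r} (chart_at_infinity \<tau>)"
      using \<tau>(2) unfolding vanishes_to_infinite_order_iff by blast
    have "normal_form k ({-r<..<r} - {0}) (chart_at_infinity \<tau>)" by (rule normal_form_mono[OF r(3)]) auto
    then have "normal_form k ({-r<..<r} - {0}) (\<lambda>\<psi>. \<sigma> (inversion \<psi>))"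
    proof (rule normal_form_cong[rotated])
      fix \<psi> assume "\<psi> \<in> test_fun ({-r<..<r} - {0})"
      then have \<psi>: "\<psi> \<in> test_fun (- {0})" by (rule test_fun_mono) auto
      have "\<psi> 0 = 0" using test_fun_nonzero[OF \<psi>] by (metis abs_zero)
      moreover have "inversion \<psi> \<in> test_fun UNIV" by (rule test_fun_mono[OF inversion_test_fun[OF \<psi>]]) auto
      moreover from this have "restrict_to_real_line \<tau> (inversion \<psi>) = \<sigma> (inversion \<psi>)"
        using \<tau>(1) unfolding extends_to_rp1_def by blast
      ultimately show "chart_at_infinity \<tau> \<psi> = \<sigma> (inversion \<psi>)"
        unfolding restrict_to_real_line_def chart_at_infinity_def by (simp only: inversion_inversion)
    qed
    then show ?thesis using r by blast
  qed
  have wb: "weight_bounded K \<sigma>" for K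
  proof -
    define k where "k = nat \<lceil>\<bar>K\<bar>\<rceil>"
    have "K \<le> real k" unfolding k_def using real_nat_ceiling_ge[of "\<bar>K\<bar>"] by linarith
    moreover have "weight_bounded (real k) \<sigma>"
    proof -
      obtain r0 where r0: "r0 > 0" "r0 < 1" "normal_form k ({-r0<..<r0} - {0}) \<sigma>" using nf0[of k] by blast
      obtain r1 where r1: "r1 > 0" "r1 < 1" "normal_form (k + 2) ({-r1<..<r1} - {0}) (\<lambda>\<psi>. \<sigma> (inversion \<psi>))" using nf1[of "k + 2"] by blast
      show ?thesis by (rule weight_bounded_glue[OF temp r0 r1])
    qed
    ultimately show ?thesis by (rule weight_bounded_mono[rotated])
  qed
  show "regular_off_0 \<sigma>" unfolding regular_off_0_def by (intro conjI allI lin wb nf0)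
  show "regular_off_0 (\<lambda>\<psi>. \<sigma> (inversion \<psi>))"
    unfolding regular_off_0_def by (intro conjI allI linear_off_0_inversion lin weight_bounded_inversion wb nf1)
qed

text \<open>Existence uses the canonical families, and uniqueness in the definite description is
  \<open>mellin_value\<close>.\<close>

lemma signed_mellin_eq:
  assumes "\<sigma> \<in> mellin_source d"
  shows "signed_mellin d \<sigma> s = moderate_extension \<sigma> (signed_power d (s - 1))"
  unfolding signed_mellin_def
proof (rule the_equality)
  note reg = mellin_source_regular[OF assms]
  have van: "vanishes_to_infinite_order 0 \<sigma>"
    and ext: "extends_canonically_across_infinity \<sigma>" using assms by (auto simp: mellin_source_def)
  obtain \<tau> where \<tau>: "extends_to_rp1 \<sigma> \<tau>" "vanishes_to_infinite_order 0 (chart_at_infinity \<tau>)"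
    using ext unfolding extends_canonically_across_infinity_def by blast
  \<comment> \<open>Both orders of vanishing are at our disposal; these integers put s strictly
    inside the strip.\<close>
  define k0 where "k0 = \<lfloor>- Re s\<rfloor> + 1"
  define kinf where "kinf = \<lfloor>Re s\<rfloor> + 1"
  have k: "- real_of_int k0 < Re s" "Re s < real_of_int kinf" unfolding k0_def kinf_def by linarith+
  then have "real_of_int (k0 + kinf) > 0" by simp
  then have k1: "k0 + kinf \<ge> 1" by linarith
  have \<phi>: "cutoff \<in> test_fun UNIV" "\<forall>\<^sub>F x in nhds 0. cutoff x = 1"
  proof -
    show "cutoff \<in> test_fun UNIV"
      by (rule test_funI[OF smooth_on_cutoff, of "{-2..2}"]) (auto intro: cutoff_0)
    show "\<forall>\<^sub>F x in nhds 0. cutoff x = 1" unfolding eventually_nhds_metric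
      by (intro exI[of _ 1]) (auto intro: cutoff_1 simp: dist_norm)
  qed
  let ?E = "\<lambda>s \<phi>. moderate_extension \<sigma> (\<lambda>x. signed_power d (s - 1) x * \<phi> x)"
  let ?F = "\<lambda>s \<phi>. moderate_extension (\<lambda>\<psi>. \<sigma> (inversion \<psi>)) (\<lambda>x. signed_power d (s - 1) x * \<phi> x)"
  note EF = holomorphic_extension_exists[OF reg(1), of d k0] holomorphic_extension_exists[OF reg(2), of d kinf]
  show "\<exists>k0 kinf \<tau> E F \<phi>.
        vanishes_to_order 0 k0 \<sigma> \<and>
        extends_to_rp1 \<sigma> \<tau> \<and> vanishes_to_order 0 kinf (chart_at_infinity \<tau>) \<and>
        k0 + kinf \<ge> 1 \<and> - of_int k0 < Re s \<and> Re s < of_int kinf \<and>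
        holomorphic_extension d k0 \<sigma> E \<and>
        holomorphic_extension d kinf (\<lambda>\<psi>. \<sigma> (inversion \<psi>)) F \<and>
        \<phi> \<in> test_fun UNIV \<and> (\<forall>\<^sub>F x in nhds 0. \<phi> x = 1) \<and>
        moderate_extension \<sigma> (signed_power d (s - 1)) = E s \<phi> + F (- s) (complementary_cutoff \<phi>)"
    by (rule exI[of _ k0], rule exI[of _ kinf], rule exI[of _ \<tau>], rule exI[of _ ?E], rule exI[of _ ?F], rule exI[of _ cutoff],
        intro conjI van[unfolded vanishes_to_infinite_order_def, rule_format] \<tau>(1)
        \<tau>(2)[unfolded vanishes_to_infinite_order_def, rule_format] k1 k EF \<phi> mellin_value[OF reg EF k \<phi>, symmetric])
next
  note reg = mellin_source_regular[OF assms]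
  fix w
  assume "\<exists>k0 kinf \<tau> E F \<phi>.
        vanishes_to_order 0 k0 \<sigma> \<and>
        extends_to_rp1 \<sigma> \<tau> \<and> vanishes_to_order 0 kinf (chart_at_infinity \<tau>) \<and>
        k0 + kinf \<ge> 1 \<and> - of_int k0 < Re s \<and> Re s < of_int kinf \<and>
        holomorphic_extension d k0 \<sigma> E \<and>
        holomorphic_extension d kinf (\<lambda>\<psi>. \<sigma> (inversion \<psi>)) F \<and>
        \<phi> \<in> test_fun UNIV \<and> (\<forall>\<^sub>F x in nhds 0. \<phi> x = 1) \<and>
        w = E s \<phi> + F (- s) (complementary_cutoff \<phi>)"
  then show "w = moderate_extension \<sigma> (signed_power d (s - 1))"
    by (elim exE conjE) (simp only: mellin_value[OF reg])
qed

section \<open>Injectivity\<close>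

lemma schwartz_euler_bound:
  assumes "\<phi> \<in> schwartz"
  obtains B where "B \<ge> 0" "\<forall>j\<le>N. \<forall>x. \<bar>x\<bar> ^ M * norm ((euler ^^ j) \<phi> x) \<le> B"
proof -
  define P where "P j C \<longleftrightarrow> C \<ge> 0 \<and> (\<forall>U f x. open U \<and> smooth_on U f \<and> x \<in> U \<longrightarrow>
     norm ((euler ^^ j) f x) \<le> C * (\<Sum>i\<le>j. \<bar>x\<bar> ^ i * norm (nderiv i f x)))" for j C
  have "\<forall>j. \<exists>C. P j C" unfolding P_def by (intro allI norm_euler_le)
  then obtain C where "\<forall>j. P j (C j)" by (rule choice[THEN exE])
  then have C: "C j \<ge> 0" "open U \<and> smooth_on U f \<and> x \<in> U \<longrightarrow>
     norm ((euler ^^ j) f x) \<le> C j * (\<Sum>i\<le>j. \<bar>x\<bar> ^ i * norm (nderiv i f x))" for j U f x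
    unfolding P_def by simp_all
  define S where "S i = (SUP x. norm (of_real x ^ (M + i) * nderiv i \<phi> x))" for i
  have S: "\<bar>x\<bar> ^ (M + i) * norm (nderiv i \<phi> x) \<le> S i" for i x
    using schwartz_le_SUP[OF assms, of x "M + i" i] by (simp add: S_def norm_mult norm_power)
  have S0: "S i \<ge> 0" for i using S[of 0 i] order_trans[OF _ S[of 1 i]] by simp
  have "\<bar>x\<bar> ^ M * norm ((euler ^^ j) \<phi> x) \<le> (\<Sum>j\<le>N. C j * (\<Sum>i\<le>j. S i))" if j: "j \<le> N" for j x
  proof -
    have "\<bar>x\<bar> ^ M * norm ((euler ^^ j) \<phi> x) \<le> \<bar>x\<bar> ^ M * (C j * (\<Sum>i\<le>j. \<bar>x\<bar> ^ i * norm (nderiv i \<phi> x)))"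
      using C(2)[where U = UNIV and f = \<phi> and x = x and j = j] schwartzD(1)[OF assms] by (intro mult_left_mono) auto
    also have "\<dots> = C j * (\<Sum>i\<le>j. \<bar>x\<bar> ^ (M + i) * norm (nderiv i \<phi> x))"
      by (simp add: sum_distrib_left power_add mult_ac)
    also have "\<dots> \<le> C j * (\<Sum>i\<le>j. S i)" by (intro mult_left_mono sum_mono S C)
    also have "\<dots> \<le> (\<Sum>j\<le>N. C j * (\<Sum>i\<le>j. S i))"
      using j by (intro member_le_sum mult_nonneg_nonneg sum_nonneg S0 C) auto
    finally show ?thesis .
  qed
  moreover have "0 \<le> (\<Sum>j\<le>N. C j * (\<Sum>i\<le>j. S i))" by (intro mult_nonneg_nonneg sum_nonneg S0 C)
  ultimately show thesis by (intro that[of "\<Sum>j\<le>N. C j * (\<Sum>i\<le>j. S i)"]) simp_all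
qed

lemma moderate_schwartz:
  assumes "\<phi> \<in> schwartz" shows "moderate 0 \<phi>"
  unfolding moderate_def
proof (intro conjI allI)
  show "smooth_on (- {0}) \<phi>" by (rule smooth_on_subset[OF schwartzD(1)[OF assms]]) auto
  fix N
  obtain B where "\<forall>j\<le>N. \<forall>x. \<bar>x\<bar> ^ 0 * norm ((euler ^^ j) \<phi> x) \<le> B" using assms by (rule schwartz_euler_bound)
  then show "\<exists>B. ebound N (wt 0) \<phi> B" unfolding ebound_def by (intro exI[of _ B]) simp
qed

text \<open>At infinity rapid decay beats any weight. Near 0 the function vanishes, and on a <= |x|
  < 1 the weight is at most its value at a.\<close>

lemma ebound_schwartz_decay:
  assumes \<psi>: "\<psi> \<in> schwartz" "a > 0" "a < 1" "\<forall>x. \<bar>x\<bar> < a \<longrightarrow> \<psi> x = 0"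
  obtains B where "ebound N (wt (- real M)) \<psi> B"
proof -
  obtain B0 where B0: "B0 \<ge> 0" "\<forall>j\<le>N. \<forall>x. \<bar>x\<bar> ^ 0 * norm ((euler ^^ j) \<psi> x) \<le> B0" using \<psi>(1) by (rule schwartz_euler_bound)
  obtain B1 where B1: "B1 \<ge> 0" "\<forall>j\<le>N. \<forall>x. \<bar>x\<bar> ^ M * norm ((euler ^^ j) \<psi> x) \<le> B1" using \<psi>(1) by (rule schwartz_euler_bound)
  define B where "B = B1 + B0 * wt (real M) a"
  have "norm ((euler ^^ j) \<psi> x) \<le> B * wt (- real M) x" if j: "j \<le> N" and x: "x \<noteq> 0" for j x
  proof -
    have inv: "wt (real M) x * wt (- real M) x = 1" using wt_add[of "real M" "- real M" x] by simp
    consider "\<bar>x\<bar> \<ge> 1" | "\<bar>x\<bar> < a" | "a \<le> \<bar>x\<bar>" "\<bar>x\<bar> < 1" by linarith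
    then have "wt (real M) x * norm ((euler ^^ j) \<psi> x) \<le> B"
    proof cases
      case 1
      have "wt (real M) x * norm ((euler ^^ j) \<psi> x) \<le> B1" using B1(2)[rule_format, OF j, of x] by (simp only: power_wt'[OF 1])
      also have "\<dots> \<le> B" using B0(1) by (simp add: B_def)
      finally show ?thesis .
    next
      case 2
      have "(euler ^^ j) \<psi> x = 0"
        by (rule euler_zero_outside[of "- ball 0 a"]) (use \<psi>(4) 2 in auto)
      then show ?thesis using B0(1) B1(1) by (simp add: B_def)
    next
      case 3
      have "ln a \<le> ln \<bar>x\<bar>" "ln \<bar>x\<bar> \<le> 0" using 3 assms by auto
      then have "\<bar>ln \<bar>x\<bar>\<bar> \<le> \<bar>ln \<bar>a\<bar>\<bar>" using assms(2) by simp
      then have "wt (real M) x \<le> wt (real M) a" unfolding wt_def by (simp add: mult_left_mono)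
      then have "wt (real M) x * norm ((euler ^^ j) \<psi> x) \<le> wt (real M) a * B0"
        using B0(2) j by (intro mult_mono) auto
      then show ?thesis using B1(1) by (simp add: B_def mult.commute)
    qed
    then have "wt (- real M) x * (wt (real M) x * norm ((euler ^^ j) \<psi> x)) \<le> wt (- real M) x * B"
      by (intro mult_left_mono) auto
    moreover have "wt (- real M) x * (wt (real M) x * norm ((euler ^^ j) \<psi> x)) = norm ((euler ^^ j) \<psi> x)"
      using inv by (simp add: mult.assoc[symmetric] mult.commute)
    ultimately show ?thesis by (simp add: mult.commute)
  qed
  then show thesis by (intro that[of B]) (simp add: ebound_def)
qed

lemma exp_minus_tendsto_0: "(\<lambda>n. c * exp (- real n)) \<longlonglongrightarrow> 0"
proof -
  have "(\<lambda>n. c * exp (- real n)) \<longlonglongrightarrow> c * 0"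
    by (intro tendsto_intros filterlim_compose[OF exp_at_bot] filterlim_compose[OF filterlim_uminus_at_bot_at_top] filterlim_real_sequentially)
  then show ?thesis by simp
qed

text \<open>Cutting off must not change the limit. Near 0 the error is controlled by a normal form
  of order 1, away from 0 by temperedness and rapid decay; both errors are multiples of exp(-n).
  Hence an element of the source is determined by its values off 0.\<close>

lemma schwartz_eq_moderate_extension:
  assumes \<sigma>: "\<sigma> \<in> mellin_source d" and \<phi>: "\<phi> \<in> schwartz"
  shows "\<sigma> \<phi> = moderate_extension \<sigma> \<phi>"
proof -
  have temp: "tempered_distribution \<sigma>" and van: "vanishes_to_infinite_order 0 \<sigma>"
    using \<sigma> by (auto simp: mellin_source_def)
  note lin = tempered_linear[OF temp]
  note reg = mellin_source_regular(1)[OF \<sigma>]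
  obtain r where r: "r > 0" "r < 1" "normal_form 1 {-r<..<r} \<sigma>"
    using van unfolding vanishes_to_infinite_order_iff by blast
  obtain C1 N1 where C1: "C1 \<ge> 0" "\<forall>\<phi>\<in>test_fun {-r<..<r}. \<forall>B. ebound N1 (wt (real 1)) \<phi> B \<longrightarrow> norm (\<sigma> \<phi>) \<le> C1 * B"
    using r(3) by (rule normal_form_estimate) (use r in auto)
  obtain C2 N2 where C2: "C2 \<ge> 0" "\<forall>f\<in>schwartz. \<forall>e>0. (\<forall>x. \<bar>x\<bar> < e \<longrightarrow> f x = 0) \<longrightarrow>
    (\<forall>B. ebound N2 (wt (- real N2)) f B \<longrightarrow> norm (\<sigma> f) \<le> C2 * B)"
    using temp by (rule tempered_estimate)
  define \<phi>0 where "\<phi>0 x = \<phi> x * zero_cutoff r x" for x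
  define \<psi> where "\<psi> x = (1 + (-1) * zero_cutoff r x) * \<phi> x" for x
  have cs: "smooth_on UNIV (zero_cutoff r)" by (rule test_fun_smooth[OF zero_cutoff(1)[OF r(1)]])
  have \<phi>0: "\<phi>0 \<in> test_fun {-r<..<r}" unfolding \<phi>0_def[abs_def]
    by (intro test_fun_mult zero_cutoff r smooth_on_subset[OF schwartzD(1)[OF \<phi>]]) auto
  have bdd: "bounded (range (nderiv n (\<lambda>x. 1 + (-1) * f x)))" and sm1: "smooth_on UNIV (\<lambda>x. 1 + (-1) * f x)"
    if f: "f \<in> test_fun A" for f n and A :: "real set"
  proof -
    note sf = test_fun_smooth[OF f]
    show "smooth_on UNIV (\<lambda>x. 1 + (-1) * f x)" by (intro smooth_on_add smooth_on_cmult smooth_on_const sf open_UNIV)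
    have "nderiv n (\<lambda>x. 1 + (-1) * f x) = (\<lambda>x. (if n = 0 then 1 else 0) + (-1) * nderiv n f x)"
      using nderiv_add[OF open_UNIV smooth_on_const[OF open_UNIV] smooth_on_cmult[OF open_UNIV sf] UNIV_I, of n 1 "-1"]
        nderiv_cmult[OF open_UNIV sf UNIV_I, of n "-1"] nderiv_const[OF open_UNIV UNIV_I, of n 1]
      by (simp add: fun_eq_iff)
    moreover obtain B where B: "\<And>x. norm (nderiv n f x) \<le> B" using test_fun_bounded[OF f, of n] by (auto simp: bounded_iff)
    have "norm ((if n = 0 then 1 else 0) + (-1) * nderiv n f x) \<le> 1 + B" for x
      using B[of x] by (intro order_trans[OF norm_triangle_ineq] add_mono) auto
    then have "bounded (range (\<lambda>x. (if n = 0 then 1 else 0) + (-1) * nderiv n f x))"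
      unfolding bounded_iff by (intro exI[of _ "1 + B"]) blast
    ultimately show "bounded (range (nderiv n (\<lambda>x. 1 + (-1) * f x)))" by (simp only:)
  qed
  have \<psi>: "\<psi> \<in> schwartz" unfolding \<psi>_def[abs_def]
    by (intro schwartz_mult \<phi> bdd[OF zero_cutoff(1)[OF r(1)]] sm1[OF zero_cutoff(1)[OF r(1)]])
  have \<psi>0: "\<forall>x. \<bar>x\<bar> < r / 3 \<longrightarrow> \<psi> x = 0" using zero_cutoff(2)[OF r(1)] by (simp add: \<psi>_def)
  define N where "N = max N1 N2"
  obtain A where A: "A \<ge> 0" "\<And>n. ebound N (\<lambda>x. exp (- real n) * wt 1 x) (\<lambda>x. annulus_cutoff n x - 1) A"
    using ebound_annulus_tail[of N] by blast
  obtain B where B: "ebound N (wt 0) \<phi>0 B" using moderate_test_fun[OF \<phi>0] by (rule moderateE)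
  have r3: "r / 3 > 0" "r / 3 < 1" using r by auto
  \<comment> \<open>One unit of decay more than the tempered estimate asks for, to be spent on the
    cutoff tail.\<close>
  obtain B' where B': "ebound N (wt (- real (Suc N2))) \<psi> B'"
    using \<psi> r3 \<psi>0 by (rule ebound_schwartz_decay)
  define D where "D = C1 * (2 ^ N * (A * B)) + C2 * (2 ^ N * (A * B'))"
  have "norm (\<sigma> (\<lambda>x. annulus_cutoff n x * \<phi> x) - \<sigma> \<phi>) \<le> D * exp (- real n)" for n
  proof -
    have sn: "smooth_on UNIV (\<lambda>x. annulus_cutoff n x + (-1))"
      by (intro smooth_on_add smooth_on_annulus_cutoff smooth_on_const) auto
    let ?f = "\<lambda>x. (annulus_cutoff n x - 1) * \<phi>0 x"
    let ?g = "\<lambda>x. (annulus_cutoff n x - 1) * \<psi> x"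
    have f: "?f \<in> test_fun {-r<..<r}"
      using smooth_on_subset[OF sn] by (intro test_fun_mult \<phi>0) simp_all
    have g: "?g \<in> schwartz"
    proof -
      have "(\<lambda>x. (-1) * ((1 + (-1) * annulus_cutoff n x) * \<psi> x)) \<in> schwartz"
        by (intro schwartz_cmult schwartz_mult \<psi> bdd[OF annulus_cutoff_test_fun] sm1[OF annulus_cutoff_test_fun])
      then show ?thesis by (simp add: algebra_simps)
    qed
    have "ebound N (\<lambda>x. exp (- real n) * wt 1 x * wt 0 x) ?f (2 ^ N * (A * B))"
      using smooth_on_subset[OF sn] by (intro ebound_mult A(2) B moderate_smooth[OF moderate_test_fun[OF \<phi>0]]) simp_all
    then have "ebound N1 (wt (real 1)) ?f (2 ^ N * (A * B) * exp (- real n))"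
      by (rule ebound_mono) (auto simp: N_def)
    then have 1: "norm (\<sigma> ?f) \<le> C1 * (2 ^ N * (A * B) * exp (- real n))" using C1(2) f by blast
    have "ebound N (\<lambda>x. exp (- real n) * wt 1 x * wt (- real (Suc N2)) x) ?g (2 ^ N * (A * B'))"
      using smooth_on_subset[OF sn] by (intro ebound_mult A(2) B' moderate_smooth[OF moderate_schwartz[OF \<psi>]]) simp_all
    then have "ebound N2 (wt (- real N2)) ?g (2 ^ N * (A * B') * exp (- real n))"
    proof (rule ebound_mono)
      fix x :: real
      have "wt 1 x * wt (- real (Suc N2)) x = wt (- real N2) x" by (simp add: wt_add[symmetric])
      then have "exp (- real n) * wt 1 x * wt (- real (Suc N2)) x = exp (- real n) * wt (- real N2) x" by (simp only: mult.assoc)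
      then show "2 ^ N * (A * B') * (exp (- real n) * wt 1 x * wt (- real (Suc N2)) x)
         \<le> 2 ^ N * (A * B') * exp (- real n) * wt (- real N2) x" by (simp only: mult.assoc order_refl)
    qed (simp add: N_def)
    moreover have "\<forall>x. \<bar>x\<bar> < r / 3 \<longrightarrow> ?g x = 0" using \<psi>0 by simp
    ultimately have 2: "norm (\<sigma> ?g) \<le> C2 * (2 ^ N * (A * B') * exp (- real n))"
      using C2(2)[rule_format, OF g r3(1)] by blast
    have fS: "?f \<in> schwartz" by (rule test_fun_schwartz[OF f])
    have "(\<lambda>x. annulus_cutoff n x * \<phi> x) = (\<lambda>x. \<phi> x + (?f x + ?g x))"
      by (simp add: fun_eq_iff \<phi>0_def \<psi>_def algebra_simps)
    then have "\<sigma> (\<lambda>x. annulus_cutoff n x * \<phi> x) = \<sigma> \<phi> + (\<sigma> ?f + \<sigma> ?g)"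
      using linear_functional_add[OF lin \<phi> schwartz_add[OF fS g]] linear_functional_add[OF lin fS g] by simp
    then have "norm (\<sigma> (\<lambda>x. annulus_cutoff n x * \<phi> x) - \<sigma> \<phi>) \<le> norm (\<sigma> ?f) + norm (\<sigma> ?g)"
      using norm_triangle_ineq by simp
    then show ?thesis using 1 2 by (simp add: D_def algebra_simps)
  qed
  then have "(\<lambda>n. \<sigma> (\<lambda>x. annulus_cutoff n x * \<phi> x) - \<sigma> \<phi>) \<longlonglongrightarrow> 0"
    by (intro Lim_null_comparison[OF always_eventually exp_minus_tendsto_0[of D]]) auto
  then have "(\<lambda>n. \<sigma> (\<lambda>x. annulus_cutoff n x * \<phi> x)) \<longlonglongrightarrow> \<sigma> \<phi>" by (simp add: LIM_zero_iff)
  from LIMSEQ_unique[OF this moderate_extension_lim[OF regular_off_0D[OF reg] moderate_schwartz[OF \<phi>]]]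
  show ?thesis .
qed

section \<open>Density of trigonometric polynomials\<close>

text \<open>Trigonometric polynomials of period 2 pi, as a complex linear span closed by rules, so
  that properties follow by induction. Other periods arise by rescaling the argument.\<close>

inductive_set trig :: "(real \<Rightarrow> complex) set" where
  trig_exp: "(\<lambda>u. exp (\<i> * of_int k * of_real u)) \<in> trig"
| trig_add: "p \<in> trig \<Longrightarrow> q \<in> trig \<Longrightarrow> (\<lambda>u. p u + q u) \<in> trig"
| trig_cmult: "p \<in> trig \<Longrightarrow> (\<lambda>u. c * p u) \<in> trig"

lemma trig_const: "(\<lambda>u. c) \<in> trig"
  using trig_cmult[OF trig_exp[of 0], of c] by simp

lemma trig_mult:
  assumes "p \<in> trig" "q \<in> trig"
  shows "(\<lambda>u. p u * q u) \<in> trig"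
  using assms(1)
proof induction
  case (trig_exp k)
  from assms(2) show ?case
  proof induction
    case (trig_exp l)
    have "(\<lambda>u. exp (\<i> * of_int k * of_real u) * exp (\<i> * of_int l * of_real u)) = (\<lambda>u. exp (\<i> * of_int (k + l) * of_real u))"
      by (simp add: exp_add[symmetric] algebra_simps)
    then show ?case using trig.trig_exp[of "k + l"] by simp
  qed (simp_all add: distrib_left trig.trig_add mult.left_commute trig.trig_cmult)
qed (simp_all add: distrib_right trig.trig_add mult.assoc trig.trig_cmult)

lemma trig_smooth: "p \<in> trig \<Longrightarrow> smooth_on UNIV p"
  by (induction rule: trig.induct) (auto intro: smooth_on_add smooth_on_cmult smooth_on_exp)

lemma trig_periodic: "p \<in> trig \<Longrightarrow> p (u + 2 * pi) = p u"
proof (induction rule: trig.induct)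
  case (trig_exp k)
  have "exp (\<i> * of_int k * of_real (u + 2 * pi)) = exp (\<i> * of_int k * of_real u) * exp ((2 * of_int k * pi) * \<i>)"
    by (simp add: exp_add[symmetric] algebra_simps)
  also have "exp ((2 * of_int k * pi) * \<i>) = 1"
    by (rule exp_integer_2pi) simp
  finally show ?case by simp
qed auto

text \<open>Only the frequency 0 has no periodic antiderivative; the constant \<open>c\<close> is
  the mean value of \<open>p\<close> that must be removed.\<close>

lemma trig_antiderivative:
  "p \<in> trig \<Longrightarrow> \<exists>c. \<exists>q\<in>trig. \<forall>u. (q has_vector_derivative p u - c) (at u)"
proof (induction rule: trig.induct)
  case (trig_exp k)
  show ?case
  proof (cases "k = 0")
    case True
    then show ?thesis by (intro exI[of _ 1] bexI[OF _ trig_const[of 0]]) auto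
  next
    case False
    have "((\<lambda>u. 1 / (\<i> * of_int k) * exp (\<i> * of_int k * of_real u)) has_vector_derivative
        exp (\<i> * of_int k * of_real u) - 0) (at u)" for u
      by (rule has_vector_derivative_eq_rhs[OF has_vector_derivative_real_field])
        (auto intro!: derivative_eq_intros simp: False)
    then show ?thesis by (intro exI[of _ 0] bexI[OF _ trig_cmult[OF trig.trig_exp[of k], of "1 / (\<i> * of_int k)"]]) blast
  qed
next
  case (trig_add p q)
  then obtain c P d Q where "P \<in> trig" "\<And>u. (P has_vector_derivative p u - c) (at u)"
    "Q \<in> trig" "\<And>u. (Q has_vector_derivative q u - d) (at u)" by auto
  then show ?case
    using has_vector_derivative_add[of P "p _ - c" _ Q "q _ - d"]
    by (intro exI[of _ "c + d"] bexI[OF _ trig.trig_add[of P Q]]) (auto simp: algebra_simps)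
next
  case (trig_cmult p a)
  then obtain c P where "P \<in> trig" "\<And>u. (P has_vector_derivative p u - c) (at u)" by auto
  then show ?case
    using has_vector_derivative_mult_right[of P "p _ - c" _ a]
    by (intro exI[of _ "a * c"] bexI[OF _ trig.trig_cmult[of P]]) (auto simp: algebra_simps)
qed

lemma trig_polynomial:
  "real_polynomial_function g \<Longrightarrow> (\<lambda>u. of_real (g (cis u))) \<in> trig"
proof (induction rule: real_polynomial_function.induct)
  case (linear f)
  have "f (cis u) = cos u * f 1 + sin u * f \<i>" for u
  proof -
    have "cis u = cos u *\<^sub>R 1 + sin u *\<^sub>R \<i>" by (simp add: complex_eq_iff)
    then show ?thesis using linear by (simp add: linear_simps)
  qed
  moreover have "complex_of_real (cos u) = 1 / 2 * exp (\<i> * of_int 1 * of_real u) + 1 / 2 * exp (\<i> * of_int (-1) * of_real u)" for u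
    by (simp add: cos_of_real[symmetric] cos_exp_eq)
  moreover have "complex_of_real (sin u) = 1 / (2 * \<i>) * exp (\<i> * of_int 1 * of_real u) + (- 1 / (2 * \<i>)) * exp (\<i> * of_int (-1) * of_real u)" for u
    by (simp add: sin_of_real[symmetric] sin_exp_eq diff_divide_distrib right_diff_distrib)
  ultimately have "(\<lambda>u. complex_of_real (f (cis u))) =
    (\<lambda>u. of_real (f 1) * (1 / 2 * exp (\<i> * of_int 1 * of_real u) + 1 / 2 * exp (\<i> * of_int (-1) * of_real u)) +
         of_real (f \<i>) * (1 / (2 * \<i>) * exp (\<i> * of_int 1 * of_real u) + (- 1 / (2 * \<i>)) * exp (\<i> * of_int (-1) * of_real u)))"
    by (simp only: fun_eq_iff of_real_add of_real_mult mult.commute) simp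
  also have "\<dots> \<in> trig" by (intro trig.trig_add trig.trig_cmult trig.trig_exp)
  finally show ?case .
next
  case (add f g) then show ?case by (simp add: trig.trig_add)
next
  case (mult f g) then show ?case by (simp add: trig_mult)
qed (simp_all add: trig_const)

text \<open>Transport \<open>f\<close> to the unit circle and apply the Stone-Weierstrass theorem
  there: polynomials restricted to the circle are trigonometric polynomials.\<close>

lemma trig_dense_real:
  fixes f :: "real \<Rightarrow> real"
  assumes "continuous_on UNIV f" "\<And>u. \<bar>u\<bar> > pi / 2 \<Longrightarrow> f u = 0" "e > 0"
  shows "\<exists>q\<in>trig. \<forall>u. \<bar>u\<bar> \<le> pi \<longrightarrow> norm (of_real (f u) - q u) \<le> e"
proof -
  define F where "F z = f (Arg z)" for z
  let ?S = "sphere (0::complex) 1"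
  \<comment> \<open>The jump of \<open>Arg\<close> at the negative axis is harmless, because
    \<open>f\<close> vanishes for angles beyond pi/2. Continuity is checked on two open arcs
    covering the circle, one avoiding the jump and one where \<open>F\<close> is zero.\<close>
  have "continuous_on (?S \<inter> {z. Re z > - 1 / 2}) F"
  proof -
    have "continuous_on (?S \<inter> {z. Re z > - 1 / 2}) Arg"
    proof (rule continuous_at_imp_continuous_on, intro ballI continuous_at_Arg)
      fix z assume z: "z \<in> ?S \<inter> {z. Re z > - 1 / 2}"
      show "z \<notin> \<real>\<^sub>\<le>\<^sub>0"
      proof
        assume "z \<in> \<real>\<^sub>\<le>\<^sub>0"
        then have "Re z \<le> 0" "Im z = 0" by (auto simp: complex_nonpos_Reals_iff)
        moreover have "cmod z = 1" using z by simp
        ultimately have "\<bar>Re z\<bar> = 1" by (simp add: cmod_eq_Re)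
        then show False using z \<open>Re z \<le> 0\<close> by auto
      qed
    qed
    from continuous_on_compose2[OF assms(1) this] show ?thesis by (simp add: F_def[abs_def])
  qed
  moreover have "continuous_on (?S \<inter> {z. Re z < 0}) F"
  proof -
    have "F z = 0" if "z \<in> ?S \<inter> {z. Re z < 0}" for z
    proof -
      have "z \<noteq> 0" using that by auto
      then have "Re z = cmod z * cos (Arg z)" using Re_rcis[of "cmod z" "Arg z"] by (simp add: rcis_cmod_Arg)
      moreover have "Re z < 0" "cmod z = 1" using that by auto
      ultimately have "cos (Arg z) < 0" by (metis mult_1)
      have "\<not> \<bar>Arg z\<bar> \<le> pi / 2"
      proof
        assume "\<bar>Arg z\<bar> \<le> pi / 2"
        then have "- (pi / 2) \<le> Arg z" "Arg z \<le> pi / 2" by linarith+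
        from cos_ge_zero[OF this] \<open>cos (Arg z) < 0\<close> show False by simp
      qed
      then show ?thesis using assms(2) by (simp add: F_def)
    qed
    then show ?thesis by (intro continuous_on_eq[OF continuous_on_const[of _ 0]]) simp
  qed
  moreover have "openin (top_of_set ?S) (?S \<inter> {z. Re z > - 1 / 2})" "openin (top_of_set ?S) (?S \<inter> {z. Re z < 0})"
    by (auto intro!: openin_open_Int simp: open_halfspace_Re_gt open_halfspace_Re_lt)
  moreover have "(?S \<inter> {z. Re z > - 1 / 2}) \<union> (?S \<inter> {z. Re z < 0}) = ?S" by auto
  ultimately have "continuous_on ?S F"
    using continuous_on_Un_local_open[of "?S \<inter> {z. Re z > - 1 / 2}" "?S \<inter> {z. Re z < 0}" F] by simp
  from Stone_Weierstrass_real_polynomial_function[OF compact_sphere this assms(3)]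
  obtain g where g: "real_polynomial_function g" "\<And>z. z \<in> ?S \<Longrightarrow> \<bar>F z - g z\<bar> < e" by auto
  have "norm (of_real (f u) - complex_of_real (g (cis u))) \<le> e" if "\<bar>u\<bar> \<le> pi" for u
  proof -
    have "F (cis u) = f u"
    proof (cases "u = - pi")
      case True
      have "cis u = cis pi" using True by (simp add: complex_eq_iff)
      moreover have "Arg (cis pi) = pi" by (rule Arg_cis) auto
      ultimately have "F (cis u) = f pi" by (simp only: F_def)
      also have "\<dots> = f u" using True assms(2)[of pi] assms(2)[of "- pi"] pi_gt_zero by simp
      finally show ?thesis .
    next
      case False
      then have "u \<in> {-pi<..pi}" using that by auto
      from Arg_cis[OF this] show ?thesis by (simp only: F_def)
    qed
    then have "\<bar>f u - g (cis u)\<bar> < e" using g(2)[of "cis u"] by simp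
    then have "norm (complex_of_real (f u - g (cis u))) \<le> e" unfolding norm_of_real by linarith
    then show ?thesis by simp
  qed
  then show ?thesis by (intro bexI[OF _ trig_polynomial[OF g(1)]]) simp
qed

lemma trig_dense_0:
  fixes f :: "real \<Rightarrow> complex"
  assumes "continuous_on UNIV f" "\<And>u. \<bar>u\<bar> > pi / 2 \<Longrightarrow> f u = 0" "e > 0"
  shows "\<exists>q\<in>trig. \<forall>u. \<bar>u\<bar> \<le> pi \<longrightarrow> norm (f u - q u) \<le> e"
proof -
  obtain p where p: "p \<in> trig" "\<forall>u. \<bar>u\<bar> \<le> pi \<longrightarrow> norm (of_real (Re (f u)) - p u) \<le> e / 2"
    using trig_dense_real[of "\<lambda>u. Re (f u)" "e / 2"] assms by (auto intro!: continuous_intros)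
  obtain q where q: "q \<in> trig" "\<forall>u. \<bar>u\<bar> \<le> pi \<longrightarrow> norm (of_real (Im (f u)) - q u) \<le> e / 2"
    using trig_dense_real[of "\<lambda>u. Im (f u)" "e / 2"] assms by (auto intro!: continuous_intros)
  have "norm (f u - (p u + \<i> * q u)) \<le> e" if "\<bar>u\<bar> \<le> pi" for u
  proof -
    have "f u - (p u + \<i> * q u) = (of_real (Re (f u)) - p u) + \<i> * (of_real (Im (f u)) - q u)"
      by (subst complex_eq[of "f u"]) (simp add: algebra_simps)
    also have "norm \<dots> \<le> e / 2 + e / 2"
      using p(2) q(2) that by (intro order_trans[OF norm_triangle_ineq] add_mono) (auto simp: norm_mult)
    finally show ?thesis by simp
  qed
  then show ?thesis by (intro bexI[OF _ trig_add[OF p(1) trig_cmult[OF q(1), of \<i>]]]) simp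
qed

text \<open>Approximation of the derivative loses only a mean value, which is small because \<open>h\<close> is periodic.\<close>

lemma trig_dense:
  assumes "smooth_on UNIV h" "\<And>u. \<bar>u\<bar> > pi / 2 \<Longrightarrow> h u = 0" "e > 0"
  shows "\<exists>q\<in>trig. \<forall>j\<le>N. \<forall>u. \<bar>u\<bar> \<le> pi \<longrightarrow> norm (nderiv j h u - nderiv j q u) \<le> e"
  using assms
proof (induction N arbitrary: h e)
  case 0
  have "continuous_on UNIV h" using smooth_on_continuous[OF 0(1), of 0] by simp
  from trig_dense_0[OF this 0(2,3)] show ?case by simp
next
  case (Suc N)
  \<comment> \<open>The derivative is approximated up to \<open>d\<close> and the mean costs another
    \<open>d\<close>. Derivatives are then off by at most 2 d and the function by at most 2 pi d; d
    (4 pi + 2) = e dominates both.\<close>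
  define d where "d = e / (4 * pi + 2)"
  have p: "4 * pi + 2 > 0" using pi_gt_zero by linarith
  have d: "d > 0" "d * (4 * pi + 2) = e"
    unfolding d_def using Suc.prems(3) p by (simp_all only: divide_pos_pos, simp)
  have "2 * d \<le> d * (4 * pi + 2)" using d(1) pi_gt_zero by (simp add: algebra_simps)
  then have d3: "2 * d \<le> e" using d(2) by linarith
  have supp: "nderiv j h u = 0" if "\<bar>u\<bar> > pi / 2" for j u
  proof (rule nderiv_zero_outside[of "{-(pi/2)..pi/2}"])
    show "h x = 0" if "x \<notin> {-(pi/2)..pi/2}" for x using that by (intro Suc.prems(2)) (auto simp: abs_if)
  qed (use that in \<open>auto simp: abs_if split: if_splits\<close>)
  obtain q where q: "q \<in> trig" "\<forall>j\<le>N. \<forall>u. \<bar>u\<bar> \<le> pi \<longrightarrow> norm (nderiv j (nderiv 1 h) u - nderiv j q u) \<le> d"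
    using Suc.IH[OF smooth_on_nderiv[OF Suc.prems(1), of 1] supp d(1)] by blast
  obtain c Q where cQ: "Q \<in> trig" "\<forall>u. (Q has_vector_derivative q u - c) (at u)"
    using trig_antiderivative[OF q(1)] by blast
  have hD: "(h has_vector_derivative nderiv 1 h u) (at u)" for u by (rule smooth_onD0[OF Suc.prems(1)]) auto
  have q0: "norm (nderiv 1 h u - q u) \<le> d" if "\<bar>u\<bar> \<le> pi" for u
    using q(2)[rule_format, of 0 u] that by simp
  have c: "norm c \<le> d"
  proof -
    \<comment> \<open>Its derivative is h' - q, which is small, while \<open>h\<close> and the
      periodic \<open>Q\<close> agree with themselves at both ends of the period. Its increment is
      therefore -2 pi c, which bounds the mean.\<close>
    define D where "D u = h u - (Q u + of_real u * c)" for u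
    have DD: "(D has_vector_derivative nderiv 1 h u - q u) (at u)" for u
    proof -
      have "((\<lambda>u. of_real u * c) has_vector_derivative c) (at u)"
        by (rule has_vector_derivative_eq_rhs[OF has_vector_derivative_real_field]) (auto intro!: derivative_eq_intros)
      from has_vector_derivative_diff[OF hD has_vector_derivative_add[OF cQ(2)[rule_format, of u] this]]
      show ?thesis unfolding D_def[abs_def] by simp
    qed
    have "norm (D pi - D (- pi)) \<le> d * \<bar>pi - (- pi)\<bar>"
      by (rule norm_diff_le_vector_derivative[of "{- pi..pi}" D "\<lambda>u. nderiv 1 h u - q u"])
        (use DD q0 pi_gt_zero in auto)
    moreover have "h pi = 0" "h (- pi) = 0" using Suc.prems(2) pi_gt_zero by auto
    moreover have "Q pi = Q (- pi)" using trig_periodic[OF cQ(1), of "- pi"] by simp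
    ultimately have "norm (2 * pi * c) \<le> d * (2 * pi)" by (simp add: D_def norm_minus_commute algebra_simps)
    then show ?thesis using pi_gt_zero by (simp add: norm_mult mult.commute)
  qed
  \<comment> \<open>Normalized to agree with \<open>h\<close> at 0, so that the error can be
    integrated from there.\<close>
  define P where "P u = Q u + (- Q 0 + h 0)" for u
  have P: "P \<in> trig" unfolding P_def[abs_def] by (intro trig_add cQ trig_const)
  have PD: "(P has_vector_derivative q u - c) (at u)" for u
    unfolding P_def[abs_def] using has_vector_derivative_add[OF cQ(2)[rule_format, of u] has_vector_derivative_const] by simp
  have nP: "nderiv 1 P u = q u + (- c)" for u
    unfolding nderiv_1 using vector_derivative_at[OF PD] by simp
  have 0: "norm (h u - P u) \<le> e" if u: "\<bar>u\<bar> \<le> pi" for u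
  proof -
    have "norm ((h u - P u) - (h 0 - P 0)) \<le> (2 * d) * \<bar>u - 0\<bar>"
    proof (rule norm_diff_le_vector_derivative[of "{- pi..pi}" "\<lambda>u. h u - P u" "\<lambda>u. nderiv 1 h u - (q u - c)"])
      show "((\<lambda>u. h u - P u) has_vector_derivative nderiv 1 h y - (q y - c)) (at y)" for y
        by (intro has_vector_derivative_diff hD PD)
      show "norm (nderiv 1 h y - (q y - c)) \<le> 2 * d" if "y \<in> {- pi..pi}" for y
      proof -
        have "norm (nderiv 1 h y - q y) \<le> d" using that by (intro q0) auto
        moreover have "norm (nderiv 1 h y - (q y - c)) = norm ((nderiv 1 h y - q y) + c)" by (simp add: algebra_simps)
        ultimately show ?thesis using c norm_triangle_ineq[of "nderiv 1 h y - q y" c] by linarith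
      qed
    qed (use u pi_gt_zero in auto)
    also have "(2 * d) * \<bar>u - 0\<bar> \<le> (2 * d) * pi" using u d(1) by (intro mult_left_mono) auto
    also have "\<dots> \<le> d * (4 * pi + 2)" using d(1) pi_gt_zero by (simp add: algebra_simps)
    finally show ?thesis by (simp add: P_def d(2))
  qed
  have "norm (nderiv j h u - nderiv j P u) \<le> e" if j: "j \<le> Suc N" and u: "\<bar>u\<bar> \<le> pi" for j u
  proof (cases j)
    case 0
    then show ?thesis using \<open>\<bar>u\<bar> \<le> pi \<Longrightarrow> norm (h u - P u) \<le> e\<close> u by simp
  next
    case (Suc i)
    have "nderiv j P u = nderiv i (\<lambda>u. q u + (- c)) u"
      unfolding Suc nderiv_Suc_right using nP by (intro arg_cong[where f = "\<lambda>g. nderiv i g u"]) (simp add: fun_eq_iff)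
    also have "\<dots> = nderiv i q u + (if i = 0 then - c else 0)"
      using nderiv_add[OF open_UNIV trig_smooth[OF q(1)] smooth_on_const[OF open_UNIV] UNIV_I, of i "- c"]
        nderiv_const[OF open_UNIV UNIV_I, of i "- c"] by simp
    finally have "nderiv j h u - nderiv j P u = (nderiv i (nderiv 1 h) u - nderiv i q u) + (if i = 0 then c else 0)"
      unfolding Suc nderiv_Suc_right by simp
    moreover have "norm (nderiv i (nderiv 1 h) u - nderiv i q u) \<le> d" using q(2) Suc j u by simp
    moreover have "norm (if i = 0 then c else 0) \<le> d" using c d(1) by simp
    ultimately show ?thesis using norm_triangle_ineq[of "nderiv i (nderiv 1 h) u - nderiv i q u" "if i = 0 then c else 0"] d3 by simp
  qed
  then show ?case by (intro bexI[OF _ P]) simp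
qed

lemma trig_nderiv_periodic:
  assumes "q \<in> trig" shows "nderiv j q (u + 2 * pi) = nderiv j q u"
proof -
  have eq: "(\<lambda>u. q (u + 2 * pi)) = q" using trig_periodic[OF assms] by (simp add: fun_eq_iff)
  have "nderiv j (\<lambda>u. q (u + c)) u = nderiv j q (u + c)" for c
  proof (rule smooth_on_seqI(2)[where F = "\<lambda>n x. nderiv n q (x + c)", OF open_UNIV])
    show "((\<lambda>x. nderiv n q (x + c)) has_vector_derivative nderiv (Suc n) q (x + c)) (at x)" for n x
    proof -
      have "((\<lambda>x. x + c) has_vector_derivative 1) (at x)"
        by (simp add: has_vector_derivative_def has_derivative_add_const has_derivative_ident)
      from vector_diff_chain_at[OF this smooth_onD[OF trig_smooth[OF assms], of "x + c" n]] show ?thesis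
        by (simp add: o_def)
    qed
  qed auto
  from this[of "2 * pi"] show ?thesis by (simp add: eq)
qed

lemma trig_bounded_by_period:
  assumes "q \<in> trig" "\<And>u. \<bar>u\<bar> \<le> pi \<Longrightarrow> norm (nderiv j q u) \<le> B"
  shows "norm (nderiv j q u) \<le> B"
proof -
  have shift: "nderiv j q (v + 2 * pi * of_nat n) = nderiv j q v" for v n
  proof (induction n)
    case (Suc n)
    have "v + 2 * pi * of_nat (Suc n) = (v + 2 * pi * of_nat n) + 2 * pi" by (simp add: algebra_simps)
    then show ?case using trig_nderiv_periodic[OF assms(1), of j "v + 2 * pi * of_nat n"] Suc by (simp only:)
  qed simp
  define k where "k = \<lfloor>(u + pi) / (2 * pi)\<rfloor>"
  define v where "v = u - 2 * pi * of_int k"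
  have "of_int k \<le> (u + pi) / (2 * pi)" "(u + pi) / (2 * pi) < of_int k + 1" unfolding k_def by linarith+
  then have "of_int k * (2 * pi) \<le> u + pi" "u + pi < (of_int k + 1) * (2 * pi)"
    using pi_gt_zero by (simp_all add: pos_le_divide_eq pos_divide_less_eq)
  then have v: "\<bar>v\<bar> \<le> pi" unfolding v_def by (simp add: algebra_simps abs_le_iff)
  have "nderiv j q u = nderiv j q v"
  proof (cases "k \<ge> 0")
    case True
    then have "u = v + 2 * pi * of_nat (nat k)" by (simp add: v_def)
    then show ?thesis using shift by metis
  next
    case False
    then have "v = u + 2 * pi * of_nat (nat (- k))" by (simp add: v_def)
    then show ?thesis using shift by metis
  qed
  then show ?thesis using assms(2)[OF v] by simp
qed

lemma nderiv_diff:
  assumes "smooth_on UNIV f" "smooth_on UNIV g"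
  shows "nderiv n (\<lambda>x. f x - g x) x = nderiv n f x - nderiv n g x"
  using nderiv_add[OF open_UNIV assms(1) smooth_on_cmult[OF open_UNIV assms(2), of "-1"] UNIV_I, of n x]
    nderiv_cmult[OF open_UNIV assms(2) UNIV_I, of n "-1" x] by simp

section \<open>Functionals with vanishing transform\<close>

text \<open>The frequencies of q(c ln |x|) are the numbers k c, so the summands are signed powers
  with imaginary exponents, where the functional is zero by hypothesis.\<close>

lemma moderate_extension_trig:
  assumes \<rho>: "linear_off_0 \<rho>" "weight_bounded 1 \<rho>"
    and zero: "\<And>t. moderate_extension \<rho> (signed_power d (\<i> * of_real t)) = 0"
    and q: "q \<in> trig"
  shows "moderate 0 (\<lambda>x. of_real (sgn x) ^ d * q (c * ln \<bar>x\<bar>))"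
    "moderate_extension \<rho> (\<lambda>x. of_real (sgn x) ^ d * q (c * ln \<bar>x\<bar>)) = 0"
proof -
  have wb: "weight_bounded (0 + 1) \<rho>" using \<rho>(2) by simp
  have "moderate 0 (\<lambda>x. of_real (sgn x) ^ d * q (c * ln \<bar>x\<bar>)) \<and>
    moderate_extension \<rho> (\<lambda>x. of_real (sgn x) ^ d * q (c * ln \<bar>x\<bar>)) = 0"
    using q
  proof induction
    case (trig_exp k)
    let ?s = "\<i> * of_real (of_int k * c)"
    have eq: "signed_power d ?s x = of_real (sgn x) ^ d * exp (\<i> * of_int k * of_real (c * ln \<bar>x\<bar>))" if "x \<noteq> 0" for x
      using that by (simp add: signed_power_eq mult_ac)
    have "moderate 0 (signed_power d ?s)" using moderate_signed_power[of ?s d] by simp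
    then have 1: "moderate 0 (\<lambda>x. of_real (sgn x) ^ d * exp (\<i> * of_int k * of_real (c * ln \<bar>x\<bar>)))"
      by (rule moderate_cong) (rule eq)
    have "moderate_extension \<rho> (signed_power d ?s) = moderate_extension \<rho> (\<lambda>x. of_real (sgn x) ^ d * exp (\<i> * of_int k * of_real (c * ln \<bar>x\<bar>)))"
      by (rule moderate_extension_cong) (rule eq)
    then show ?case using 1 zero[of "of_int k * c"] by simp
  next
    case (trig_add p q)
    then show ?case
      using moderate_add[of 0 "\<lambda>x. of_real (sgn x) ^ d * p (c * ln \<bar>x\<bar>)" "\<lambda>x. of_real (sgn x) ^ d * q (c * ln \<bar>x\<bar>)"]
        moderate_extension_add[OF \<rho>(1) wb, of "\<lambda>x. of_real (sgn x) ^ d * p (c * ln \<bar>x\<bar>)" "\<lambda>x. of_real (sgn x) ^ d * q (c * ln \<bar>x\<bar>)"]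
      by (simp add: distrib_left)
  next
    case (trig_cmult p a)
    then show ?case
      using moderate_cmult[of 0 "\<lambda>x. of_real (sgn x) ^ d * p (c * ln \<bar>x\<bar>)" a]
        moderate_extension_cmult[OF \<rho>(1) wb, of "\<lambda>x. of_real (sgn x) ^ d * p (c * ln \<bar>x\<bar>)" a]
      by (simp add: mult.left_commute)
  qed
  then show "moderate 0 (\<lambda>x. of_real (sgn x) ^ d * q (c * ln \<bar>x\<bar>))"
    "moderate_extension \<rho> (\<lambda>x. of_real (sgn x) ^ d * q (c * ln \<bar>x\<bar>)) = 0" by auto
qed

text \<open>With f = sgn^d h(ln |x|), approximate \<open>h\<close> by a trigonometric polynomial
  \<open>w\<close> of period 2 R0, on which the functional vanishes. Within |u| <= R0 they are
  close; beyond, \<open>h\<close> is zero and \<open>w\<close> stays bounded, which the weight exp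
  |u| makes small. Weight 2 for the functional leaves room for errors of weight 1.\<close>

lemma mellin_zero_imp_zero:
  assumes \<rho>: "linear_off_0 \<rho>" "weight_bounded 2 \<rho>"
    and zero: "\<And>t. moderate_extension \<rho> (signed_power d (\<i> * of_real t)) = 0"
    and f: "f \<in> test_fun (- {0})" "\<And>x. f (- x) = (-1) ^ d * f x"
  shows "\<rho> f = 0"
proof -
  have wb2: "weight_bounded (1 + 1) \<rho>" and wb1: "weight_bounded 1 \<rho>"
    using \<rho>(2) weight_bounded_mono[OF \<rho>(2), of 1] by simp_all
  obtain C N where CN: "C \<ge> 0" "\<forall>f B. moderate 1 f \<longrightarrow> ebound N (wt 1) f B \<longrightarrow> norm (moderate_extension \<rho> f) \<le> C * B"
    using moderate_extension_bound[OF \<rho>(1) wb2] by (elim exE conjE) (rule that)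
  define h where "h u = f (exp u)" for u
  have sf: "smooth_on (- {0}) f" by (rule moderate_smooth[OF moderate_test_fun[OF f(1)]])
  have h: "smooth_on UNIV h" unfolding h_def[abs_def] by (rule smooth_on_exp_compose[OF sf])
  obtain a where a: "a > 0" "a < 1" "\<And>x. \<bar>x\<bar> < a \<Longrightarrow> f x = 0" "\<And>x. 1 / a < \<bar>x\<bar> \<Longrightarrow> f x = 0"
    using test_fun_nonzero[OF f(1)] by blast
  define b where "b = - ln a"
  have b: "b > 0" using a by (simp add: b_def)
  have h0: "h u = 0" if u: "\<bar>u\<bar> > b" for u
  proof -
    consider "u < ln a" | "u > - ln a" using u unfolding b_def by linarith
    then show ?thesis
    proof cases
      case 1
      then have "exp u < a" using a(1) by (metis exp_less_cancel_iff exp_ln)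
      then show ?thesis using a(3) by (simp add: h_def)
    next
      case 2
      then have "exp u > exp (- ln a)" by simp
      then have "1 / a < exp u" using a(1) by (simp add: exp_minus divide_inverse)
      then show ?thesis using a(4) by (simp add: h_def)
    qed
  qed
  have feq: "f x = of_real (sgn x) ^ d * h (ln \<bar>x\<bar>)" if "x \<noteq> 0" for x
  proof (cases "x > 0")
    case False
    have "f (- (- x)) = (-1) ^ d * f (- x)" by (rule f(2)[of "- x"])
    then show ?thesis using False that by (simp add: h_def)
  qed (simp add: h_def)
  have "\<forall>j. \<exists>B. \<forall>u. norm (nderiv j h u) \<le> B"
  proof
    fix j
    have "bounded (range (nderiv j h))"
      by (rule nderiv_bounded[OF h, of "{-b..b}"]) (auto intro!: h0 simp: abs_if)
    then show "\<exists>B. \<forall>u. norm (nderiv j h u) \<le> B" by (simp add: bounded_iff)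
  qed
  then obtain M0 where M0: "\<forall>j. \<forall>u. norm (nderiv j h u) \<le> M0 j" by (rule choice[THEN exE])
  define M where "M = (\<Sum>j\<le>N. M0 j)"
  have M0pos: "M0 j \<ge> 0" for j using M0[rule_format, of j 0] norm_ge_zero order_trans by blast
  have M: "norm (nderiv j h u) \<le> M" if "j \<le> N" for j u
    unfolding M_def by (rule order_trans[OF M0[rule_format, of j u]], rule member_le_sum) (use that M0pos in auto)
  have Mpos: "M \<ge> 0" unfolding M_def by (intro sum_nonneg M0pos)
  have small: "norm (\<rho> f) \<le> C * e" if e: "e > 0" for e
  proof -
    define e1 where "e1 = e / 2"
    \<comment> \<open>The second bound makes \<open>w\<close> negligible outside one period, the
      third puts the rescaled support of \<open>h\<close> into [-pi/2, pi/2] as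
      \<open>trig_dense\<close> requires, and the fourth makes the scaling factor at most 1.\<close>
    obtain R0 where R0: "R0 \<ge> 1" "(M + e1) * exp (- R0) \<le> e" "R0 \<ge> 2 * b" "R0 \<ge> pi"
    proof -
      have "(\<lambda>n. (M + e1) * exp (- real n)) \<longlonglongrightarrow> 0" by (rule exp_minus_tendsto_0)
      then have "\<forall>\<^sub>F n in sequentially. (M + e1) * exp (- real n) < e" using e by (rule order_tendstoD)
      then obtain n where n: "\<And>m. m \<ge> n \<Longrightarrow> (M + e1) * exp (- real m) < e" by (auto simp: eventually_sequentially)
      obtain m :: nat where m: "real m \<ge> max (max 1 (2 * b)) (max pi (real n))" using real_arch_simple by blast
      show thesis by (rule that[of "real m"]) (use m n[of m] in auto)
    qed
    \<comment> \<open>Rescaling to period 2 pi. Because c <= 1, undoing it does not enlarge the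
      errors of the derivatives.\<close>
    define c where "c = pi / R0"
    have c: "c > 0" "c \<le> 1" "c * R0 = pi" using R0 pi_gt_zero by (auto simp: c_def)
    define h' where "h' v = h ((1 / c) * v)" for v
    have h': "smooth_on UNIV h'" unfolding h'_def[abs_def] by (rule smooth_on_scale[OF h])
    have nh': "nderiv j h' v = of_real (1 / c) ^ j * nderiv j h ((1 / c) * v)" for j v
      unfolding h'_def[abs_def] by (rule nderiv_scale[OF h])
    define e2 where "e2 = e1"
    obtain q where q: "q \<in> trig" "\<forall>j\<le>N. \<forall>u. \<bar>u\<bar> \<le> pi \<longrightarrow> norm (nderiv j h' u - nderiv j q u) \<le> e2"
    proof -
      have "\<exists>q\<in>trig. \<forall>j\<le>N. \<forall>u. \<bar>u\<bar> \<le> pi \<longrightarrow> norm (nderiv j h' u - nderiv j q u) \<le> e2"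
      proof (rule trig_dense[OF h'])
        show "h' u = 0" if "\<bar>u\<bar> > pi / 2" for u
        proof -
          have "\<bar>(1 / c) * u\<bar> = \<bar>u\<bar> / c" using c(1) by (simp add: abs_mult)
          moreover have "\<bar>u\<bar> / c > (pi / 2) / c" by (rule divide_strict_right_mono[OF that c(1)])
          moreover have "(pi / 2) / c = R0 / 2" using c by (simp add: field_simps)
          ultimately show ?thesis unfolding h'_def using R0(3) by (intro h0) linarith
        qed
      qed (use e in \<open>simp add: e2_def e1_def\<close>)
      then show thesis using that by blast
    qed
    define w where "w u = q (c * u)" for u
    have w: "smooth_on UNIV w" unfolding w_def[abs_def] by (rule smooth_on_scale[OF trig_smooth[OF q(1)]])
    have nw: "nderiv j w u = of_real c ^ j * nderiv j q (c * u)" for j u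
      unfolding w_def[abs_def] by (rule nderiv_scale[OF trig_smooth[OF q(1)]])
    have hh': "nderiv j h u = of_real c ^ j * nderiv j h' (c * u)" for j u
      unfolding nh' using c(1) by (simp add: power_mult_distrib[symmetric] mult.assoc[symmetric])
    have near: "norm (nderiv j h u - nderiv j w u) \<le> e1" if "j \<le> N" "\<bar>u\<bar> \<le> R0" for j u
    proof -
      have "\<bar>c * u\<bar> \<le> pi" using that(2) c by (metis abs_mult abs_of_pos mult_left_mono less_imp_le)
      then have "norm (nderiv j h' (c * u) - nderiv j q (c * u)) \<le> e1" using q(2) that(1) by (simp add: e2_def)
      moreover have "c ^ j \<le> 1" using c by (intro power_le_one) auto
      ultimately have "c ^ j * norm (nderiv j h' (c * u) - nderiv j q (c * u)) \<le> 1 * e1"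
        using c(1) by (intro mult_mono) auto
      moreover have "nderiv j h u - nderiv j w u = of_real c ^ j * (nderiv j h' (c * u) - nderiv j q (c * u))"
        by (simp add: hh' nw right_diff_distrib)
      ultimately show ?thesis using c(1) by (simp add: norm_mult norm_power)
    qed
    \<comment> \<open>On one period this follows from closeness to \<open>h\<close>, and periodicity
      spreads it to the whole line.\<close>
    have far: "norm (nderiv j w u) \<le> M + e1" if j: "j \<le> N" for j u
    proof -
      have "norm (of_real c ^ j * nderiv j q v) \<le> M + e1" if v: "\<bar>v\<bar> \<le> pi" for v
      proof -
        have "\<bar>v / c\<bar> \<le> R0" using v c by (simp add: abs_divide pos_divide_le_eq mult.commute)
        from near[OF j this] have "norm (nderiv j h (v / c) - nderiv j w (v / c)) \<le> e1" .
        then have "norm (nderiv j w (v / c)) \<le> M + e1" using M[OF j, of "v / c"] norm_triangle_ineq2[of "nderiv j w (v / c)" "nderiv j h (v / c)"]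
          by (simp add: norm_minus_commute)
        then show ?thesis using c(1) by (simp add: nw)
      qed
      then have "norm (nderiv j q v) \<le> (M + e1) / c ^ j" if "\<bar>v\<bar> \<le> pi" for v
        using that c(1) by (simp add: norm_mult norm_power pos_le_divide_eq mult.commute)
      from trig_bounded_by_period[OF q(1) this, of "c * u"] show ?thesis
        using c(1) by (simp add: nw norm_mult norm_power pos_le_divide_eq mult.commute)
    qed
    have key: "norm (nderiv j (\<lambda>u. h u - w u) u) \<le> e * exp \<bar>u\<bar>" if j: "j \<le> N" for j u
    proof (cases "\<bar>u\<bar> \<le> R0")
      case True
      have "norm (nderiv j (\<lambda>u. h u - w u) u) \<le> e1" unfolding nderiv_diff[OF h w] by (rule near[OF j True])
      also have "e1 \<le> e * 1" using e by (simp add: e1_def)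
      also have "\<dots> \<le> e * exp \<bar>u\<bar>" using e by (intro mult_left_mono) auto
      finally show ?thesis .
    next
      case False
      have "nderiv j h u = 0"
        by (rule nderiv_zero_outside[of "{-b..b}"]) (use False R0(3) b in \<open>auto intro!: h0 simp: abs_if split: if_splits\<close>)
      then have "norm (nderiv j (\<lambda>u. h u - w u) u) \<le> (M + e1) * exp (- R0) * exp R0"
        using far[OF j, of u] by (simp add: nderiv_diff[OF h w] mult.assoc exp_add[symmetric])
      also have "\<dots> \<le> e * exp \<bar>u\<bar>"
        using R0(2) False e by (intro mult_mono) auto
      finally show ?thesis .
    qed
    let ?g = "\<lambda>x. of_real (sgn x) ^ d * w (ln \<bar>x\<bar>)"
    have g: "moderate 0 ?g" "moderate_extension \<rho> ?g = 0"
      using moderate_extension_trig[OF \<rho>(1) wb1 zero q(1), of c] by (simp_all add: w_def)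
    have dm: "moderate 1 (\<lambda>x. f x + (-1) * ?g x)"
      by (rule moderate_mono[OF moderate_add[OF moderate_test_fun[OF f(1)] moderate_cmult[OF g(1)]]]) simp
    have shw: "smooth_on UNIV (\<lambda>u. h u - w u)"
      using smooth_on_add[OF open_UNIV h smooth_on_cmult[OF open_UNIV w, of "-1"]] by simp
    have "ebound N (wt 1) (\<lambda>x. of_real (sgn x) ^ d * (h (ln \<bar>x\<bar>) - w (ln \<bar>x\<bar>))) e"
      unfolding ebound_def
    proof (intro allI impI)
      fix j and x :: real assume j: "j \<le> N" and x: "x \<noteq> 0"
      have "norm (of_real (sgn x) ^ d * nderiv j (\<lambda>u. h u - w u) (ln \<bar>x\<bar>)) = norm (nderiv j (\<lambda>u. h u - w u) (ln \<bar>x\<bar>))"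
        using x by (simp add: norm_mult norm_power)
      then show "norm ((euler ^^ j) (\<lambda>x. of_real (sgn x) ^ d * (h (ln \<bar>x\<bar>) - w (ln \<bar>x\<bar>))) x) \<le> e * wt 1 x"
        using key[OF j, of "ln \<bar>x\<bar>"] euler_sgn_ln[OF shw x, of j d] by (simp add: wt_def)
    qed
    then have "ebound N (wt 1) (\<lambda>x. f x + (-1) * ?g x) e"
      by (rule ebound_cong[rotated]) (simp add: feq right_diff_distrib)
    with dm have "norm (moderate_extension \<rho> (\<lambda>x. f x + (-1) * ?g x)) \<le> C * e" using CN(2) by blast
    moreover have "moderate_extension \<rho> (\<lambda>x. f x + (-1) * ?g x) = \<rho> f + (-1) * 0"
      using moderate_extension_add[OF \<rho>(1) _ moderate_test_fun[OF f(1)] moderate_cmult[OF g(1)], of "-1"]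
        moderate_extension_cmult[OF \<rho>(1) _ g(1), of "-1"] moderate_extension_test_fun[OF f(1), of \<rho>] wb1 g(2) by simp
    ultimately show ?thesis by simp
  qed
  have "norm (\<rho> f) \<le> C * 0"
  proof (rule field_le_epsilon)
    fix y :: real assume y: "y > 0"
    have "norm (\<rho> f) \<le> C * (y / (C + 1))" using y CN(1) by (intro small) simp
    also have "\<dots> \<le> y" using y CN(1) by (simp add: field_simps)
    finally show "norm (\<rho> f) \<le> C * 0 + y" by simp
  qed
  then show ?thesis by simp
qed

section \<open>Extension across infinity\<close>

lemma schwartz_reflect:
  assumes "\<phi> \<in> schwartz" shows "(\<lambda>x. \<phi> (- x)) \<in> schwartz"
  unfolding schwartz_def
proof (intro CollectI conjI allI)
  note s = schwartzD(1)[OF assms]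
  show "smooth_on UNIV (\<lambda>x. \<phi> (- x))" using smooth_on_scale[OF s, of "-1"] by simp
  fix m n
  obtain B where B: "\<And>x. norm (of_real x ^ m * nderiv n \<phi> x) \<le> B"
    using schwartzD(2)[OF assms, of m n] by (auto simp: bounded_iff)
  have "norm (of_real x ^ m * nderiv n (\<lambda>x. \<phi> (- x)) x) \<le> B" for x
    using B[of "- x"] nderiv_scale[OF s, of n "-1" x] by (simp add: norm_mult norm_power)
  then show "bounded (range (\<lambda>x. of_real x ^ m * nderiv n (\<lambda>x. \<phi> (- x)) x))" by (auto simp: bounded_iff)
qed

lemma euler_constants:
  obtains C where "\<forall>j. 0 \<le> C j \<and> (\<forall>U f x. open U \<and> smooth_on U f \<and> x \<in> U \<longrightarrow>
     norm ((euler ^^ j) f x) \<le> C j * (\<Sum>i\<le>j. \<bar>x\<bar> ^ i * norm (nderiv i f x)))"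
proof -
  define P where "P j C \<longleftrightarrow> C \<ge> 0 \<and> (\<forall>U f x. open U \<and> smooth_on U f \<and> x \<in> U \<longrightarrow>
     norm ((euler ^^ j) f x) \<le> C * (\<Sum>i\<le>j. \<bar>x\<bar> ^ i * norm (nderiv i f x)))" for j C
  have "\<forall>j. \<exists>C. P j C" unfolding P_def by (intro allI norm_euler_le)
  then obtain C where "\<forall>j. P j (C j)" by (rule choice[THEN exE])
  then show thesis unfolding P_def by (rule that)
qed

lemma SUP_interval:
  assumes "smooth_on UNIV f"
  shows "x \<in> {-1..1} \<Longrightarrow> norm (nderiv n f x) \<le> (SUP x\<in>{-1..1}. norm (nderiv n f x))"
    and "0 \<le> (SUP x\<in>{-1..1}. norm (nderiv n f x))"
proof -
  have "bounded (nderiv n f ` {-1..1})"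
    by (intro compact_imp_bounded compact_continuous_image continuous_on_subset[OF smooth_on_continuous[OF assms]]) auto
  then have bdd: "bdd_above ((\<lambda>x. norm (nderiv n f x)) ` {-1..1})" by (auto simp: bounded_iff bdd_above_def)
  show *: "norm (nderiv n f x) \<le> (SUP x\<in>{-1..1}. norm (nderiv n f x))" if "x \<in> {-1..1}" for x
    using that bdd by (rule cSUP_upper)
  show "0 \<le> (SUP x\<in>{-1..1}. norm (nderiv n f x))" by (rule order_trans[OF norm_ge_zero *[of 0]]) simp
qed

text \<open>For |x| <= 1 the first chart bounds the Euler derivatives directly. For |x| > 1 write
  phi as x^(-2) psi(1/x): the prefactor is at most 1, and inversion changes only the signs of Euler
  derivatives.\<close>

lemma rp1_ebound:
  obtains D where "D \<ge> 0" "\<forall>\<phi> \<psi>. (\<phi>, \<psi>) \<in> rp1_measures \<longrightarrow> ebound N (wt 0) \<phi>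
     (D * (\<Sum>n\<le>N. (SUP x\<in>{-1..1}. norm (nderiv n \<phi> x)) + (SUP y\<in>{-1..1}. norm (nderiv n \<psi> y))))"
proof -
  obtain C where C0: "\<forall>j. 0 \<le> C j \<and> (\<forall>U f x. open U \<and> smooth_on U f \<and> x \<in> U \<longrightarrow>
     norm ((euler ^^ j) f x) \<le> C j * (\<Sum>i\<le>j. \<bar>x\<bar> ^ i * norm (nderiv i f x)))"
    by (rule euler_constants)
  have C1: "0 \<le> C j" for j by (rule conjunct1[OF spec[OF C0]])
  have C2: "norm ((euler ^^ j) f x) \<le> C j * (\<Sum>i\<le>j. \<bar>x\<bar> ^ i * norm (nderiv i f x))"
    if "open U" "smooth_on U f" "x \<in> U" for j U f x
    by (rule conjunct2[OF spec[OF C0], rule_format, OF conjI[OF that(1) conjI[OF that(2,3)]]])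
  note C = C1 C2
  define Q where "Q m c \<longleftrightarrow> (\<forall>\<phi> x. smooth_on (- {0}) \<phi> \<and> x \<noteq> 0 \<longrightarrow>
     (euler ^^ m) (\<lambda>x. signed_power 0 (-2) x * \<phi> x) x = signed_power 0 (-2) x * (\<Sum>i\<le>m. c i * (euler ^^ i) \<phi> x))" for m c
  have "\<forall>m. \<exists>c. Q m c" unfolding Q_def by (intro allI euler_signed_power_mult)
  then obtain c where c: "\<forall>m. Q m (c m)" by (rule choice[THEN exE])
  define D where "D = (\<Sum>j\<le>N. C j) + (\<Sum>j\<le>N. \<Sum>i\<le>j. norm (c j i) * C i)"
  have D0: "D \<ge> 0" unfolding D_def by (intro add_nonneg_nonneg sum_nonneg mult_nonneg_nonneg C) auto
  have near: "norm ((euler ^^ j) f x) \<le> C j * (\<Sum>n\<le>N. SUP x\<in>{-1..1}. norm (nderiv n f x))"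
    if "smooth_on UNIV f" "j \<le> N" "\<bar>x\<bar> \<le> 1" for f j x
  proof -
    have "norm ((euler ^^ j) f x) \<le> C j * (\<Sum>i\<le>j. \<bar>x\<bar> ^ i * norm (nderiv i f x))"
      by (rule C(2)[OF open_UNIV that(1) UNIV_I])
    also have "\<dots> \<le> C j * (\<Sum>i\<le>j. 1 * (SUP x\<in>{-1..1}. norm (nderiv i f x)))"
      using that(3) by (intro mult_left_mono sum_mono mult_mono C(1) SUP_interval[OF that(1)] power_le_one) auto
    also have "\<dots> \<le> C j * (\<Sum>n\<le>N. SUP x\<in>{-1..1}. norm (nderiv n f x))"
      using that(2) unfolding mult_1 by (intro mult_left_mono sum_mono2 C(1) SUP_interval[OF that(1)]) auto
    finally show ?thesis .
  qed
  have "ebound N (wt 0) \<phi> (D * (\<Sum>n\<le>N. (SUP x\<in>{-1..1}. norm (nderiv n \<phi> x)) + (SUP y\<in>{-1..1}. norm (nderiv n \<psi> y))))"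
    if "(\<phi>, \<psi>) \<in> rp1_measures" for \<phi> \<psi>
    unfolding ebound_def
  proof (intro allI impI)
    have sm: "smooth_on UNIV \<phi>" "smooth_on UNIV \<psi>" and eq: "\<And>y. y \<noteq> 0 \<Longrightarrow> \<psi> y = inversion \<phi> y"
      using that by (auto simp: rp1_measures_def)
    let ?a = "\<Sum>n\<le>N. SUP x\<in>{-1..1}. norm (nderiv n \<phi> x)"
    let ?b = "\<Sum>n\<le>N. SUP x\<in>{-1..1}. norm (nderiv n \<psi> x)"
    have ab: "?a \<ge> 0" "?b \<ge> 0" by (intro sum_nonneg SUP_interval sm)+
    fix j and x :: real assume j: "j \<le> N" and x: "x \<noteq> 0"
    have "norm ((euler ^^ j) \<phi> x) \<le> D * (?a + ?b)"
    proof (cases "\<bar>x\<bar> \<le> 1")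
      case True
      have "norm ((euler ^^ j) \<phi> x) \<le> C j * ?a" by (rule near[OF sm(1) j True])
      also have "\<dots> \<le> D * (?a + ?b)"
      proof (rule mult_mono)
        have "C j \<le> (\<Sum>j\<le>N. C j)" using j C(1) by (intro member_le_sum) auto
        also have "\<dots> \<le> D" unfolding D_def by (simp add: sum_nonneg C)
        finally show "C j \<le> D" .
      qed (use ab D0 in auto)
      finally show ?thesis .
    next
      case False
      have s0: "smooth_on (- {0}) (\<lambda>x. \<psi> (1 / x))"
        by (rule smooth_on_inverse_compose_off_0[OF smooth_on_subset[OF sm(2)]]) auto
      have p: "\<phi> y = signed_power 0 (-2) y * \<psi> (1 / y)" if "y \<noteq> 0" for y
      proof -
        have "inversion \<psi> y = \<phi> y" using that eq[of "1 / y"] by (simp add: inversion_def power_divide)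
        then show ?thesis using inversion_eq[OF that, of \<psi>] by simp
      qed
      have "(euler ^^ j) \<phi> x = (euler ^^ j) (\<lambda>y. signed_power 0 (-2) y * \<psi> (1 / y)) x"
        by (rule euler_cong[OF open_nonzero]) (use p x in auto)
      also have "\<dots> = signed_power 0 (-2) x * (\<Sum>i\<le>j. c j i * (euler ^^ i) (\<lambda>x. \<psi> (1 / x)) x)"
        using s0 x by (intro c[unfolded Q_def, rule_format] conjI)
      also have "norm \<dots> \<le> 1 * (\<Sum>i\<le>j. norm (c j i) * (C i * ?b))"
        unfolding norm_mult
      proof (rule mult_mono)
        have "norm (signed_power 0 (-2) x) = 1 / x ^ 2"
          using x exp_of_nat_mult[of 2 "ln \<bar>x\<bar>"] by (simp add: norm_signed_power exp_minus divide_inverse)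
        also have "\<dots> \<le> 1" using False x one_le_power[of "\<bar>x\<bar>" 2] by (simp add: divide_le_eq)
        finally show "norm (signed_power 0 (-2) x) \<le> 1" .
        have "norm ((euler ^^ i) (\<lambda>x. \<psi> (1 / x)) x) \<le> C i * ?b" if "i \<le> j" for i
        proof -
          have "norm ((euler ^^ i) (\<lambda>x. \<psi> (1 / x)) x) = norm ((euler ^^ i) \<psi> (1 / x))"
            using euler_inverse_compose[OF smooth_on_subset[OF sm(2)] x, of i] by (simp add: norm_mult norm_power)
          also have "\<dots> \<le> C i * ?b" using False that j by (intro near[OF sm(2)]) (auto simp: abs_divide)
          finally show ?thesis .
        qed
        then show "norm (\<Sum>i\<le>j. c j i * (euler ^^ i) (\<lambda>x. \<psi> (1 / x)) x) \<le> (\<Sum>i\<le>j. norm (c j i) * (C i * ?b))"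
          by (intro order_trans[OF norm_sum sum_mono]) (auto simp: norm_mult intro!: mult_left_mono)
      qed auto
      also have "1 * (\<Sum>i\<le>j. norm (c j i) * (C i * ?b)) = (\<Sum>i\<le>j. norm (c j i) * C i) * ?b"
        by (simp add: sum_distrib_right mult.assoc)
      also have "\<dots> \<le> D * (?a + ?b)"
      proof (rule mult_mono)
        have "(\<Sum>i\<le>j. norm (c j i) * C i) \<le> (\<Sum>j\<le>N. \<Sum>i\<le>j. norm (c j i) * C i)"
          using j C(1) by (intro member_le_sum[of j _ "\<lambda>j. \<Sum>i\<le>j. norm (c j i) * C i"] sum_nonneg mult_nonneg_nonneg) auto
        also have "\<dots> \<le> D" unfolding D_def by (simp add: sum_nonneg C)
        finally show "(\<Sum>i\<le>j. norm (c j i) * C i) \<le> D" .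
      qed (use ab D0 in auto)
      finally show ?thesis .
    qed
    then show "norm ((euler ^^ j) \<phi> x) \<le> D * (\<Sum>n\<le>N. (SUP x\<in>{-1..1}. norm (nderiv n \<phi> x)) + (SUP y\<in>{-1..1}. norm (nderiv n \<psi> y))) * wt 0 x"
      by (simp add: sum.distrib)
  qed
  then show thesis by (intro that[OF D0] allI impI)
qed

lemma moderate_rp1:
  assumes "(\<phi>, \<psi>) \<in> rp1_measures" shows "moderate 0 \<phi>"
  unfolding moderate_def
proof (intro conjI allI)
  have "smooth_on UNIV \<phi>" using assms by (auto simp: rp1_measures_def)
  then show "smooth_on (- {0}) \<phi>" by (rule smooth_on_subset) auto
  fix N
  obtain D where D: "\<forall>\<phi> \<psi>. (\<phi>, \<psi>) \<in> rp1_measures \<longrightarrow> ebound N (wt 0) \<phi>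
     (D * (\<Sum>n\<le>N. (SUP x\<in>{-1..1}. norm (nderiv n \<phi> x)) + (SUP y\<in>{-1..1}. norm (nderiv n \<psi> y))))"
    by (rule rp1_ebound)
  show "\<exists>B. ebound N (wt 0) \<phi> B" by (rule exI, rule D[rule_format, OF assms])
qed

text \<open>The source is rebuilt from data off 0 and infinity: exhaustion defines the tempered
  distribution as well as its extension to the projective line, whose chart at infinity is the
  extension of the inverted functional.\<close>

theorem mellin_source_of_regular:
  assumes reg: "regular_off_0 \<rho>" "regular_off_0 (\<lambda>\<psi>. \<rho> (inversion \<psi>))"
    and parity: "\<And>f. f \<in> test_fun (- {0}) \<Longrightarrow> \<rho> (\<lambda>x. f (- x)) = (-1) ^ d * \<rho> f"
  defines "\<sigma> \<equiv> \<lambda>\<phi>. if \<phi> \<in> schwartz then moderate_extension \<rho> \<phi> else 0"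
  shows "\<sigma> \<in> mellin_source d" "signed_mellin d \<sigma> s = moderate_extension \<rho> (signed_power d (s - 1))"
proof -
  note lin = regular_off_0D(1)[OF reg(1)] and wb = regular_off_0D(2)[OF reg(1)]
  have \<sigma>: "\<sigma> \<phi> = moderate_extension \<rho> \<phi>" if "\<phi> \<in> schwartz" for \<phi> using that by (simp add: \<sigma>_def)
  obtain C N where CN: "C \<ge> 0" "\<forall>f B. moderate 0 f \<longrightarrow> ebound N (wt 0) f B \<longrightarrow> norm (moderate_extension \<rho> f) \<le> C * B"
    using moderate_extension_bound[where K = 0, OF lin wb] by (elim exE conjE) (rule that)
  have temp: "tempered_distribution \<sigma>"
    unfolding tempered_distribution_def
  proof (intro conjI)
    show "linear_functional_on schwartz \<sigma>"
      unfolding linear_functional_on_def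
      using moderate_extension_add[OF lin wb moderate_schwartz moderate_schwartz] moderate_extension_cmult[OF lin wb moderate_schwartz]
      by (simp add: \<sigma> schwartz_add schwartz_cmult)
    show "\<forall>\<phi>. \<phi> \<notin> schwartz \<longrightarrow> \<sigma> \<phi> = 0" by (simp add: \<sigma>_def)
    obtain E where E0: "\<forall>j. 0 \<le> E j \<and> (\<forall>U f x. open U \<and> smooth_on U f \<and> x \<in> U \<longrightarrow>
     norm ((euler ^^ j) f x) \<le> E j * (\<Sum>i\<le>j. \<bar>x\<bar> ^ i * norm (nderiv i f x)))"
    by (rule euler_constants)
  have E1: "0 \<le> E j" for j by (rule conjunct1[OF spec[OF E0]])
  have E2: "norm ((euler ^^ j) f x) \<le> E j * (\<Sum>i\<le>j. \<bar>x\<bar> ^ i * norm (nderiv i f x))"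
    if "open U" "smooth_on U f" "x \<in> U" for j U f x
    by (rule conjunct2[OF spec[OF E0], rule_format, OF conjI[OF that(1) conjI[OF that(2,3)]]])
  note E = E1 E2
    have "norm (\<sigma> \<phi>) \<le> (C * (\<Sum>j\<le>N. E j)) * (\<Sum>m\<le>N. \<Sum>n\<le>N. SUP x. norm (of_real x ^ m * nderiv n \<phi> x))"
      if \<phi>: "\<phi> \<in> schwartz" for \<phi>
    proof -
      let ?S = "\<Sum>m\<le>N. \<Sum>n\<le>N. SUP x. norm (of_real x ^ m * nderiv n \<phi> x)"
      have pos: "0 \<le> (SUP x. norm (of_real x ^ m * nderiv n \<phi> x))" for m n
        by (rule order_trans[OF norm_ge_zero schwartz_le_SUP[OF \<phi>, of 0]])
      have S0: "?S \<ge> 0" by (intro sum_nonneg pos)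
      have "ebound N (wt 0) \<phi> ((\<Sum>j\<le>N. E j) * ?S)"
        unfolding ebound_def
      proof (intro allI impI)
        fix j and x :: real assume j: "j \<le> N" and x: "x \<noteq> 0"
        have "norm ((euler ^^ j) \<phi> x) \<le> E j * (\<Sum>i\<le>j. \<bar>x\<bar> ^ i * norm (nderiv i \<phi> x))"
          by (rule E(2)[OF open_UNIV schwartzD(1)[OF \<phi>] UNIV_I])
        also have "\<dots> \<le> E j * (\<Sum>i\<le>j. SUP x. norm (of_real x ^ i * nderiv i \<phi> x))"
          using schwartz_le_SUP[OF \<phi>, of x] by (intro mult_left_mono sum_mono E) (simp add: norm_mult norm_power)
        also have "\<dots> \<le> E j * ?S"
        proof (intro mult_left_mono E)
          have "(\<Sum>i\<le>j. SUP x. norm (of_real x ^ i * nderiv i \<phi> x)) \<le> (\<Sum>i\<le>N. SUP x. norm (of_real x ^ i * nderiv i \<phi> x))"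
            using j by (intro sum_mono2 pos) auto
          also have "\<dots> \<le> ?S"
            by (intro sum_mono member_le_sum[of _ "{..N}" "\<lambda>n. SUP x. norm (of_real x ^ _ * nderiv n \<phi> x)"] pos) auto
          finally show "(\<Sum>i\<le>j. SUP x. norm (of_real x ^ i * nderiv i \<phi> x)) \<le> ?S" .
        qed
        also have "\<dots> \<le> (\<Sum>j\<le>N. E j) * ?S" using j E(1) by (intro mult_right_mono member_le_sum S0) auto
        finally show "norm ((euler ^^ j) \<phi> x) \<le> (\<Sum>j\<le>N. E j) * ?S * wt 0 x" by simp
      qed
      from CN(2)[rule_format, OF moderate_schwartz[OF \<phi>] this] show ?thesis by (simp add: \<sigma>[OF \<phi>] mult.assoc)
    qed
    then show "\<exists>C N. \<forall>\<phi>\<in>schwartz. norm (\<sigma> \<phi>) \<le> C * (\<Sum>m\<le>N. \<Sum>n\<le>N. SUP x. norm (of_real x ^ m * nderiv n \<phi> x))"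
      by (intro exI[of _ "C * (\<Sum>j\<le>N. E j)"] exI[of _ N]) simp
  qed
  have par: "has_parity d \<sigma>"
    unfolding has_parity_def
  proof
    fix \<phi> assume \<phi>: "\<phi> \<in> schwartz"
    have "(\<lambda>x. annulus_cutoff n x * \<phi> (- x)) = (\<lambda>x. (\<lambda>x. annulus_cutoff n x * \<phi> x) (- x))" for n
      by (simp add: annulus_cutoff_minus)
    then have "\<rho> (\<lambda>x. annulus_cutoff n x * \<phi> (- x)) = (-1) ^ d * \<rho> (\<lambda>x. annulus_cutoff n x * \<phi> x)" for n
      using parity[OF annulus_cutoff_mult_test_fun[OF moderate_smooth[OF moderate_schwartz[OF \<phi>]]], of n] by simp
    moreover have "(\<lambda>n. (-1) ^ d * \<rho> (\<lambda>x. annulus_cutoff n x * \<phi> x)) \<longlonglongrightarrow> (-1) ^ d * moderate_extension \<rho> \<phi>"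
      by (intro tendsto_mult_left moderate_extension_lim[OF lin wb moderate_schwartz[OF \<phi>]])
    ultimately have "(\<lambda>n. \<rho> (\<lambda>x. annulus_cutoff n x * \<phi> (- x))) \<longlonglongrightarrow> (-1) ^ d * moderate_extension \<rho> \<phi>" by simp
    from LIMSEQ_unique[OF this moderate_extension_lim[OF lin wb moderate_schwartz[OF schwartz_reflect[OF \<phi>]]]]
    show "\<sigma> (\<lambda>x. \<phi> (- x)) = (-1) ^ d * \<sigma> \<phi>" by (simp add: \<sigma> \<phi> schwartz_reflect)
  qed
  \<comment> \<open>Off 0 the even signed power of exponent 0 is 1, so this is a case of
    \<open>normal_form_moderate_extension\<close>.\<close>
  have nf: "\<exists>r>0. r < 1 \<and> normal_form k {-r<..<r} (moderate_extension \<rho>')" if "regular_off_0 \<rho>'" for k \<rho>'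
  proof -
    have "(\<lambda>\<phi>. moderate_extension \<rho>' (\<lambda>x. signed_power 0 0 x * \<phi> x)) = moderate_extension \<rho>'"
      by (rule ext, rule moderate_extension_cong) (simp add: signed_power_def)
    then show ?thesis using normal_form_moderate_extension[OF that, of k 0 0] by simp
  qed
  have van: "vanishes_to_infinite_order 0 \<sigma>"
    unfolding vanishes_to_infinite_order_iff
  proof
    fix k
    obtain r where r: "r > 0" "r < 1" "normal_form k {-r<..<r} (moderate_extension \<rho>)" using nf[OF reg(1), of k] by (elim exE conjE) (rule that)
    have "normal_form k {-r<..<r} \<sigma>"
      by (rule normal_form_cong[OF _ r(3)]) (simp add: \<sigma> test_fun_schwartz)
    with r(1,2) show "\<exists>r>0. r < 1 \<and> normal_form k {-r<..<r} \<sigma>" by (intro exI[of _ r] conjI)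
  qed
  define \<tau> :: rp1_functional where "\<tau> p = moderate_extension \<rho> (fst p)" for p
  obtain D where D: "D \<ge> 0" "\<forall>\<phi> \<psi>. (\<phi>, \<psi>) \<in> rp1_measures \<longrightarrow> ebound N (wt 0) \<phi>
     (D * (\<Sum>n\<le>N. (SUP x\<in>{-1..1}. norm (nderiv n \<phi> x)) + (SUP y\<in>{-1..1}. norm (nderiv n \<psi> y))))"
    by (rule rp1_ebound)
  have "rp1_distribution \<tau>"
    unfolding rp1_distribution_def \<tau>_def fst_conv
  proof (intro conjI allI impI)
    show "moderate_extension \<rho> (\<lambda>x. \<phi> x + \<phi>' x) = moderate_extension \<rho> \<phi> + moderate_extension \<rho> \<phi>'"
      if "(\<phi>, \<psi>) \<in> rp1_measures \<and> (\<phi>', \<psi>') \<in> rp1_measures" for \<phi> \<psi> \<phi>' \<psi>'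
      by (rule moderate_extension_add[OF lin wb moderate_rp1[OF that[THEN conjunct1]] moderate_rp1[OF that[THEN conjunct2]]])
    show "moderate_extension \<rho> (\<lambda>x. c * \<phi> x) = c * moderate_extension \<rho> \<phi>" if "(\<phi>, \<psi>) \<in> rp1_measures" for c \<phi> \<psi>
      by (rule moderate_extension_cmult[OF lin wb moderate_rp1[OF that]])
    show "\<exists>C N. \<forall>\<phi> \<psi>. (\<phi>, \<psi>) \<in> rp1_measures \<longrightarrow> norm (moderate_extension \<rho> \<phi>) \<le>
       C * (\<Sum>n\<le>N. (SUP x\<in>{-1..1}. norm (nderiv n \<phi> x)) + (SUP y\<in>{-1..1}. norm (nderiv n \<psi> y)))"
    proof (intro exI[of _ "C * D"] exI[of _ N] allI impI)
      fix \<phi> \<psi> assume m: "(\<phi>, \<psi>) \<in> rp1_measures"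
      show "norm (moderate_extension \<rho> \<phi>) \<le>
       C * D * (\<Sum>n\<le>N. (SUP x\<in>{-1..1}. norm (nderiv n \<phi> x)) + (SUP y\<in>{-1..1}. norm (nderiv n \<psi> y)))"
        unfolding mult.assoc by (rule CN(2)[rule_format, OF moderate_rp1[OF m] D(2)[rule_format, OF m]])
    qed
  qed
  moreover have "\<forall>\<phi>\<in>test_fun UNIV. restrict_to_real_line \<tau> \<phi> = \<sigma> \<phi>"
    by (simp add: restrict_to_real_line_def \<tau>_def \<sigma> test_fun_schwartz)
  moreover have "vanishes_to_infinite_order 0 (chart_at_infinity \<tau>)"
  proof -
    have "chart_at_infinity \<tau> = moderate_extension (\<lambda>\<psi>. \<rho> (inversion \<psi>))"
      by (simp add: fun_eq_iff chart_at_infinity_def \<tau>_def moderate_extension_inversion)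
    then show ?thesis unfolding vanishes_to_infinite_order_iff by (simp only:) (intro allI nf reg(2))
  qed
  ultimately have "extends_canonically_across_infinity \<sigma>"
    unfolding extends_canonically_across_infinity_def extends_to_rp1_def by blast
  then show src: "\<sigma> \<in> mellin_source d" using temp par van by (simp add: mellin_source_def)
  have "\<sigma> (\<lambda>x. annulus_cutoff n x * signed_power d (s - 1) x) = \<rho> (\<lambda>x. annulus_cutoff n x * signed_power d (s - 1) x)" for n
  proof -
    have tf: "(\<lambda>x. annulus_cutoff n x * signed_power d (s - 1) x) \<in> test_fun (- {0})"
      by (rule annulus_cutoff_mult_test_fun[OF smooth_on_signed_power])
    show ?thesis using \<sigma>[OF test_fun_schwartz[OF tf]] moderate_extension_test_fun[OF tf, of \<rho>] by simp
  qed
  then have "moderate_extension \<sigma> (signed_power d (s - 1)) = moderate_extension \<rho> (signed_power d (s - 1))"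
    by (simp add: moderate_extension_def)
  then show "signed_mellin d \<sigma> s = moderate_extension \<rho> (signed_power d (s - 1))"
    using signed_mellin_eq[OF src] by simp
qed

section \<open>The inverse transform\<close>

lemma integrable_inverse_one_plus_square: "integrable lborel (\<lambda>t::real. 1 / (1 + t ^ 2))"
proof -
  have "set_integrable lborel (einterval (- \<infinity>) \<infinity>) (\<lambda>t::real. inverse (1 + t ^ 2))"
  proof (rule interval_integral_FTC_nonneg)
    show "DERIV arctan x :> inverse (1 + x ^ 2)" for x by (rule DERIV_arctan)
    show "isCont (\<lambda>t. inverse (1 + t ^ 2)) x" for x :: real
      by (intro continuous_intros) (metis add_pos_nonneg less_irrefl zero_le_power2 zero_less_one)
    show "((arctan \<circ> real_of_ereal) \<longlongrightarrow> - (pi / 2)) (at_right (- \<infinity>))"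
      unfolding ereal_tendsto_simps by (rule tendsto_arctan_at_bot)
    show "((arctan \<circ> real_of_ereal) \<longlongrightarrow> pi / 2) (at_left \<infinity>)"
      unfolding ereal_tendsto_simps by (rule tendsto_arctan_at_top)
  qed auto
  then show ?thesis by (simp add: set_integrable_def einterval_def inverse_eq_divide)
qed

lemma strip_integrable:
  assumes "continuous_on UNIV g" "\<And>t. norm (g t) \<le> A / (1 + t ^ 2)"
  shows "integrable lborel (g :: real \<Rightarrow> complex)"
proof (rule Bochner_Integration.integrable_bound)
  show "integrable lborel (\<lambda>t. A * (1 / (1 + t ^ 2)))" by (intro integrable_mult_right integrable_inverse_one_plus_square)
  show "g \<in> borel_measurable lborel" using assms(1) by (simp add: borel_measurable_continuous_onI)
  show "AE t in lborel. norm (g t) \<le> norm (A * (1 / (1 + t ^ 2)))"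
    by (intro AE_I2 order_trans[OF assms(2)]) (simp add: divide_right_mono add_nonneg_nonneg)
qed

text \<open>Cauchy's formula on rectangles of growing height. The decay of order t^(-2) makes the
  vertical integrals converge absolutely and the horizontal sides vanish.\<close>

lemma Cauchy_strip:
  fixes \<Psi> :: "complex \<Rightarrow> complex"
  assumes hol: "\<Psi> holomorphic_on {z. Re z < K + 1}" and K: "K > 0"
    and bound: "\<And>c t. \<bar>c\<bar> \<le> K \<Longrightarrow> norm (\<Psi> (Complex c t)) \<le> A / (1 + t ^ 2)" and s: "\<bar>Re s\<bar> < K"
  shows "(LINT t|lborel. \<Psi> (Complex K t) / (Complex K t - s)) - (LINT t|lborel. \<Psi> (Complex (- K) t) / (Complex (- K) t - s)) = 2 * pi * \<Psi> s"
proof -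
  define f where "f w = \<Psi> w / (w - s)" for w
  let ?S = "{z. Re z < K + 1}"
  have A0: "A \<ge> 0"
  proof -
    have "norm (\<Psi> (Complex 0 0)) \<le> A / (1 + 0 ^ 2)" using K by (intro bound) auto
    then show ?thesis using norm_ge_zero[of "\<Psi> (Complex 0 0)"] by (simp del: norm_ge_zero)
  qed
  have contf: "continuous_on (?S - {s}) f"
    unfolding f_def[abs_def]
    by (intro continuous_intros continuous_on_subset[OF holomorphic_on_imp_continuous_on[OF hol]]) auto
  have vert: "continuous_on UNIV (\<lambda>t. f (Complex c t))" if c: "c = K \<or> c = - K" for c
  proof (rule continuous_on_compose2[OF contf])
    show "continuous_on UNIV (Complex c)" unfolding Complex_eq[abs_def] by (intro continuous_intros)
    show "range (Complex c) \<subseteq> ?S - {s}" using c K s by auto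
  qed
  define m where "m = K - \<bar>Re s\<bar>"
  have m: "m > 0" using s by (simp add: m_def)
  have vb: "norm (f (Complex c t)) \<le> (A / m) / (1 + t ^ 2)" if c: "c = K \<or> c = - K" for c t
  proof -
    have "m \<le> \<bar>Re (Complex c t - s)\<bar>" using c s by (auto simp: m_def)
    also have "\<dots> \<le> norm (Complex c t - s)" by (rule abs_Re_le_cmod)
    finally have "norm (\<Psi> (Complex c t)) / norm (Complex c t - s) \<le> (A / (1 + t ^ 2)) / m"
      using m c K A0 by (intro frac_le bound) auto
    then show ?thesis by (simp add: f_def norm_divide mult.commute)
  qed
  have int: "integrable lborel (\<lambda>t. f (Complex c t))" if c: "c = K \<or> c = - K" for c
    using vert[OF c] vb[OF c] by (rule strip_integrable)
  \<comment> \<open>The summand |Im s| + 1 keeps s inside every rectangle and at distance at least 1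
    from its horizontal sides.\<close>
  define T where "T n = real n + \<bar>Im s\<bar> + 1" for n :: nat
  have lim: "(\<lambda>n. integral {- T n..T n} (\<lambda>t. f (Complex c t))) \<longlonglongrightarrow> (LINT t|lborel. f (Complex c t))" if c: "c = K \<or> c = - K" for c
  proof -
    have "(\<lambda>n. LINT t|lborel. indicator {- T n..T n} t *\<^sub>R f (Complex c t)) \<longlonglongrightarrow> (LINT t|lborel. f (Complex c t))"
    proof (rule integral_dominated_convergence[where w = "\<lambda>t. norm (f (Complex c t))"])
      show "integrable lborel (\<lambda>t. norm (f (Complex c t)))" by (intro integrable_norm int c)
      show "(\<lambda>t. f (Complex c t)) \<in> borel_measurable lborel" using int[OF c] by (rule borel_measurable_integrable)
      then show "(\<lambda>t. indicator {- T n..T n} t *\<^sub>R f (Complex c t)) \<in> borel_measurable lborel" for n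
        by (intro borel_measurable_scaleR borel_measurable_indicator) auto
      show "AE t in lborel. (\<lambda>n. indicator {- T n..T n} t *\<^sub>R f (Complex c t)) \<longlonglongrightarrow> f (Complex c t)"
      proof (rule AE_I2, rule tendsto_eventually)
        fix t :: real
        obtain n0 :: nat where n0: "\<bar>t\<bar> \<le> real n0" using real_arch_simple by blast
        show "\<forall>\<^sub>F n in sequentially. indicator {- T n..T n} t *\<^sub>R f (Complex c t) = f (Complex c t)"
        proof (rule eventually_sequentiallyI[of n0])
          fix n assume "n0 \<le> n"
          then have "\<bar>t\<bar> \<le> T n" using n0 by (simp add: T_def)
          then show "indicator {- T n..T n} t *\<^sub>R f (Complex c t) = f (Complex c t)" by (simp add: abs_le_iff)
        qed
      qed
      show "AE t in lborel. norm (indicator {- T n..T n} t *\<^sub>R f (Complex c t)) \<le> norm (f (Complex c t))" for n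
        by (intro AE_I2) (simp add: indicator_def)
    qed
    moreover have "(LINT t|lborel. indicator {- T n..T n} t *\<^sub>R f (Complex c t)) = integral {- T n..T n} (\<lambda>t. f (Complex c t))" for n
    proof -
      have "set_integrable lborel {- T n..T n} (\<lambda>t. f (Complex c t))"
        unfolding set_integrable_def by (intro integrable_mult_indicator int c) auto
      from set_borel_integral_eq_integral(2)[OF this] show ?thesis by (simp add: set_lebesgue_integral_def)
    qed
    ultimately show ?thesis by simp
  qed
  \<comment> \<open>The contribution of the two horizontal sides.\<close>
  define h where "h n = contour_integral (linepath (Complex (- K) (- T n)) (Complex K (- T n))) f
     + contour_integral (linepath (Complex K (T n)) (Complex (- K) (T n))) f" for n
  have T1: "T n - \<bar>Im s\<bar> \<ge> 1" "T n > 0" "T n \<ge> real n" for n by (auto simp: T_def)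
  have hor: "norm (f w) \<le> A / (1 + T n ^ 2)" if w: "\<bar>Re w\<bar> \<le> K" "\<bar>Im w\<bar> = T n" for w n
  proof -
    have "1 \<le> \<bar>Im (w - s)\<bar>" using w(2) T1(1)[of n] by auto
    also have "\<dots> \<le> norm (w - s)" by (rule abs_Im_le_cmod)
    finally have 1: "1 \<le> norm (w - s)" .
    have "norm (\<Psi> (Complex (Re w) (Im w))) \<le> A / (1 + Im w ^ 2)" using w(1) by (rule bound)
    moreover have "Im w ^ 2 = T n ^ 2" using w(2) by (metis power2_abs)
    ultimately have 2: "norm (\<Psi> w) \<le> A / (1 + T n ^ 2)" by simp
    have "norm (f w) \<le> norm (\<Psi> w) / 1" unfolding f_def norm_divide using 1 by (intro divide_left_mono) auto
    then show ?thesis using 2 by simp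
  qed
  have key: "h n + (\<i> * integral {- T n..T n} (\<lambda>t. f (Complex K t)) - \<i> * integral {- T n..T n} (\<lambda>t. f (Complex (- K) t))) = 2 * pi * \<i> * \<Psi> s"
    and hb: "norm (h n) \<le> 2 * (A / (1 + T n ^ 2) * (2 * K))" for n
  proof -
    let ?a1 = "Complex (- K) (- T n)" and ?a2 = "Complex K (- T n)" and ?a3 = "Complex K (T n)" and ?a4 = "Complex (- K) (T n)"
    have box: "s \<in> box ?a1 ?a3" using s T1[of n] by (auto simp: in_box_complex_iff abs_less_iff)
    have im: "path_image (rectpath ?a1 ?a3) \<subseteq> ?S - {s}"
    proof -
      have "path_image (rectpath ?a1 ?a3) \<subseteq> cbox ?a1 ?a3 - box ?a1 ?a3"
        using K T1[of n] by (subst path_image_rectpath_cbox_minus_box) auto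
      moreover have "cbox ?a1 ?a3 \<subseteq> ?S" by (auto simp: in_cbox_complex_iff)
      ultimately show ?thesis using box by blast
    qed
    have "((\<lambda>w. \<Psi> w / (w - s)) has_contour_integral (2 * pi * \<i> * winding_number (rectpath ?a1 ?a3) s * \<Psi> s)) (rectpath ?a1 ?a3)"
    proof (rule Cauchy_integral_formula_convex_simple[of ?S])
      show "convex ?S" by (rule convex_halfspace_Re_lt)
      show "s \<in> interior ?S" using s by (subst interior_open) (auto simp: open_halfspace_Re_lt)
    qed (use hol im in auto)
    then have ci: "contour_integral (rectpath ?a1 ?a3) f = 2 * pi * \<i> * \<Psi> s"
      unfolding f_def[abs_def] using winding_number_rectpath[OF box] by (simp add: contour_integral_unique)
    have rp: "rectpath ?a1 ?a3 = linepath ?a1 ?a2 +++ linepath ?a2 ?a3 +++ linepath ?a3 ?a4 +++ linepath ?a4 ?a1"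
      by (simp add: rectpath_def Let_def)
    have seg: "closed_segment ?a1 ?a2 \<union> closed_segment ?a2 ?a3 \<union> closed_segment ?a3 ?a4 \<union> closed_segment ?a4 ?a1 \<subseteq> ?S - {s}"
      using im unfolding rp by (simp add: path_image_join Un_assoc)
    have ig: "f contour_integrable_on linepath ?a1 ?a2" "f contour_integrable_on linepath ?a2 ?a3"
      "f contour_integrable_on linepath ?a3 ?a4" "f contour_integrable_on linepath ?a4 ?a1"
      using seg by (auto intro!: contour_integrable_continuous_linepath continuous_on_subset[OF contf])
    have sum: "contour_integral (rectpath ?a1 ?a3) f = contour_integral (linepath ?a1 ?a2) f + (contour_integral (linepath ?a2 ?a3) f
       + (contour_integral (linepath ?a3 ?a4) f + contour_integral (linepath ?a4 ?a1) f))"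
      unfolding rp using ig by (simp add: contour_integrable_join)
    have v1: "contour_integral (linepath ?a2 ?a3) f = \<i> * integral {- T n..T n} (\<lambda>t. f (Complex K t))"
      by (rule contour_integral_linepath_same_Re) (use T1[of n] in auto)
    have "contour_integral (linepath ?a1 ?a4) f = \<i> * integral {- T n..T n} (\<lambda>t. f (Complex (- K) t))"
      by (rule contour_integral_linepath_same_Re) (use T1[of n] in auto)
    moreover have "contour_integral (linepath ?a4 ?a1) f = - contour_integral (linepath ?a1 ?a4) f"
      using contour_integral_reverse_linepath[of ?a1 ?a4 f] seg
      by (simp add: closed_segment_commute continuous_on_subset[OF contf])
    ultimately have v2: "contour_integral (linepath ?a4 ?a1) f = - (\<i> * integral {- T n..T n} (\<lambda>t. f (Complex (- K) t)))" by simp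
    show "h n + (\<i> * integral {- T n..T n} (\<lambda>t. f (Complex K t)) - \<i> * integral {- T n..T n} (\<lambda>t. f (Complex (- K) t))) = 2 * pi * \<i> * \<Psi> s"
      using ci sum v1 v2 by (simp add: h_def algebra_simps)
    have B0: "0 \<le> A / (1 + T n ^ 2)" using A0 by simp
    have "norm (contour_integral (linepath ?a1 ?a2) f) \<le> A / (1 + T n ^ 2) * norm (?a2 - ?a1)"
    proof (rule contour_integral_bound_linepath[OF ig(1) B0])
      fix w assume "w \<in> closed_segment ?a1 ?a2"
      then have "\<bar>Re w\<bar> \<le> K \<and> Im w = - T n" using K by (auto simp: closed_segment_same_Im closed_segment_eq_real_ivl)
      then show "norm (f w) \<le> A / (1 + T n ^ 2)" using T1[of n] by (intro hor) auto
    qed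
    moreover have "norm (contour_integral (linepath ?a3 ?a4) f) \<le> A / (1 + T n ^ 2) * norm (?a4 - ?a3)"
    proof (rule contour_integral_bound_linepath[OF ig(3) B0])
      fix w assume "w \<in> closed_segment ?a3 ?a4"
      then have "\<bar>Re w\<bar> \<le> K \<and> Im w = T n" using K by (auto simp: closed_segment_same_Im closed_segment_eq_real_ivl)
      then show "norm (f w) \<le> A / (1 + T n ^ 2)" using T1[of n] by (intro hor) auto
    qed
    moreover have "norm (?a2 - ?a1) = 2 * K" "norm (?a4 - ?a3) = 2 * K" using K by (simp_all add: cmod_def real_sqrt_mult)
    ultimately show "norm (h n) \<le> 2 * (A / (1 + T n ^ 2) * (2 * K))"
      unfolding h_def using norm_triangle_ineq[of "contour_integral (linepath ?a1 ?a2) f" "contour_integral (linepath ?a3 ?a4) f"] by simp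
  qed
  have "h \<longlonglongrightarrow> 0"
  proof (rule Lim_null_comparison)
    show "\<forall>\<^sub>F n in sequentially. norm (h n) \<le> 4 * A * K / (1 + real n ^ 2)"
    proof (rule always_eventually, rule allI)
      fix n
      have "A / (1 + T n ^ 2) \<le> A / (1 + real n ^ 2)"
        using T1(3)[of n] A0 by (intro divide_left_mono add_left_mono power_mono) (auto intro!: mult_pos_pos add_pos_nonneg)
      then have "2 * (A / (1 + T n ^ 2) * (2 * K)) \<le> 2 * (A / (1 + real n ^ 2) * (2 * K))" using K by (intro mult_left_mono mult_right_mono) auto
      then show "norm (h n) \<le> 4 * A * K / (1 + real n ^ 2)" using hb[of n] by (simp add: mult_ac)
    qed
    have "filterlim (\<lambda>n. 1 + real n ^ 2) at_top sequentially"
      by (intro filterlim_tendsto_add_at_top[OF tendsto_const] filterlim_pow_at_top filterlim_real_sequentially) auto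
    then show "(\<lambda>n. 4 * A * K / (1 + real n ^ 2)) \<longlonglongrightarrow> 0" by (rule real_tendsto_divide_at_top[OF tendsto_const])
  qed
  then have "(\<lambda>n. h n + (\<i> * integral {- T n..T n} (\<lambda>t. f (Complex K t)) - \<i> * integral {- T n..T n} (\<lambda>t. f (Complex (- K) t))))
     \<longlonglongrightarrow> 0 + (\<i> * (LINT t|lborel. f (Complex K t)) - \<i> * (LINT t|lborel. f (Complex (- K) t)))"
    by (intro tendsto_intros lim) auto
  then have "\<i> * ((LINT t|lborel. f (Complex K t)) - (LINT t|lborel. f (Complex (- K) t))) = \<i> * (2 * pi * \<Psi> s)"
    unfolding key by (simp add: LIMSEQ_const_iff algebra_simps)
  then show ?thesis unfolding f_def by simp
qed

section \<open>Mellin integrals of powers and of inverse Mellin integrals\<close>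

lemma integrable_even:
  fixes p :: "real \<Rightarrow> complex"
  assumes p: "integrable lborel p" and 0: "\<And>x. x \<le> 0 \<Longrightarrow> p x = 0"
  shows "integrable lborel (\<lambda>x. p \<bar>x\<bar>)" "(LINT x|lborel. p \<bar>x\<bar>) = 2 * (LINT x|lborel. p x)"
proof -
  have n: "integrable lborel (\<lambda>x. p (- x))" using lborel_integrable_real_affine[OF p, of "-1" 0] by simp
  have ni: "(LINT x|lborel. p (- x)) = (LINT x|lborel. p x)"
    using lborel_integral_real_affine[of "-1" p 0] by simp
  have eq: "(\<lambda>x. p \<bar>x\<bar>) = (\<lambda>x. p x + p (- x))" by (auto simp: fun_eq_iff abs_if 0)
  show "integrable lborel (\<lambda>x. p \<bar>x\<bar>)" unfolding eq by (rule Bochner_Integration.integrable_add[OF p n])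
  show "(LINT x|lborel. p \<bar>x\<bar>) = 2 * (LINT x|lborel. p x)"
    unfolding eq Bochner_Integration.integral_add[OF p n] ni by simp
qed

text \<open>Extended real endpoints cover (0, 1) and (1, infinity) together. The limits are assumed
  for every \<open>w\<close> with the same real part, since the case w = Re z gives absolute
  integrability and w = z the value.\<close>

lemma power_FTC:
  fixes z :: complex and l u :: ereal
  assumes z: "Re z \<noteq> 0" and lu: "0 \<le> l" "l < u"
    and A: "\<And>w. Re w = Re z \<Longrightarrow> (((\<lambda>x. exp (w * of_real (ln x))) \<circ> real_of_ereal) \<longlongrightarrow> A) (at_right l)"
    and B: "\<And>w. Re w = Re z \<Longrightarrow> (((\<lambda>x. exp (w * of_real (ln x))) \<circ> real_of_ereal) \<longlongrightarrow> B) (at_left u)"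
  shows "set_integrable lborel (einterval l u) (\<lambda>x. exp ((z - 1) * of_real (ln x)))" (is ?int)
    and "(LBINT x=l..u. exp ((z - 1) * of_real (ln x))) = (B - A) / z"
proof -
  have pos: "x > 0" if "l < ereal x" for x
  proof -
    have "0 < ereal x" using lu(1) that by (rule le_less_trans)
    then show ?thesis by simp
  qed
  have real_lim: "(((\<lambda>x. exp (Re z * ln x) / Re z) \<circ> real_of_ereal) \<longlongrightarrow> Re L / Re z) F"
    if "\<And>w. Re w = Re z \<Longrightarrow> (((\<lambda>x. exp (w * of_real (ln x))) \<circ> real_of_ereal) \<longlongrightarrow> L) F" for L F
  proof -
    have "((\<lambda>x. Re (exp (of_real (Re z) * of_real (ln (real_of_ereal x)))) / Re z) \<longlongrightarrow> Re L / Re z) F"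
      using that[of "of_real (Re z)"] z by (intro tendsto_divide tendsto_Re tendsto_const) (simp_all add: o_def)
    then show ?thesis by (simp add: Re_exp o_def)
  qed
  have "set_integrable lborel (einterval l u) (\<lambda>x. exp ((Re z - 1) * ln x))"
  proof (rule interval_integral_FTC_nonneg(1)[OF lu(2)])
    show "DERIV (\<lambda>x. exp (Re z * ln x) / Re z) x :> exp ((Re z - 1) * ln x)" if "l < ereal x" "ereal x < u" for x
    proof -
      have "exp ((Re z - 1) * ln x) = exp (Re z * ln x) * (Re z * (1 / x)) / Re z"
        using pos[OF that(1)] z by (simp add: left_diff_distrib exp_diff)
      then show ?thesis using pos[OF that(1)] by (auto intro!: derivative_eq_intros)
    qed
    show "isCont (\<lambda>x. exp ((Re z - 1) * ln x)) x" if "l < ereal x" "ereal x < u" for x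
      using pos[OF that(1)] by (intro continuous_intros) auto
    show "(((\<lambda>x. exp (Re z * ln x) / Re z) \<circ> real_of_ereal) \<longlongrightarrow> Re A / Re z) (at_right l)" by (rule real_lim[OF A])
    show "(((\<lambda>x. exp (Re z * ln x) / Re z) \<circ> real_of_ereal) \<longlongrightarrow> Re B / Re z) (at_left u)" by (rule real_lim[OF B])
  qed auto
  then show int: ?int
    unfolding set_integrable_def
    by (rule Bochner_Integration.integrable_bound) (auto simp: norm_mult indicator_def intro!: AE_I2)
  show "(LBINT x=l..u. exp ((z - 1) * of_real (ln x))) = (B - A) / z"
    unfolding diff_divide_distrib
  proof (rule interval_integral_FTC_integrable[OF lu(2) _ _ int])
    show "((\<lambda>x. exp (z * of_real (ln x)) / z) has_vector_derivative exp ((z - 1) * of_real (ln x))) (at x)"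
      if "l < ereal x" "ereal x < u" for x
    proof -
      have x: "x > 0" by (rule pos[OF that(1)])
      have "(ln has_real_derivative 1 / x) (at x)" using x by (auto intro!: derivative_eq_intros)
      then have 1: "((\<lambda>x. of_real (ln x)) has_vector_derivative (of_real (1 / x) :: complex)) (at x)"
        by (rule has_vector_derivative_of_real)
      have "((\<lambda>w. exp (z * w) / z) has_field_derivative exp (z * w)) (at w)" for w
        using z by (auto intro!: derivative_eq_intros)
      from field_vector_diff_chain_at[OF 1 this]
      have "((\<lambda>x. exp (z * of_real (ln x)) / z) has_vector_derivative of_real (1 / x) * exp (z * of_real (ln x))) (at x)"
        by (simp add: o_def)
      moreover have "of_real (1 / x) * exp (z * of_real (ln x)) = exp ((z - 1) * of_real (ln x))"
        using x by (simp add: left_diff_distrib exp_diff exp_of_real)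
      ultimately show ?thesis by simp
    qed
    show "isCont (\<lambda>x. exp ((z - 1) * of_real (ln x))) x" if "l < ereal x" "ereal x < u" for x
      using pos[OF that(1)] by (intro continuous_intros) auto
    have z0: "z \<noteq> 0" using z by auto
    show "(((\<lambda>x. exp (z * of_real (ln x)) / z) \<circ> real_of_ereal) \<longlongrightarrow> A / z) (at_right l)"
      using tendsto_divide[OF A[of z] tendsto_const[of z] z0] by (simp add: o_def)
    show "(((\<lambda>x. exp (z * of_real (ln x)) / z) \<circ> real_of_ereal) \<longlongrightarrow> B / z) (at_left u)"
      using tendsto_divide[OF B[of z] tendsto_const[of z] z0] by (simp add: o_def)
  qed
qed

text \<open>The piece of the half-line on which x^(z-1) is integrable, according to the sign r of Re
  z.\<close>

definition half_line_piece :: "real \<Rightarrow> real set" where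
  "half_line_piece r = (if r > 0 then {0<..<1} else {1<..})"

text \<open>The antiderivative x^z / z contributes only at 1, as upper or lower endpoint, hence the
  sign; the factor 2 counts both half-lines.\<close>

lemma power_integral:
  fixes z :: complex
  assumes z: "Re z \<noteq> 0"
  shows "integrable lborel (\<lambda>x. indicator (half_line_piece (Re z)) \<bar>x\<bar> *\<^sub>R exp ((z - 1) * of_real (ln \<bar>x\<bar>)))" (is ?int)
    and "(LINT x|lborel. indicator (half_line_piece (Re z)) \<bar>x\<bar> *\<^sub>R exp ((z - 1) * of_real (ln \<bar>x\<bar>))) = 2 * of_real (sgn (Re z)) / z" (is ?eq)
proof -
  let ?p = "\<lambda>x. indicator (half_line_piece (Re z)) x *\<^sub>R exp ((z - 1) * of_real (ln x))"
  have at_1: "((\<lambda>x. exp (w * of_real (ln x))) \<longlongrightarrow> 1) (at_left 1)" "((\<lambda>x. exp (w * of_real (ln x))) \<longlongrightarrow> 1) (at_right 1)" for w :: complex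
  proof -
    have "isCont (\<lambda>x. exp (w * of_real (ln x))) 1" by (intro continuous_intros) auto
    then have "((\<lambda>x. exp (w * of_real (ln x))) \<longlongrightarrow> 1) (at 1)" by (simp add: isCont_def)
    then show "((\<lambda>x. exp (w * of_real (ln x))) \<longlongrightarrow> 1) (at_left 1)" "((\<lambda>x. exp (w * of_real (ln x))) \<longlongrightarrow> 1) (at_right 1)"
      by (rule tendsto_within_subset; simp)+
  qed
  have "integrable lborel ?p \<and> (LINT x|lborel. ?p x) = of_real (sgn (Re z)) / z"
  proof (cases "Re z > 0")
    case True
    have lim0: "((\<lambda>x. exp (w * of_real (ln x))) \<longlongrightarrow> 0) (at_right 0)" if "Re w = Re z" for w :: complex
    proof (rule tendsto_norm_zero_cancel)
      have "filterlim (\<lambda>x. Re z * ln x) at_bot (at_right 0)"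
        by (rule filterlim_tendsto_pos_mult_at_bot[OF tendsto_const True ln_at_0])
      from filterlim_compose[OF exp_at_bot this] show "((\<lambda>x. norm (exp (w * of_real (ln x)))) \<longlongrightarrow> 0) (at_right 0)"
        using that by simp
    qed
    have e: "einterval 0 1 = half_line_piece (Re z)"
      using True by (auto simp: einterval_def half_line_piece_def zero_ereal_def one_ereal_def)
    have "set_integrable lborel (einterval 0 1) (\<lambda>x. exp ((z - 1) * of_real (ln x)))"
      by (rule power_FTC(1)[where A = 0 and B = 1]) (use at_1 lim0 z in \<open>simp_all add: zero_ereal_def one_ereal_def ereal_tendsto_simps\<close>)
    moreover have "(LBINT x=0..1. exp ((z - 1) * of_real (ln x))) = (1 - 0) / z"
      by (rule power_FTC(2)) (use at_1 lim0 z in \<open>simp_all add: zero_ereal_def one_ereal_def ereal_tendsto_simps\<close>)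
    ultimately show ?thesis using True by (simp add: e interval_lebesgue_integral_def set_integrable_def set_lebesgue_integral_def)
  next
    case False
    have lim0: "((\<lambda>x. exp (w * of_real (ln x))) \<longlongrightarrow> 0) at_top" if "Re w = Re z" for w :: complex
    proof (rule tendsto_norm_zero_cancel)
      have "filterlim (\<lambda>x. Re z * ln x) at_bot at_top"
        using False z by (intro filterlim_tendsto_neg_mult_at_bot[OF tendsto_const _ ln_at_top]) auto
      from filterlim_compose[OF exp_at_bot this] show "((\<lambda>x. norm (exp (w * of_real (ln x)))) \<longlongrightarrow> 0) at_top"
        using that by simp
    qed
    have e: "einterval 1 \<infinity> = half_line_piece (Re z)"
      using False by (auto simp: einterval_def half_line_piece_def one_ereal_def)
    have "set_integrable lborel (einterval 1 \<infinity>) (\<lambda>x. exp ((z - 1) * of_real (ln x)))"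
      by (rule power_FTC(1)[where A = 1 and B = 0]) (use at_1 lim0 z in \<open>simp_all add: zero_ereal_def one_ereal_def ereal_tendsto_simps\<close>)
    moreover have "(LBINT x=1..\<infinity>. exp ((z - 1) * of_real (ln x))) = (0 - 1) / z"
      by (rule power_FTC(2)) (use at_1 lim0 z in \<open>simp_all add: zero_ereal_def one_ereal_def ereal_tendsto_simps\<close>)
    ultimately show ?thesis using False z by (simp add: e interval_lebesgue_integral_def set_integrable_def set_lebesgue_integral_def)
  qed
  moreover have "?p x = 0" if "x \<le> 0" for x using that by (simp add: half_line_piece_def)
  ultimately show ?int ?eq using integrable_even[of ?p] by simp_all
qed

text \<open>Exchanging the integrals leaves the Mellin integral of a pure power, which is a Cauchy
  kernel 1/(w - s) on the line Re w = c. The position of s relative to that line decides which piece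
  of the half-line is used.\<close>

lemma mellin_inverse_piece:
  fixes \<Psi> :: "complex \<Rightarrow> complex" and c :: real and s :: complex
  assumes cont: "continuous_on UNIV (\<lambda>t. \<Psi> (Complex c t))"
    and bound: "\<And>t. norm (\<Psi> (Complex c t)) \<le> A / (1 + t ^ 2)"
  defines "G \<equiv> \<lambda>x. LINT t|lborel. \<Psi> (Complex c t) * exp (- Complex c t * of_real (ln \<bar>x\<bar>))"
  shows "G \<in> borel_measurable borel"
    and "norm (G x) \<le> (LINT t|lborel. norm (\<Psi> (Complex c t))) * exp (- c * ln \<bar>x\<bar>)"
    and "Re s \<noteq> c \<Longrightarrow> integrable lborel (\<lambda>x. indicator (half_line_piece (Re s - c)) \<bar>x\<bar> *\<^sub>R (G x * exp ((s - 1) * of_real (ln \<bar>x\<bar>))))"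
    and "Re s \<noteq> c \<Longrightarrow> (LINT x|lborel. indicator (half_line_piece (Re s - c)) \<bar>x\<bar> *\<^sub>R (G x * exp ((s - 1) * of_real (ln \<bar>x\<bar>))))
      = 2 * of_real (sgn (c - Re s)) * (LINT t|lborel. \<Psi> (Complex c t) / (Complex c t - s))"
proof -
  define \<psi> where "\<psi> t = \<Psi> (Complex c t)" for t
  have C: "Complex c t = of_real c + \<i> * of_real t" for t by (simp add: Complex_eq)
  have [measurable]: "\<psi> \<in> borel_measurable borel" unfolding \<psi>_def by (rule borel_measurable_continuous_onI[OF cont])
  have [measurable]: "(exp :: complex \<Rightarrow> complex) \<in> borel_measurable borel"
    by (intro borel_measurable_continuous_onI continuous_intros)
  have int: "integrable lborel \<psi>" unfolding \<psi>_def using cont bound by (rule strip_integrable)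
  have G: "G = (\<lambda>x. LINT t|lborel. \<psi> t * exp (- Complex c t * of_real (ln \<bar>x\<bar>)))" by (simp add: G_def \<psi>_def)
  have "(\<lambda>x. LINT t|lborel. \<psi> t * exp (- Complex c t * of_real (ln \<bar>x\<bar>))) \<in> borel_measurable borel"
    by (rule lborel.borel_measurable_lebesgue_integral) (unfold C, measurable)
  then show "G \<in> borel_measurable borel" by (simp add: G)
  have "norm (G x) \<le> (LINT t|lborel. norm (\<psi> t * exp (- Complex c t * of_real (ln \<bar>x\<bar>))))" unfolding G by (rule integral_norm_bound)
  also have "\<dots> = (LINT t|lborel. norm (\<psi> t) * exp (- c * ln \<bar>x\<bar>))" by (simp add: norm_mult)
  finally show "norm (G x) \<le> (LINT t|lborel. norm (\<Psi> (Complex c t))) * exp (- c * ln \<bar>x\<bar>)" by (simp add: \<psi>_def)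
  assume s: "Re s \<noteq> c"
  define S where "S = half_line_piece (Re s - c)"
  have [measurable]: "S \<in> sets borel" by (simp add: S_def half_line_piece_def)
  define F where "F x t = \<psi> t * (indicator S \<bar>x\<bar> *\<^sub>R exp ((s - Complex c t - 1) * of_real (ln \<bar>x\<bar>)))" for x t
  \<comment> \<open>The modulus of the x-dependent factor does not involve \<open>t\<close>, so
    absolute integrability on the product splits into two single integrals.\<close>
  define q where "q x = indicator S \<bar>x\<bar> *\<^sub>R exp ((of_real (Re s - c) - 1) * of_real (ln \<bar>x\<bar>) :: complex)" for x
  have q: "integrable lborel q" unfolding q_def S_def using power_integral(1)[of "of_real (Re s - c)"] s by simp
  have nF: "norm (F x t) = norm (q x) * norm (\<psi> t)" for x t by (simp add: F_def q_def norm_mult)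
  have mF: "(\<lambda>(x, t). F x t) \<in> borel_measurable (lborel \<Otimes>\<^sub>M lborel)" unfolding F_def C by measurable
  have prod: "integrable (lborel \<Otimes>\<^sub>M lborel) (\<lambda>(x, t). F x t)"
  proof (rule lborel_pair.Fubini_integrable[OF mF])
    show "integrable lborel (\<lambda>x. LINT t|lborel. norm (case (x, t) of (x, t) \<Rightarrow> F x t))"
      using q by (simp add: nF)
    show "AE x in lborel. integrable lborel (\<lambda>t. case (x, t) of (x, t) \<Rightarrow> F x t)"
    proof (rule AE_I2)
      fix x :: real
      have "integrable lborel (\<lambda>t. norm (q x) * norm (\<psi> t))" using int by (intro integrable_mult_right integrable_norm)
      moreover have "F x \<in> borel_measurable lborel" unfolding F_def[abs_def] C by measurable
      ultimately have "integrable lborel (F x)"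
        by (rule Bochner_Integration.integrable_bound) (auto simp: nF)
      then show "integrable lborel (\<lambda>t. case (x, t) of (x, t) \<Rightarrow> F x t)" by simp
    qed
  qed
  from lborel_pair.Fubini_integral[OF prod]
  have fub: "(LINT x|lborel. LINT t|lborel. F x t) = (LINT t|lborel. LINT x|lborel. F x t)" by simp
  have L: "(LINT t|lborel. F x t) = indicator S \<bar>x\<bar> *\<^sub>R (G x * exp ((s - 1) * of_real (ln \<bar>x\<bar>)))" for x
  proof -
    have "F x t = (\<psi> t * exp (- Complex c t * of_real (ln \<bar>x\<bar>))) * (indicator S \<bar>x\<bar> *\<^sub>R exp ((s - 1) * of_real (ln \<bar>x\<bar>)))" for t
    proof -
      have "exp ((s - Complex c t - 1) * of_real (ln \<bar>x\<bar>)) = exp (- Complex c t * of_real (ln \<bar>x\<bar>)) * exp ((s - 1) * of_real (ln \<bar>x\<bar>))"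
        unfolding mult_exp_exp by (rule arg_cong[of _ _ exp]) (simp add: algebra_simps)
      then show ?thesis by (simp add: F_def scaleR_conv_of_real)
    qed
    then have "(LINT t|lborel. F x t) = G x * (indicator S \<bar>x\<bar> *\<^sub>R exp ((s - 1) * of_real (ln \<bar>x\<bar>)))"
      unfolding G by (simp only: integral_mult_left_zero)
    then show ?thesis by (simp add: scaleR_conv_of_real)
  qed
  have R: "(LINT x|lborel. F x t) = 2 * of_real (sgn (c - Re s)) * (\<Psi> (Complex c t) / (Complex c t - s))" for t
  proof -
    have "(LINT x|lborel. F x t) = \<psi> t * (LINT x|lborel. indicator S \<bar>x\<bar> *\<^sub>R exp ((s - Complex c t - 1) * of_real (ln \<bar>x\<bar>)))"
      unfolding F_def by (rule integral_mult_right_zero)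
    also have "\<dots> = \<psi> t * (2 * of_real (sgn (Re s - c)) / (s - Complex c t))"
      unfolding S_def using power_integral(2)[of "s - Complex c t"] s by simp
    also have "\<dots> = 2 * of_real (sgn (c - Re s)) * (\<Psi> (Complex c t) / (Complex c t - s))"
    proof -
      have 1: "sgn (Re s - c) = - sgn (c - Re s)" by (simp add: sgn_if)
      have 2: "s - Complex c t = - (Complex c t - s)" by simp
      have 3: "p * (2 * - q / (- w)) = 2 * q * (p / w)" for p q w :: complex by (simp add: mult_ac)
      show ?thesis unfolding 1 2 \<psi>_def of_real_minus by (rule 3)
    qed
    finally show ?thesis .
  qed
  show "(LINT x|lborel. indicator (half_line_piece (Re s - c)) \<bar>x\<bar> *\<^sub>R (G x * exp ((s - 1) * of_real (ln \<bar>x\<bar>))))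
      = 2 * of_real (sgn (c - Re s)) * (LINT t|lborel. \<Psi> (Complex c t) / (Complex c t - s))"
    using fub unfolding L R S_def integral_mult_right_zero .
  show "integrable lborel (\<lambda>x. indicator (half_line_piece (Re s - c)) \<bar>x\<bar> *\<^sub>R (G x * exp ((s - 1) * of_real (ln \<bar>x\<bar>))))"
    using lborel_pair.integrable_fst[OF prod] unfolding L S_def .
qed

lemma moderate_growth_strip:
  assumes "H holomorphic_on UNIV" "moderate_growth_on_vertical_strips H" and K: "K > 0"
  obtains A N where "A \<ge> 0" "\<forall>c t. \<bar>c\<bar> \<le> K \<longrightarrow> norm (H (Complex c t)) \<le> A * (1 + t ^ 2) ^ N"
proof -
  obtain T C :: real and N where TC: "T > 0" "C > 0"
    and g: "\<forall>s. - K \<le> Re s \<and> Re s \<le> K \<and> \<bar>Im s\<bar> \<ge> T \<longrightarrow> norm (H s) \<le> C * \<bar>Im s\<bar> ^ N"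
    using assms(2)[unfolded moderate_growth_on_vertical_strips_def, rule_format, of "- K" K] K by auto
  have "bounded (H ` cbox (Complex (- K) (- T)) (Complex K T))"
    by (intro compact_imp_bounded compact_continuous_image compact_cbox holomorphic_on_imp_continuous_on holomorphic_on_subset[OF assms(1)]) auto
  then obtain B where B: "\<And>s. s \<in> cbox (Complex (- K) (- T)) (Complex K T) \<Longrightarrow> norm (H s) \<le> B"
    by (auto simp: bounded_iff)
  have "norm (H (Complex c t)) \<le> (C + \<bar>B\<bar>) * (1 + t ^ 2) ^ N" if c: "\<bar>c\<bar> \<le> K" for c t
  proof (cases "\<bar>t\<bar> \<ge> T")
    case True
    have "0 \<le> (\<bar>t\<bar> - 1) ^ 2" by simp
    then have t: "\<bar>t\<bar> \<le> 1 + t ^ 2" by (simp add: power2_diff)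
    have "norm (H (Complex c t)) \<le> C * \<bar>t\<bar> ^ N" using g[rule_format, of "Complex c t"] c True by (auto simp: abs_le_iff)
    also have "\<dots> \<le> (C + \<bar>B\<bar>) * (1 + t ^ 2) ^ N" using t TC by (intro mult_mono power_mono) auto
    finally show ?thesis .
  next
    case False
    have "norm (H (Complex c t)) \<le> B" using False c by (intro B) (auto simp: in_cbox_complex_iff)
    also have "\<dots> \<le> (C + \<bar>B\<bar>) * 1" using TC by simp
    also have "\<dots> \<le> (C + \<bar>B\<bar>) * (1 + t ^ 2) ^ N" using TC by (intro mult_left_mono one_le_power) auto
    finally show ?thesis .
  qed
  then show thesis using TC by (intro that[of "C + \<bar>B\<bar>" N]) auto
qed

text \<open>Off 0 the weight is min(x^2, x^(-2)). It is the integrable factor for which two units of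
  weight are given up in the construction below.\<close>

lemma wt_minus_2_le: "wt (- 2) x \<le> 2 * (1 / (1 + x ^ 2))"
proof -
  consider "x = 0" | "x \<noteq> 0" "\<bar>x\<bar> < 1" | "\<bar>x\<bar> \<ge> 1" by linarith
  then show ?thesis
  proof cases
    case 1 then show ?thesis by (simp add: wt_def)
  next
    case 2
    have "x ^ 2 \<le> 1" using 2 power_le_one[of "\<bar>x\<bar>" 2] by simp
    moreover have "x ^ 2 * x ^ 2 \<le> 1 * 1" using calculation by (intro mult_mono) auto
    ultimately have "x ^ 2 * (1 + x ^ 2) \<le> 2" by (simp add: algebra_simps)
    then have "x ^ 2 \<le> 2 / (1 + x ^ 2)" by (simp add: pos_le_divide_eq add_pos_nonneg)
    then show ?thesis using power_wt[of x 2] 2 by simp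
  next
    case 3
    have "1 \<le> x ^ 2" using 3 one_le_power[of "\<bar>x\<bar>" 2] by simp
    have "wt (- 2) x = 1 / x ^ 2"
      using 3 exp_of_nat_mult[of 2 "ln \<bar>x\<bar>"] by (simp add: wt_def exp_minus divide_inverse)
    also have "\<dots> \<le> 2 * (1 / (1 + x ^ 2))" 
    proof -
      have "x \<noteq> 0" using 3 by auto
      then have "(1 + x ^ 2) / x ^ 2 \<le> 2" using \<open>1 \<le> x ^ 2\<close> by (simp add: pos_divide_le_eq)
      then show ?thesis by (simp add: pos_le_divide_eq add_pos_nonneg)
    qed
    finally show ?thesis .
  qed
qed

lemma integrable_wt: "integrable lebesgue (wt (- 2))"
proof -
  have "integrable lborel (wt (- 2))"
  proof (rule Bochner_Integration.integrable_bound)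
    show "integrable lborel (\<lambda>x. 2 * (1 / (1 + x ^ 2)) :: real)" by (intro integrable_mult_right integrable_inverse_one_plus_square)
    show "wt (- 2) \<in> borel_measurable lborel" unfolding wt_def[abs_def] by measurable
    show "AE x in lborel. norm (wt (- 2) x) \<le> norm (2 * (1 / (1 + x ^ 2)) :: real)"
      using wt_minus_2_le by (intro AE_I2) (simp add: wt_def)
  qed
  then show ?thesis by (simp add: integrable_completion borel_measurable_integrable)
qed

lemma euler_reflect:
  assumes "smooth_on UNIV f"
  shows "(euler ^^ n) (\<lambda>x. f (- x)) = (\<lambda>x. (euler ^^ n) f (- x))"
proof (induction n)
  case (Suc n)
  have "nderiv 1 (\<lambda>x. (euler ^^ n) f (- x)) x = - nderiv 1 ((euler ^^ n) f) (- x)" for x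
    using nderiv_scale[OF smooth_on_euler[OF open_UNIV assms, of n], of 1 "- 1" x] by simp
  note reflect = this
  have eu: "euler g x = of_real x * nderiv 1 g x" for g x by (simp add: euler_def)
  show ?case
  proof
    fix x
    have "(euler ^^ Suc n) (\<lambda>x. f (- x)) x = of_real x * nderiv 1 ((euler ^^ n) (\<lambda>x. f (- x))) x"
      unfolding funpow.simps o_apply by (rule eu)
    also have "\<dots> = of_real (- x) * nderiv 1 ((euler ^^ n) f) (- x)" unfolding Suc.IH reflect by simp
    also have "\<dots> = (euler ^^ Suc n) f (- x)" unfolding funpow.simps o_apply by (rule eu[symmetric])
    finally show "(euler ^^ Suc n) (\<lambda>x. f (- x)) x = (euler ^^ Suc n) f (- x)" .
  qed
qed simp

section \<open>The functional built from one strip\<close>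

text \<open>Holomorphy is asked up to Re z = K + 1, where dividing by a power of s - (K + 1) creates
  a pole. This half-plane contains both lines Re z = K and Re z = -K.\<close>

locale strip_function =
  fixes d M :: nat and K A :: real and \<Psi> :: "complex \<Rightarrow> complex"
  assumes K: "K > 0" and hol: "\<Psi> holomorphic_on {z. Re z < K + 1}"
    and bound: "\<And>c t. \<bar>c\<bar> \<le> K \<Longrightarrow> norm (\<Psi> (Complex c t)) \<le> A / (1 + t ^ 2)"
begin

text \<open>The inverse Mellin integral along Re s = c, without its normalizing constant.\<close>

definition G where "G c x = (LINT t|lborel. \<Psi> (Complex c t) * exp (- Complex c t * of_real (ln \<bar>x\<bar>)))"

text \<open>
  The inverse Mellin integral of \<open>\<Psi>\<close>, taken along \<open>Re s = -K\<close> for \<open>\<bar>x\<bar> < 1\<close> and along \<open>Re s = K\<close> for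
  \<open>\<bar>x\<bar> > 1\<close>; by Cauchy's formula in the strip between the two lines its Mellin transform is still \<open>\<Psi>\<close>.
\<close>

definition density :: "real \<Rightarrow> complex" where
  "density x = of_real (sgn x) ^ d * (1 / (4 * of_real pi)) *
     (indicator {0<..<1} \<bar>x\<bar> *\<^sub>R G (- K) x + indicator {1<..} \<bar>x\<bar> *\<^sub>R G K x)"

lemma vertical_continuous: "\<bar>c\<bar> \<le> K \<Longrightarrow> continuous_on UNIV (\<lambda>t. \<Psi> (Complex c t))"
proof (rule continuous_on_compose2[OF holomorphic_on_imp_continuous_on[OF hol]])
  show "continuous_on UNIV (Complex c)" unfolding Complex_eq[abs_def] by (intro continuous_intros)
qed auto

lemma G_measurable: "\<bar>c\<bar> \<le> K \<Longrightarrow> G c \<in> borel_measurable borel"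
  unfolding G_def[abs_def] by (rule mellin_inverse_piece(1)[OF vertical_continuous bound])

lemma density_measurable: "density \<in> borel_measurable borel"
proof -
  have [measurable]: "G (- K) \<in> borel_measurable borel" "G K \<in> borel_measurable borel"
    using K by (auto intro: G_measurable)
  show ?thesis unfolding density_def[abs_def] by measurable
qed

lemma density_reflect: "density (- x) = (-1) ^ d * density x"
proof -
  have "(of_real (sgn (- x)) :: complex) = (-1) * of_real (sgn x)" by simp
  then show ?thesis unfolding density_def G_def abs_minus_cancel by (simp only: power_mult_distrib mult.assoc)
qed

text \<open>On Re s = c the integral is of size |x|^(-c). The line -K for |x| < 1 and the line K for
  |x| > 1 both make this the weight of exponent -K.\<close>

lemma density_bound: obtains B where "B \<ge> 0" "\<forall>x. norm (density x) \<le> B * wt (- K) x"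
proof -
  define I where "I c = (LINT t|lborel. norm (\<Psi> (Complex c t)))" for c
  have I0: "I c \<ge> 0" for c unfolding I_def by simp
  have G: "norm (G c x) \<le> I c * exp (- c * ln \<bar>x\<bar>)" if "\<bar>c\<bar> \<le> K" for c x
    unfolding G_def I_def by (rule mellin_inverse_piece(2)[OF vertical_continuous[OF that] bound[OF that]])
  have "norm (indicator {0<..<1} \<bar>x\<bar> *\<^sub>R G (- K) x) \<le> I (- K) * wt (- K) x" for x
    using G[of "- K" x] K I0[of "- K"] by (simp add: indicator_def wt_def abs_of_neg)
  moreover have "norm (indicator {1<..} \<bar>x\<bar> *\<^sub>R G K x) \<le> I K * wt (- K) x" for x
    using G[of K x] K I0[of K] by (simp add: indicator_def wt_def abs_of_pos)
  ultimately have 1: "norm (indicator {0<..<1} \<bar>x\<bar> *\<^sub>R G (- K) x + indicator {1<..} \<bar>x\<bar> *\<^sub>R G K x) \<le> (I (- K) + I K) * wt (- K) x" for x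
    by (intro order_trans[OF norm_triangle_ineq]) (simp add: distrib_right add_mono)
  have 2: "norm (of_real (sgn x) ^ d * (1 / (4 * of_real pi)) :: complex) \<le> 1" for x
  proof -
    have "norm (of_real (sgn x) ^ d :: complex) \<le> 1" by (simp add: norm_power power_le_one norm_of_real abs_sgn_eq)
    moreover have "norm (1 / (4 * of_real pi) :: complex) \<le> 1" using pi_gt3 by (simp add: norm_divide norm_mult)
    ultimately show ?thesis unfolding norm_mult by (simp add: mult_le_one)
  qed
  have "norm (density x) \<le> 1 * ((I (- K) + I K) * wt (- K) x)" for x
    unfolding density_def norm_mult[of "_ * _" "_ + _"] using 1[of x] 2[of x] by (intro mult_mono) auto
  then show thesis using I0 by (intro that[of "I (- K) + I K"]) auto
qed

lemma density_0 [simp]: "density 0 = 0" by (simp add: density_def)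

lemma density_mellin:
  assumes s: "\<bar>Re s\<bar> < K"
  shows "integrable lborel (\<lambda>x. density x * signed_power d (s - 1) x)"
    and "(LINT x|lborel. density x * signed_power d (s - 1) x) = \<Psi> s"
proof -
  define X where "X c x = indicator (half_line_piece (Re s - c)) \<bar>x\<bar> *\<^sub>R (G c x * exp ((s - 1) * of_real (ln \<bar>x\<bar>)))" for c x
  have pieces: "half_line_piece (Re s - (- K)) = {0<..<1}" "half_line_piece (Re s - K) = {1<..}"
    using s by (auto simp: half_line_piece_def)
  have X: "density x * signed_power d (s - 1) x = (1 / (4 * of_real pi)) * (X (- K) x + X K x)" for x
  proof (cases "x = 0")
    case False
    then have "(of_real (sgn x) ^ d * of_real (sgn x) ^ d :: complex) = 1"
      by (simp add: power_mult_distrib[symmetric] of_real_mult[symmetric] sgn_if del: of_real_mult)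
    moreover have "p * q * r * (p * e) = (p * p) * (q * (r * e))" for p q r e :: complex by (simp add: mult_ac)
    ultimately have "density x * signed_power d (s - 1) x = (1 / (4 * of_real pi)) *
      ((indicator {0<..<1} \<bar>x\<bar> *\<^sub>R G (- K) x + indicator {1<..} \<bar>x\<bar> *\<^sub>R G K x) * exp ((s - 1) * of_real (ln \<bar>x\<bar>)))"
      unfolding density_def signed_power_eq[OF False] by (simp only: mult_1)
    then show ?thesis unfolding X_def pieces by (simp only: distrib_right mult_scaleR_left)
  qed (simp add: X_def half_line_piece_def)
  have iX: "integrable lborel (X c)" and LX: "(LINT x|lborel. X c x) = 2 * of_real (sgn (c - Re s)) * (LINT t|lborel. \<Psi> (Complex c t) / (Complex c t - s))"
    if "c = K \<or> c = - K" for c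
  proof -
    have c: "\<bar>c\<bar> \<le> K" "Re s \<noteq> c" using that s K by auto
    show "integrable lborel (X c)" unfolding X_def[abs_def] G_def
      by (rule mellin_inverse_piece(3)[OF vertical_continuous[OF c(1)] bound[OF c(1)] c(2)])
    show "(LINT x|lborel. X c x) = 2 * of_real (sgn (c - Re s)) * (LINT t|lborel. \<Psi> (Complex c t) / (Complex c t - s))"
      unfolding X_def G_def by (rule mellin_inverse_piece(4)[OF vertical_continuous[OF c(1)] bound[OF c(1)] c(2)])
  qed
  show "integrable lborel (\<lambda>x. density x * signed_power d (s - 1) x)"
    unfolding X by (intro integrable_mult_right Bochner_Integration.integrable_add iX) auto
  have "(LINT x|lborel. density x * signed_power d (s - 1) x) = (1 / (4 * of_real pi)) * ((LINT x|lborel. X (- K) x) + (LINT x|lborel. X K x))"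
    unfolding X integral_mult_right_zero by (subst Bochner_Integration.integral_add) (auto intro!: iX)
  \<comment> \<open>The constant 4 pi is 2 for the two half-lines times 2 pi from Cauchy's
    formula.\<close>
  also have "\<dots> = (1 / (4 * of_real pi)) * (2 * ((LINT t|lborel. \<Psi> (Complex K t) / (Complex K t - s)) - (LINT t|lborel. \<Psi> (Complex (- K) t) / (Complex (- K) t - s))))"
    using s K by (simp add: LX)
  also have "\<dots> = (1 / (4 * of_real pi)) * (2 * (2 * pi * \<Psi> s))"
    by (subst Cauchy_strip[OF hol K bound s]) auto
  also have "\<dots> = \<Psi> s" by simp
  finally show "(LINT x|lborel. density x * signed_power d (s - 1) x) = \<Psi> s" .
qed

text \<open>Decay of weight -K against growth of weight K - 2 leaves the integrable weight -2.
  \<open>F\<close> replaces the Euler derivative so that its value at 0 and its measurability can be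
  supplied separately.\<close>

lemma integrable_density_euler:
  assumes "ebound M (wt (K - 2)) f B" "i \<le> M" "F \<in> borel_measurable lebesgue" "\<And>x. x \<noteq> 0 \<Longrightarrow> F x = (euler ^^ i) f x"
    and D: "D \<ge> 0" "\<forall>x. norm (density x) \<le> D * wt (- K) x"
  shows "norm (density x * F x) \<le> D * B * wt (- 2) x"
    and "integrable lebesgue (\<lambda>x. density x * F x)"
    and "norm (LINT x|lebesgue. density x * F x) \<le> D * B * (LINT x|lebesgue. wt (- 2) x)"
proof -
  have B: "B \<ge> 0" by (rule ebound_nonneg[OF assms(1)])
  show le: "norm (density x * F x) \<le> D * B * wt (- 2) x" for x
  proof (cases "x = 0")
    case True then show ?thesis using B D(1) by (simp add: wt_def)
  next
    case False
    have "norm (F x) \<le> B * wt (K - 2) x" using assms(1,2) assms(4)[OF False] False by (simp add: ebound_def)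
    then have "norm (density x * F x) \<le> (D * wt (- K) x) * (B * wt (K - 2) x)"
      unfolding norm_mult using D by (intro mult_mono) (auto simp: wt_def)
    also have "\<dots> = D * B * wt (- K + (K - 2)) x" unfolding wt_add by (simp add: mult_ac)
    finally show ?thesis by simp
  qed
  have "density \<in> borel_measurable lebesgue" using density_measurable by (simp add: measurable_completion)
  then have "(\<lambda>x. density x * F x) \<in> borel_measurable lebesgue" using assms(3) by (rule borel_measurable_times)
  moreover have int: "integrable lebesgue (\<lambda>x. D * B * wt (- 2) x)" by (intro integrable_mult_right integrable_wt)
  ultimately show i: "integrable lebesgue (\<lambda>x. density x * F x)"
    by - (rule Bochner_Integration.integrable_bound, assumption+, rule AE_I2, rule order_trans[OF le], simp)
  have "norm (LINT x|lebesgue. density x * F x) \<le> (LINT x|lebesgue. norm (density x * F x))" by (rule integral_norm_bound)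
  also have "\<dots> \<le> (LINT x|lebesgue. D * B * wt (- 2) x)" by (intro integral_mono integrable_norm i int le)
  also have "\<dots> = D * B * (LINT x|lebesgue. wt (- 2) x)" by (rule integral_mult_right_zero)
  finally show "norm (LINT x|lebesgue. density x * F x) \<le> D * B * (LINT x|lebesgue. wt (- 2) x)" .
qed

text \<open>
  The Euler operator multiplies \<open>(sgn x)\<^sup>d \<bar>x\<bar>\<^sup>s\<^sup>-\<^sup>1\<close> by \<open>s - 1\<close>, so applying its polynomial with these coefficients
  amounts to the factor \<open>((s - 1) - K)\<^sup>M\<close>, which undoes the division of \<open>H\<close> by \<open>(s - (K + 1))\<^sup>M\<close>.
\<close>

definition coefficient :: "nat \<Rightarrow> complex" where "coefficient i = of_nat (M choose i) * (- of_real K) ^ (M - i)"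

text \<open>All derivatives act on the test function, so that no smoothness of the density is
  needed.\<close>

definition R :: functional where
  "R f = (\<Sum>i\<le>M. coefficient i * (LINT x|lebesgue. density x * (euler ^^ i) f x))"

lemma R_weight_bounded: "weight_bounded (K - 2) R"
proof -
  obtain D where D: "D \<ge> 0" "\<forall>x. norm (density x) \<le> D * wt (- K) x" by (rule density_bound)
  define W where "W = (LINT x|lebesgue. wt (- 2) x)"
  have W: "W \<ge> 0" unfolding W_def by (simp add: wt_def)
  have "norm (R f) \<le> (\<Sum>i\<le>M. norm (coefficient i)) * (D * W) * B" if f: "f \<in> test_fun (- {0})" "ebound M (wt (K - 2)) f B" for f B
  proof -
    have "norm (R f) \<le> (\<Sum>i\<le>M. norm (coefficient i) * (D * B * W))"
      unfolding R_def
    proof (rule sum_norm_le)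
      fix i assume "i \<in> {..M}"
      then show "norm (coefficient i * (LINT x|lebesgue. density x * (euler ^^ i) f x)) \<le> norm (coefficient i) * (D * B * W)"
        unfolding norm_mult W_def using integrable_density_euler(3)[OF f(2) _ test_fun_measurable(2)[OF f(1)] refl D, of i]
        by (intro mult_left_mono) auto
    qed
    then show ?thesis unfolding sum_distrib_right[symmetric] by (simp only: mult_ac)
  qed
  then show ?thesis unfolding weight_bounded_def using D(1) W
    by (intro exI[of _ "(\<Sum>i\<le>M. norm (coefficient i)) * (D * W)"] exI[of _ M]) (simp add: sum_nonneg)
qed

lemma R_linear: assumes "K \<ge> 2" shows "linear_off_0 R"
proof -
  obtain D where D: "D \<ge> 0" "\<forall>x. norm (density x) \<le> D * wt (- K) x" by (rule density_bound)
  have int: "integrable lebesgue (\<lambda>x. density x * (euler ^^ i) f x)" if f: "f \<in> test_fun (- {0})" and i: "i \<le> M" for f i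
  proof -
    have "moderate (K - 2) f" using assms by (intro moderate_mono[OF moderate_test_fun[OF f]]) simp
    then obtain B where "ebound M (wt (K - 2)) f B" by (rule moderateE)
    from integrable_density_euler(2)[OF this i test_fun_measurable(2)[OF f] refl D] show ?thesis .
  qed
  note sm = test_fun_smooth[of _ "- {0}"]
  show ?thesis
    unfolding linear_functional_on_def
  proof (intro conjI ballI allI)
    fix f g assume fg: "f \<in> test_fun (- {0})" "g \<in> test_fun (- {0})"
    have "(LINT x|lebesgue. density x * (euler ^^ i) (\<lambda>x. f x + g x) x) =
        (LINT x|lebesgue. density x * (euler ^^ i) f x) + (LINT x|lebesgue. density x * (euler ^^ i) g x)" if "i \<le> M" for i
      unfolding euler_add[OF open_UNIV sm[OF fg(1)] sm[OF fg(2)] UNIV_I] distrib_left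
      by (rule Bochner_Integration.integral_add[OF int[OF fg(1) that] int[OF fg(2) that]])
    then show "R (\<lambda>x. f x + g x) = R f + R g" unfolding R_def by (simp add: distrib_left sum.distrib)
  next
    fix c f assume f: "f \<in> test_fun (- {0})"
    have "(LINT x|lebesgue. density x * (euler ^^ i) (\<lambda>x. c * f x) x) = c * (LINT x|lebesgue. density x * (euler ^^ i) f x)" for i
      unfolding euler_cmult[OF open_UNIV sm[OF f] UNIV_I] mult.left_commute[of _ c] by (rule integral_mult_right_zero)
    then show "R (\<lambda>x. c * f x) = c * R f" unfolding R_def by (simp add: sum_distrib_left mult.left_commute)
  qed
qed

lemma R_parity: assumes f: "f \<in> test_fun (- {0})" shows "R (\<lambda>x. f (- x)) = (-1) ^ d * R f"
proof -
  note sm = test_fun_smooth[OF f]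
  have "(LINT x|lebesgue. density x * (euler ^^ i) (\<lambda>x. f (- x)) x) = (-1) ^ d * (LINT x|lebesgue. density x * (euler ^^ i) f x)" for i
  proof -
    let ?F = "(euler ^^ i) f"
    have [measurable]: "?F \<in> borel_measurable borel" "density \<in> borel_measurable borel"
      using smooth_on_continuous[OF smooth_on_euler[OF open_UNIV sm], of 0 i] density_measurable
      by (auto intro: borel_measurable_continuous_onI)
    have "(LINT x|lebesgue. density x * (euler ^^ i) (\<lambda>x. f (- x)) x) = (LINT x|lborel. density x * ?F (- x))"
      unfolding euler_reflect[OF sm] by (rule integral_completion) measurable
    also have "\<dots> = (LINT x|lborel. density (- x) * ?F x)"
      using lborel_integral_real_affine[of "- 1" "\<lambda>x. density x * ?F (- x)" 0] by simp
    also have "\<dots> = (-1) ^ d * (LINT x|lborel. density x * ?F x)"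
      unfolding density_reflect mult.assoc by (rule integral_mult_right_zero)
    also have "(LINT x|lborel. density x * ?F x) = (LINT x|lebesgue. density x * ?F x)"
      by (rule integral_completion[symmetric]) measurable
    finally show ?thesis .
  qed
  then show ?thesis unfolding R_def by (simp add: sum_distrib_left mult.left_commute)
qed

text \<open>The decay of the density at 0 lets it be divided by x^k and stay bounded, as long as k
  <= K.\<close>

lemma R_normal_form: assumes k: "real k \<le> K" shows "normal_form k ({-(1/2)<..<1/2} - {0}) R"
proof -
  obtain D where D: "D \<ge> 0" "\<forall>x. norm (density x) \<le> D * wt (- K) x" by (rule density_bound)
  define h where "h i x = coefficient i * (indicator {-1<..<1} x *\<^sub>R (density x / of_real x ^ k))" for i x
  show ?thesis
  proof (rule normal_formI[where L = "map (\<lambda>i. (h i, i)) [0..<Suc M]"])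
    have "h i \<in> borel_measurable lebesgue" for i
    proof -
      have [measurable]: "density \<in> borel_measurable borel" by (rule density_measurable)
      have "h i \<in> borel_measurable borel" unfolding h_def[abs_def] by measurable
      then show ?thesis by (simp add: measurable_completion)
    qed
    moreover have "norm (h i x) \<le> norm (coefficient i) * D" for i x
    proof (cases "\<bar>x\<bar> < 1 \<and> x \<noteq> 0")
      case True
      then have w: "\<bar>x\<bar> ^ k = wt (- real k) x" by (intro power_wt) auto
      have "norm (density x) \<le> D * wt (- K) x" using D(2) by blast
      also have "\<dots> \<le> D * wt (- real k) x" using k D(1) by (intro mult_left_mono wt_mono) auto
      finally have "norm (density x / of_real x ^ k) \<le> D"
        using True unfolding norm_divide norm_power norm_of_real w by (simp add: pos_divide_le_eq wt_def)
      then show ?thesis unfolding h_def norm_mult norm_scaleR using True D(1) by (intro mult_left_mono) (auto simp: indicator_def)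
    next
      case False
      then have "h i x = 0" by (auto simp: h_def indicator_def)
      then show ?thesis using D(1) by simp
    qed
    ultimately show "admissible (map (\<lambda>i. (h i, i)) [0..<Suc M])" unfolding admissible_def by fastforce
    fix \<phi> assume \<phi>: "\<phi> \<in> test_fun ({-(1/2)<..<1/2} - {0})"
    obtain C where C: "compact C" "C \<subseteq> {-(1/2)<..<1/2} - {0}" "\<forall>x. x \<notin> C \<longrightarrow> \<phi> x = 0"
      using \<phi> unfolding test_fun_def by blast
    have "coefficient i * (density x * (euler ^^ i) \<phi> x) = h i x * (of_real x ^ k * (euler ^^ i) \<phi> x)" for i x
    proof (cases "x \<in> C")
      case True
      then have "x \<in> {-(1/2)<..<1/2} - {0}" using C(2) by blast
      then have "x \<noteq> 0" "\<bar>x\<bar> < 1" by (auto simp: abs_less_iff)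
      then show ?thesis by (simp add: h_def indicator_def abs_less_iff)
    next
      case False
      then have "(euler ^^ i) \<phi> x = 0" by (intro euler_zero_outside[OF compact_imp_closed[OF C(1)] C(3)[rule_format]])
      then show ?thesis by simp
    qed
    then have "coefficient i * (LINT x|lebesgue. density x * (euler ^^ i) \<phi> x) = (LINT x|lebesgue. h i x * (of_real x ^ k * (euler ^^ i) \<phi> x))" for i
      by (simp only: integral_mult_right_zero[symmetric])
    then show "R \<phi> = (\<Sum>(g, m)\<leftarrow>map (\<lambda>i. (h i, i)) [0..<Suc M]. LINT x|lebesgue. g x * (of_real x ^ k * (euler ^^ m) \<phi> x))"
      unfolding R_def by (simp add: o_def interv_sum_list_conv_sum_set_nat atLeast0LessThan lessThan_Suc_atMost del: upt_Suc)
  qed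
qed

text \<open>The first condition on s places it inside the strip of Cauchy's formula; the second
  keeps the signed power within weight K - 2, so that the cutoffs can be removed by dominated
  convergence.\<close>

lemma R_mellin:
  assumes s: "\<bar>Re s\<bar> < K" "\<bar>Re s - 1\<bar> \<le> K - 2"
  shows "moderate_extension R (signed_power d (s - 1)) = (s - of_real (K + 1)) ^ M * \<Psi> s"
proof -
  obtain D where D: "D \<ge> 0" "\<forall>x. norm (density x) \<le> D * wt (- K) x" by (rule density_bound)
  let ?P = "signed_power d (s - 1)"
  obtain B where B: "B \<ge> 0" "\<forall>n. ebound M (\<lambda>x. 1) (annulus_cutoff n) B" using ebound_annulus_cutoff[of M] by blast
  have eb: "ebound M (wt (K - 2)) (\<lambda>x. annulus_cutoff n x * ?P x) (2 ^ M * (B * (1 + norm (s - 1)) ^ M))" for n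
  proof -
    have "ebound M (\<lambda>x. 1 * wt \<bar>Re (s - 1)\<bar> x) (\<lambda>x. annulus_cutoff n x * ?P x) (2 ^ M * (B * (1 + norm (s - 1)) ^ M))"
      using B(2) by (intro ebound_mult smooth_on_subset[OF smooth_on_annulus_cutoff] smooth_on_signed_power ebound_signed_power) auto
    then show ?thesis using s(2) by (intro ebound_wt_mono[of M "\<bar>Re (s - 1)\<bar>" _ _ "K - 2"]) simp_all
  qed
  have tf: "(\<lambda>x. annulus_cutoff n x * ?P x) \<in> test_fun (- {0})" for n
    by (rule annulus_cutoff_mult_test_fun[OF smooth_on_signed_power])
  define E where "E = D * (2 ^ M * (B * (1 + norm (s - 1)) ^ M))"
  have P: "?P \<in> borel_measurable lebesgue"
    by (rule smooth_off_0_measurable[OF smooth_on_signed_power]) (simp add: signed_power_def)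
  have m: "density \<in> borel_measurable lebesgue" using density_measurable by (simp add: measurable_completion)
  have lim: "(\<lambda>n. LINT x|lebesgue. density x * (euler ^^ i) (\<lambda>x. annulus_cutoff n x * ?P x) x) \<longlonglongrightarrow>
     (LINT x|lebesgue. density x * ((s - 1) ^ i * ?P x))" if i: "i \<le> M" for i
  proof (rule integral_dominated_convergence[where w = "\<lambda>x. E * wt (- 2) x"])
    show "(\<lambda>x. density x * ((s - 1) ^ i * ?P x)) \<in> borel_measurable lebesgue"
      by (intro borel_measurable_times m P borel_measurable_const)
    show "(\<lambda>x. density x * (euler ^^ i) (\<lambda>x. annulus_cutoff n x * ?P x) x) \<in> borel_measurable lebesgue" for n
      by (intro borel_measurable_times m test_fun_measurable(2)[OF tf])
    show "integrable lebesgue (\<lambda>x. E * wt (- 2) x)" by (intro integrable_mult_right integrable_wt)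
    show "AE x in lebesgue. (\<lambda>n. density x * (euler ^^ i) (\<lambda>x. annulus_cutoff n x * ?P x) x) \<longlonglongrightarrow> density x * ((s - 1) ^ i * ?P x)"
    proof (rule AE_I2, rule tendsto_eventually)
      fix x :: real
      show "\<forall>\<^sub>F n in sequentially. density x * (euler ^^ i) (\<lambda>x. annulus_cutoff n x * ?P x) x = density x * ((s - 1) ^ i * ?P x)"
      proof (cases "x = 0")
        case False
        from annulus_cutoff_eventually_1[OF this, of ?P] show ?thesis
          by (rule eventually_mono) (simp add: euler_signed_power[OF False])
      qed simp
    qed
    show "AE x in lebesgue. norm (density x * (euler ^^ i) (\<lambda>x. annulus_cutoff n x * ?P x) x) \<le> E * wt (- 2) x" for n
      unfolding E_def by (intro AE_I2 integrable_density_euler(1)[OF eb i test_fun_measurable(2)[OF tf] refl D])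
  qed
  have val: "(LINT x|lebesgue. density x * ((s - 1) ^ i * ?P x)) = (s - 1) ^ i * \<Psi> s" for i
  proof -
    have "(LINT x|lebesgue. density x * ((s - 1) ^ i * ?P x)) = (s - 1) ^ i * (LINT x|lebesgue. density x * ?P x)"
      unfolding mult.left_commute[of _ "(s - 1) ^ i"] by (rule integral_mult_right_zero)
    also have "(LINT x|lebesgue. density x * ?P x) = (LINT x|lborel. density x * ?P x)"
      by (rule integral_completion[OF borel_measurable_integrable[OF density_mellin(1)[OF s(1)]]])
    finally show ?thesis unfolding density_mellin(2)[OF s(1)] .
  qed
  have "(\<lambda>n. R (\<lambda>x. annulus_cutoff n x * ?P x)) \<longlonglongrightarrow> (\<Sum>i\<le>M. coefficient i * ((s - 1) ^ i * \<Psi> s))"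
    unfolding R_def by (intro tendsto_sum tendsto_mult_left) (use lim val in auto)
  then have "moderate_extension R ?P = (\<Sum>i\<le>M. coefficient i * ((s - 1) ^ i * \<Psi> s))"
    unfolding moderate_extension_def by (rule limI)
  also have "\<dots> = (\<Sum>i\<le>M. of_nat (M choose i) * (s - 1) ^ i * (- of_real K) ^ (M - i)) * \<Psi> s"
    unfolding sum_distrib_right by (rule sum.cong) (simp_all add: coefficient_def mult_ac)
  also have "(\<Sum>i\<le>M. of_nat (M choose i) * (s - 1) ^ i * (- of_real K) ^ (M - i)) = ((s - 1) + (- of_real K)) ^ M"
    by (rule binomial_ring[symmetric])
  also have "(s - 1) + (- of_real K) = s - of_real (K + 1)" by simp
  finally show ?thesis .
qed

end

section \<open>Independence of the contour\<close>

lemma moderate_extension_functional_cong: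
  assumes "\<And>f. f \<in> test_fun (- {0}) \<Longrightarrow> \<rho> f = \<rho>' f" "smooth_on (- {0}) f"
  shows "moderate_extension \<rho> f = moderate_extension \<rho>' f"
  unfolding moderate_extension_def using assms(1)[OF annulus_cutoff_mult_test_fun[OF assms(2)]] by simp

lemma linear_off_0_combination:
  assumes "linear_off_0 \<rho>" "linear_off_0 \<rho>'"
  shows "linear_off_0 (\<lambda>f. a * \<rho> f + b * \<rho>' f)"
  unfolding linear_functional_on_def
  by (simp add: linear_functional_add[OF assms(1)] linear_functional_add[OF assms(2)]
      linear_functional_cmult[OF assms(1)] linear_functional_cmult[OF assms(2)] algebra_simps)

lemma weight_bounded_combination:
  assumes "weight_bounded K \<rho>" "weight_bounded K \<rho>'"
  shows "weight_bounded K (\<lambda>f. a * \<rho> f + b * \<rho>' f)"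
proof -
  obtain C N where C: "C \<ge> 0" "\<forall>f\<in>test_fun (- {0}). \<forall>B. ebound N (wt K) f B \<longrightarrow> norm (\<rho> f) \<le> C * B"
    using assms(1) by (rule weight_boundedE)
  obtain C' N' where C': "C' \<ge> 0" "\<forall>f\<in>test_fun (- {0}). \<forall>B. ebound N' (wt K) f B \<longrightarrow> norm (\<rho>' f) \<le> C' * B"
    using assms(2) by (rule weight_boundedE)
  have "norm (a * \<rho> f + b * \<rho>' f) \<le> (norm a * C + norm b * C') * B"
    if f: "f \<in> test_fun (- {0})" "ebound (max N N') (wt K) f B" for f B
  proof -
    have "norm (\<rho> f) \<le> C * B" by (rule C(2)[rule_format, OF f(1) ebound_wt_mono[OF f(2)]]) auto
    moreover have "norm (\<rho>' f) \<le> C' * B" by (rule C'(2)[rule_format, OF f(1) ebound_wt_mono[OF f(2)]]) auto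
    ultimately have "norm a * norm (\<rho> f) + norm b * norm (\<rho>' f) \<le> norm a * (C * B) + norm b * (C' * B)"
      by (intro add_mono mult_left_mono) auto
    then show ?thesis by (intro order_trans[OF norm_triangle_ineq]) (simp add: norm_mult algebra_simps)
  qed
  then show ?thesis unfolding weight_bounded_def using C(1) C'(1)
    by (intro exI[of _ "norm a * C + norm b * C'"] exI[of _ "max N N'"] conjI ballI allI impI) simp_all
qed

lemma moderate_extension_combination:
  assumes "linear_off_0 \<rho>" "weight_bounded (K + 1) \<rho>" "linear_off_0 \<rho>'" "weight_bounded (K + 1) \<rho>'" "moderate K f"
  shows "moderate_extension (\<lambda>f. a * \<rho> f + b * \<rho>' f) f = a * moderate_extension \<rho> f + b * moderate_extension \<rho>' f"
  unfolding moderate_extension_def[of "\<lambda>f. a * \<rho> f + b * \<rho>' f"]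
  by (rule limI) (intro tendsto_add tendsto_mult_left moderate_extension_lim[OF assms(1,2,5)] moderate_extension_lim[OF assms(3-5)])

lemma regular_off_0_combination:
  assumes "regular_off_0 \<rho>" "regular_off_0 \<rho>'"
  shows "regular_off_0 (\<lambda>f. a * \<rho> f + b * \<rho>' f)"
  unfolding regular_off_0_def
proof (intro conjI allI)
  show "linear_off_0 (\<lambda>f. a * \<rho> f + b * \<rho>' f)" by (intro linear_off_0_combination regular_off_0D(1) assms)
  show "weight_bounded K (\<lambda>f. a * \<rho> f + b * \<rho>' f)" for K by (intro weight_bounded_combination regular_off_0D(2) assms)
  fix k
  obtain r where r: "r > 0" "r < 1" "normal_form k ({-r<..<r} - {0}) \<rho>"
    using assms(1) unfolding regular_off_0_def by (elim conjE) (erule allE[of _ k], elim exE conjE, rule that)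
  obtain r' where r': "r' > 0" "r' < 1" "normal_form k ({-r'<..<r'} - {0}) \<rho>'"
    using assms(2) unfolding regular_off_0_def by (elim conjE) (erule allE[of _ k], elim exE conjE, rule that)
  have "normal_form k ({-min r r'<..<min r r'} - {0}) (\<lambda>f. a * \<rho> f + b * \<rho>' f)"
    by (rule normal_form_add[OF normal_form_cmult[OF normal_form_mono[OF r(3)]] normal_form_cmult[OF normal_form_mono[OF r'(3)]]]) auto
  then show "\<exists>r>0. r < 1 \<and> normal_form k ({-r<..<r} - {0}) (\<lambda>f. a * \<rho> f + b * \<rho>' f)"
    using r(1,2) r'(1,2) by (intro exI[of _ "min r r'"] conjI) auto
qed

definition parity_off_0 :: "nat \<Rightarrow> functional \<Rightarrow> bool" where
  "parity_off_0 d \<rho> \<longleftrightarrow> (\<forall>f\<in>test_fun (- {0}). \<rho> (\<lambda>x. f (- x)) = (-1) ^ d * \<rho> f)"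

lemma test_fun_reflect:
  assumes "f \<in> test_fun (- {0})" shows "(\<lambda>x. f (- x)) \<in> test_fun (- {0})"
proof -
  obtain K where K: "smooth_on UNIV f" "compact K" "K \<subseteq> - {0}" "\<forall>x. x \<notin> K \<longrightarrow> f x = 0"
    using assms unfolding test_fun_def by blast
  have "smooth_on UNIV (\<lambda>x. f (- x))" using smooth_on_scale[OF K(1), of "-1"] by simp
  moreover have "compact (uminus ` K)" by (rule compact_negations[OF K(2)])
  moreover have "uminus ` K \<subseteq> - {0}" using K(3) by auto
  moreover have "f (- x) = 0" if "x \<notin> uminus ` K" for x using that by (intro K(4)[rule_format]) (auto simp: image_iff)
  ultimately show ?thesis by (intro test_funI)
qed

text \<open>The uniqueness result treats test functions of one parity. The symmetrization e = f +
  (-1)^d f(-x) reduces to it, because a functional of parity d takes twice its value at f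
  there.\<close>

lemma mellin_determines:
  assumes \<rho>: "linear_off_0 \<rho>" "weight_bounded 2 \<rho>" "parity_off_0 d \<rho>"
    and \<rho>': "linear_off_0 \<rho>'" "weight_bounded 2 \<rho>'" "parity_off_0 d \<rho>'"
    and eq: "\<And>t. moderate_extension \<rho> (signed_power d (\<i> * of_real t)) = moderate_extension \<rho>' (signed_power d (\<i> * of_real t))"
    and f: "f \<in> test_fun (- {0})"
  shows "\<rho> f = \<rho>' f"
proof -
  define D where "D f = 1 * \<rho> f + (- 1) * \<rho>' f" for f
  define e where "e x = f x + (-1) ^ d * f (- x)" for x
  have D: "linear_off_0 D" "weight_bounded 2 D"
    unfolding D_def[abs_def] by (intro linear_off_0_combination weight_bounded_combination \<rho> \<rho>')+
  have zero: "moderate_extension D (signed_power d (\<i> * of_real t)) = 0" for t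
  proof -
    have "moderate 0 (signed_power d (\<i> * of_real t))" using moderate_signed_power[of "\<i> * of_real t" d] by simp
    moreover have "weight_bounded (0 + 1) \<rho>" "weight_bounded (0 + 1) \<rho>'"
      by (rule weight_bounded_mono[OF \<rho>(2)], simp) (rule weight_bounded_mono[OF \<rho>'(2)], simp)
    ultimately have "moderate_extension D (signed_power d (\<i> * of_real t)) =
      1 * moderate_extension \<rho> (signed_power d (\<i> * of_real t)) + (- 1) * moderate_extension \<rho>' (signed_power d (\<i> * of_real t))"
      unfolding D_def[abs_def] by (intro moderate_extension_combination[where K = 0] \<rho>(1) \<rho>'(1))
    then show ?thesis by (simp add: eq)
  qed
  note fr = test_fun_reflect[OF f]
  have sq: "((-1) ^ d * (-1) ^ d :: complex) = 1" by (simp add: power_mult_distrib[symmetric])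
  have "e \<in> test_fun (- {0})" unfolding e_def[abs_def] by (intro test_fun_add test_fun_cmult f fr)
  moreover have "e (- x) = (-1) ^ d * e x" for x
    using sq by (simp add: e_def distrib_left mult.assoc[symmetric])
  ultimately have "D e = 0" by (rule mellin_zero_imp_zero[OF D zero])
  moreover have "D e = D f + (-1) ^ d * D (\<lambda>x. f (- x))"
    unfolding e_def[abs_def] linear_functional_add[OF D(1) f test_fun_cmult[OF fr]] linear_functional_cmult[OF D(1) fr] ..
  moreover have "D (\<lambda>x. f (- x)) = (-1) ^ d * D f"
    using \<rho>(3) \<rho>'(3) f by (simp add: D_def parity_off_0_def algebra_simps)
  ultimately have "D f + D f = 0" using sq by (simp add: mult.assoc[symmetric])
  then have "D f = 0" by simp
  then show ?thesis by (simp add: D_def)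
qed

section \<open>Assembling the inverse from finite stages\<close>

abbreviation entire_moderate :: "(complex \<Rightarrow> complex) set" where
  "entire_moderate \<equiv> {H. H holomorphic_on UNIV \<and> moderate_growth_on_vertical_strips H}"

text \<open>A finite stage of the inverse: everything asked of an element of the source, but only up
  to order \<open>n\<close>. The strip is centred at 1 because the exponent of the kernel is s -
  1.\<close>

definition partial_inverse :: "nat \<Rightarrow> (complex \<Rightarrow> complex) \<Rightarrow> nat \<Rightarrow> functional \<Rightarrow> bool" where
  "partial_inverse d H n \<rho> \<longleftrightarrow> linear_off_0 \<rho> \<and> weight_bounded (real n) \<rho> \<and>
     (\<forall>k\<le>n. normal_form k ({-(1/2)<..<1/2} - {0}) \<rho>) \<and> parity_off_0 d \<rho> \<and>
     (\<forall>s. \<bar>Re s - 1\<bar> \<le> real n \<longrightarrow> moderate_extension \<rho> (signed_power d (s - 1)) = H s)"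

lemma partial_inverse_exists:
  assumes "H \<in> entire_moderate"
  shows "\<exists>\<rho>. partial_inverse d H n \<rho>"
proof -
  have H: "H holomorphic_on UNIV" "moderate_growth_on_vertical_strips H" using assms by auto
  \<comment> \<open>Two units are lost to the integrable weight -2.\<close>
  define K where "K = real n + 2"
  have K: "K > 0" by (simp add: K_def)
  obtain A N where A: "A \<ge> 0" "\<forall>c t. \<bar>c\<bar> \<le> K \<longrightarrow> norm (H (Complex c t)) \<le> A * (1 + t ^ 2) ^ N"
    by (rule moderate_growth_strip[OF H K])
  \<comment> \<open>On the strip |w - (K + 1)|^2 >= 1 + t^2. Hence this power beats the growth (1 +
    t^2)^N and leaves a factor 1 / (1 + t^2).\<close>
  define M where "M = 2 * Suc N"
  define \<Psi> where "\<Psi> s = H s / (s - of_real (K + 1)) ^ M" for s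
  interpret strip_function d M K A \<Psi>
  proof
    show "K > 0" by (rule K)
    show "\<Psi> holomorphic_on {z. Re z < K + 1}"
      unfolding \<Psi>_def[abs_def] by (intro holomorphic_intros holomorphic_on_subset[OF H(1)]) auto
    fix c t :: real assume c: "\<bar>c\<bar> \<le> K"
    have p: "1 + t ^ 2 > 0" by (simp add: add_pos_nonneg)
    \<comment> \<open>The pole lies at distance at least 1 to the right of the closed strip.\<close>
    have "1 ^ 2 \<le> (K + 1 - c) ^ 2" using c by (intro power_mono) auto
    then have "1 + t ^ 2 \<le> norm (Complex c t - of_real (K + 1)) ^ 2"
      by (simp add: cmod_power2 power2_commute[of c])
    then have "(1 + t ^ 2) ^ Suc N \<le> norm (Complex c t - of_real (K + 1)) ^ M"
      unfolding M_def power_mult using p by (intro power_mono) auto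
    then have "norm (\<Psi> (Complex c t)) \<le> (A * (1 + t ^ 2) ^ N) / (1 + t ^ 2) ^ Suc N"
      unfolding \<Psi>_def norm_divide norm_power using A c p by (intro frac_le) auto
    also have "\<dots> = A / (1 + t ^ 2)" using p by simp
    finally show "norm (\<Psi> (Complex c t)) \<le> A / (1 + t ^ 2)" .
  qed
  show ?thesis
  proof (rule exI[of _ R])
  show "partial_inverse d H n R"
    unfolding partial_inverse_def parity_off_0_def
  proof (intro conjI ballI allI impI)
    show "linear_off_0 R" by (rule R_linear) (simp add: K_def)
    show "weight_bounded (real n) R" using R_weight_bounded by (simp add: K_def)
    show "normal_form k ({-(1/2)<..<1/2} - {0}) R" if "k \<le> n" for k using that by (intro R_normal_form) (simp add: K_def)
    show "R (\<lambda>x. f (- x)) = (-1) ^ d * R f" if "f \<in> test_fun (- {0})" for f by (rule R_parity[OF that])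
    fix s assume s: "\<bar>Re s - 1\<bar> \<le> real n"
    then have s': "\<bar>Re s\<bar> < K" "\<bar>Re s - 1\<bar> \<le> K - 2" by (auto simp: K_def)
    have "s - of_real (K + 1) \<noteq> 0"
    proof
      assume "s - of_real (K + 1) = 0"
      then have "s = of_real (K + 1)" by simp
      with s' show False by simp
    qed
    then show "moderate_extension R (signed_power d (s - 1)) = H s"
      unfolding R_mellin[OF s'] \<Psi>_def by simp
  qed
  qed
qed

lemma regular_off_0_of_partial_inverses:
  assumes inv: "\<And>n. n \<ge> 2 \<Longrightarrow> partial_inverse d H n (Q n)"
    and eq: "\<And>n f. n \<ge> 2 \<Longrightarrow> f \<in> test_fun (- {0}) \<Longrightarrow> Q n f = \<rho> f"
  shows "regular_off_0 \<rho>"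
  unfolding regular_off_0_def
proof (intro conjI allI)
  show "linear_off_0 \<rho>"
  proof -
    have Q: "linear_off_0 (Q 2)" using inv[of 2] by (simp add: partial_inverse_def)
    have eq2: "\<rho> f = Q 2 f" if "f \<in> test_fun (- {0})" for f using eq[of 2 f] that by simp
    show ?thesis unfolding linear_functional_on_def
      by (simp add: eq2 test_fun_add test_fun_cmult linear_functional_add[OF Q] linear_functional_cmult[OF Q])
  qed
  fix K
  obtain n where n: "n \<ge> 2" "K \<le> real n" using real_arch_simple[of "max 2 K"] by auto
  have "weight_bounded K (Q n)"
    using weight_bounded_mono[OF _ n(2)] inv[OF n(1)] by (simp add: partial_inverse_def)
  then obtain C N where C: "C \<ge> 0" "\<forall>f\<in>test_fun (- {0}). \<forall>B. ebound N (wt K) f B \<longrightarrow> norm (Q n f) \<le> C * B"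
    by (rule weight_boundedE)
  show "weight_bounded K \<rho>" unfolding weight_bounded_def
    by (intro exI[of _ C] exI[of _ N] conjI ballI allI impI C(1)) (simp add: C(2) eq[OF n(1), symmetric])
next
  fix k :: nat
  have "normal_form k ({-(1/2)<..<1/2} - {0}) (Q (k + 2))" using inv[of "k + 2"] by (simp add: partial_inverse_def)
  then have "normal_form k ({-(1/2)<..<1/2} - {0}) \<rho>"
    by (rule normal_form_cong[rotated]) (rule eq, simp, erule test_fun_mono, auto)
  then show "\<exists>r>0. r < 1 \<and> normal_form k ({-r<..<r} - {0}) \<rho>" by (intro exI[of _ "1 / 2"] conjI) auto
qed

lemma entire_moderate_reflect:
  assumes "H \<in> entire_moderate" shows "(\<lambda>s. H (- s)) \<in> entire_moderate"
proof -
  have H: "H holomorphic_on UNIV" "moderate_growth_on_vertical_strips H" using assms by auto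
  have "(H \<circ> uminus) holomorphic_on UNIV"
    by (rule holomorphic_on_compose) (auto intro: holomorphic_intros holomorphic_on_subset[OF H(1)])
  moreover have "moderate_growth_on_vertical_strips (\<lambda>s. H (- s))"
    unfolding moderate_growth_on_vertical_strips_def
  proof (intro allI impI)
    fix a b :: real assume "a < b"
    then obtain T C :: real and N where TC: "T > 0" "C > 0"
      and g: "\<forall>s. - b \<le> Re s \<and> Re s \<le> - a \<and> \<bar>Im s\<bar> \<ge> T \<longrightarrow> norm (H s) \<le> C * \<bar>Im s\<bar> ^ N"
      using H(2)[unfolded moderate_growth_on_vertical_strips_def, rule_format, of "- b" "- a"] by auto
    have "norm (H (- s)) \<le> C * \<bar>Im s\<bar> ^ N" if "a \<le> Re s \<and> Re s \<le> b \<and> \<bar>Im s\<bar> \<ge> T" for s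
      using g[rule_format, of "- s"] that by simp
    with TC show "\<exists>T C. \<exists>N::nat. T > 0 \<and> C > 0 \<and> (\<forall>s. a \<le> Re s \<and> Re s \<le> b \<and> \<bar>Im s\<bar> \<ge> T \<longrightarrow> norm (H (- s)) \<le> C * \<bar>Im s\<bar> ^ N)"
      by (intro exI[of _ T] exI[of _ C] exI[of _ N]) simp
  qed
  ultimately show ?thesis by (simp add: o_def)
qed

text \<open>By uniqueness all stages for H agree off 0, which makes their common value regular at 0.
  The stages for H(-s) agree with the inverted functional and supply its regularity, that is, the
  behaviour at infinity.\<close>

theorem signed_mellin_surjective:
  assumes H: "H \<in> entire_moderate"
  shows "\<exists>\<sigma>\<in>mellin_source d. signed_mellin d \<sigma> = H"
proof -
  have "\<forall>n. \<exists>\<rho>. partial_inverse d H n \<rho>" by (intro allI partial_inverse_exists H)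
  then obtain Q where Q: "\<forall>n. partial_inverse d H n (Q n)" by (rule choice[THEN exE])
  have "\<forall>n. \<exists>\<rho>. partial_inverse d (\<lambda>s. H (- s)) n \<rho>" by (intro allI partial_inverse_exists entire_moderate_reflect H)
  then obtain Q' where Q': "\<forall>n. partial_inverse d (\<lambda>s. H (- s)) n (Q' n)" by (rule choice[THEN exE])
  have QD: "linear_off_0 (Q n)" "weight_bounded (real n) (Q n)" "parity_off_0 d (Q n)"
    "\<bar>Re s - 1\<bar> \<le> real n \<Longrightarrow> moderate_extension (Q n) (signed_power d (s - 1)) = H s" for n s
    using Q[rule_format, of n] by (auto simp: partial_inverse_def)
  have QD': "linear_off_0 (Q' n)" "weight_bounded (real n) (Q' n)" "parity_off_0 d (Q' n)"
    "\<bar>Re s - 1\<bar> \<le> real n \<Longrightarrow> moderate_extension (Q' n) (signed_power d (s - 1)) = H (- s)" for n s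
    using Q'[rule_format, of n] by (auto simp: partial_inverse_def)
  \<comment> \<open>The uniqueness result needs weight 2 for the inverted functional, and inversion
    costs another 2. The strip of stage 4 also contains the line Re s = -1 met after
    inversion.\<close>
  define \<rho> where "\<rho> = Q 4"
  have w2: "weight_bounded 2 (Q n)" "weight_bounded 2 (Q' n)" if "n \<ge> 2" for n
    using that by (auto intro: weight_bounded_mono[OF QD(2)] weight_bounded_mono[OF QD'(2)])
  have eq: "Q n f = \<rho> f" if n: "n \<ge> 2" and f: "f \<in> test_fun (- {0})" for n f
    unfolding \<rho>_def
  proof (rule mellin_determines[OF QD(1) w2(1)[OF n] QD(3) QD(1) w2(1) QD(3) _ f])
    fix t
    have "moderate_extension (Q k) (signed_power d (\<i> * of_real t)) = H (1 + \<i> * of_real t)" for k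
      using QD(4)[of "1 + \<i> * of_real t" k] by simp
    then show "moderate_extension (Q n) (signed_power d (\<i> * of_real t)) = moderate_extension (Q 4) (signed_power d (\<i> * of_real t))" by simp
  qed simp
  have eq': "Q' n f = \<rho> (inversion f)" if n: "n \<ge> 2" and f: "f \<in> test_fun (- {0})" for n f
  proof (rule mellin_determines[where \<rho>' = "\<lambda>\<psi>. \<rho> (inversion \<psi>)", OF QD'(1) w2(2)[OF n] QD'(3) _ _ _ _ f])
    show "linear_off_0 (\<lambda>\<psi>. \<rho> (inversion \<psi>))" unfolding \<rho>_def by (rule linear_off_0_inversion[OF QD(1)])
    show "weight_bounded 2 (\<lambda>\<psi>. \<rho> (inversion \<psi>))"
      unfolding \<rho>_def using QD(2)[of 4] by (intro weight_bounded_inversion) simp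
    have "inversion (\<lambda>x. f (- x)) = (\<lambda>x. inversion f (- x))" for f by (simp add: inversion_def fun_eq_iff)
    then show "parity_off_0 d (\<lambda>\<psi>. \<rho> (inversion \<psi>))"
      using QD(3)[of 4] by (simp add: parity_off_0_def \<rho>_def inversion_test_fun)
    fix t
    have "moderate_extension (Q' n) (signed_power d (\<i> * of_real t)) = H (- 1 - \<i> * of_real t)"
      using QD'(4)[of "1 + \<i> * of_real t" n] by simp
    moreover have "moderate_extension (\<lambda>\<psi>. \<rho> (inversion \<psi>)) (signed_power d (\<i> * of_real t)) = H (- 1 - \<i> * of_real t)"
    proof -
      have "moderate_extension \<rho> (inversion (signed_power d (\<i> * of_real t))) = moderate_extension \<rho> (signed_power d (- (\<i> * of_real t) - 2))"
        using inversion_signed_power[of _ d "\<i> * of_real t" "\<lambda>_. 1"] by (intro moderate_extension_cong) simp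
      also have "- (\<i> * of_real t) - 2 = (- 1 - \<i> * of_real t) - 1" by simp
      also have "moderate_extension \<rho> (signed_power d ((- 1 - \<i> * of_real t) - 1)) = H (- 1 - \<i> * of_real t)"
        unfolding \<rho>_def by (rule QD(4)) simp
      finally show ?thesis unfolding moderate_extension_inversion .
    qed
    ultimately show "moderate_extension (Q' n) (signed_power d (\<i> * of_real t)) = moderate_extension (\<lambda>\<psi>. \<rho> (inversion \<psi>)) (signed_power d (\<i> * of_real t))" by simp
  qed
  have reg: "regular_off_0 \<rho>" by (rule regular_off_0_of_partial_inverses[OF Q[rule_format] eq])
  have reg': "regular_off_0 (\<lambda>\<psi>. \<rho> (inversion \<psi>))" by (rule regular_off_0_of_partial_inverses[OF Q'[rule_format] eq'])
  have par: "\<rho> (\<lambda>x. f (- x)) = (-1) ^ d * \<rho> f" if "f \<in> test_fun (- {0})" for f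
    using QD(3)[of 4] that by (simp add: \<rho>_def parity_off_0_def)
  note src = mellin_source_of_regular[OF reg reg' par]
  have "signed_mellin d (\<lambda>\<phi>. if \<phi> \<in> schwartz then moderate_extension \<rho> \<phi> else 0) s = H s" for s
  proof -
    obtain n :: nat where n: "n \<ge> 2" "\<bar>Re s - 1\<bar> \<le> real n" using real_arch_simple[of "max 2 \<bar>Re s - 1\<bar>"] by auto
    have "signed_mellin d (\<lambda>\<phi>. if \<phi> \<in> schwartz then moderate_extension \<rho> \<phi> else 0) s = moderate_extension \<rho> (signed_power d (s - 1))"
      by (rule src(2))
    also have "\<dots> = moderate_extension (Q n) (signed_power d (s - 1))"
      by (rule moderate_extension_functional_cong[OF eq[OF n(1), symmetric] smooth_on_signed_power])
    also have "\<dots> = H s" by (rule QD(4)[OF n(2)])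
    finally show ?thesis .
  qed
  then show ?thesis by (intro bexI[OF _ src(1)] ext)
qed

section \<open>The isomorphism\<close>

lemma mellin_source_has_parity_off_0: "\<sigma> \<in> mellin_source d \<Longrightarrow> parity_off_0 d \<sigma>"
  using test_fun_schwartz by (auto simp: mellin_source_def has_parity_def parity_off_0_def)

text \<open>A combination is regular off 0 together with its inversion, so exhaustion makes it an
  element of the source. On Schwartz functions exhaustion returns the combination itself, by
  \<open>schwartz_eq_moderate_extension\<close>.\<close>

lemma mellin_source_combination:
  assumes "\<sigma> \<in> mellin_source d" "\<sigma>' \<in> mellin_source d"
  shows "(\<lambda>\<phi>. a * \<sigma> \<phi> + b * \<sigma>' \<phi>) \<in> mellin_source d" (is "?\<rho> \<in> _")
    and "signed_mellin d (\<lambda>\<phi>. a * \<sigma> \<phi> + b * \<sigma>' \<phi>) = (\<lambda>s. a * signed_mellin d \<sigma> s + b * signed_mellin d \<sigma>' s)"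
proof -
  note reg = mellin_source_regular[OF assms(1)] and reg' = mellin_source_regular[OF assms(2)]
  have comb: "moderate_extension ?\<rho> f = a * moderate_extension \<sigma> f + b * moderate_extension \<sigma>' f" if "moderate K f" for K f
    using that by (intro moderate_extension_combination regular_off_0D reg(1) reg'(1))
  have eq: "(\<lambda>\<phi>. if \<phi> \<in> schwartz then moderate_extension ?\<rho> \<phi> else 0) = ?\<rho>"
  proof
    fix \<phi>
    show "(if \<phi> \<in> schwartz then moderate_extension ?\<rho> \<phi> else 0) = ?\<rho> \<phi>"
      using assms comb[OF moderate_schwartz, of \<phi>] schwartz_eq_moderate_extension[OF assms(1), of \<phi>]
        schwartz_eq_moderate_extension[OF assms(2), of \<phi>]
      by (simp add: mellin_source_def tempered_distribution_def)
  qed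
  have par: "?\<rho> (\<lambda>x. f (- x)) = (-1) ^ d * ?\<rho> f" if "f \<in> test_fun (- {0})" for f
    using mellin_source_has_parity_off_0[OF assms(1)] mellin_source_has_parity_off_0[OF assms(2)] that
    by (simp add: parity_off_0_def distrib_left mult.left_commute)
  note src = mellin_source_of_regular[OF regular_off_0_combination[OF reg(1) reg'(1)] regular_off_0_combination[OF reg(2) reg'(2)] par, unfolded eq]
  show "?\<rho> \<in> mellin_source d" by (rule src(1))
  show "signed_mellin d ?\<rho> = (\<lambda>s. a * signed_mellin d \<sigma> s + b * signed_mellin d \<sigma>' s)"
    by (rule ext) (simp only: src(2) comb[OF moderate_signed_power] signed_mellin_eq[OF assms(1)] signed_mellin_eq[OF assms(2)])
qed

lemma signed_mellin_inj: "inj_on (signed_mellin d) (mellin_source d)"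
proof (rule inj_onI)
  fix \<sigma> \<sigma>' assume \<sigma>: "\<sigma> \<in> mellin_source d" and \<sigma>': "\<sigma>' \<in> mellin_source d" and eq: "signed_mellin d \<sigma> = signed_mellin d \<sigma>'"
  \<comment> \<open>The line Re s = 1 suffices: there the kernel has the imaginary exponent s -
    1.\<close>
  have off_0: "\<sigma> f = \<sigma>' f" if "f \<in> test_fun (- {0})" for f
  proof (rule mellin_determines[OF _ _ mellin_source_has_parity_off_0[OF \<sigma>] _ _ mellin_source_has_parity_off_0[OF \<sigma>'] _ that])
    fix t
    show "moderate_extension \<sigma> (signed_power d (\<i> * of_real t)) = moderate_extension \<sigma>' (signed_power d (\<i> * of_real t))"
      using fun_cong[OF eq, of "1 + \<i> * of_real t"] by (simp add: signed_mellin_eq[OF \<sigma>] signed_mellin_eq[OF \<sigma>'])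
  qed (intro regular_off_0D mellin_source_regular(1)[OF \<sigma>] mellin_source_regular(1)[OF \<sigma>'])+
  show "\<sigma> = \<sigma>'"
  proof
    fix \<phi>
    show "\<sigma> \<phi> = \<sigma>' \<phi>"
    proof (cases "\<phi> \<in> schwartz")
      case True
      have "moderate_extension \<sigma> \<phi> = moderate_extension \<sigma>' \<phi>"
        by (rule moderate_extension_functional_cong[OF off_0 moderate_smooth[OF moderate_schwartz[OF True]]])
      then show ?thesis by (simp add: schwartz_eq_moderate_extension[OF \<sigma> True] schwartz_eq_moderate_extension[OF \<sigma>' True])
    next
      case False
      then show ?thesis using \<sigma> \<sigma>' by (simp add: mellin_source_def tempered_distribution_def)
    qed
  qed
qed

lemma signed_mellin_entire_moderate:
  assumes \<sigma>: "\<sigma> \<in> mellin_source d"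
  shows "signed_mellin d \<sigma> \<in> entire_moderate"
proof -
  note lin = regular_off_0D(1)[OF mellin_source_regular(1)[OF \<sigma>]] and wb = regular_off_0D(2)[OF mellin_source_regular(1)[OF \<sigma>]]
  have "(\<lambda>s. moderate_extension \<sigma> (\<lambda>x. signed_power d s x * signed_power 0 0 x)) holomorphic_on UNIV"
    by (rule holomorphic_moderate_extension[OF lin wb moderate_signed_power])
  moreover have "moderate_extension \<sigma> (\<lambda>x. signed_power d s x * signed_power 0 0 x) = moderate_extension \<sigma> (signed_power d s)" for s
    by (rule moderate_extension_cong) (simp add: signed_power_def)
  ultimately have "(\<lambda>s. moderate_extension \<sigma> (signed_power d s)) holomorphic_on UNIV" by simp
  moreover have "(\<lambda>s. s - 1) holomorphic_on UNIV" by (intro holomorphic_intros)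
  ultimately have "((\<lambda>s. moderate_extension \<sigma> (signed_power d s)) \<circ> (\<lambda>s. s - 1)) holomorphic_on UNIV"
    by (intro holomorphic_on_compose_gen[of _ UNIV _ UNIV]) auto
  then have hol: "signed_mellin d \<sigma> holomorphic_on UNIV"
    by (simp add: o_def signed_mellin_eq[OF \<sigma>, abs_def])
  have "moderate_growth_on_vertical_strips (signed_mellin d \<sigma>)"
    unfolding moderate_growth_on_vertical_strips_def
  proof (intro allI impI)
    fix a b :: real assume "a < b"
    define K where "K = \<bar>a\<bar> + \<bar>b\<bar> + 1"
    obtain C N where C: "C \<ge> 0" "\<forall>f B. moderate K f \<longrightarrow> ebound N (wt K) f B \<longrightarrow> norm (moderate_extension \<sigma> f) \<le> C * B"
      using moderate_extension_bound[where K = K, OF lin wb] by (elim exE conjE) (rule that)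
    have "norm (signed_mellin d \<sigma> s) \<le> ((C + 1) * (K + 2) ^ N) * \<bar>Im s\<bar> ^ N" if s: "a \<le> Re s \<and> Re s \<le> b \<and> 1 \<le> \<bar>Im s\<bar>" for s
    proof -
      have K: "\<bar>Re (s - 1)\<bar> \<le> K" using s by (auto simp: K_def)
      have "1 + norm (s - 1) \<le> 1 + (\<bar>Re (s - 1)\<bar> + \<bar>Im (s - 1)\<bar>)" by (intro add_left_mono cmod_le)
      also have "\<dots> \<le> (1 + K) * 1 + \<bar>Im s\<bar>" using K by simp
      also have "\<dots> \<le> (1 + K) * \<bar>Im s\<bar> + \<bar>Im s\<bar>" using s by (intro add_right_mono mult_left_mono) (auto simp: K_def)
      also have "\<dots> = (K + 2) * \<bar>Im s\<bar>" by (simp add: algebra_simps)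
      \<comment> \<open>Since |Im s| >= 1, the bounded part 1 + K can be multiplied by |Im s|. This
        converts the factor (1 + |s - 1|)^N of \<open>ebound_signed_power\<close> into a power of
        |Im s|.\<close>
      finally have le: "1 + norm (s - 1) \<le> (K + 2) * \<bar>Im s\<bar>" .
      have "norm (signed_mellin d \<sigma> s) \<le> C * (1 + norm (s - 1)) ^ N"
        unfolding signed_mellin_eq[OF \<sigma>]
        by (rule C(2)[rule_format, OF moderate_mono[OF moderate_signed_power K] ebound_wt_mono[OF ebound_signed_power K order_refl]])
      also have "\<dots> \<le> (C + 1) * ((K + 2) * \<bar>Im s\<bar>) ^ N" using C(1) le by (intro mult_mono power_mono) auto
      finally show ?thesis by (simp add: power_mult_distrib mult.assoc)
    qed
    moreover have "(C + 1) * (K + 2) ^ N > 0" using C(1) by (intro mult_pos_pos zero_less_power) (auto simp: K_def)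
    ultimately show "\<exists>T C. \<exists>N::nat. T > 0 \<and> C > 0 \<and>
        (\<forall>s. a \<le> Re s \<and> Re s \<le> b \<and> \<bar>Im s\<bar> \<ge> T \<longrightarrow> norm (signed_mellin d \<sigma> s) \<le> C * \<bar>Im s\<bar> ^ N)"
      by (intro exI[of _ 1] exI[of _ "(C + 1) * (K + 2) ^ N"] exI[of _ N]) simp
  qed
  with hol show ?thesis by simp
qed

theorem theorem4p8:
  fixes \<delta> :: nat
  assumes "\<delta> \<in> {0, 1}"
  shows "complex_linear_isomorphism (signed_mellin \<delta>)
           (mellin_source \<delta>)
           {H :: complex \<Rightarrow> complex. H holomorphic_on UNIV \<and> moderate_growth_on_vertical_strips H}"
proof -
  let ?V = "mellin_source \<delta>"
  have image: "signed_mellin \<delta> ` ?V = entire_moderate"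
    using signed_mellin_entire_moderate[of _ \<delta>] signed_mellin_surjective[of _ \<delta>] by (auto simp: image_iff)
  have add: "(\<lambda>x. f x + g x) \<in> ?V" "signed_mellin \<delta> (\<lambda>x. f x + g x) = (\<lambda>s. signed_mellin \<delta> f s + signed_mellin \<delta> g s)"
    if "f \<in> ?V" "g \<in> ?V" for f g
    using mellin_source_combination[OF that, of 1 1] by simp_all
  have cmult: "(\<lambda>x. c * f x) \<in> ?V" "signed_mellin \<delta> (\<lambda>x. c * f x) = (\<lambda>s. c * signed_mellin \<delta> f s)" if "f \<in> ?V" for c f
    using mellin_source_combination[OF that that, of c 0] by simp_all
  have "(\<lambda>s. 0) \<in> entire_moderate"
    by (auto simp: moderate_growth_on_vertical_strips_def intro!: exI[of _ "1::real"])
  \<comment> \<open>Surjectivity at the zero function shows that the source is nonempty; scaling by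
    0 then gives its zero element.\<close>
  then obtain \<sigma> where "\<sigma> \<in> ?V" using image by blast
  from cmult(1)[OF this, of 0] have zero: "(\<lambda>x. 0) \<in> ?V" by simp
  have V: "complex_function_space ?V"
    unfolding complex_function_space_def using zero add(1) cmult(1) by simp
  \<comment> \<open>Closure of the target under sums and multiples is carried over from the source
    along the linear surjection.\<close>
  have W: "complex_function_space entire_moderate"
    unfolding complex_function_space_def
  proof (intro conjI ballI allI)
    show "(\<lambda>s. 0) \<in> entire_moderate" by fact
    fix f assume f: "f \<in> entire_moderate"
    then obtain \<sigma> where \<sigma>: "\<sigma> \<in> ?V" "f = signed_mellin \<delta> \<sigma>" unfolding image[symmetric] by blast
    show "(\<lambda>s. c * f s) \<in> entire_moderate" for c
      using signed_mellin_entire_moderate[OF cmult(1)[OF \<sigma>(1)], of c] by (simp only: cmult(2)[OF \<sigma>(1)] \<sigma>(2))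
    fix g assume "g \<in> entire_moderate"
    then obtain \<sigma>' where \<sigma>': "\<sigma>' \<in> ?V" "g = signed_mellin \<delta> \<sigma>'" unfolding image[symmetric] by blast
    show "(\<lambda>s. f s + g s) \<in> entire_moderate"
      using signed_mellin_entire_moderate[OF add(1)[OF \<sigma>(1) \<sigma>'(1)]] by (simp only: add(2)[OF \<sigma>(1) \<sigma>'(1)] \<sigma>(2) \<sigma>'(2))
  qed
  show ?thesis
    unfolding complex_linear_isomorphism_def bij_betw_def using V W add(2) cmult(2) signed_mellin_inj image by simp
qed

end
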